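(* Let $G$ be a second countable locally compact Hausdorff groupoid with a Haar system, and let $K\subseteq H$ be closed wide subgroupoids of $G$, with Haar systems $\{\lambda_K^u\}_{u\in G^0}$ and $\{\lambda_H^u\}_{u\in G^0}$. Let $\mu_G=\{\mu_G^u\}_{u\in G^0}$ and $\mu_H=\{\mu_H^u\}_{u\in G^0}$ be full equivariant $r_{G^0}$-systems on $G/H$ and $H/K$ respectively, and let $\gamma=\{\gamma^u\}_{u\in G^0}$ be the full equivariant $r_{G^0}$-system on $G/K$ given by $$\int_{G/K} f\, d\gamma^{u}=\int_{G/H}\int_{H/K} f(xhK)\,d\mu_H^{d(x)}(hK)\,d\mu_G^{u}(xH),\qquad f\in C_c(G/K).$$ Let $\sigma$ be a continuous unitary representation of $K$. Then the representations $\left(\mathrm{ind}_K^G(\sigma),\gamma\right)$ and $\left(\mathrm{ind}_H^G\left(\mathrm{ind}_K^H(\sigma),\mu_H\right),\mu_G\right)$ of $G$ are unitarily equivalent.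
   Context: Groupoids. For a groupoid $G$: $r(x)=xx^{-1}$, $d(x)=x^{-1}x$, unit space $G^0$, $G^2=\{(x,y):d(x)=r(y)\}$, $G^u=r^{-1}(u)$. Topological groupoids are second countable, locally compact and Hausdorff. A Haar system on $G$ is a family $\{\lambda^u\}_{u\in G^0}$ of positive Radon measures on $G$ with $\mathrm{supp}\,\lambda^u=G^u$, $u\mapsto\int f\,d\lambda^u$ continuous for $f\in C_c(G)$, and $\int f(xy)\,d\lambda^{d(x)}(y)=\int f(y)\,d\lambda^{r(x)}(y)$. A subgroupoid is wide if its unit space is $G^0$. For $H$ a closed wide subgroupoid with a Haar system $\{\lambda_H^u\}$, $G/H$ is the space of cosets $xH=\{xh:h\in H, r(h)=d(x)\}$ with quotient topology (locally compact Hausdorff), quotient map $q_H$, moment map $r_{G^0}(xH)=r(x)$ and left action $g\cdot xH=gxH$ (for $d(g)=r(x)$). A full equivariant $r_{G^0}$-system on $G/H$ is a family $\mu=\{\mu^u\}_{u\in G^0}$ of positive Radon measures on $G/H$ with $\mathrm{supp}\,\mu^u=r_{G^0}^{-1}(u)$, $u\mapsto\int f\,d\mu^u$ continuous for $f\in C_c(G/H)$, and $\int f(x\cdot y)\,d\mu^{d(x)}(y)=\int f(y)\,d\mu^{r(x)}(y)$ for $x\in G$. The same definitions apply to $K\subseteq G$ and to $K\subseteq H$. Hilbert bundles and representations. A continuous field of Hilbert spaces (continuous Hilbert bundle) over $G^0$ is a family $\{\mathcal H_u\}_{u\in G^0}$ with a linear subspace $\Gamma\subset\prod_u\mathcal H_u$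 such that $\{\xi(u):\xi\in\Gamma\}$ is dense in $\mathcal H_u$, $u\mapsto\|\xi(u)\|$ is continuous for $\xi\in\Gamma$, and $\Gamma$ is closed under locally uniform approximation. The total space $\mathcal H=\bigsqcup_u\mathcal H_u$, with projection $p$, has the topology generated by the sets $\{h:\ p(h)\in V,\ \|h-\xi(p(h))\|<\epsilon\}$ ($V\subset G^0$ open, $\epsilon>0$, $\xi\in\Gamma$); $C_0(G^0,\mathcal H)$ is the space of continuous sections vanishing at infinity, with sup norm. A continuous unitary representation $(\mathcal H^\pi,\pi)$ of $G$ consists of a continuous Hilbert bundle $\mathcal H^\pi$ over $G^0$ and unitaries $\pi(x):\mathcal H^\pi_{d(x)}\to\mathcal H^\pi_{r(x)}$ with $\pi(u)=\mathrm{id}$ for $u\in G^0$, $\pi(x)\pi(y)=\pi(xy)$ on $G^2$, $\pi(x^{-1})=\pi(x)^{-1}$, and $x\mapsto\langle\pi(x)\xi(d(x)),\eta(r(x))\rangle$ continuous for $\xi,\eta\in C_0(G^0,\mathcal H^\pi)$. $\mathrm{Mor}(\pi,\pi')$ is the vector space of bundle morphisms (continuous, fibre-preserving, fibrewise bounded linear) $T:\mathcal H^\pi\to\mathcal H^{\pi'}$ with $T_{r(x)}\pi(x)=\pi'(x)T_{d(x)}$ for all $x\in G$; $\pi,\pi'$ are (unitarily) equivalent if some $T\in \mathrm{Mor}(\pi,\pi')$ has every $T_u$ unitary. Induced representation. Let $(\mathcal H^\sigma,\sigma)$ be a continuous unitary representation of a closed wide subgroupoid $H$ of $G$ and $\mu$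 a full equivariant $r_{G^0}$-system on $G/H$. $C(G,\mathcal H^\sigma)$ is the set of continuous $f:G\to\mathcal H^\sigma$ with $f(x)\in\mathcal H^\sigma_{d(x)}$, and $$\mathcal F_0^\sigma(G)=\{f\in C(G,\mathcal H^\sigma): q_H(\mathrm{supp} f)\text{ compact},\ f(x\xi)=\sigma(\xi^{-1})f(x)\ \text{for } (x,\xi)\in G^2,\ \xi\in H\}.$$ For $f,g\in\mathcal F_0^\sigma(G)$ put $\langle f,g\rangle(u)=\int_{G/H}\langle f(x),g(x)\rangle_{\mathcal H^\sigma_{d(x)}}d\mu^u(xH)$ and $\|f\|=\sup_u\sqrt{\langle f,f\rangle(u)}$; $\mathcal F^\sigma(G)=\mathcal F^\sigma(G,\mu)$ is the completion, a Hilbert $C_0(G^0)$-module with $(bf)(x)=b(r(x))f(x)$. It determines a continuous Hilbert bundle $\bar{\mathcal F}^\sigma_G$ over $G^0$ with fibres $\mathcal F^u=\mathcal F^\sigma(G)/\{f:\langle f,f\rangle(u)=0\}$, equivalently the completion of $\{f|_{G^u}:f\in\mathcal F_0^\sigma(G)\}$ in the norm $\sqrt{\langle f,f\rangle(u)}$, and with the topology determined by the sections $t_F(u)=F+\{f:\langle f,f\rangle(u)=0\}$, $F\in\mathcal F^\sigma(G)$. The induced representation $(\mathrm{ind}_H^G(\sigma),\mu)$ is the continuous unitary representation $L$ of $G$ on $\bar{\mathcal F}^\sigma_G$ with $L(x):\mathcal F^{d(x)}\to\mathcal F^{r(x)}$, $(L(x)f)(y)=f(x^{-1}y)$. *)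

theory Defs
  imports "HOL-Analysis.Analysis" "HOL-Algebra.Module"
begin

section \<open>Groupoids\<close>

text \<open>
  The set of arrows is the \<^const>\<open>topspace\<close> of the topology; \<open>gmul\<close> is meaningful only on
  composable pairs.
\<close>

record 'g groupoid =
  gtop :: "'g topology"
  gmul :: "'g \<Rightarrow> 'g \<Rightarrow> 'g"
  ginv :: "'g \<Rightarrow> 'g"

abbreviation arrows :: "'g groupoid \<Rightarrow> 'g set"
  where "arrows G \<equiv> topspace (gtop G)"

definition rng :: "'g groupoid \<Rightarrow> 'g \<Rightarrow> 'g"
  where "rng G x = gmul G x (ginv G x)"

definition src :: "'g groupoid \<Rightarrow> 'g \<Rightarrow> 'g"
  where "src G x = gmul G (ginv G x) x"

definition units :: "'g groupoid \<Rightarrow> 'g set"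
  where "units G = rng G ` arrows G"

definition unit_space :: "'g groupoid \<Rightarrow> 'g topology"
  where "unit_space G = subtopology (gtop G) (units G)"

definition composable :: "'g groupoid \<Rightarrow> ('g \<times> 'g) set"
  where "composable G = {(x, y). x \<in> arrows G \<and> y \<in> arrows G \<and> src G x = rng G y}"

definition range_fibre :: "'g groupoid \<Rightarrow> 'g \<Rightarrow> 'g set"
  where "range_fibre G u = {x \<in> arrows G. rng G x = u}"

definition is_groupoid :: "'g groupoid \<Rightarrow> bool"
  where "is_groupoid G \<longleftrightarrow>
    (\<forall>x \<in> arrows G. ginv G x \<in> arrows G \<and> ginv G (ginv G x) = x
       \<and> (ginv G x, x) \<in> composable G \<and> (x, ginv G x) \<in> composable G) \<and>
    (\<forall>(x, y) \<in> composable G. gmul G x y \<in> arrows G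
       \<and> gmul G (ginv G x) (gmul G x y) = y \<and> gmul G (gmul G x y) (ginv G y) = x) \<and>
    (\<forall>x y z. (x, y) \<in> composable G \<longrightarrow> (y, z) \<in> composable G \<longrightarrow>
       (gmul G x y, z) \<in> composable G \<and> (x, gmul G y z) \<in> composable G
       \<and> gmul G (gmul G x y) z = gmul G x (gmul G y z))"

definition topological_groupoid :: "'g groupoid \<Rightarrow> bool"
  where "topological_groupoid G \<longleftrightarrow>
    is_groupoid G \<and>
    second_countable (gtop G) \<and> locally_compact_space (gtop G) \<and> Hausdorff_space (gtop G) \<and>
    continuous_map (subtopology (prod_topology (gtop G) (gtop G)) (composable G)) (gtop G)
      (\<lambda>(x, y). gmul G x y) \<and>
    continuous_map (gtop G) (gtop G) (ginv G)"

definition closed_wide_subgroupoid :: "'g groupoid \<Rightarrow> 'g set \<Rightarrow> bool"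
  where "closed_wide_subgroupoid G H \<longleftrightarrow>
    closedin (gtop G) H \<and>
    (\<forall>x \<in> H. ginv G x \<in> H) \<and>
    (\<forall>x \<in> H. \<forall>y \<in> H. (x, y) \<in> composable G \<longrightarrow> gmul G x y \<in> H) \<and>
    rng G ` H = units G"

definition sub_groupoid :: "'g groupoid \<Rightarrow> 'g set \<Rightarrow> 'g groupoid"
  where "sub_groupoid G H = G\<lparr>gtop := subtopology (gtop G) H\<rparr>"


section \<open>Coset spaces\<close>

definition coset :: "'g groupoid \<Rightarrow> 'g set \<Rightarrow> 'g \<Rightarrow> 'g set"
  where "coset G H x = {gmul G x h | h. h \<in> H \<and> rng G h = src G x}"

definition coset_space :: "'g groupoid \<Rightarrow> 'g set \<Rightarrow> 'g set topology"
  where "coset_space G H = topology (\<lambda>U. U \<subseteq> coset G H ` arrows G \<and>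
    openin (gtop G) {x \<in> arrows G. coset G H x \<in> U})"

lemma openin_coset_space:
  "openin (coset_space G H) U \<longleftrightarrow>
    U \<subseteq> coset G H ` arrows G \<and> openin (gtop G) {x \<in> arrows G. coset G H x \<in> U}"
proof -
  let ?P = "\<lambda>U. U \<subseteq> coset G H ` arrows G \<and> openin (gtop G) {x \<in> arrows G. coset G H x \<in> U}"
  have "istopology ?P"
    unfolding istopology_def
  proof (intro conjI allI impI)
    fix S T assume "?P S" "?P T"
    moreover have "{x \<in> arrows G. coset G H x \<in> S \<inter> T}
      = {x \<in> arrows G. coset G H x \<in> S} \<inter> {x \<in> arrows G. coset G H x \<in> T}" by auto
    ultimately show "S \<inter> T \<subseteq> coset G H ` arrows G"
      "openin (gtop G) {x \<in> arrows G. coset G H x \<in> S \<inter> T}" by auto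
  next
    fix \<K> assume *: "\<forall>K \<in> \<K>. ?P K"
    then show "\<Union>\<K> \<subseteq> coset G H ` arrows G" by auto
    have "{x \<in> arrows G. coset G H x \<in> \<Union>\<K>} = (\<Union>K \<in> \<K>. {x \<in> arrows G. coset G H x \<in> K})"
      by auto
    with * show "openin (gtop G) {x \<in> arrows G. coset G H x \<in> \<Union>\<K>}" by auto
  qed
  then show ?thesis
    unfolding coset_space_def by (simp add: topology_inverse')
qed

lemma topspace_coset_space: "topspace (coset_space G H) = coset G H ` arrows G"
proof -
  have "{x \<in> arrows G. coset G H x \<in> coset G H ` arrows G} = arrows G" by auto
  then have "openin (coset_space G H) (coset G H ` arrows G)"
    by (simp add: openin_coset_space)
  then show ?thesis
    by (meson openin_coset_space openin_subset openin_topspace subset_antisym)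
qed

lemma quotient_map_coset: "quotient_map (gtop G) (coset_space G H) (coset G H)"
  unfolding quotient_map_def by (simp add: openin_coset_space topspace_coset_space)

text \<open>The functions of \<open>xH\<close> integrated below do not depend on the representative \<open>x\<close>.\<close>

definition coset_rep :: "'g set \<Rightarrow> 'g"
  where "coset_rep C = (SOME x. x \<in> C)"

definition coset_rng :: "'g groupoid \<Rightarrow> 'g set \<Rightarrow> 'g"
  where "coset_rng G C = (THE u. rng G ` C = {u})"

definition coset_range_fibre :: "'g groupoid \<Rightarrow> 'g set \<Rightarrow> 'g \<Rightarrow> 'g set set"
  where "coset_range_fibre G H u = {C \<in> topspace (coset_space G H). coset_rng G C = u}"

definition translate :: "'g groupoid \<Rightarrow> 'g \<Rightarrow> 'g set \<Rightarrow> 'g set"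
  where "translate G x C = gmul G x ` C"


section \<open>Radon measures, Haar systems and equivariant systems\<close>

definition Cc :: "'a topology \<Rightarrow> ('a \<Rightarrow> complex) set"
  where "Cc X = {f. continuous_map X euclidean f \<and>
    compactin X (X closure_of {x \<in> topspace X. f x \<noteq> 0})}"

definition radon_measure :: "'a topology \<Rightarrow> 'a measure \<Rightarrow> bool"
  where "radon_measure X M \<longleftrightarrow>
    space M = topspace X \<and> sets M = sigma_sets (topspace X) {U. openin X U} \<and>
    (\<forall>C. compactin X C \<longrightarrow> emeasure M C < \<infinity>) \<and>
    (\<forall>A \<in> sets M. emeasure M A = (INF U \<in> {U. openin X U \<and> A \<subseteq> U}. emeasure M U)) \<and>
    (\<forall>U. openin X U \<longrightarrow> emeasure M U = (SUP C \<in> {C. compactin X C \<and> C \<subseteq> U}. emeasure M C))"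

definition measure_support :: "'a topology \<Rightarrow> 'a measure \<Rightarrow> 'a set"
  where "measure_support X M =
    {x \<in> topspace X. \<forall>U. openin X U \<and> x \<in> U \<longrightarrow> emeasure M U > 0}"

text \<open>
  The integrand \<open>f (x y)\<close> is meaningful only for \<open>y\<close> with \<open>r(y) = d(x)\<close>, where \<open>\<lambda>\<^bsup>d(x)\<^esup>\<close> is
  concentrated, and need not be measurable elsewhere; hence the integral over a range fibre.
  Likewise for the systems on coset spaces.
\<close>

definition haar_system :: "'g groupoid \<Rightarrow> ('g \<Rightarrow> 'g measure) \<Rightarrow> bool"
  where "haar_system G lam \<longleftrightarrow>
    (\<forall>u \<in> units G. radon_measure (gtop G) (lam u) \<and>
       measure_support (gtop G) (lam u) = range_fibre G u) \<and>
    (\<forall>f \<in> Cc (gtop G). continuous_map (unit_space G) euclidean (\<lambda>u. LINT x|lam u. f x)) \<and>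
    (\<forall>f \<in> Cc (gtop G). \<forall>x \<in> arrows G.
       (LINT y : range_fibre G (src G x)|lam (src G x). f (gmul G x y)) =
       (LINT y|lam (rng G x). f y))"

definition full_equivariant_system ::
    "'g groupoid \<Rightarrow> 'g set \<Rightarrow> ('g \<Rightarrow> 'g set measure) \<Rightarrow> bool"
  where "full_equivariant_system G H \<mu> \<longleftrightarrow>
    (\<forall>u \<in> units G. radon_measure (coset_space G H) (\<mu> u) \<and>
       measure_support (coset_space G H) (\<mu> u) = coset_range_fibre G H u) \<and>
    (\<forall>f \<in> Cc (coset_space G H).
       continuous_map (unit_space G) euclidean (\<lambda>u. LINT C|\<mu> u. f C)) \<and>
    (\<forall>f \<in> Cc (coset_space G H). \<forall>x \<in> arrows G.
       (LINT C : coset_range_fibre G H (src G x)|\<mu> (src G x). f (translate G x C)) =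
       (LINT C|\<mu> (rng G x). f C))"


section \<open>Hilbert spaces on carrier sets\<close>

definition complex_ring :: "complex ring"
  where "complex_ring = \<lparr>carrier = UNIV, mult = (*), one = 1, zero = 0, add = (+)\<rparr>"

text \<open>
  The fields \<open>mult\<close> and \<open>one\<close>, which \<^typ>\<open>('a, 'b) module\<close> inherits from rings, are not used.
\<close>

record 'h prehilbert = "(complex, 'h) module" +
  hinner :: "'h \<Rightarrow> 'h \<Rightarrow> complex"

definition hnorm :: "'h prehilbert \<Rightarrow> 'h \<Rightarrow> real"
  where "hnorm V a = sqrt (Re (hinner V a a))"

definition cauchy_sequences :: "('a, 'm) ring_scheme \<Rightarrow> ('a \<Rightarrow> real) \<Rightarrow> (nat \<Rightarrow> 'a) set"
  where "cauchy_sequences V n = {s. (\<forall>i. s i \<in> carrier V) \<and>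
    (\<forall>e>0. \<exists>N. \<forall>i\<ge>N. \<forall>j\<ge>N. n (s i \<ominus>\<^bsub>V\<^esub> s j) < e)}"

definition is_hilbert_space :: "'h prehilbert \<Rightarrow> bool"
  where "is_hilbert_space V \<longleftrightarrow>
    Module.module complex_ring V \<and>
    (\<forall>a \<in> carrier V. \<forall>b \<in> carrier V. \<forall>c \<in> carrier V.
       hinner V (a \<oplus>\<^bsub>V\<^esub> b) c = hinner V a c + hinner V b c) \<and>
    (\<forall>z. \<forall>a \<in> carrier V. \<forall>b \<in> carrier V. hinner V (z \<odot>\<^bsub>V\<^esub> a) b = z * hinner V a b) \<and>
    (\<forall>a \<in> carrier V. \<forall>b \<in> carrier V. hinner V b a = cnj (hinner V a b)) \<and>
    (\<forall>a \<in> carrier V. a \<noteq> \<zero>\<^bsub>V\<^esub> \<longrightarrow> Re (hinner V a a) > 0) \<and>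
    (\<forall>s \<in> cauchy_sequences V (hnorm V). \<exists>a \<in> carrier V.
       (\<lambda>i. hnorm V (s i \<ominus>\<^bsub>V\<^esub> a)) \<longlonglongrightarrow> 0)"

definition bounded_linear_on :: "'h prehilbert \<Rightarrow> 'k prehilbert \<Rightarrow> ('h \<Rightarrow> 'k) \<Rightarrow> bool"
  where "bounded_linear_on V W T \<longleftrightarrow>
    T \<in> carrier V \<rightarrow> carrier W \<and>
    (\<forall>a \<in> carrier V. \<forall>b \<in> carrier V. T (a \<oplus>\<^bsub>V\<^esub> b) = T a \<oplus>\<^bsub>W\<^esub> T b) \<and>
    (\<forall>z. \<forall>a \<in> carrier V. T (z \<odot>\<^bsub>V\<^esub> a) = z \<odot>\<^bsub>W\<^esub> T a) \<and>
    (\<exists>M. \<forall>a \<in> carrier V. hnorm W (T a) \<le> M * hnorm V a)"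

definition unitary_on :: "'h prehilbert \<Rightarrow> 'k prehilbert \<Rightarrow> ('h \<Rightarrow> 'k) \<Rightarrow> bool"
  where "unitary_on V W T \<longleftrightarrow>
    bounded_linear_on V W T \<and> bij_betw T (carrier V) (carrier W) \<and>
    (\<forall>a \<in> carrier V. \<forall>b \<in> carrier V. hinner W (T a) (T b) = hinner V a b)"


subsection \<open>Completion\<close>

text \<open>
  The completion of \<open>V\<close> in the (semi)norm \<open>n\<close> consists of Cauchy sequences modulo sequences
  tending to zero.
\<close>

definition null_rel :: "('a, 'm) ring_scheme \<Rightarrow> ('a \<Rightarrow> real) \<Rightarrow> ((nat \<Rightarrow> 'a) \<times> (nat \<Rightarrow> 'a)) set"
  where "null_rel V n = {(s, t). s \<in> cauchy_sequences V n \<and> t \<in> cauchy_sequences V n \<and>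
    (\<lambda>i. n (s i \<ominus>\<^bsub>V\<^esub> t i)) \<longlonglongrightarrow> 0}"

definition completion :: "('a, 'm) ring_scheme \<Rightarrow> ('a \<Rightarrow> real) \<Rightarrow> (nat \<Rightarrow> 'a) set set"
  where "completion V n = cauchy_sequences V n // null_rel V n"

definition limit_class :: "'a prehilbert \<Rightarrow> (nat \<Rightarrow> 'a) \<Rightarrow> (nat \<Rightarrow> 'a) set"
  where "limit_class V s = null_rel V (hnorm V) `` {s}"

definition hilbert_completion :: "'a prehilbert \<Rightarrow> (nat \<Rightarrow> 'a) set prehilbert"
  where "hilbert_completion V =
    \<lparr>carrier = completion V (hnorm V), mult = undefined, one = undefined,
     zero = limit_class V (\<lambda>_. \<zero>\<^bsub>V\<^esub>),
     add = (\<lambda>A B. \<Union>s \<in> A. \<Union>t \<in> B. limit_class V (\<lambda>i. s i \<oplus>\<^bsub>V\<^esub> t i)),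
     smult = (\<lambda>z A. \<Union>s \<in> A. limit_class V (\<lambda>i. z \<odot>\<^bsub>V\<^esub> s i)),
     hinner = (\<lambda>A B. lim (\<lambda>i. hinner V ((SOME s. s \<in> A) i) ((SOME t. t \<in> B) i)))\<rparr>"


section \<open>Continuous Hilbert bundles\<close>

definition section_module ::
    "'x set \<Rightarrow> ('x \<Rightarrow> 'h prehilbert) \<Rightarrow> ('x \<Rightarrow> 'h) set \<Rightarrow> (complex, 'x \<Rightarrow> 'h) module"
  where "section_module D V S =
    \<lparr>carrier = S, mult = undefined, one = undefined,
     zero = (\<lambda>x \<in> D. \<zero>\<^bsub>V x\<^esub>),
     add = (\<lambda>f g. \<lambda>x \<in> D. f x \<oplus>\<^bsub>V x\<^esub> g x),
     smult = (\<lambda>z f. \<lambda>x \<in> D. z \<odot>\<^bsub>V x\<^esub> f x)\<rparr>"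

record ('b, 'h) hilbert_bundle =
  fibre :: "'b \<Rightarrow> 'h prehilbert"
  sections :: "('b \<Rightarrow> 'h) set"

definition locally_uniform_closure ::
    "'b topology \<Rightarrow> ('b \<Rightarrow> 'h prehilbert) \<Rightarrow> ('b \<Rightarrow> 'h) set \<Rightarrow> ('b \<Rightarrow> 'h) set"
  where "locally_uniform_closure B V S =
    {\<xi> \<in> \<Pi>\<^sub>E u \<in> topspace B. carrier (V u).
       \<forall>u\<^sub>0 \<in> topspace B. \<forall>e>0. \<exists>\<eta> \<in> S. \<exists>U. openin B U \<and> u\<^sub>0 \<in> U \<and>
         (\<forall>u \<in> U. hnorm (V u) (\<xi> u \<ominus>\<^bsub>V u\<^esub> \<eta> u) < e)}"

definition continuous_hilbert_bundle ::
    "'b topology \<Rightarrow> ('b, 'h, 'm) hilbert_bundle_scheme \<Rightarrow> bool"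
  where "continuous_hilbert_bundle B E \<longleftrightarrow>
    (\<forall>u \<in> topspace B. is_hilbert_space (fibre E u)) \<and>
    submodule (sections E) complex_ring
      (section_module (topspace B) (fibre E) (\<Pi>\<^sub>E u \<in> topspace B. carrier (fibre E u))) \<and>
    (\<forall>u \<in> topspace B. \<forall>h \<in> carrier (fibre E u). \<forall>e>0. \<exists>\<xi> \<in> sections E.
       hnorm (fibre E u) (h \<ominus>\<^bsub>fibre E u\<^esub> \<xi> u) < e) \<and>
    (\<forall>\<xi> \<in> sections E. continuous_map B euclidean (\<lambda>u. hnorm (fibre E u) (\<xi> u))) \<and>
    locally_uniform_closure B (fibre E) (sections E) \<subseteq> sections E"

text \<open>The disjoint union of the fibres is realised as a set of pairs \<open>(p(h), h)\<close>.\<close>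

definition total_space ::
    "'b topology \<Rightarrow> ('b, 'h, 'm) hilbert_bundle_scheme \<Rightarrow> ('b \<times> 'h) topology"
  where "total_space B E = topology_generated_by
    {{(u, h). u \<in> V \<and> h \<in> carrier (fibre E u) \<and> hnorm (fibre E u) (h \<ominus>\<^bsub>fibre E u\<^esub> \<xi> u) < e} |
      V e \<xi>. openin B V \<and> e > 0 \<and> \<xi> \<in> sections E}"

definition C0_sections ::
    "'b topology \<Rightarrow> ('b, 'h, 'm) hilbert_bundle_scheme \<Rightarrow> ('b \<Rightarrow> 'h) set"
  where "C0_sections B E =
    {\<xi>. continuous_map B (total_space B E) (\<lambda>u. (u, \<xi> u)) \<and>
       (\<forall>e>0. \<exists>C. compactin B C \<and> (\<forall>u \<in> topspace B - C. hnorm (fibre E u) (\<xi> u) < e))}"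


section \<open>Representations of groupoids\<close>

record ('g, 'h) representation = "('g, 'h) hilbert_bundle" +
  act :: "'g \<Rightarrow> 'h \<Rightarrow> 'h"

definition continuous_unitary_representation :: "'g groupoid \<Rightarrow> ('g, 'h) representation \<Rightarrow> bool"
  where "continuous_unitary_representation G \<pi> \<longleftrightarrow>
    continuous_hilbert_bundle (unit_space G) \<pi> \<and>
    (\<forall>x \<in> arrows G. unitary_on (fibre \<pi> (src G x)) (fibre \<pi> (rng G x)) (act \<pi> x)) \<and>
    (\<forall>u \<in> units G. \<forall>h \<in> carrier (fibre \<pi> u). act \<pi> u h = h) \<and>
    (\<forall>(x, y) \<in> composable G. \<forall>h \<in> carrier (fibre \<pi> (src G y)).
       act \<pi> x (act \<pi> y h) = act \<pi> (gmul G x y) h) \<and>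
    (\<forall>x \<in> arrows G. \<forall>h \<in> carrier (fibre \<pi> (rng G x)).
       act \<pi> (ginv G x) h = inv_into (carrier (fibre \<pi> (src G x))) (act \<pi> x) h) \<and>
    (\<forall>\<xi> \<in> C0_sections (unit_space G) \<pi>. \<forall>\<eta> \<in> C0_sections (unit_space G) \<pi>.
       continuous_map (gtop G) euclidean
         (\<lambda>x. hinner (fibre \<pi> (rng G x)) (act \<pi> x (\<xi> (src G x))) (\<eta> (rng G x))))"

definition Mor ::
    "'g groupoid \<Rightarrow> ('g, 'h) representation \<Rightarrow> ('g, 'k) representation \<Rightarrow> ('g \<Rightarrow> 'h \<Rightarrow> 'k) set"
  where "Mor G \<pi> \<pi>' =
    {T. continuous_map (total_space (unit_space G) \<pi>) (total_space (unit_space G) \<pi>')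
          (\<lambda>(u, h). (u, T u h)) \<and>
        (\<forall>u \<in> units G. bounded_linear_on (fibre \<pi> u) (fibre \<pi>' u) (T u)) \<and>
        (\<forall>x \<in> arrows G. \<forall>h \<in> carrier (fibre \<pi> (src G x)).
           T (rng G x) (act \<pi> x h) = act \<pi>' x (T (src G x) h))}"

definition unitarily_equivalent ::
    "'g groupoid \<Rightarrow> ('g, 'h) representation \<Rightarrow> ('g, 'k) representation \<Rightarrow> bool"
  where "unitarily_equivalent G \<pi> \<pi>' \<longleftrightarrow>
    (\<exists>T \<in> Mor G \<pi> \<pi>'. \<forall>u \<in> units G. unitary_on (fibre \<pi> u) (fibre \<pi>' u) (T u))"


section \<open>Induced representations\<close>

text \<open>The space \<open>\<F>\<^sub>0\<^sup>\<sigma>(G)\<close>, with functions taken to be \<^const>\<open>undefined\<close> off the groupoid.\<close>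

definition ind_functions ::
    "'g groupoid \<Rightarrow> 'g set \<Rightarrow> ('g, 'h) representation \<Rightarrow> ('g \<Rightarrow> 'h) set"
  where "ind_functions G H \<sigma> =
    {f \<in> \<Pi>\<^sub>E x \<in> arrows G. carrier (fibre \<sigma> (src G x)).
       continuous_map (gtop G) (total_space (unit_space G) \<sigma>) (\<lambda>x. (src G x, f x)) \<and>
       compactin (coset_space G H) (coset G H `
         (gtop G closure_of {x \<in> arrows G. f x \<noteq> \<zero>\<^bsub>fibre \<sigma> (src G x)\<^esub>})) \<and>
       (\<forall>x \<in> arrows G. \<forall>h \<in> H. src G x = rng G h \<longrightarrow>
         f (gmul G x h) = act \<sigma> (ginv G h) (f x))}"

text \<open>
  The integral is taken over the cosets in the support of \<open>\<mu>\<^sup>u\<close>, so that it also makes sense for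
  functions defined only on the range fibre of \<open>u\<close>.
\<close>

definition ind_inner ::
    "'g groupoid \<Rightarrow> 'g set \<Rightarrow> ('g, 'h) representation \<Rightarrow> ('g \<Rightarrow> 'g set measure) \<Rightarrow>
      ('g \<Rightarrow> 'h) \<Rightarrow> ('g \<Rightarrow> 'h) \<Rightarrow> 'g \<Rightarrow> complex"
  where "ind_inner G H \<sigma> \<mu> f g u =
    (LINT C : coset_range_fibre G H u|\<mu> u.
       hinner (fibre \<sigma> (src G (coset_rep C))) (f (coset_rep C)) (g (coset_rep C)))"

definition ind_norm ::
    "'g groupoid \<Rightarrow> 'g set \<Rightarrow> ('g, 'h) representation \<Rightarrow> ('g \<Rightarrow> 'g set measure) \<Rightarrow>
      ('g \<Rightarrow> 'h) \<Rightarrow> real"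
  where "ind_norm G H \<sigma> \<mu> f = (SUP u \<in> units G. sqrt (Re (ind_inner G H \<sigma> \<mu> f f u)))"

text \<open>The completion \<open>\<F>\<^sup>\<sigma>(G, \<mu>)\<close> of \<open>\<F>\<^sub>0\<^sup>\<sigma>(G)\<close>.\<close>

definition ind_completion ::
    "'g groupoid \<Rightarrow> 'g set \<Rightarrow> ('g, 'h) representation \<Rightarrow> ('g \<Rightarrow> 'g set measure) \<Rightarrow>
      (nat \<Rightarrow> 'g \<Rightarrow> 'h) set set"
  where "ind_completion G H \<sigma> \<mu> =
    completion (section_module (arrows G) (\<lambda>x. fibre \<sigma> (src G x)) (ind_functions G H \<sigma>))
      (ind_norm G H \<sigma> \<mu>)"

definition ind_prefibre ::
    "'g groupoid \<Rightarrow> 'g set \<Rightarrow> ('g, 'h) representation \<Rightarrow> ('g \<Rightarrow> 'g set measure) \<Rightarrow> 'g \<Rightarrow>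
      ('g \<Rightarrow> 'h) prehilbert"
  where "ind_prefibre G H \<sigma> \<mu> u =
    module.extend
      (section_module (range_fibre G u) (\<lambda>x. fibre \<sigma> (src G x))
        ((\<lambda>f. restrict f (range_fibre G u)) ` ind_functions G H \<sigma>))
      (prehilbert.fields (\<lambda>f g. ind_inner G H \<sigma> \<mu> f g u))"

definition ind_fibre ::
    "'g groupoid \<Rightarrow> 'g set \<Rightarrow> ('g, 'h) representation \<Rightarrow> ('g \<Rightarrow> 'g set measure) \<Rightarrow> 'g \<Rightarrow>
      (nat \<Rightarrow> 'g \<Rightarrow> 'h) set prehilbert"
  where "ind_fibre G H \<sigma> \<mu> u = hilbert_completion (ind_prefibre G H \<sigma> \<mu> u)"

text \<open>
  The section \<open>t\<^sub>F\<close>: under the identification of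
  \<open>\<F>\<^sup>\<sigma>(G) / {F. \<langle>F, F\<rangle>(u) = 0}\<close> with the completion of the restrictions to the range fibre of
  \<open>u\<close>, the class of the limit \<open>F\<close> of \<open>f\<^sub>i \<in> \<F>\<^sub>0\<^sup>\<sigma>(G)\<close> is the limit of the restrictions of \<open>f\<^sub>i\<close>.
\<close>

definition ind_section ::
    "'g groupoid \<Rightarrow> 'g set \<Rightarrow> ('g, 'h) representation \<Rightarrow> ('g \<Rightarrow> 'g set measure) \<Rightarrow>
      (nat \<Rightarrow> 'g \<Rightarrow> 'h) set \<Rightarrow> 'g \<Rightarrow> (nat \<Rightarrow> 'g \<Rightarrow> 'h) set"
  where "ind_section G H \<sigma> \<mu> F =
    (\<lambda>u \<in> units G. \<Union>f \<in> F.
       limit_class (ind_prefibre G H \<sigma> \<mu> u) (\<lambda>i. restrict (f i) (range_fibre G u)))"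

text \<open>
  The space of sections is generated by the \<open>t\<^sub>F\<close>; these already determine the topology of the
  total space. The action is translation of functions, applied to the members of Cauchy sequences.
\<close>

definition ind ::
    "'g groupoid \<Rightarrow> 'g set \<Rightarrow> ('g, 'h) representation \<Rightarrow> ('g \<Rightarrow> 'g set measure) \<Rightarrow>
      ('g, (nat \<Rightarrow> 'g \<Rightarrow> 'h) set) representation"
  where "ind G H \<sigma> \<mu> =
    \<lparr>fibre = ind_fibre G H \<sigma> \<mu>,
     sections = locally_uniform_closure (unit_space G) (ind_fibre G H \<sigma> \<mu>)
       (ind_section G H \<sigma> \<mu> ` ind_completion G H \<sigma> \<mu>),
     act = (\<lambda>x A. (\<lambda>f i. \<lambda>y \<in> range_fibre G (rng G x). f i (gmul G (ginv G x) y)) ` A)\<rparr>"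

end

theory Submission imports Defs begin

text \<open>
  Induction in stages. A function \<open>f\<close> on \<open>G\<close> that is equivariant under \<open>K\<close> becomes, on writing
  \<open>f~(x) = (h \<mapsto> f(xh))\<close>, a function on \<open>G\<close> whose value at \<open>x\<close> is a \<open>K\<close>-equivariant function on the
  range fibre of \<open>d(x)\<close> in \<open>H\<close>, that is, a vector of \<open>ind\<^sub>K\<^sup>H \<sigma>\<close> over \<open>d(x)\<close>; and \<open>f~\<close> is equivariant
  under \<open>H\<close>. The formula that defines \<open>\<gamma>\<close>, applied to the inner product of two such functions, says
  exactly that \<open>f \<mapsto> f~\<close> is isometric on every fibre over \<open>G\<^sup>0\<close>. Left translation is untouched by the
  construction, so the extension to the completions intertwines. What remains is analysis: \<open>f~\<close> is
  an induced function (it is continuous and has compact support modulo \<open>H\<close>), the functions \<open>f~\<close> are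
  dense, and the resulting fibrewise unitary is continuous on the bundles.

  Everything about continuity is reduced to local approximation by sections
  (\<open>continuous_total_iff\<close>) and to continuity of integrals depending on a parameter
  (\<open>param_integral\<close>). Both meet in \<open>slice_distance_continuous\<close>, which yields the continuity of \<open>f~\<close>.

  Density rests on an approximation theorem for equivariant functions on a groupoid with a closed
  subgroupoid (\<open>uniform_approximation\<close>): a family of induced functions that is pointwise dense and
  stable under multiplication by functions on the coset space is uniformly dense, by a partition of
  unity. It is used twice. For all induced functions, pointwise density comes from averaging
  sections with the Haar system of the subgroupoid (\<open>pointwise_density\<close>); iterating the
  approximation then gives a Tietze theorem (\<open>equivariant_Tietze\<close>), by which an equivariant
  function on a closed set stable under the subgroupoid, with compact support in the coset space,
  extends to an induced function. For the family of all \<open>f~\<close>, pointwise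
  density follows from this extension theorem: every vector in the fibre of \<open>ind\<^sub>K\<^sup>H \<sigma>\<close> over
  \<open>d(x)\<close> is a limit of functions on \<open>H\<close>, and these extend to \<open>G\<close> and may be translated by \<open>x\<close>
  (\<open>slice_surjective\<close>). Pointwise density also makes the intermediate representation an instance
  of \<open>equivariant_field\<close>, so that the results on induced bundles apply to it.

  The extension theorem has a second use: it characterises the restrictions of induced functions to
  a range fibre by equivariance and compact support alone (\<open>PF_carrier_iff\<close>), so that translation
  by \<open>x\<close> is seen to be a bijection between the fibres over \<open>d(x)\<close> and \<open>r(x)\<close> before completion.
\<close>

section \<open>Semi-inner product spaces\<close>

lemma complex_ring_simps [simp]:
  "carrier complex_ring = UNIV" "add complex_ring = (+)" "mult complex_ring = (*)"
  "one complex_ring = 1" "zero complex_ring = 0"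
  by (simp_all add: complex_ring_def)

lemma cring_complex_ring: "cring complex_ring"
proof -
  have "\<exists>y. y + x = (0::complex) \<and> x + y = 0" for x
    by (rule exI[of _ "- x"]) simp
  then show ?thesis
    by unfold_locales (auto simp: complex_ring_def algebra_simps Units_def)
qed

lemma complex_ring_uminus [simp]: "\<ominus>\<^bsub>complex_ring\<^esub> z = - z"
proof -
  interpret cring complex_ring by (rule cring_complex_ring)
  show ?thesis
    using minus_equality[of "- z" z] by simp
qed

text \<open>
  Forms that need not be definite, since the fibres of an induced bundle are first spaces of
  functions, among which some of norm zero may be nonzero.
\<close>

locale semi_inner =
  fixes V :: "'h prehilbert"  (structure)
  assumes mod: "Module.module complex_ring V"
    and inner_add_left: "\<lbrakk>a \<in> carrier V; b \<in> carrier V; c \<in> carrier V\<rbrakk> \<Longrightarrow>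
      hinner V (a \<oplus> b) c = hinner V a c + hinner V b c"
    and inner_smult_left: "\<lbrakk>a \<in> carrier V; b \<in> carrier V\<rbrakk> \<Longrightarrow>
      hinner V (z \<odot> a) b = z * hinner V a b"
    and inner_cnj: "\<lbrakk>a \<in> carrier V; b \<in> carrier V\<rbrakk> \<Longrightarrow> hinner V b a = cnj (hinner V a b)"
    and inner_pos: "a \<in> carrier V \<Longrightarrow> Re (hinner V a a) \<ge> 0"
begin

interpretation M: module complex_ring V by (rule mod)

lemma add_closed [simp]: "\<lbrakk>a \<in> carrier V; b \<in> carrier V\<rbrakk> \<Longrightarrow> a \<oplus> b \<in> carrier V"
  and zero_closed [simp]: "\<zero> \<in> carrier V"
  and minus_closed [simp]: "\<lbrakk>a \<in> carrier V; b \<in> carrier V\<rbrakk> \<Longrightarrow> a \<ominus> b \<in> carrier V"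
  and uminus_closed [simp]: "a \<in> carrier V \<Longrightarrow> \<ominus> a \<in> carrier V"
  and smult_closed [simp]: "a \<in> carrier V \<Longrightarrow> z \<odot> a \<in> carrier V"
  by simp_all

lemma minus_eq_smult: "\<lbrakk>a \<in> carrier V; b \<in> carrier V\<rbrakk> \<Longrightarrow> a \<ominus> b = a \<oplus> (-1) \<odot> b"
  using M.smult_l_minus[of 1 b] M.smult_one[of b] by (simp add: a_minus_def)

lemma uminus_eq_smult: "a \<in> carrier V \<Longrightarrow> \<ominus> a = (-1) \<odot> a"
  using M.smult_l_minus[of 1 a] M.smult_one[of a] by simp

lemma zero_smult: "a \<in> carrier V \<Longrightarrow> 0 \<odot> a = \<zero>"
  using M.smult_l_null[of a] by simp

lemma smult_zero: "z \<odot> \<zero> = \<zero>"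
  using M.smult_r_null[of z] by simp

lemma minus_self: "a \<in> carrier V \<Longrightarrow> a \<ominus> a = \<zero>"
  using M.r_neg by (simp add: a_minus_def)

lemma minus_eq_zeroD: "\<lbrakk>a \<in> carrier V; b \<in> carrier V; a \<ominus> b = \<zero>\<rbrakk> \<Longrightarrow> a = b"
  by (metis M.M.minus_equality M.M.minus_minus a_minus_def uminus_closed M.M.a_comm)

lemma inner_smult_right:
  "\<lbrakk>a \<in> carrier V; c \<in> carrier V\<rbrakk> \<Longrightarrow> hinner V c (z \<odot> a) = cnj z * hinner V c a"
  using inner_cnj[of "z \<odot> a" c] inner_cnj[of a c] by (simp add: inner_smult_left)

lemma inner_add_right:
  "\<lbrakk>a \<in> carrier V; b \<in> carrier V; c \<in> carrier V\<rbrakk> \<Longrightarrow> hinner V c (a \<oplus> b) = hinner V c a + hinner V c b"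
  using inner_cnj[of "a \<oplus> b" c] inner_cnj[of a c] inner_cnj[of b c] by (simp add: inner_add_left)

lemma inner_zero_left: "c \<in> carrier V \<Longrightarrow> hinner V \<zero> c = 0"
  using inner_smult_left[of c c 0] zero_smult[of c] by simp

lemma inner_zero_right: "c \<in> carrier V \<Longrightarrow> hinner V c \<zero> = 0"
  using inner_smult_right[of c c 0] zero_smult[of c] by simp

lemma inner_uminus:
  "\<lbrakk>a \<in> carrier V; c \<in> carrier V\<rbrakk> \<Longrightarrow> hinner V (\<ominus> a) c = - hinner V a c"
  "\<lbrakk>a \<in> carrier V; c \<in> carrier V\<rbrakk> \<Longrightarrow> hinner V c (\<ominus> a) = - hinner V c a"
  by (simp_all add: uminus_eq_smult inner_smult_left inner_smult_right)

lemma inner_minus: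
  "\<lbrakk>a \<in> carrier V; b \<in> carrier V; c \<in> carrier V\<rbrakk> \<Longrightarrow> hinner V (a \<ominus> b) c = hinner V a c - hinner V b c"
  "\<lbrakk>a \<in> carrier V; b \<in> carrier V; c \<in> carrier V\<rbrakk> \<Longrightarrow> hinner V c (a \<ominus> b) = hinner V c a - hinner V c b"
  by (simp_all add: minus_eq_smult inner_smult_left inner_smult_right inner_add_left inner_add_right)

lemmas inner_simps = inner_add_left inner_add_right inner_smult_left inner_smult_right
  inner_minus inner_uminus inner_zero_left inner_zero_right

lemma inner_self: "a \<in> carrier V \<Longrightarrow> hinner V a a = complex_of_real ((hnorm V a)\<^sup>2)"
  using inner_cnj[of a a] inner_pos[of a]
  by (simp add: hnorm_def complex_eq_iff)

lemma norm_sq: "a \<in> carrier V \<Longrightarrow> (hnorm V a)\<^sup>2 = Re (hinner V a a)"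
  using inner_pos[of a] by (simp add: hnorm_def)

lemma norm_ge0 [simp]: "a \<in> carrier V \<Longrightarrow> hnorm V a \<ge> 0"
  using inner_pos[of a] by (simp add: hnorm_def)

lemma norm_zero [simp]: "hnorm V \<zero> = 0"
  by (simp add: hnorm_def inner_simps(9))

lemma norm_smult:
  assumes a: "a \<in> carrier V"
  shows "hnorm V (z \<odot> a) = cmod z * hnorm V a"
proof -
  have "hinner V (z \<odot> a) (z \<odot> a) = complex_of_real ((cmod z * hnorm V a)\<^sup>2)"
    using a complex_norm_square[of z]
    by (simp add: inner_smult_left inner_smult_right inner_self[of a] power_mult_distrib mult_ac)
  then have "(hnorm V (z \<odot> a))\<^sup>2 = (cmod z * hnorm V a)\<^sup>2"
    using a by (simp add: norm_sq)
  then show ?thesis using a by simp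
qed

lemma norm_minus_sq:
  assumes "a \<in> carrier V" "b \<in> carrier V"
  shows "(hnorm V (a \<ominus> z \<odot> b))\<^sup>2
    = (hnorm V a)\<^sup>2 - 2 * Re (cnj z * hinner V a b) + (cmod z)\<^sup>2 * (hnorm V b)\<^sup>2"
proof -
  have "hinner V (a \<ominus> z \<odot> b) (a \<ominus> z \<odot> b)
    = hinner V a a - (cnj z * hinner V a b + cnj (cnj z * hinner V a b)) + z * cnj z * hinner V b b"
    using assms inner_cnj[of a b] by (simp add: inner_simps algebra_simps)
  then show ?thesis
    using assms by (simp add: norm_sq[of "a \<ominus> z \<odot> b"] inner_self[of a] inner_self[of b]
        flip: complex_norm_square of_real_power of_real_mult)
qed

lemma Cauchy_Schwarz:
  assumes a: "a \<in> carrier V" and b: "b \<in> carrier V"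
  shows "cmod (hinner V a b) \<le> hnorm V a * hnorm V b"
proof (cases "hnorm V b = 0")
  case True
  have "hinner V a b = 0"
  proof (rule ccontr)
    assume nz: "hinner V a b \<noteq> 0"
    define c where "c = (cmod (hinner V a b))\<^sup>2"
    have c: "c > 0" using nz by (simp add: c_def)
    define t where "t = ((hnorm V a)\<^sup>2 + 1) / (2 * c)"
    have "Re (cnj (t * hinner V a b) * hinner V a b) = t * c"
      by (simp add: c_def cmod_power2) (simp add: algebra_simps power2_eq_square)
    then have "(hnorm V (a \<ominus> (t * hinner V a b) \<odot> b))\<^sup>2 = (hnorm V a)\<^sup>2 - 2 * (t * c)"
      using norm_minus_sq[OF a b, of "t * hinner V a b"] True by simp
    also have "\<dots> = - 1" using c by (simp add: t_def field_simps)
    finally show False by (metis zero_le_power2 not_one_le_zero neg_0_le_iff_le)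
  qed
  then show ?thesis using True by simp
next
  case False
  define B where "B = (hnorm V b)\<^sup>2"
  define c where "c = (cmod (hinner V a b))\<^sup>2"
  have B: "B > 0" using False by (simp add: B_def)
  define z where "z = hinner V a b / B"
  have 1: "Re (cnj z * hinner V a b) = c / B"
    by (simp add: z_def c_def cmod_power2 add_divide_distrib) (simp add: power2_eq_square)
  have 2: "(cmod z)\<^sup>2 * B = c / B"
    using B by (simp add: z_def c_def norm_divide power_divide power2_eq_square)
  have "0 \<le> (hnorm V (a \<ominus> z \<odot> b))\<^sup>2" by simp
  also have "\<dots> = (hnorm V a)\<^sup>2 - c / B"
    using norm_minus_sq[OF a b, of z] 1 2 by (simp add: B_def)
  finally have "c \<le> (hnorm V a)\<^sup>2 * B" using B by (simp add: field_simps)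
  then have "(cmod (hinner V a b))\<^sup>2 \<le> (hnorm V a * hnorm V b)\<^sup>2"
    by (simp add: c_def B_def power_mult_distrib)
  then show ?thesis using a b by (auto intro: power2_le_imp_le)
qed

lemma norm_triangle:
  assumes a: "a \<in> carrier V" and b: "b \<in> carrier V"
  shows "hnorm V (a \<oplus> b) \<le> hnorm V a + hnorm V b"
proof -
  have "(hnorm V (a \<oplus> b))\<^sup>2 = (hnorm V a)\<^sup>2 + 2 * Re (hinner V a b) + (hnorm V b)\<^sup>2"
    using a b inner_cnj[of a b] by (simp add: norm_sq inner_simps)
  also have "\<dots> \<le> (hnorm V a)\<^sup>2 + 2 * (hnorm V a * hnorm V b) + (hnorm V b)\<^sup>2"
    using Cauchy_Schwarz[OF a b] complex_Re_le_cmod[of "hinner V a b"] by linarith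
  also have "\<dots> = (hnorm V a + hnorm V b)\<^sup>2" by (simp add: power2_sum)
  finally show ?thesis using a b by (auto intro: power2_le_imp_le)
qed

text \<open>
  Norms of combinations of vectors are compared by expanding inner products, which avoids
  calculation with the module laws.
\<close>

lemma norm_cong: "hinner V a a = hinner V b b \<Longrightarrow> hnorm V a = hnorm V b"
  by (simp add: hnorm_def)

lemma norm_minus_commute: "\<lbrakk>a \<in> carrier V; b \<in> carrier V\<rbrakk> \<Longrightarrow> hnorm V (a \<ominus> b) = hnorm V (b \<ominus> a)"
  by (rule norm_cong) (simp add: inner_simps)

lemma norm_minus_zero: "a \<in> carrier V \<Longrightarrow> hnorm V (a \<ominus> \<zero>) = hnorm V a"
  by (rule norm_cong) (simp add: inner_simps)

lemma norm_minus_self: "a \<in> carrier V \<Longrightarrow> hnorm V (a \<ominus> a) = 0"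
  by (simp add: minus_self)

lemma norm_triangle_minus:
  assumes "a \<in> carrier V" "b \<in> carrier V" "c \<in> carrier V"
  shows "hnorm V (a \<ominus> c) \<le> hnorm V (a \<ominus> b) + hnorm V (b \<ominus> c)"
proof -
  have "hnorm V (a \<ominus> c) = hnorm V ((a \<ominus> b) \<oplus> (b \<ominus> c))"
    using assms by (intro norm_cong) (simp add: inner_simps)
  then show ?thesis using assms by (simp add: norm_triangle)
qed

lemma norm_le_minus:
  assumes "a \<in> carrier V" "b \<in> carrier V"
  shows "hnorm V a \<le> hnorm V (a \<ominus> b) + hnorm V b"
  using norm_triangle_minus[of a b \<zero>] assms by (simp add: norm_minus_zero)

lemma norm_diff_le:
  assumes "a \<in> carrier V" "b \<in> carrier V"
  shows "\<bar>hnorm V a - hnorm V b\<bar> \<le> hnorm V (a \<ominus> b)"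
  using norm_le_minus[OF assms] norm_le_minus[OF assms(2,1)] norm_minus_commute[OF assms] by linarith

lemma norm_add_diff:
  assumes "a \<in> carrier V" "b \<in> carrier V" "c \<in> carrier V" "d \<in> carrier V"
  shows "hnorm V ((a \<oplus> b) \<ominus> (c \<oplus> d)) \<le> hnorm V (a \<ominus> c) + hnorm V (b \<ominus> d)"
proof -
  have "hnorm V ((a \<oplus> b) \<ominus> (c \<oplus> d)) = hnorm V ((a \<ominus> c) \<oplus> (b \<ominus> d))"
    using assms by (intro norm_cong) (simp add: inner_simps)
  then show ?thesis using assms by (simp add: norm_triangle)
qed

lemma norm_smult_diff:
  assumes "a \<in> carrier V" "b \<in> carrier V"
  shows "hnorm V (z \<odot> a \<ominus> z \<odot> b) = cmod z * hnorm V (a \<ominus> b)"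
proof -
  have "hnorm V (z \<odot> a \<ominus> z \<odot> b) = hnorm V (z \<odot> (a \<ominus> b))"
    using assms by (intro norm_cong) (simp add: inner_simps algebra_simps)
  then show ?thesis using assms by (simp add: norm_smult)
qed

lemma norm_smult_diff2:
  assumes "a \<in> carrier V"
  shows "hnorm V (z \<odot> a \<ominus> w \<odot> a) = cmod (z - w) * hnorm V a"
proof -
  have "hnorm V (z \<odot> a \<ominus> w \<odot> a) = hnorm V ((z - w) \<odot> a)"
    using assms by (intro norm_cong) (simp add: inner_simps algebra_simps)
  then show ?thesis using assms by (simp add: norm_smult)
qed

lemma inner_diff_le:
  assumes "a \<in> carrier V" "b \<in> carrier V" "c \<in> carrier V" "d \<in> carrier V"
  shows "cmod (hinner V a b - hinner V c d)
    \<le> hnorm V (a \<ominus> c) * hnorm V b + hnorm V c * hnorm V (b \<ominus> d)"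
proof -
  have "hinner V a b - hinner V c d = hinner V (a \<ominus> c) b + hinner V c (b \<ominus> d)"
    using assms by (simp add: inner_simps)
  also have "cmod \<dots> \<le> cmod (hinner V (a \<ominus> c) b) + cmod (hinner V c (b \<ominus> d))"
    by (rule norm_triangle_ineq)
  finally show ?thesis
    using Cauchy_Schwarz[of "a \<ominus> c" b] Cauchy_Schwarz[of c "b \<ominus> d"] assms by simp
qed

text \<open>
  Polarisation reduces the continuity of inner products of sections to that of their norms.
\<close>

lemma inner_polar:
  assumes "a \<in> carrier V" "b \<in> carrier V"
  shows "hinner V a b = complex_of_real ((hnorm V (a \<oplus> b))\<^sup>2 / 2 - (hnorm V a)\<^sup>2 / 2 - (hnorm V b)\<^sup>2 / 2)
     + \<i> * complex_of_real ((hnorm V (a \<oplus> \<i> \<odot> b))\<^sup>2 / 2 - (hnorm V a)\<^sup>2 / 2 - (hnorm V b)\<^sup>2 / 2)"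
  using assms inner_cnj[of a b] by (simp add: norm_sq inner_simps complex_eq_iff add_divide_distrib)

end

section \<open>Completions\<close>

lemma null_le:
  fixes f g :: "nat \<Rightarrow> real"
  assumes "\<And>n. 0 \<le> f n" "\<And>n. f n \<le> g n" "g \<longlonglongrightarrow> 0"
  shows "f \<longlonglongrightarrow> 0"
  using assms by (intro tendsto_sandwich[OF _ _ tendsto_const assms(3)]) auto

context semi_inner
begin

interpretation M: module complex_ring V by (rule mod)

abbreviation "cs \<equiv> cauchy_sequences V (hnorm V)"
abbreviation "HC \<equiv> hilbert_completion V"

lemma cs_carrier: "s \<in> cs \<Longrightarrow> s i \<in> carrier V"
  by (simp add: cauchy_sequences_def)

lemma csD: "\<lbrakk>s \<in> cs; e > 0\<rbrakk> \<Longrightarrow> \<exists>N. \<forall>i\<ge>N. \<forall>j\<ge>N. hnorm V (s i \<ominus> s j) < e"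
  by (simp add: cauchy_sequences_def)

lemma const_cs: "a \<in> carrier V \<Longrightarrow> (\<lambda>_. a) \<in> cs"
  by (simp add: cauchy_sequences_def norm_minus_self)

lemma cs_perturb:
  assumes s: "s \<in> cs" and t: "\<And>i. t i \<in> carrier V" and lim: "(\<lambda>i. hnorm V (s i \<ominus> t i)) \<longlonglongrightarrow> 0"
  shows "t \<in> cs"
proof -
  have "\<exists>N. \<forall>i\<ge>N. \<forall>j\<ge>N. hnorm V (t i \<ominus> t j) < e" if e: "e > 0" for e
  proof -
    obtain N1 where N1: "\<forall>i\<ge>N1. \<forall>j\<ge>N1. hnorm V (s i \<ominus> s j) < e / 3" using csD[OF s, of "e/3"] e by auto
    obtain N2 where N2: "\<forall>i\<ge>N2. \<bar>hnorm V (s i \<ominus> t i)\<bar> < e / 3"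
      using lim e unfolding LIMSEQ_iff by (metis diff_zero divide_pos_pos real_norm_def zero_less_numeral)
    have "hnorm V (t i \<ominus> t j) < e" if "i \<ge> max N1 N2" "j \<ge> max N1 N2" for i j
    proof -
      have "hnorm V (t i \<ominus> t j) \<le> hnorm V (t i \<ominus> s i) + hnorm V (s i \<ominus> t j)"
        using s t by (intro norm_triangle_minus) (auto simp: cs_carrier)
      also have "hnorm V (s i \<ominus> t j) \<le> hnorm V (s i \<ominus> s j) + hnorm V (s j \<ominus> t j)"
        using s t by (intro norm_triangle_minus) (auto simp: cs_carrier)
      also have "hnorm V (t i \<ominus> s i) = hnorm V (s i \<ominus> t i)"
        using s t by (intro norm_minus_commute) (auto simp: cs_carrier)
      moreover have "hnorm V (s i \<ominus> s j) < e/3" "\<bar>hnorm V (s i \<ominus> t i)\<bar> < e/3" "\<bar>hnorm V (s j \<ominus> t j)\<bar> < e/3"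
        using N1 N2 that by auto
      ultimately show ?thesis by linarith
    qed
    then show ?thesis by blast
  qed
  then show ?thesis using t by (simp add: cauchy_sequences_def)
qed

lemma cs_add:
  assumes s: "s \<in> cs" and t: "t \<in> cs"
  shows "(\<lambda>i. s i \<oplus> t i) \<in> cs"
proof -
  have "\<exists>N. \<forall>i\<ge>N. \<forall>j\<ge>N. hnorm V ((s i \<oplus> t i) \<ominus> (s j \<oplus> t j)) < e" if e: "e > 0" for e
  proof -
    obtain N1 where N1: "\<forall>i\<ge>N1. \<forall>j\<ge>N1. hnorm V (s i \<ominus> s j) < e / 2" using csD[OF s, of "e/2"] e by auto
    obtain N2 where N2: "\<forall>i\<ge>N2. \<forall>j\<ge>N2. hnorm V (t i \<ominus> t j) < e / 2" using csD[OF t, of "e/2"] e by auto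
    have "hnorm V ((s i \<oplus> t i) \<ominus> (s j \<oplus> t j)) < e" if "i \<ge> max N1 N2" "j \<ge> max N1 N2" for i j
    proof -
      have "hnorm V (s i \<ominus> s j) < e/2" "hnorm V (t i \<ominus> t j) < e/2" using N1 N2 that by auto
      then show ?thesis
        using norm_add_diff[of "s i" "t i" "s j" "t j"] s t by (simp add: cs_carrier)
    qed
    then show ?thesis by blast
  qed
  then show ?thesis using s t by (simp add: cauchy_sequences_def)
qed

lemma cs_smult:
  assumes s: "s \<in> cs"
  shows "(\<lambda>i. z \<odot> s i) \<in> cs"
proof -
  have "\<exists>N. \<forall>i\<ge>N. \<forall>j\<ge>N. hnorm V (z \<odot> s i \<ominus> z \<odot> s j) < e" if e: "e > 0" for e
  proof -
    obtain N where N: "\<forall>i\<ge>N. \<forall>j\<ge>N. hnorm V (s i \<ominus> s j) < e / (cmod z + 1)"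
      using csD[OF s, of "e/(cmod z + 1)"] e by (auto simp: add_nonneg_pos)
    have "hnorm V (z \<odot> s i \<ominus> z \<odot> s j) < e" if "i \<ge> N" "j \<ge> N" for i j
    proof -
      have p: "cmod z + 1 > 0" by (simp add: add_nonneg_pos)
      have "hnorm V (s i \<ominus> s j) * (cmod z + 1) < e"
        using N that p by (simp add: pos_less_divide_eq)
      moreover have "hnorm V (s i \<ominus> s j) \<ge> 0" using s by (simp add: cs_carrier)
      ultimately have "cmod z * hnorm V (s i \<ominus> s j) < e" by (simp only: algebra_simps)
      then show ?thesis using s by (simp add: norm_smult_diff cs_carrier)
    qed
    then show ?thesis by blast
  qed
  then show ?thesis using s by (simp add: cauchy_sequences_def)
qed

lemma cs_bounded:
  assumes s: "s \<in> cs"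
  obtains B where "B > 0" "\<And>i. hnorm V (s i) \<le> B"
proof -
  obtain N where N: "\<forall>i\<ge>N. \<forall>j\<ge>N. hnorm V (s i \<ominus> s j) < 1" using csD[OF s, of 1] by auto
  define M where "M = Max (insert 0 ((\<lambda>i. hnorm V (s i)) ` {..N}))"
  define B where "B = M + 1"
  have le: "hnorm V (s i) \<le> B - 1" if "i \<le> N" for i
    unfolding B_def add_diff_cancel_right' unfolding M_def by (rule Max_ge) (use that in auto)
  have "B - 1 \<ge> 0"
    unfolding B_def add_diff_cancel_right' unfolding M_def by (rule Max_ge) auto
  have "hnorm V (s i) \<le> B" for i
  proof (cases "i \<le> N")
    case False
    then have "hnorm V (s i) \<le> hnorm V (s i \<ominus> s N) + hnorm V (s N)" "hnorm V (s i \<ominus> s N) < 1"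
      using N s by (auto intro: norm_le_minus simp: cs_carrier)
    then show ?thesis using le[of N] by simp
  qed (use le[of i] in auto)
  then show ?thesis using that[of B] \<open>B - 1 \<ge> 0\<close> by simp
qed

lemma lc_mem:
  "t \<in> limit_class V s \<longleftrightarrow> s \<in> cs \<and> t \<in> cs \<and> (\<lambda>i. hnorm V (s i \<ominus> t i)) \<longlonglongrightarrow> 0"
  by (auto simp: limit_class_def null_rel_def)

lemma lc_self: "s \<in> cs \<Longrightarrow> s \<in> limit_class V s"
  by (simp add: lc_mem norm_minus_self cs_carrier)

lemma null_trans:
  assumes "\<And>i. s i \<in> carrier V" "\<And>i. t i \<in> carrier V" "\<And>i. r i \<in> carrier V"
    and "(\<lambda>i. hnorm V (s i \<ominus> t i)) \<longlonglongrightarrow> 0" "(\<lambda>i. hnorm V (t i \<ominus> r i)) \<longlonglongrightarrow> 0"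
  shows "(\<lambda>i. hnorm V (s i \<ominus> r i)) \<longlonglongrightarrow> 0"
proof (rule null_le)
  show "(\<lambda>i. hnorm V (s i \<ominus> t i) + hnorm V (t i \<ominus> r i)) \<longlonglongrightarrow> 0"
    using tendsto_add[OF assms(4,5)] by simp
qed (use assms in \<open>auto intro: norm_triangle_minus\<close>)

lemma null_sym:
  assumes "s \<in> cs" "t \<in> cs"
  shows "(\<lambda>i. hnorm V (s i \<ominus> t i)) = (\<lambda>i. hnorm V (t i \<ominus> s i))"
  using assms by (auto simp: cs_carrier norm_minus_commute)

lemma lc_eqI:
  assumes s: "s \<in> cs" and t: "t \<in> cs" and lim: "(\<lambda>i. hnorm V (s i \<ominus> t i)) \<longlonglongrightarrow> 0"
  shows "limit_class V s = limit_class V t"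
proof -
  have lim': "(\<lambda>i. hnorm V (t i \<ominus> s i)) \<longlonglongrightarrow> 0" using lim null_sym[OF s t] by simp
  have "r \<in> limit_class V s \<longleftrightarrow> r \<in> limit_class V t" for r
    using s t lim lim' null_trans[of s t r] null_trans[of t s r] by (auto simp: lc_mem cs_carrier)
  then show ?thesis by blast
qed

lemma lc_eq_iff:
  assumes "s \<in> cs" "t \<in> cs"
  shows "limit_class V s = limit_class V t \<longleftrightarrow> (\<lambda>i. hnorm V (s i \<ominus> t i)) \<longlonglongrightarrow> 0"
  using lc_eqI[OF assms] lc_self[OF assms(2)] by (metis lc_mem)

lemma lc_memD:
  assumes "t \<in> limit_class V s"
  shows "s \<in> cs" "t \<in> cs" "(\<lambda>i. hnorm V (s i \<ominus> t i)) \<longlonglongrightarrow> 0" "(\<lambda>i. hnorm V (t i \<ominus> s i)) \<longlonglongrightarrow> 0"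
  using assms null_sym[of s t] by (auto simp: lc_mem)

lemma lc_of_mem: "t \<in> limit_class V s \<Longrightarrow> limit_class V t = limit_class V s"
  by (metis lc_mem lc_eqI)

lemma HC_carrier: "carrier HC = limit_class V ` cs"
  by (auto simp: hilbert_completion_def completion_def quotient_def limit_class_def)

lemma lc_carrier: "s \<in> cs \<Longrightarrow> limit_class V s \<in> carrier HC"
  by (simp add: HC_carrier)

lemma HC_cases:
  assumes "A \<in> carrier HC" obtains s where "s \<in> cs" "A = limit_class V s"
  using assms by (auto simp: HC_carrier)

text \<open>
  Evaluates the operations of the completion, which are unions over all representatives.
\<close>

lemma UN_lc:
  assumes s: "s \<in> cs"
    and "\<And>t. t \<in> limit_class V s \<Longrightarrow> F t = F s"
  shows "(\<Union>t \<in> limit_class V s. F t) = F s"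
  using assms lc_self[OF s] by blast

lemma HC_add:
  assumes s: "s \<in> cs" and t: "t \<in> cs"
  shows "limit_class V s \<oplus>\<^bsub>HC\<^esub> limit_class V t = limit_class V (\<lambda>i. s i \<oplus> t i)"
proof -
  have eq: "limit_class V (\<lambda>i. s' i \<oplus> t' i) = limit_class V (\<lambda>i. s i \<oplus> t i)"
    if s': "s' \<in> limit_class V s" and t': "t' \<in> limit_class V t" for s' t'
  proof (rule lc_eqI)
    show "(\<lambda>i. s' i \<oplus> t' i) \<in> cs" "(\<lambda>i. s i \<oplus> t i) \<in> cs"
      using that s t by (auto simp: lc_mem intro: cs_add)
    have c: "s i \<in> carrier V" "t i \<in> carrier V" "s' i \<in> carrier V" "t' i \<in> carrier V" for i
      using that by (auto simp: lc_mem cs_carrier)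
    have lim: "(\<lambda>i. hnorm V (s' i \<ominus> s i) + hnorm V (t' i \<ominus> t i)) \<longlonglongrightarrow> 0 + 0"
      by (intro tendsto_add lc_memD(4)[OF s'] lc_memD(4)[OF t'])
    show "(\<lambda>i. hnorm V ((s' i \<oplus> t' i) \<ominus> (s i \<oplus> t i))) \<longlonglongrightarrow> 0"
      by (rule null_le[OF _ _ lim[simplified]]) (simp_all add: c norm_add_diff)
  qed
  have "(\<Union>t' \<in> limit_class V t. limit_class V (\<lambda>i. s' i \<oplus> t' i)) = limit_class V (\<lambda>i. s i \<oplus> t i)"
    if "s' \<in> limit_class V s" for s'
    using eq[OF that] lc_self[OF t] by blast
  then show ?thesis using lc_self[OF s] by (auto simp: hilbert_completion_def)
qed

lemma HC_smult:
  assumes s: "s \<in> cs"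
  shows "z \<odot>\<^bsub>HC\<^esub> limit_class V s = limit_class V (\<lambda>i. z \<odot> s i)"
proof -
  have "limit_class V (\<lambda>i. z \<odot> s' i) = limit_class V (\<lambda>i. z \<odot> s i)"
    if s': "s' \<in> limit_class V s" for s'
  proof (rule lc_eqI)
    show "(\<lambda>i. z \<odot> s' i) \<in> cs" "(\<lambda>i. z \<odot> s i) \<in> cs"
      using that s by (auto simp: lc_mem intro: cs_smult)
    have c: "s i \<in> carrier V" "s' i \<in> carrier V" for i
      using that by (auto simp: lc_mem cs_carrier)
    have "(\<lambda>i. cmod z * hnorm V (s' i \<ominus> s i)) \<longlonglongrightarrow> cmod z * 0"
      by (intro tendsto_intros lc_memD(4)[OF s'])
    then show "(\<lambda>i. hnorm V (z \<odot> s' i \<ominus> z \<odot> s i)) \<longlonglongrightarrow> 0"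
      by (simp add: norm_smult_diff c)
  qed
  then have "(\<Union>s' \<in> limit_class V s. limit_class V (\<lambda>i. z \<odot> s' i)) = limit_class V (\<lambda>i. z \<odot> s i)"
    by (rule UN_lc[OF s])
  then show ?thesis by (simp add: hilbert_completion_def)
qed

lemma HC_zero: "\<zero>\<^bsub>HC\<^esub> = limit_class V (\<lambda>_. \<zero>)"
  by (simp add: hilbert_completion_def)

lemma inner_null:
  assumes s: "s \<in> cs" "s' \<in> cs" and t: "t \<in> cs" "t' \<in> cs"
    and "(\<lambda>i. hnorm V (s i \<ominus> s' i)) \<longlonglongrightarrow> 0" "(\<lambda>i. hnorm V (t i \<ominus> t' i)) \<longlonglongrightarrow> 0"
  shows "(\<lambda>i. hinner V (s i) (t i) - hinner V (s' i) (t' i)) \<longlonglongrightarrow> 0"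
proof -
  obtain B where B: "B > 0" "\<And>i. hnorm V (t i) \<le> B" using cs_bounded[OF t(1)] by blast
  obtain C where C: "C > 0" "\<And>i. hnorm V (s' i) \<le> C" using cs_bounded[OF s(2)] by blast
  have le: "cmod (hinner V (s i) (t i) - hinner V (s' i) (t' i))
    \<le> hnorm V (s i \<ominus> s' i) * B + C * hnorm V (t i \<ominus> t' i)" for i
  proof -
    have "cmod (hinner V (s i) (t i) - hinner V (s' i) (t' i))
      \<le> hnorm V (s i \<ominus> s' i) * hnorm V (t i) + hnorm V (s' i) * hnorm V (t i \<ominus> t' i)"
      using s t by (intro inner_diff_le) (auto simp: cs_carrier)
    also have "\<dots> \<le> hnorm V (s i \<ominus> s' i) * B + C * hnorm V (t i \<ominus> t' i)"
      using s t B C by (intro add_mono mult_mono) (auto simp: cs_carrier)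
    finally show ?thesis .
  qed
  have lim: "(\<lambda>i. hnorm V (s i \<ominus> s' i) * B + C * hnorm V (t i \<ominus> t' i)) \<longlonglongrightarrow> 0 * B + C * 0"
    using assms by (intro tendsto_intros)
  show ?thesis
    by (rule Lim_null_comparison[OF _ lim[simplified]]) (simp add: le)
qed

lemma inner_convergent:
  assumes s: "s \<in> cs" and t: "t \<in> cs"
  shows "convergent (\<lambda>i. hinner V (s i) (t i))"
proof -
  obtain B where B: "B > 0" "\<And>i. hnorm V (t i) \<le> B" using cs_bounded[OF t] by blast
  obtain C where C: "C > 0" "\<And>i. hnorm V (s i) \<le> C" using cs_bounded[OF s] by blast
  have "Cauchy (\<lambda>i. hinner V (s i) (t i))"
  proof (rule CauchyI)
    fix e :: real assume e: "e > 0"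
    obtain N1 where N1: "\<forall>i\<ge>N1. \<forall>j\<ge>N1. hnorm V (s i \<ominus> s j) < e / (2 * B)"
      using csD[OF s, of "e/(2*B)"] e B by auto
    obtain N2 where N2: "\<forall>i\<ge>N2. \<forall>j\<ge>N2. hnorm V (t i \<ominus> t j) < e / (2 * C)"
      using csD[OF t, of "e/(2*C)"] e C by auto
    have "cmod (hinner V (s i) (t i) - hinner V (s j) (t j)) < e"
      if "i \<ge> max N1 N2" "j \<ge> max N1 N2" for i j
    proof -
      have "cmod (hinner V (s i) (t i) - hinner V (s j) (t j))
        \<le> hnorm V (s i \<ominus> s j) * hnorm V (t i) + hnorm V (s j) * hnorm V (t i \<ominus> t j)"
        using s t by (intro inner_diff_le) (auto simp: cs_carrier)
      also have "\<dots> \<le> hnorm V (s i \<ominus> s j) * B + C * hnorm V (t i \<ominus> t j)"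
        using s t B C by (intro add_mono mult_mono) (auto simp: cs_carrier)
      also have "\<dots> < e / (2 * B) * B + C * (e / (2 * C))"
        using N1 N2 that B C by (intro add_strict_mono mult_strict_right_mono mult_strict_left_mono) auto
      also have "\<dots> = e" using B C by simp
      finally show ?thesis .
    qed
    then show "\<exists>M. \<forall>m\<ge>M. \<forall>n\<ge>M. norm (hinner V (s m) (t m) - hinner V (s n) (t n)) < e" by blast
  qed
  then show ?thesis by (simp add: Cauchy_convergent_iff)
qed

lemma HC_inner:
  assumes s: "s \<in> cs" and t: "t \<in> cs"
  shows "(\<lambda>i. hinner V (s i) (t i)) \<longlonglongrightarrow> hinner HC (limit_class V s) (limit_class V t)"
proof -
  define s' where "s' = (SOME r. r \<in> limit_class V s)"
  define t' where "t' = (SOME r. r \<in> limit_class V t)"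
  have s': "s' \<in> limit_class V s" unfolding s'_def using lc_self[OF s] by (rule someI[of "\<lambda>r. r \<in> limit_class V s"])
  have t': "t' \<in> limit_class V t" unfolding t'_def using lc_self[OF t] by (rule someI[of "\<lambda>r. r \<in> limit_class V t"])
  have "hinner HC (limit_class V s) (limit_class V t) = lim (\<lambda>i. hinner V (s' i) (t' i))"
    by (simp add: hilbert_completion_def s'_def t'_def)
  moreover have "(\<lambda>i. hinner V (s' i) (t' i)) \<longlonglongrightarrow> lim (\<lambda>i. hinner V (s' i) (t' i))"
    using inner_convergent s' t' by (auto simp: lc_mem convergent_LIMSEQ_iff)
  moreover have "(\<lambda>i. hinner V (s i) (t i) - hinner V (s' i) (t' i)) \<longlonglongrightarrow> 0"
    using s' t' by (intro inner_null) (auto simp: lc_mem)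
  ultimately show ?thesis
    using tendsto_add[of "\<lambda>i. hinner V (s i) (t i) - hinner V (s' i) (t' i)" 0 sequentially
      "\<lambda>i. hinner V (s' i) (t' i)"] by simp
qed

lemma HC_abelian: "abelian_group HC"
proof (rule abelian_groupI)
  fix A B assume "A \<in> carrier HC" "B \<in> carrier HC"
  then obtain s t where s: "s \<in> cs" "A = limit_class V s" and t: "t \<in> cs" "B = limit_class V t"
    unfolding HC_carrier by blast
  show "A \<oplus>\<^bsub>HC\<^esub> B \<in> carrier HC" using s t by (simp add: HC_add cs_add lc_carrier)
  show "A \<oplus>\<^bsub>HC\<^esub> B = B \<oplus>\<^bsub>HC\<^esub> A" using s t by (simp add: HC_add cs_carrier M.a_comm)
  fix C assume "C \<in> carrier HC"
  then obtain r where r: "r \<in> cs" "C = limit_class V r" unfolding HC_carrier by blast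
  show "A \<oplus>\<^bsub>HC\<^esub> B \<oplus>\<^bsub>HC\<^esub> C = A \<oplus>\<^bsub>HC\<^esub> (B \<oplus>\<^bsub>HC\<^esub> C)"
    using s t r by (simp add: HC_add cs_add cs_carrier M.a_assoc)
next
  show "\<zero>\<^bsub>HC\<^esub> \<in> carrier HC" by (simp add: HC_zero lc_carrier const_cs)
next
  fix A assume "A \<in> carrier HC"
  then obtain s where s: "s \<in> cs" "A = limit_class V s" unfolding HC_carrier by blast
  show "\<zero>\<^bsub>HC\<^esub> \<oplus>\<^bsub>HC\<^esub> A = A" using s by (simp add: HC_zero HC_add const_cs cs_carrier)
  have "(-1) \<odot>\<^bsub>HC\<^esub> A \<oplus>\<^bsub>HC\<^esub> A = limit_class V (\<lambda>i. (-1) \<odot> s i \<oplus> s i)"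
    using s by (simp add: HC_smult HC_add cs_smult)
  also have "\<dots> = \<zero>\<^bsub>HC\<^esub>"
    using s by (simp add: HC_zero cs_carrier M.l_neg flip: uminus_eq_smult)
  finally have "(-1) \<odot>\<^bsub>HC\<^esub> A \<oplus>\<^bsub>HC\<^esub> A = \<zero>\<^bsub>HC\<^esub>" .
  moreover have "(-1) \<odot>\<^bsub>HC\<^esub> A \<in> carrier HC" using s by (simp add: HC_smult cs_smult lc_carrier)
  ultimately show "\<exists>y\<in>carrier HC. y \<oplus>\<^bsub>HC\<^esub> A = \<zero>\<^bsub>HC\<^esub>" by blast
qed

lemma HC_module: "Module.module complex_ring HC"
proof (rule moduleI[OF cring_complex_ring HC_abelian])
  fix z w A B assume "A \<in> carrier HC"
  then obtain s where s: "s \<in> cs" "A = limit_class V s" unfolding HC_carrier by blast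
  show "z \<odot>\<^bsub>HC\<^esub> A \<in> carrier HC" using s by (simp add: HC_smult cs_smult lc_carrier)
  show "(z \<oplus>\<^bsub>complex_ring\<^esub> w) \<odot>\<^bsub>HC\<^esub> A = z \<odot>\<^bsub>HC\<^esub> A \<oplus>\<^bsub>HC\<^esub> w \<odot>\<^bsub>HC\<^esub> A"
    using s M.smult_l_distr by (simp add: HC_smult HC_add cs_smult cs_carrier)
  show "(z \<otimes>\<^bsub>complex_ring\<^esub> w) \<odot>\<^bsub>HC\<^esub> A = z \<odot>\<^bsub>HC\<^esub> (w \<odot>\<^bsub>HC\<^esub> A)"
    using s M.smult_assoc1 by (simp add: HC_smult cs_smult cs_carrier)
  show "\<one>\<^bsub>complex_ring\<^esub> \<odot>\<^bsub>HC\<^esub> A = A"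
    using s M.smult_one by (simp add: HC_smult cs_carrier)
  assume "B \<in> carrier HC"
  then obtain t where t: "t \<in> cs" "B = limit_class V t" unfolding HC_carrier by blast
  show "z \<odot>\<^bsub>HC\<^esub> (A \<oplus>\<^bsub>HC\<^esub> B) = z \<odot>\<^bsub>HC\<^esub> A \<oplus>\<^bsub>HC\<^esub> z \<odot>\<^bsub>HC\<^esub> B"
    using s t M.smult_r_distr by (simp add: HC_smult HC_add cs_smult cs_add cs_carrier)
qed

lemma HC_semi_inner: "semi_inner HC"
proof (rule semi_inner.intro)
  show "Module.module complex_ring HC" by (rule HC_module)
  fix A B C z assume "A \<in> carrier HC"
  then obtain s where s: "s \<in> cs" "A = limit_class V s" unfolding HC_carrier by blast
  have "(\<lambda>i. Re (hinner V (s i) (s i))) \<longlonglongrightarrow> Re (hinner HC A A)"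
    using HC_inner[OF s(1) s(1)] s by (intro tendsto_intros) auto
  then show "0 \<le> Re (hinner HC A A)"
    by (rule LIMSEQ_le_const) (use s in \<open>auto simp: cs_carrier inner_pos\<close>)
  assume "B \<in> carrier HC"
  then obtain t where t: "t \<in> cs" "B = limit_class V t" unfolding HC_carrier by blast
  have "(\<lambda>i. z * hinner V (s i) (t i)) \<longlonglongrightarrow> z * hinner HC A B"
    using HC_inner[OF s(1) t(1)] s t by (intro tendsto_intros) auto
  moreover have "(\<lambda>i. hinner V (z \<odot> s i) (t i)) \<longlonglongrightarrow> hinner HC (z \<odot>\<^bsub>HC\<^esub> A) B"
    using HC_inner[OF cs_smult[OF s(1)] t(1)] s t by (simp add: HC_smult)
  ultimately show "hinner HC (z \<odot>\<^bsub>HC\<^esub> A) B = z * hinner HC A B"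
    using s t by (simp add: inner_smult_left cs_carrier LIMSEQ_unique)
  have "(\<lambda>i. cnj (hinner V (s i) (t i))) \<longlonglongrightarrow> cnj (hinner HC A B)"
    using HC_inner[OF s(1) t(1)] s t by (intro tendsto_intros) auto
  moreover have "(\<lambda>i. hinner V (t i) (s i)) \<longlonglongrightarrow> hinner HC B A"
    using HC_inner[OF t(1) s(1)] s t by simp
  moreover have "hinner V (t i) (s i) = cnj (hinner V (s i) (t i))" for i
    using s t by (intro inner_cnj) (auto simp: cs_carrier)
  ultimately show "hinner HC B A = cnj (hinner HC A B)"
    by (simp add: LIMSEQ_unique)
  assume "C \<in> carrier HC"
  then obtain r where r: "r \<in> cs" "C = limit_class V r" unfolding HC_carrier by blast
  have "(\<lambda>i. hinner V (s i) (r i) + hinner V (t i) (r i)) \<longlonglongrightarrow> hinner HC A C + hinner HC B C"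
    using HC_inner[OF s(1) r(1)] HC_inner[OF t(1) r(1)] s t r by (intro tendsto_intros) auto
  moreover have "(\<lambda>i. hinner V (s i \<oplus> t i) (r i)) \<longlonglongrightarrow> hinner HC (A \<oplus>\<^bsub>HC\<^esub> B) C"
    using HC_inner[OF cs_add[OF s(1) t(1)] r(1)] s t r by (simp add: HC_add)
  ultimately show "hinner HC (A \<oplus>\<^bsub>HC\<^esub> B) C = hinner HC A C + hinner HC B C"
    using s t r by (simp add: inner_add_left cs_carrier LIMSEQ_unique)
qed

lemma HC_minus:
  assumes "s \<in> cs" "t \<in> cs"
  shows "limit_class V s \<ominus>\<^bsub>HC\<^esub> limit_class V t = limit_class V (\<lambda>i. s i \<ominus> t i)"
    and "(\<lambda>i. s i \<ominus> t i) \<in> cs"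
proof -
  interpret HC: semi_inner HC by (rule HC_semi_inner)
  show "limit_class V s \<ominus>\<^bsub>HC\<^esub> limit_class V t = limit_class V (\<lambda>i. s i \<ominus> t i)"
    using assms by (simp add: HC.minus_eq_smult lc_carrier HC_smult HC_add cs_smult)
      (simp add: minus_eq_smult cs_carrier)
  show "(\<lambda>i. s i \<ominus> t i) \<in> cs"
    using assms cs_add[OF assms(1) cs_smult[OF assms(2), of "-1"]]
    by (simp add: minus_eq_smult cs_carrier)
qed

lemma HC_norm: "s \<in> cs \<Longrightarrow> (\<lambda>i. hnorm V (s i)) \<longlonglongrightarrow> hnorm HC (limit_class V s)"
  using HC_inner[of s s] unfolding hnorm_def[of V "s _"] hnorm_def[of HC] by (intro tendsto_intros)

lemma HC_norm_minus:
  "\<lbrakk>s \<in> cs; t \<in> cs\<rbrakk> \<Longrightarrow> (\<lambda>i. hnorm V (s i \<ominus> t i)) \<longlonglongrightarrow> hnorm HC (limit_class V s \<ominus>\<^bsub>HC\<^esub> limit_class V t)"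
  using HC_norm HC_minus by simp

lemma HC_const:
  shows "\<lbrakk>a \<in> carrier V; b \<in> carrier V\<rbrakk> \<Longrightarrow>
      hinner HC (limit_class V (\<lambda>_. a)) (limit_class V (\<lambda>_. b)) = hinner V a b"
    and "a \<in> carrier V \<Longrightarrow> hnorm HC (limit_class V (\<lambda>_. a)) = hnorm V a"
    and "\<lbrakk>a \<in> carrier V; b \<in> carrier V\<rbrakk> \<Longrightarrow>
      limit_class V (\<lambda>_. a) \<oplus>\<^bsub>HC\<^esub> limit_class V (\<lambda>_. b) = limit_class V (\<lambda>_. a \<oplus> b)"
    and "\<lbrakk>a \<in> carrier V; b \<in> carrier V\<rbrakk> \<Longrightarrow>
      limit_class V (\<lambda>_. a) \<ominus>\<^bsub>HC\<^esub> limit_class V (\<lambda>_. b) = limit_class V (\<lambda>_. a \<ominus> b)"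
    and "a \<in> carrier V \<Longrightarrow> z \<odot>\<^bsub>HC\<^esub> limit_class V (\<lambda>_. a) = limit_class V (\<lambda>_. z \<odot> a)"
  using LIMSEQ_unique[OF HC_inner[OF const_cs const_cs] tendsto_const, of a b]
    LIMSEQ_unique[OF HC_norm[OF const_cs] tendsto_const, of a]
    HC_add[of "\<lambda>_. a" "\<lambda>_. b"] HC_minus[of "\<lambda>_. a" "\<lambda>_. b"] HC_smult[of "\<lambda>_. a" z] const_cs
  by simp_all

lemma HC_approx:
  assumes s: "s \<in> cs" and e: "e > 0"
  shows "\<exists>N. \<forall>n\<ge>N. hnorm HC (limit_class V s \<ominus>\<^bsub>HC\<^esub> limit_class V (\<lambda>_. s n)) < e"
proof -
  obtain N where N: "\<forall>i\<ge>N. \<forall>j\<ge>N. hnorm V (s i \<ominus> s j) < e / 2" using csD[OF s, of "e/2"] e by auto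
  have "hnorm HC (limit_class V s \<ominus>\<^bsub>HC\<^esub> limit_class V (\<lambda>_. s n)) \<le> e / 2" if "n \<ge> N" for n
  proof (rule LIMSEQ_le_const2)
    show "(\<lambda>i. hnorm V (s i \<ominus> s n)) \<longlonglongrightarrow> hnorm HC (limit_class V s \<ominus>\<^bsub>HC\<^esub> limit_class V (\<lambda>_. s n))"
      using s by (intro HC_norm_minus const_cs) (auto simp: cs_carrier)
    show "\<exists>N. \<forall>i\<ge>N. hnorm V (s i \<ominus> s n) \<le> e / 2"
      using N that less_imp_le by blast
  qed
  then have "hnorm HC (limit_class V s \<ominus>\<^bsub>HC\<^esub> limit_class V (\<lambda>_. s n)) < e" if "n \<ge> N" for n
    using that e by fastforce
  then show ?thesis by blast
qed

lemma HC_dense: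
  assumes A: "A \<in> carrier HC" and e: "e > 0"
  obtains a where "a \<in> carrier V" "hnorm HC (A \<ominus>\<^bsub>HC\<^esub> limit_class V (\<lambda>_. a)) < e"
proof -
  obtain s where s: "s \<in> cs" "A = limit_class V s" using HC_cases[OF A] by blast
  obtain N where "hnorm HC (limit_class V s \<ominus>\<^bsub>HC\<^esub> limit_class V (\<lambda>_. s N)) < e"
    using HC_approx[OF s(1) e] by blast
  then show thesis using that[of "s N"] s by (simp add: cs_carrier)
qed

lemma HC_hilbert: "is_hilbert_space HC"
proof -
  interpret HC: semi_inner HC by (rule HC_semi_inner)
  have pos: "Re (hinner HC A A) > 0" if A: "A \<in> carrier HC" "A \<noteq> \<zero>\<^bsub>HC\<^esub>" for A
  proof -
    obtain s where s: "s \<in> cs" "A = limit_class V s" using A unfolding HC_carrier by blast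
    have "hnorm HC A \<noteq> 0"
    proof
      assume "hnorm HC A = 0"
      then have "(\<lambda>i. hnorm V (s i \<ominus> \<zero>)) \<longlonglongrightarrow> 0"
        using HC_norm[OF s(1)] s by (simp add: cs_carrier norm_minus_zero)
      then have "A = \<zero>\<^bsub>HC\<^esub>" using s by (simp add: HC_zero lc_eq_iff const_cs)
      then show False using A by simp
    qed
    then show ?thesis using HC.inner_pos[OF A(1)] by (simp add: hnorm_def)
  qed
  have complete: "\<exists>A\<in>carrier HC. (\<lambda>i. hnorm HC (S i \<ominus>\<^bsub>HC\<^esub> A)) \<longlonglongrightarrow> 0"
    if S: "S \<in> cauchy_sequences HC (hnorm HC)" for S
  proof -
    have Sc: "S n \<in> carrier HC" for n using S by (simp add: cauchy_sequences_def)
    have "\<exists>a. a \<in> carrier V \<and> hnorm HC (S n \<ominus>\<^bsub>HC\<^esub> limit_class V (\<lambda>_. a)) < 1 / real (Suc n)" for n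
      by (rule HC_dense[OF Sc, of "1 / real (Suc n)" n]) auto
    then obtain a where a: "\<And>n. a n \<in> carrier V"
      and an: "\<And>n. hnorm HC (S n \<ominus>\<^bsub>HC\<^esub> limit_class V (\<lambda>_. a n)) < 1 / real (Suc n)" by metis
    define c where "c n = limit_class V (\<lambda>_. a n)" for n
    have cc: "c n \<in> carrier HC" for n by (simp add: c_def lc_carrier const_cs a)
    have lim1: "(\<lambda>n. hnorm HC (S n \<ominus>\<^bsub>HC\<^esub> c n)) \<longlonglongrightarrow> 0"
      by (rule null_le[OF _ _ LIMSEQ_inverse_real_of_nat])
        (use an in \<open>simp_all add: c_def[symmetric] inverse_eq_divide Sc cc less_imp_le\<close>)
    have "c \<in> HC.cs" by (rule HC.cs_perturb[OF S cc lim1])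
    then have a_cs: "a \<in> cs"
      by (simp add: cauchy_sequences_def c_def a HC_const)
    have "(\<lambda>n. hnorm HC (c n \<ominus>\<^bsub>HC\<^esub> limit_class V a)) \<longlonglongrightarrow> 0"
    proof (rule LIMSEQ_I)
      fix e :: real assume "e > 0"
      then obtain N where N: "\<forall>n\<ge>N. hnorm HC (limit_class V a \<ominus>\<^bsub>HC\<^esub> c n) < e"
        using HC_approx[OF a_cs] by (auto simp: c_def)
      have "norm (hnorm HC (c n \<ominus>\<^bsub>HC\<^esub> limit_class V a) - 0) < e" if "n \<ge> N" for n
        using N that HC.norm_minus_commute[of "c n" "limit_class V a"] cc lc_carrier[OF a_cs] by simp
      then show "\<exists>no. \<forall>n\<ge>no. norm (hnorm HC (c n \<ominus>\<^bsub>HC\<^esub> limit_class V a) - 0) < e" by blast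
    qed
    then have "(\<lambda>n. hnorm HC (S n \<ominus>\<^bsub>HC\<^esub> limit_class V a)) \<longlonglongrightarrow> 0"
      using HC.null_trans[of S c "\<lambda>_. limit_class V a"] Sc cc lc_carrier[OF a_cs] lim1 by blast
    then show ?thesis using lc_carrier[OF a_cs] by blast
  qed
  show ?thesis
    unfolding is_hilbert_space_def
    using HC.mod HC.inner_add_left HC.inner_smult_left HC.inner_cnj pos complete by blast
qed

end

lemma hilbert_semi_inner:
  assumes "is_hilbert_space V" shows "semi_inner V"
proof -
  note H = assms[unfolded is_hilbert_space_def]
  have mod: "Module.module complex_ring V" using H by blast
  interpret M: module complex_ring V by (rule mod)
  have s: "hinner V (z \<odot>\<^bsub>V\<^esub> a) b = z * hinner V a b" if "a \<in> carrier V" "b \<in> carrier V" for z a b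
    using H that by blast
  have "hinner V \<zero>\<^bsub>V\<^esub> \<zero>\<^bsub>V\<^esub> = 0"
    using s[of "\<zero>\<^bsub>V\<^esub>" "\<zero>\<^bsub>V\<^esub>" 0] M.smult_l_null[of "\<zero>\<^bsub>V\<^esub>"] by simp
  moreover have "0 < Re (hinner V a a)" if "a \<in> carrier V" "a \<noteq> \<zero>\<^bsub>V\<^esub>" for a using H that by blast
  ultimately have "0 \<le> Re (hinner V a a)" if "a \<in> carrier V" for a
    using that by (cases "a = \<zero>\<^bsub>V\<^esub>") (auto simp: less_imp_le)
  with H show ?thesis by (intro semi_inner.intro) blast+
qed

lemma hilbert_norm_eq_0:
  assumes H: "is_hilbert_space V" and a: "a \<in> carrier V" and 0: "hnorm V a = 0"
  shows "a = \<zero>\<^bsub>V\<^esub>"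
proof (rule ccontr)
  assume "a \<noteq> \<zero>\<^bsub>V\<^esub>"
  then have "0 < Re (hinner V a a)" using H a unfolding is_hilbert_space_def by blast
  then show False using 0 by (simp add: hnorm_def)
qed

text \<open>A linear isometry extends to the completions by acting on the members of Cauchy sequences.\<close>

definition completion_map :: "'k prehilbert \<Rightarrow> ('h \<Rightarrow> 'k) \<Rightarrow> (nat \<Rightarrow> 'h) set \<Rightarrow> (nat \<Rightarrow> 'k) set"
  where "completion_map W j A = (\<Union>s \<in> A. limit_class W (\<lambda>i. j (s i)))"

locale linear_isometry = V: semi_inner V + W: semi_inner W for V :: "'h prehilbert" and W :: "'k prehilbert" +
  fixes j :: "'h \<Rightarrow> 'k"
  assumes map_closed: "a \<in> carrier V \<Longrightarrow> j a \<in> carrier W"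
    and map_add: "\<lbrakk>a \<in> carrier V; b \<in> carrier V\<rbrakk> \<Longrightarrow> j (a \<oplus>\<^bsub>V\<^esub> b) = j a \<oplus>\<^bsub>W\<^esub> j b"
    and map_smult: "a \<in> carrier V \<Longrightarrow> j (z \<odot>\<^bsub>V\<^esub> a) = z \<odot>\<^bsub>W\<^esub> j a"
    and map_inner: "\<lbrakk>a \<in> carrier V; b \<in> carrier V\<rbrakk> \<Longrightarrow> hinner W (j a) (j b) = hinner V a b"
begin

lemma map_minus: "\<lbrakk>a \<in> carrier V; b \<in> carrier V\<rbrakk> \<Longrightarrow> j (a \<ominus>\<^bsub>V\<^esub> b) = j a \<ominus>\<^bsub>W\<^esub> j b"
  by (simp add: V.minus_eq_smult W.minus_eq_smult map_add map_smult map_closed)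

lemma map_norm: "a \<in> carrier V \<Longrightarrow> hnorm W (j a) = hnorm V a"
  by (simp add: hnorm_def map_inner)

lemma map_norm_minus: "\<lbrakk>a \<in> carrier V; b \<in> carrier V\<rbrakk> \<Longrightarrow> hnorm W (j a \<ominus>\<^bsub>W\<^esub> j b) = hnorm V (a \<ominus>\<^bsub>V\<^esub> b)"
  by (metis map_minus map_norm V.minus_closed)

lemma map_cs_iff: "(\<And>i. s i \<in> carrier V) \<Longrightarrow> (\<lambda>i. j (s i)) \<in> W.cs \<longleftrightarrow> s \<in> V.cs"
  by (simp add: cauchy_sequences_def map_norm_minus map_closed)

lemma map_cs: "s \<in> V.cs \<Longrightarrow> (\<lambda>i. j (s i)) \<in> W.cs"
  by (simp add: map_cs_iff V.cs_carrier)

lemma map_lc: "t \<in> limit_class V s \<Longrightarrow> (\<lambda>i. j (t i)) \<in> limit_class W (\<lambda>i. j (s i))"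
  by (simp add: V.lc_mem W.lc_mem map_cs map_norm_minus V.cs_carrier)

lemma completion_map_lc: 
  assumes s: "s \<in> V.cs"
  shows "completion_map W j (limit_class V s) = limit_class W (\<lambda>i. j (s i))"
  unfolding completion_map_def
  by (rule V.UN_lc[OF s]) (simp add: W.lc_of_mem map_lc)

lemma image_lc:
  assumes bij: "bij_betw j (carrier V) (carrier W)" and s: "s \<in> V.cs"
  shows "(\<lambda>f i. j (f i)) ` limit_class V s = limit_class W (\<lambda>i. j (s i))"
proof (intro subset_antisym subsetI)
  fix r assume "r \<in> limit_class W (\<lambda>i. j (s i))"
  then have r: "r \<in> W.cs" and lim: "(\<lambda>i. hnorm W (j (s i) \<ominus>\<^bsub>W\<^esub> r i)) \<longlonglongrightarrow> 0"
    by (auto simp: W.lc_mem)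
  define t where "t i = inv_into (carrier V) j (r i)" for i
  have t: "t i \<in> carrier V" "j (t i) = r i" for i
    using bij W.cs_carrier[OF r] by (auto simp: t_def bij_betw_def inv_into_into f_inv_into_f)
  then have req: "r = (\<lambda>i. j (t i))" by auto
  have "t \<in> limit_class V s"
    using s t r lim map_cs_iff[of t] by (simp add: V.lc_mem req map_norm_minus V.cs_carrier)
  then show "r \<in> (\<lambda>f i. j (f i)) ` limit_class V s" using req by blast
qed (auto simp: map_lc)

text \<open>
  Surjectivity: approximants to the members of a Cauchy sequence have preimages, and these form a
  Cauchy sequence again because the map is isometric.
\<close>

lemma completion_map_unitary:
  assumes dense: "\<And>b e. \<lbrakk>b \<in> carrier W; e > 0\<rbrakk> \<Longrightarrow> \<exists>a\<in>carrier V. hnorm W (b \<ominus>\<^bsub>W\<^esub> j a) < e"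
  shows "unitary_on (hilbert_completion V) (hilbert_completion W) (completion_map W j)"
proof -
  let ?T = "completion_map W j"
  interpret VC: semi_inner V.HC by (rule V.HC_semi_inner)
  interpret WC: semi_inner W.HC by (rule W.HC_semi_inner)
  have closed: "?T A \<in> carrier W.HC" if "A \<in> carrier V.HC" for A
    by (rule V.HC_cases[OF that]) (simp add: completion_map_lc map_cs W.lc_carrier)
  have add: "?T (A \<oplus>\<^bsub>V.HC\<^esub> B) = ?T A \<oplus>\<^bsub>W.HC\<^esub> ?T B"
    if AB: "A \<in> carrier V.HC" "B \<in> carrier V.HC" for A B
  proof -
    obtain s t where s: "s \<in> V.cs" "A = limit_class V s" and t: "t \<in> V.cs" "B = limit_class V t"
      using AB unfolding V.HC_carrier by blast
    then show ?thesis
      by (simp add: V.HC_add W.HC_add completion_map_lc map_cs V.cs_add map_add V.cs_carrier)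
  qed
  have smult: "?T (z \<odot>\<^bsub>V.HC\<^esub> A) = z \<odot>\<^bsub>W.HC\<^esub> ?T A" if AB: "A \<in> carrier V.HC" for A z
  proof -
    obtain s where s: "s \<in> V.cs" "A = limit_class V s"
      using AB unfolding V.HC_carrier by blast
    then show ?thesis
      by (simp add: V.HC_smult W.HC_smult completion_map_lc map_cs V.cs_smult map_smult V.cs_carrier)
  qed
  have inner: "hinner W.HC (?T A) (?T B) = hinner V.HC A B"
    if AB: "A \<in> carrier V.HC" "B \<in> carrier V.HC" for A B
  proof -
    obtain s t where s: "s \<in> V.cs" "A = limit_class V s" and t: "t \<in> V.cs" "B = limit_class V t"
      using AB unfolding V.HC_carrier by blast
    then show ?thesis
      using V.HC_inner[OF s(1) t(1)] W.HC_inner[OF map_cs[OF s(1)] map_cs[OF t(1)]]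
      by (simp add: completion_map_lc map_inner V.cs_carrier LIMSEQ_unique)
  qed
  have surj: "\<exists>A \<in> carrier V.HC. ?T A = B" if B: "B \<in> carrier W.HC" for B
  proof -
    obtain t where t: "t \<in> W.cs" "B = limit_class W t" using B unfolding W.HC_carrier by blast
    have "\<exists>a\<in>carrier V. hnorm W (t n \<ominus>\<^bsub>W\<^esub> j a) < 1 / real (Suc n)" for n
      using t by (intro dense) (auto simp: W.cs_carrier)
    then obtain a where a: "\<And>n. a n \<in> carrier V" "\<And>n. hnorm W (t n \<ominus>\<^bsub>W\<^esub> j (a n)) < 1 / real (Suc n)"
      by metis
    have lim: "(\<lambda>n. hnorm W (t n \<ominus>\<^bsub>W\<^esub> j (a n))) \<longlonglongrightarrow> 0"
      by (rule null_le[OF _ _ LIMSEQ_inverse_real_of_nat])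
        (use a t in \<open>simp_all add: inverse_eq_divide W.cs_carrier map_closed less_imp_le\<close>)
    have ja: "(\<lambda>n. j (a n)) \<in> W.cs" by (rule W.cs_perturb[OF t(1) _ lim]) (simp add: a map_closed)
    then have "a \<in> V.cs" using map_cs_iff a by blast
    moreover have "limit_class W (\<lambda>n. j (a n)) = B" using t ja lim by (simp add: W.lc_eqI)
    ultimately show ?thesis using V.lc_carrier completion_map_lc by blast
  qed
  have lin: "?T (A \<ominus>\<^bsub>V.HC\<^esub> B) = ?T A \<ominus>\<^bsub>W.HC\<^esub> ?T B"
    if AB: "A \<in> carrier V.HC" "B \<in> carrier V.HC" for A B
    using AB by (simp add: VC.minus_eq_smult WC.minus_eq_smult add smult closed)
  have inj: "inj_on ?T (carrier V.HC)"
  proof (rule inj_onI)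
    fix A B assume AB: "A \<in> carrier V.HC" "B \<in> carrier V.HC" "?T A = ?T B"
    then have "hnorm W.HC (?T (A \<ominus>\<^bsub>V.HC\<^esub> B)) = 0" by (simp add: lin WC.norm_minus_self closed)
    then have "hnorm V.HC (A \<ominus>\<^bsub>V.HC\<^esub> B) = 0" using AB by (simp add: hnorm_def inner)
    then show "A = B"
      using AB hilbert_norm_eq_0[OF V.HC_hilbert] by (metis VC.minus_closed VC.minus_eq_zeroD)
  qed
  have "\<exists>M. \<forall>a\<in>carrier V.HC. hnorm W.HC (?T a) \<le> M * hnorm V.HC a"
    by (rule exI[of _ 1]) (simp add: hnorm_def inner)
  moreover have "bij_betw ?T (carrier V.HC) (carrier W.HC)"
    using inj surj closed by (auto simp: bij_betw_def)
  ultimately show ?thesis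
    using closed add smult inner by (auto simp: unitary_on_def bounded_linear_on_def)
qed

end

section \<open>Continuous fields of Hilbert spaces\<close>

lemma continuous_map_euclidean_iff:
  fixes f :: "'x \<Rightarrow> 'y::metric_space"
  shows "continuous_map X euclidean f \<longleftrightarrow>
    (\<forall>x\<in>topspace X. \<forall>e>0. \<exists>U. openin X U \<and> x \<in> U \<and> (\<forall>y\<in>U. dist (f x) (f y) < e))"
  using Met_TC.continuous_map_to_metric[of X f] by (simp add: mtopology_is_euclidean)

lemma continuous_map_nbhd:
  fixes f :: "'x \<Rightarrow> 'y::metric_space"
  assumes "continuous_map X euclidean f" "x \<in> topspace X" "e > 0"
  obtains U where "openin X U" "x \<in> U" "\<And>y. y \<in> U \<Longrightarrow> dist (f x) (f y) < e"
  using assms(1)[unfolded continuous_map_euclidean_iff, rule_format, OF assms(2,3)] by blast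

lemma continuous_map_binop:
  fixes h :: "'a::topological_space \<Rightarrow> 'b::topological_space \<Rightarrow> 'c::topological_space"
  assumes "continuous_map X euclidean f" "continuous_map X euclidean g"
    and "continuous_on UNIV (\<lambda>z. h (fst z) (snd z))"
  shows "continuous_map X euclidean (\<lambda>x. h (f x) (g x))"
proof -
  have "continuous_map X euclidean (\<lambda>x. (f x, g x))"
    using continuous_map_pairedI[OF assms(1,2)] by simp
  then show ?thesis
    using continuous_map_compose[of X euclidean "\<lambda>x. (f x, g x)" euclidean "\<lambda>z. h (fst z) (snd z)"] assms(3)
    by (simp add: o_def)
qed

lemma continuous_map_unop:
  assumes "continuous_map X euclidean f" "continuous_on UNIV h"
  shows "continuous_map X euclidean (\<lambda>x. h (f x))"
  using continuous_map_compose[OF assms(1), of euclidean h] assms(2) by (simp add: o_def)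

lemma continuous_map_complex_mult:
  fixes f g :: "'x \<Rightarrow> complex"
  shows "\<lbrakk>continuous_map X euclidean f; continuous_map X euclidean g\<rbrakk> \<Longrightarrow> continuous_map X euclidean (\<lambda>x. f x * g x)"
  by (rule continuous_map_binop) (auto intro!: continuous_intros)

lemma continuous_map_real_nbhd:
  fixes f :: "'x \<Rightarrow> real"
  assumes "continuous_map X euclidean f" "x \<in> topspace X" "f x < c"
  obtains U where "openin X U" "x \<in> U" "\<And>y. y \<in> U \<Longrightarrow> f y < c"
proof
  show "openin X {y \<in> topspace X. f y \<in> {..<c}}"
    by (rule openin_continuous_map_preimage[OF assms(1)]) auto
qed (use assms in auto)

locale hilbert_field =
  fixes B :: "'b topology" and E :: "('b, 'h, 'm) hilbert_bundle_scheme"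
  assumes chb: "continuous_hilbert_bundle B E"
begin

abbreviation "fb \<equiv> fibre E"
abbreviation "nm u \<equiv> hnorm (fibre E u)"

lemma fibre_hilbert: "u \<in> topspace B \<Longrightarrow> is_hilbert_space (fb u)"
  using chb by (simp add: continuous_hilbert_bundle_def)

lemma fibre_inner: "u \<in> topspace B \<Longrightarrow> semi_inner (fb u)"
  by (simp add: fibre_hilbert hilbert_semi_inner)

lemma section_submodule:
  "submodule (sections E) complex_ring
      (section_module (topspace B) fb (\<Pi>\<^sub>E u \<in> topspace B. carrier (fb u)))"
  using chb by (simp add: continuous_hilbert_bundle_def)

lemma section_PiE: "\<xi> \<in> sections E \<Longrightarrow> \<xi> \<in> (\<Pi>\<^sub>E u \<in> topspace B. carrier (fb u))"
  using subgroup.subset[OF submodule.axioms(1)[OF section_submodule]]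
  by (auto simp: section_module_def)

lemma section_mem: "\<lbrakk>\<xi> \<in> sections E; u \<in> topspace B\<rbrakk> \<Longrightarrow> \<xi> u \<in> carrier (fb u)"
  using section_PiE by blast

lemma section_add:
  "\<lbrakk>\<xi> \<in> sections E; \<eta> \<in> sections E\<rbrakk> \<Longrightarrow> (\<lambda>u \<in> topspace B. \<xi> u \<oplus>\<^bsub>fb u\<^esub> \<eta> u) \<in> sections E"
  using subgroup.m_closed[OF submodule.axioms(1)[OF section_submodule], of \<xi> \<eta>]
  by (simp add: section_module_def)

lemma section_smult: "\<xi> \<in> sections E \<Longrightarrow> (\<lambda>u \<in> topspace B. z \<odot>\<^bsub>fb u\<^esub> \<xi> u) \<in> sections E"
  using submodule.smult_closed[OF section_submodule, of z \<xi>]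
  by (simp add: section_module_def)

lemma section_minus:
  assumes "\<xi> \<in> sections E" "\<eta> \<in> sections E"
  shows "(\<lambda>u \<in> topspace B. \<xi> u \<ominus>\<^bsub>fb u\<^esub> \<eta> u) \<in> sections E"
proof -
  have "(\<lambda>u \<in> topspace B. \<xi> u \<ominus>\<^bsub>fb u\<^esub> \<eta> u)
    = (\<lambda>u \<in> topspace B. \<xi> u \<oplus>\<^bsub>fb u\<^esub> (\<lambda>u \<in> topspace B. (-1) \<odot>\<^bsub>fb u\<^esub> \<eta> u) u)"
    using assms by (intro restrict_ext) (simp add: semi_inner.minus_eq_smult[OF fibre_inner] section_mem)
  then show ?thesis using section_add[OF assms(1) section_smult[OF assms(2), of "-1"]] by simp
qed

lemma section_norm: "\<xi> \<in> sections E \<Longrightarrow> continuous_map B euclidean (\<lambda>u. nm u (\<xi> u))"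
  using chb by (simp add: continuous_hilbert_bundle_def)

lemma section_minus_norm:
  assumes "\<xi> \<in> sections E" "\<eta> \<in> sections E"
  shows "continuous_map B euclidean (\<lambda>u. nm u (\<xi> u \<ominus>\<^bsub>fb u\<^esub> \<eta> u))"
  using section_norm[OF section_minus[OF assms]] by (rule continuous_map_eq) simp

lemma section_dense:
  assumes "u \<in> topspace B" "h \<in> carrier (fb u)" "e > 0"
  obtains \<xi> where "\<xi> \<in> sections E" "nm u (h \<ominus>\<^bsub>fb u\<^esub> \<xi> u) < e"
  using chb[unfolded continuous_hilbert_bundle_def] assms by blast

lemma section_luc: "locally_uniform_closure B fb (sections E) \<subseteq> sections E"
  using chb by (simp add: continuous_hilbert_bundle_def)

text \<open>
  Near a point the multiplier is almost constant, so that the product is a locally uniform limit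
  of constant multiples.
\<close>

lemma section_scale:
  assumes b: "continuous_map B euclidean (b :: 'b \<Rightarrow> complex)" and \<xi>: "\<xi> \<in> sections E"
  shows "(\<lambda>u \<in> topspace B. b u \<odot>\<^bsub>fb u\<^esub> \<xi> u) \<in> sections E"
proof -
  have "\<exists>\<eta>\<in>sections E. \<exists>U. openin B U \<and> v \<in> U \<and>
    (\<forall>u\<in>U. nm u ((\<lambda>u \<in> topspace B. b u \<odot>\<^bsub>fb u\<^esub> \<xi> u) u \<ominus>\<^bsub>fb u\<^esub> \<eta> u) < e)"
    if v: "v \<in> topspace B" and e: "e > 0" for v e
  proof -
    define M where "M = nm v (\<xi> v) + 1"
    have M: "M > 0" using v \<xi> by (simp add: M_def add_nonneg_pos semi_inner.norm_ge0[OF fibre_inner] section_mem)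
    obtain U1 where U1: "openin B U1" "v \<in> U1" "\<And>u. u \<in> U1 \<Longrightarrow> nm u (\<xi> u) < M"
      using continuous_map_real_nbhd[OF section_norm[OF \<xi>] v, of M] by (auto simp: M_def)
    obtain U2 where U2: "openin B U2" "v \<in> U2" "\<And>u. u \<in> U2 \<Longrightarrow> dist (b v) (b u) < e / M"
      using continuous_map_nbhd[OF b v, of "e / M"] e M by auto
    have "nm u ((\<lambda>u \<in> topspace B. b u \<odot>\<^bsub>fb u\<^esub> \<xi> u) u \<ominus>\<^bsub>fb u\<^esub> (\<lambda>u \<in> topspace B. b v \<odot>\<^bsub>fb u\<^esub> \<xi> u) u) < e"
      if u: "u \<in> U1 \<inter> U2" for u
    proof -
      have uB: "u \<in> topspace B" using u U1(1) openin_subset by blast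
      interpret F: semi_inner "fb u" by (rule fibre_inner[OF uB])
      have "cmod (b u - b v) < e / M" using U2(3)[of u] u by (simp add: dist_norm norm_minus_commute)
      then have "cmod (b u - b v) * nm u (\<xi> u) \<le> (e / M) * nm u (\<xi> u)"
        using F.norm_ge0 section_mem[OF \<xi> uB] by (intro mult_right_mono) auto
      also have "\<dots> < (e / M) * M"
        using U1(3)[of u] u e M by (intro mult_strict_left_mono) auto
      finally show ?thesis
        using uB M by (simp add: F.norm_smult_diff2 section_mem[OF \<xi>])
    qed
    then show ?thesis
      using section_smult[OF \<xi>, of "b v"] U1 U2 openin_Int[of B U1 U2] by blast
  qed
  then have "(\<lambda>u \<in> topspace B. b u \<odot>\<^bsub>fb u\<^esub> \<xi> u) \<in> locally_uniform_closure B fb (sections E)"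
    using \<xi> semi_inner.smult_closed[OF fibre_inner]
    by (auto simp: locally_uniform_closure_def section_mem)
  then show ?thesis using section_luc by blast
qed

end

text \<open>
  A map into the total space over \<open>p\<close> is continuous iff it is locally approximable by sections.
  All continuity arguments below use this form, in which sums, scalings and uniform limits are
  immediate.
\<close>

definition approx_by_sections ::
    "'x topology \<Rightarrow> 'b topology \<Rightarrow> ('b, 'h, 'm) hilbert_bundle_scheme \<Rightarrow> ('x \<Rightarrow> 'b) \<Rightarrow> ('x \<Rightarrow> 'h) \<Rightarrow> bool"
  where "approx_by_sections X B E p f \<longleftrightarrow>
    continuous_map X B p \<and> (\<forall>x\<in>topspace X. f x \<in> carrier (fibre E (p x))) \<and>
    (\<forall>x0\<in>topspace X. \<forall>e>0. \<exists>\<xi>\<in>sections E. \<exists>U. openin X U \<and> x0 \<in> U \<and>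
       (\<forall>x\<in>U. hnorm (fibre E (p x)) (f x \<ominus>\<^bsub>fibre E (p x)\<^esub> \<xi> (p x)) < e))"

context hilbert_field
begin

abbreviation "asec X \<equiv> approx_by_sections X B E"

lemma asec_cont: "asec X p f \<Longrightarrow> continuous_map X B p"
  and asec_mem: "\<lbrakk>asec X p f; x \<in> topspace X\<rbrakk> \<Longrightarrow> f x \<in> carrier (fb (p x))"
  by (auto simp: approx_by_sections_def)

lemma asec_base: "\<lbrakk>asec X p f; x \<in> topspace X\<rbrakk> \<Longrightarrow> p x \<in> topspace B"
  using asec_cont continuous_map_image_subset_topspace by fastforce

lemma asecE:
  assumes "asec X p f" "x0 \<in> topspace X" "e > 0"
  obtains \<xi> U where "\<xi> \<in> sections E" "openin X U" "x0 \<in> U"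
    "\<And>x. x \<in> U \<Longrightarrow> nm (p x) (f x \<ominus>\<^bsub>fb (p x)\<^esub> \<xi> (p x)) < e"
  using assms unfolding approx_by_sections_def by meson

lemma basic_set_union:
  "\<Union>{{(u, h). u \<in> V \<and> h \<in> carrier (fb u) \<and> nm u (h \<ominus>\<^bsub>fb u\<^esub> \<xi> u) < e} |
      V e \<xi>. openin B V \<and> e > 0 \<and> \<xi> \<in> sections E} = {(u, h). u \<in> topspace B \<and> h \<in> carrier (fb u)}"
  (is "\<Union>?S = ?R")
proof
  show "\<Union>?S \<subseteq> ?R" using openin_subset by fastforce
  show "?R \<subseteq> \<Union>?S"
  proof clarify
    fix u h assume u: "u \<in> topspace B" and h: "h \<in> carrier (fb u)"
    obtain \<xi> where \<xi>: "\<xi> \<in> sections E" "nm u (h \<ominus>\<^bsub>fb u\<^esub> \<xi> u) < 1"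
      using section_dense[OF u h, of 1] by auto
    have "{(u, h). u \<in> topspace B \<and> h \<in> carrier (fb u) \<and> nm u (h \<ominus>\<^bsub>fb u\<^esub> \<xi> u) < 1} \<in> ?S"
      using \<xi>(1) openin_topspace zero_less_one by blast
    then show "(u, h) \<in> \<Union>?S" using u h \<xi> by blast
  qed
qed

lemma topspace_total: "topspace (total_space B E) = {(u, h). u \<in> topspace B \<and> h \<in> carrier (fb u)}"
  unfolding total_space_def topology_generated_by_topspace by (rule basic_set_union)

lemma openin_total_basic:
  "\<lbrakk>openin B V; e > 0; \<xi> \<in> sections E\<rbrakk> \<Longrightarrow>
    openin (total_space B E) {(u, h). u \<in> V \<and> h \<in> carrier (fb u) \<and> nm u (h \<ominus>\<^bsub>fb u\<^esub> \<xi> u) < e}"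
  unfolding total_space_def by (rule topology_generated_by_Basis) blast

lemma continuous_into_totalI:
  assumes "\<And>V e \<xi>. \<lbrakk>openin B V; e > 0; \<xi> \<in> sections E\<rbrakk> \<Longrightarrow>
      openin X {x \<in> topspace X. fst (F x) \<in> V \<and> snd (F x) \<in> carrier (fb (fst (F x))) \<and>
        nm (fst (F x)) (snd (F x) \<ominus>\<^bsub>fb (fst (F x))\<^esub> \<xi> (fst (F x))) < e}"
    and "\<And>x. x \<in> topspace X \<Longrightarrow> fst (F x) \<in> topspace B \<and> snd (F x) \<in> carrier (fb (fst (F x)))"
  shows "continuous_map X (total_space B E) F"
  unfolding total_space_def
proof (rule continuous_on_generated_topo)
  fix U assume "U \<in> {{(u, h). u \<in> V \<and> h \<in> carrier (fb u) \<and> nm u (h \<ominus>\<^bsub>fb u\<^esub> \<xi> u) < e} |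
      V e \<xi>. openin B V \<and> e > 0 \<and> \<xi> \<in> sections E}"
  then obtain V e \<xi> where U: "U = {(u, h). u \<in> V \<and> h \<in> carrier (fb u) \<and> nm u (h \<ominus>\<^bsub>fb u\<^esub> \<xi> u) < e}"
    and *: "openin B V" "e > 0" "\<xi> \<in> sections E" by blast
  have "F -` U \<inter> topspace X = {x \<in> topspace X. fst (F x) \<in> V \<and> snd (F x) \<in> carrier (fb (fst (F x))) \<and>
        nm (fst (F x)) (snd (F x) \<ominus>\<^bsub>fb (fst (F x))\<^esub> \<xi> (fst (F x))) < e}"
    unfolding U by (auto simp: case_prod_unfold)
  then show "openin X (F -` U \<inter> topspace X)" using assms(1)[OF *] by simp
next
  show "F ` topspace X \<subseteq> \<Union>{{(u, h). u \<in> V \<and> h \<in> carrier (fb u) \<and> nm u (h \<ominus>\<^bsub>fb u\<^esub> \<xi> u) < e} |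
      V e \<xi>. openin B V \<and> e > 0 \<and> \<xi> \<in> sections E}"
    unfolding basic_set_union using assms(2) by (auto simp: case_prod_unfold)
qed

lemma continuous_total_iff: "continuous_map X (total_space B E) (\<lambda>x. (p x, f x)) \<longleftrightarrow> asec X p f"
proof
  assume c: "continuous_map X (total_space B E) (\<lambda>x. (p x, f x))"
  have m: "p x \<in> topspace B \<and> f x \<in> carrier (fb (p x))" if "x \<in> topspace X" for x
    using continuous_map_image_subset_topspace[OF c] that by (auto simp: topspace_total)
  have open1: "openin X {x \<in> topspace X. p x \<in> V \<and> nm (p x) (f x \<ominus>\<^bsub>fb (p x)\<^esub> \<xi> (p x)) < e}"
    if "openin B V" "e > 0" "\<xi> \<in> sections E" for V e \<xi>
  proof -
    have "openin X {x \<in> topspace X. (p x, f x) \<in>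
        {(u, h). u \<in> V \<and> h \<in> carrier (fb u) \<and> nm u (h \<ominus>\<^bsub>fb u\<^esub> \<xi> u) < e}}"
      by (rule openin_continuous_map_preimage[OF c openin_total_basic[OF that]])
    moreover have "{x \<in> topspace X. (p x, f x) \<in>
        {(u, h). u \<in> V \<and> h \<in> carrier (fb u) \<and> nm u (h \<ominus>\<^bsub>fb u\<^esub> \<xi> u) < e}}
      = {x \<in> topspace X. p x \<in> V \<and> nm (p x) (f x \<ominus>\<^bsub>fb (p x)\<^esub> \<xi> (p x)) < e}"
      using m by auto
    ultimately show ?thesis by simp
  qed
  have "continuous_map X B p"
    unfolding continuous_map_def
  proof (intro conjI allI impI funcsetI)
    fix V assume V: "openin B V"
    have "{x \<in> topspace X. p x \<in> V}
      = (\<Union>\<xi>\<in>sections E. {x \<in> topspace X. p x \<in> V \<and> nm (p x) (f x \<ominus>\<^bsub>fb (p x)\<^esub> \<xi> (p x)) < 1})"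
    proof (intro equalityI subsetI)
      fix x assume "x \<in> {x \<in> topspace X. p x \<in> V}"
      then have x: "x \<in> topspace X" "p x \<in> V" by auto
      obtain \<xi> where "\<xi> \<in> sections E" "nm (p x) (f x \<ominus>\<^bsub>fb (p x)\<^esub> \<xi> (p x)) < 1"
        using m[OF x(1)] section_dense[of "p x" "f x" 1] by auto
      then show "x \<in> (\<Union>\<xi>\<in>sections E. {x \<in> topspace X. p x \<in> V \<and> nm (p x) (f x \<ominus>\<^bsub>fb (p x)\<^esub> \<xi> (p x)) < 1})"
        using x by blast
    qed auto
    moreover have "openin X \<dots>" using open1[OF V, of 1] by auto
    ultimately show "openin X {x \<in> topspace X. p x \<in> V}" by simp
  qed (use m in auto)
  moreover have "\<exists>\<xi>\<in>sections E. \<exists>U. openin X U \<and> x0 \<in> U \<and>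
       (\<forall>x\<in>U. nm (p x) (f x \<ominus>\<^bsub>fb (p x)\<^esub> \<xi> (p x)) < e)" if x0: "x0 \<in> topspace X" and e: "e > 0" for x0 e
  proof -
    obtain \<xi> where \<xi>: "\<xi> \<in> sections E" "nm (p x0) (f x0 \<ominus>\<^bsub>fb (p x0)\<^esub> \<xi> (p x0)) < e"
      using m[OF x0] e section_dense by blast
    then show ?thesis
      using open1[OF openin_topspace e \<xi>(1)] m[OF x0] x0
      by (intro bexI[of _ \<xi>] exI[of _ "{x \<in> topspace X. p x \<in> topspace B \<and> nm (p x) (f x \<ominus>\<^bsub>fb (p x)\<^esub> \<xi> (p x)) < e}"]) auto
  qed
  ultimately show "asec X p f" using m by (simp add: approx_by_sections_def)
next
  assume a: "asec X p f"
  show "continuous_map X (total_space B E) (\<lambda>x. (p x, f x))"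
  proof (rule continuous_into_totalI)
    fix V \<xi> and e :: real assume V: "openin B V" and e: "e > 0" and \<xi>: "\<xi> \<in> sections E"
    let ?S = "{x \<in> topspace X. p x \<in> V \<and> f x \<in> carrier (fb (p x)) \<and> nm (p x) (f x \<ominus>\<^bsub>fb (p x)\<^esub> \<xi> (p x)) < e}"
    have "\<exists>T. openin X T \<and> x0 \<in> T \<and> T \<subseteq> ?S" if x0S: "x0 \<in> ?S" for x0
    proof -
      have x0: "x0 \<in> topspace X" "p x0 \<in> V" "nm (p x0) (f x0 \<ominus>\<^bsub>fb (p x0)\<^esub> \<xi> (p x0)) < e"
        using x0S by auto
      define d where "d = (e - nm (p x0) (f x0 \<ominus>\<^bsub>fb (p x0)\<^esub> \<xi> (p x0))) / 3"
      have d: "d > 0" using x0 by (simp add: d_def)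
      obtain \<eta> U where \<eta>: "\<eta> \<in> sections E" and U: "openin X U" "x0 \<in> U"
        and app: "\<And>x. x \<in> U \<Longrightarrow> nm (p x) (f x \<ominus>\<^bsub>fb (p x)\<^esub> \<eta> (p x)) < d"
        using asecE[OF a x0(1) d] by blast
      have base: "p x0 \<in> topspace B" using asec_base[OF a x0(1)] .
      obtain W where W: "openin B W" "p x0 \<in> W" "\<And>u. u \<in> W \<Longrightarrow>
          nm u (\<eta> u \<ominus>\<^bsub>fb u\<^esub> \<xi> u) < nm (p x0) (\<eta> (p x0) \<ominus>\<^bsub>fb (p x0)\<^esub> \<xi> (p x0)) + d"
        using continuous_map_real_nbhd[OF section_minus_norm[OF \<eta> \<xi>] base,
            of "nm (p x0) (\<eta> (p x0) \<ominus>\<^bsub>fb (p x0)\<^esub> \<xi> (p x0)) + d"] d by auto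
      interpret F0: semi_inner "fb (p x0)" by (rule fibre_inner[OF base])
      have 1: "nm (p x0) (\<eta> (p x0) \<ominus>\<^bsub>fb (p x0)\<^esub> \<xi> (p x0))
          \<le> nm (p x0) (f x0 \<ominus>\<^bsub>fb (p x0)\<^esub> \<eta> (p x0)) + nm (p x0) (f x0 \<ominus>\<^bsub>fb (p x0)\<^esub> \<xi> (p x0))"
        using F0.norm_triangle_minus[of "\<eta> (p x0)" "f x0" "\<xi> (p x0)"] F0.norm_minus_commute[of "\<eta> (p x0)" "f x0"]
          asec_mem[OF a x0(1)] section_mem[OF \<eta> base] section_mem[OF \<xi> base] by simp
      let ?T = "{x \<in> topspace X. p x \<in> W \<inter> V} \<inter> U"
      have "openin X ?T"
        using W V U asec_cont[OF a] by (intro openin_Int openin_continuous_map_preimage[of X B p]) auto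
      moreover have "x0 \<in> ?T" using x0 W U by simp
      moreover have "?T \<subseteq> ?S"
      proof
        fix x assume x: "x \<in> ?T"
        then have xX: "x \<in> topspace X" by simp
        have bx: "p x \<in> topspace B" using asec_base[OF a xX] .
        interpret F: semi_inner "fb (p x)" by (rule fibre_inner[OF bx])
        have "nm (p x) (f x \<ominus>\<^bsub>fb (p x)\<^esub> \<xi> (p x)) \<le>
          nm (p x) (f x \<ominus>\<^bsub>fb (p x)\<^esub> \<eta> (p x)) + nm (p x) (\<eta> (p x) \<ominus>\<^bsub>fb (p x)\<^esub> \<xi> (p x))"
          using asec_mem[OF a xX] section_mem[OF \<eta> bx] section_mem[OF \<xi> bx] by (rule F.norm_triangle_minus)
        also have "\<dots> < d + (nm (p x0) (\<eta> (p x0) \<ominus>\<^bsub>fb (p x0)\<^esub> \<xi> (p x0)) + d)"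
          using app[of x] W(3)[of "p x"] x by (intro add_strict_mono) auto
        also have "\<dots> < e" using 1 app[OF U(2)] unfolding d_def by argo
        finally show "x \<in> ?S" using x asec_mem[OF a xX] by simp
      qed
      ultimately show ?thesis by blast
    qed
    then show "openin X {x \<in> topspace X. fst (p x, f x) \<in> V \<and> snd (p x, f x) \<in> carrier (fb (fst (p x, f x))) \<and>
        nm (fst (p x, f x)) (snd (p x, f x) \<ominus>\<^bsub>fb (fst (p x, f x))\<^esub> \<xi> (fst (p x, f x))) < e}"
      by (subst openin_subopen) simp
  qed (use asec_mem[OF a] asec_base[OF a] in simp)
qed

lemma asec_norm:
  assumes a: "asec X p f"
  shows "continuous_map X euclidean (\<lambda>x. nm (p x) (f x))"
  unfolding continuous_map_euclidean_iff
proof (intro ballI allI impI)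
  fix x0 and e :: real assume x0: "x0 \<in> topspace X" and e: "e > 0"
  obtain \<eta> U where \<eta>: "\<eta> \<in> sections E" and U: "openin X U" "x0 \<in> U"
    and app: "\<And>x. x \<in> U \<Longrightarrow> nm (p x) (f x \<ominus>\<^bsub>fb (p x)\<^esub> \<eta> (p x)) < e / 3"
    using asecE[OF a x0, of "e/3"] e by auto
  have c: "continuous_map X euclidean (\<lambda>x. nm (p x) (\<eta> (p x)))"
    using continuous_map_compose[OF asec_cont[OF a] section_norm[OF \<eta>]] by (simp add: o_def)
  obtain W where W: "openin X W" "x0 \<in> W" "\<And>x. x \<in> W \<Longrightarrow> dist (nm (p x0) (\<eta> (p x0))) (nm (p x) (\<eta> (p x))) < e / 3"
    using continuous_map_nbhd[OF c x0, of "e / 3"] e by auto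
  have d: "\<bar>nm (p x) (f x) - nm (p x) (\<eta> (p x))\<bar> < e / 3" if "x \<in> U" for x
  proof -
    have x: "x \<in> topspace X" using that U openin_subset by blast
    interpret F: semi_inner "fb (p x)" by (rule fibre_inner[OF asec_base[OF a x]])
    show ?thesis
      using F.norm_diff_le[of "f x" "\<eta> (p x)"] app[OF that] asec_mem[OF a x] section_mem[OF \<eta> asec_base[OF a x]]
      by simp
  qed
  have "dist (nm (p x0) (f x0)) (nm (p x) (f x)) < e" if "x \<in> U \<inter> W" for x
  proof -
    have "x \<in> U" "x \<in> W" using that by auto
    then show ?thesis using d[OF U(2)] d[of x] W(3)[of x] unfolding dist_real_def by argo
  qed
  then show "\<exists>U. openin X U \<and> x0 \<in> U \<and> (\<forall>x\<in>U. dist (nm (p x0) (f x0)) (nm (p x) (f x)) < e)"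
    using U W by (intro exI[of _ "U \<inter> W"]) auto
qed

lemma asec_section: "\<lbrakk>continuous_map X B p; \<xi> \<in> sections E\<rbrakk> \<Longrightarrow> asec X p (\<lambda>x. \<xi> (p x))"
  unfolding approx_by_sections_def
proof (intro conjI ballI allI impI)
  assume p: "continuous_map X B p" and \<xi>: "\<xi> \<in> sections E"
  have b: "p x \<in> topspace B" if "x \<in> topspace X" for x
    using continuous_map_image_subset_topspace[OF p] that by blast
  show "x \<in> topspace X \<Longrightarrow> \<xi> (p x) \<in> carrier (fb (p x))" for x using section_mem[OF \<xi> b] .
  fix x0 and e :: real assume "x0 \<in> topspace X" "e > 0"
  then show "\<exists>\<xi>'\<in>sections E. \<exists>U. openin X U \<and> x0 \<in> U \<and> (\<forall>x\<in>U. nm (p x) (\<xi> (p x) \<ominus>\<^bsub>fb (p x)\<^esub> \<xi>' (p x)) < e)"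
    using \<xi> section_mem[OF \<xi> b] b
    by (intro bexI[of _ \<xi>] exI[of _ "topspace X"]) (auto simp: semi_inner.norm_minus_self[OF fibre_inner])
qed

text \<open>
  An approximant of \<open>g\<close> by sections also approximates \<open>f\<close>, by the triangle inequality.
\<close>

lemma asec_limit:
  assumes p: "continuous_map X B p" and f: "\<And>x. x \<in> topspace X \<Longrightarrow> f x \<in> carrier (fb (p x))"
    and lim: "\<And>x0 e. \<lbrakk>x0 \<in> topspace X; e > 0\<rbrakk> \<Longrightarrow> \<exists>g U. asec X p g \<and> openin X U \<and> x0 \<in> U \<and>
      (\<forall>x\<in>U. nm (p x) (f x \<ominus>\<^bsub>fb (p x)\<^esub> g x) < e)"
  shows "asec X p f"
  unfolding approx_by_sections_def
proof (intro conjI ballI allI impI p)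
  fix x0 and e :: real assume x0: "x0 \<in> topspace X" and e: "e > 0"
  obtain g U where g: "asec X p g" and U: "openin X U" "x0 \<in> U"
    and fg: "\<And>x. x \<in> U \<Longrightarrow> nm (p x) (f x \<ominus>\<^bsub>fb (p x)\<^esub> g x) < e / 2"
    using lim[OF x0, of "e/2"] e by auto
  obtain \<xi> W where \<xi>: "\<xi> \<in> sections E" and W: "openin X W" "x0 \<in> W"
    and app: "\<And>x. x \<in> W \<Longrightarrow> nm (p x) (g x \<ominus>\<^bsub>fb (p x)\<^esub> \<xi> (p x)) < e / 2"
    using asecE[OF g x0, of "e/2"] e by auto
  have "nm (p x) (f x \<ominus>\<^bsub>fb (p x)\<^esub> \<xi> (p x)) < e" if "x \<in> U \<inter> W" for x
  proof -
    have x: "x \<in> topspace X" using that U openin_subset by blast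
    interpret F: semi_inner "fb (p x)" by (rule fibre_inner[OF asec_base[OF g x]])
    show ?thesis
      using F.norm_triangle_minus[OF f[OF x] asec_mem[OF g x] section_mem[OF \<xi> asec_base[OF g x]]]
        fg[of x] app[of x] that by simp
  qed
  then show "\<exists>\<xi>\<in>sections E. \<exists>U. openin X U \<and> x0 \<in> U \<and> (\<forall>x\<in>U. nm (p x) (f x \<ominus>\<^bsub>fb (p x)\<^esub> \<xi> (p x)) < e)"
    using \<xi> U W by (intro bexI[of _ \<xi>] exI[of _ "U \<inter> W"]) auto
qed (use f in auto)

lemma asec_add:
  assumes f: "asec X p f" and g: "asec X p g"
  shows "asec X p (\<lambda>x. f x \<oplus>\<^bsub>fb (p x)\<^esub> g x)"
  unfolding approx_by_sections_def
proof (intro conjI ballI allI impI)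
  show "continuous_map X B p" using asec_cont[OF f] .
  show "x \<in> topspace X \<Longrightarrow> f x \<oplus>\<^bsub>fb (p x)\<^esub> g x \<in> carrier (fb (p x))" for x
    by (simp add: semi_inner.add_closed[OF fibre_inner[OF asec_base[OF f]]] asec_mem[OF f] asec_mem[OF g])
  fix x0 and e :: real assume x0: "x0 \<in> topspace X" and e: "e > 0"
  obtain \<xi> U where \<xi>: "\<xi> \<in> sections E" and U: "openin X U" "x0 \<in> U"
    and fa: "\<And>x. x \<in> U \<Longrightarrow> nm (p x) (f x \<ominus>\<^bsub>fb (p x)\<^esub> \<xi> (p x)) < e / 2"
    using asecE[OF f x0, of "e/2"] e by auto
  obtain \<eta> W where \<eta>: "\<eta> \<in> sections E" and W: "openin X W" "x0 \<in> W"
    and ga: "\<And>x. x \<in> W \<Longrightarrow> nm (p x) (g x \<ominus>\<^bsub>fb (p x)\<^esub> \<eta> (p x)) < e / 2"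
    using asecE[OF g x0, of "e/2"] e by auto
  let ?z = "\<lambda>u \<in> topspace B. \<xi> u \<oplus>\<^bsub>fb u\<^esub> \<eta> u"
  have "nm (p x) ((f x \<oplus>\<^bsub>fb (p x)\<^esub> g x) \<ominus>\<^bsub>fb (p x)\<^esub> ?z (p x)) < e" if "x \<in> U \<inter> W" for x
  proof -
    have x: "x \<in> topspace X" using that U openin_subset by blast
    have b: "p x \<in> topspace B" using asec_base[OF f x] .
    interpret F: semi_inner "fb (p x)" by (rule fibre_inner[OF b])
    show ?thesis
      using F.norm_add_diff[OF asec_mem[OF f x] asec_mem[OF g x] section_mem[OF \<xi> b] section_mem[OF \<eta> b]]
        fa[of x] ga[of x] that b by simp
  qed
  then show "\<exists>\<xi>\<in>sections E. \<exists>U. openin X U \<and> x0 \<in> U \<and>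
      (\<forall>x\<in>U. nm (p x) ((f x \<oplus>\<^bsub>fb (p x)\<^esub> g x) \<ominus>\<^bsub>fb (p x)\<^esub> \<xi> (p x)) < e)"
    using section_add[OF \<xi> \<eta>] U W by (intro bexI[of _ ?z] exI[of _ "U \<inter> W"]) auto
qed

lemma asec_smult:
  assumes f: "asec X p f" and a: "continuous_map X euclidean (a :: 'c \<Rightarrow> complex)"
  shows "asec X p (\<lambda>x. a x \<odot>\<^bsub>fb (p x)\<^esub> f x)"
  unfolding approx_by_sections_def
proof (intro conjI ballI allI impI)
  show "continuous_map X B p" using asec_cont[OF f] .
  show "x \<in> topspace X \<Longrightarrow> a x \<odot>\<^bsub>fb (p x)\<^esub> f x \<in> carrier (fb (p x))" for x
    by (simp add: semi_inner.smult_closed[OF fibre_inner[OF asec_base[OF f]]] asec_mem[OF f])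
  fix x0 and e :: real assume x0: "x0 \<in> topspace X" and e: "e > 0"
  define M where "M = nm (p x0) (f x0) + 1"
  have M: "M > 0"
    using semi_inner.norm_ge0[OF fibre_inner[OF asec_base[OF f x0]] asec_mem[OF f x0]] by (simp add: M_def)
  define A where "A = cmod (a x0) + 1"
  have A: "A > 0" by (simp add: A_def add_nonneg_pos)
  obtain \<xi> U where \<xi>: "\<xi> \<in> sections E" and U: "openin X U" "x0 \<in> U"
    and fa: "\<And>x. x \<in> U \<Longrightarrow> nm (p x) (f x \<ominus>\<^bsub>fb (p x)\<^esub> \<xi> (p x)) < e / (2 * A)"
    using asecE[OF f x0, of "e/(2*A)"] e A by auto
  obtain V where V: "openin X V" "x0 \<in> V" "\<And>x. x \<in> V \<Longrightarrow> nm (p x) (f x) < M"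
    using continuous_map_real_nbhd[OF asec_norm[OF f] x0, of M] by (auto simp: M_def)
  obtain W where W: "openin X W" "x0 \<in> W" "\<And>x. x \<in> W \<Longrightarrow> dist (a x0) (a x) < e / (2 * M)"
    using continuous_map_nbhd[OF a x0, of "e / (2 * M)"] e M by auto
  let ?z = "\<lambda>u \<in> topspace B. a x0 \<odot>\<^bsub>fb u\<^esub> \<xi> u"
  have "nm (p x) (a x \<odot>\<^bsub>fb (p x)\<^esub> f x \<ominus>\<^bsub>fb (p x)\<^esub> ?z (p x)) < e" if xU: "x \<in> U \<inter> V \<inter> W" for x
  proof -
    have x: "x \<in> topspace X" using xU U openin_subset by blast
    have b: "p x \<in> topspace B" using asec_base[OF f x] .
    interpret F: semi_inner "fb (p x)" by (rule fibre_inner[OF b])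
    note m = asec_mem[OF f x] section_mem[OF \<xi> b]
    have "nm (p x) (a x \<odot>\<^bsub>fb (p x)\<^esub> f x \<ominus>\<^bsub>fb (p x)\<^esub> a x0 \<odot>\<^bsub>fb (p x)\<^esub> \<xi> (p x)) \<le>
      nm (p x) (a x \<odot>\<^bsub>fb (p x)\<^esub> f x \<ominus>\<^bsub>fb (p x)\<^esub> a x0 \<odot>\<^bsub>fb (p x)\<^esub> f x) +
      nm (p x) (a x0 \<odot>\<^bsub>fb (p x)\<^esub> f x \<ominus>\<^bsub>fb (p x)\<^esub> a x0 \<odot>\<^bsub>fb (p x)\<^esub> \<xi> (p x))"
      using m by (intro F.norm_triangle_minus) auto
    also have "\<dots> = cmod (a x - a x0) * nm (p x) (f x) + cmod (a x0) * nm (p x) (f x \<ominus>\<^bsub>fb (p x)\<^esub> \<xi> (p x))"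
      using m by (simp add: F.norm_smult_diff F.norm_smult_diff2)
    also have "cmod (a x - a x0) * nm (p x) (f x) \<le> e / (2 * M) * M"
      using W(3)[of x] V(3)[of x] xU m e M
      by (intro mult_mono) (auto simp: dist_norm norm_minus_commute less_imp_le)
    also have "cmod (a x0) * nm (p x) (f x \<ominus>\<^bsub>fb (p x)\<^esub> \<xi> (p x)) \<le> cmod (a x0) * (e / (2 * A))"
      using fa[of x] xU by (intro mult_left_mono) auto
    also have "cmod (a x0) * (e / (2 * A)) < A * (e / (2 * A))"
      using e A by (intro mult_strict_right_mono) (auto simp: A_def)
    finally show ?thesis using b M A by simp
  qed
  then show "\<exists>\<xi>\<in>sections E. \<exists>U. openin X U \<and> x0 \<in> U \<and>
      (\<forall>x\<in>U. nm (p x) (a x \<odot>\<^bsub>fb (p x)\<^esub> f x \<ominus>\<^bsub>fb (p x)\<^esub> \<xi> (p x)) < e)"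
    using section_smult[OF \<xi>] U V W by (intro bexI[of _ ?z] exI[of _ "U \<inter> V \<inter> W"]) auto
qed

lemma asec_cong:
  assumes "asec X p f" "\<And>x. x \<in> topspace X \<Longrightarrow> p x = q x" "\<And>x. x \<in> topspace X \<Longrightarrow> f x = g x"
  shows "asec X q g"
proof -
  have "continuous_map X (total_space B E) (\<lambda>x. (q x, g x))"
    using assms(1) unfolding continuous_total_iff[symmetric]
    by (rule continuous_map_eq) (simp add: assms(2,3))
  then show ?thesis by (simp add: continuous_total_iff)
qed

lemma asec_compose:
  assumes f: "asec X p f" and q: "continuous_map Y X q"
  shows "asec Y (\<lambda>y. p (q y)) (\<lambda>y. f (q y))"
  using continuous_map_compose[OF q f[unfolded continuous_total_iff[symmetric]]]
  by (simp add: o_def continuous_total_iff)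

lemma asec_minus:
  assumes f: "asec X p f" and g: "asec X p g"
  shows "asec X p (\<lambda>x. f x \<ominus>\<^bsub>fb (p x)\<^esub> g x)"
  using asec_add[OF f asec_smult[OF g, of "\<lambda>_. -1"]]
  by (rule asec_cong)
    (use asec_mem[OF f] asec_mem[OF g] asec_base[OF f] in \<open>auto simp: semi_inner.minus_eq_smult[OF fibre_inner]\<close>)

lemma asec_inner:
  assumes f: "asec X p f" and g: "asec X p g"
  shows "continuous_map X euclidean (\<lambda>x. hinner (fb (p x)) (f x) (g x))"
proof -
  let ?h = "\<lambda>x. complex_of_real ((nm (p x) (f x \<oplus>\<^bsub>fb (p x)\<^esub> g x))\<^sup>2 / 2 - (nm (p x) (f x))\<^sup>2 / 2 - (nm (p x) (g x))\<^sup>2 / 2)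
     + \<i> * complex_of_real ((nm (p x) (f x \<oplus>\<^bsub>fb (p x)\<^esub> \<i> \<odot>\<^bsub>fb (p x)\<^esub> g x))\<^sup>2 / 2 - (nm (p x) (f x))\<^sup>2 / 2 - (nm (p x) (g x))\<^sup>2 / 2)"
  have c: "continuous_map X euclidean (\<lambda>x. complex_of_real (r x ^ 2 / 2))" if "continuous_map X euclidean r" for r :: "_ \<Rightarrow> real"
    using that by (rule continuous_map_unop) (auto intro!: continuous_intros)
  have "continuous_map X euclidean ?h"
    using asec_norm[OF f] asec_norm[OF g] asec_norm[OF asec_add[OF f g]]
      asec_norm[OF asec_add[OF f asec_smult[OF g, of "\<lambda>_. \<i>"]]]
    by (simp only: of_real_diff) (intro continuous_map_add continuous_map_diff continuous_map_complex_mult c; simp)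
  then show ?thesis
    by (rule continuous_map_eq)
      (simp add: semi_inner.inner_polar[OF fibre_inner[OF asec_base[OF f]] asec_mem[OF f] asec_mem[OF g]])
qed

end

section \<open>Locally compact spaces and functions of compact support\<close>

definition lchs :: "'a topology \<Rightarrow> bool"
  where "lchs X \<longleftrightarrow> locally_compact_space X \<and> Hausdorff_space X \<and> second_countable X"

lemma lchs_normal: "lchs X \<Longrightarrow> normal_space X"
  unfolding lchs_def
  by (simp add: locally_compact_Hausdorff_imp_regular_space regular_Lindelof_imp_normal_space
      second_countable_imp_Lindelof_space)

lemma lchs_compact_closed: "\<lbrakk>lchs X; compactin X C\<rbrakk> \<Longrightarrow> closedin X C"
  by (simp add: lchs_def compactin_imp_closedin)

lemma lchs_closed_subspace: "\<lbrakk>lchs X; closedin X S\<rbrakk> \<Longrightarrow> lchs (subtopology X S)"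
  by (simp add: lchs_def Hausdorff_space_subtopology second_countable_subtopology
      locally_compact_space_closed_subset)

lemma compact_neighbourhood:
  assumes X: "lchs X" and C: "compactin X C" and U: "openin X U" "C \<subseteq> U"
  obtains V D where "openin X V" "compactin X D" "C \<subseteq> V" "V \<subseteq> D" "D \<subseteq> U"
proof -
  have nb: "neighbourhood_base_of (\<lambda>C. compactin X C \<and> closedin X C) X"
    using X locally_compact_space_neighbourhood_base_closedin by (auto simp: lchs_def)
  have "\<exists>V D. openin X V \<and> compactin X D \<and> x \<in> V \<and> V \<subseteq> D \<and> D \<subseteq> U" if "x \<in> C" for x
    using nb[unfolded neighbourhood_base_of, rule_format, of U x] U that by blast
  then obtain V D where VD: "\<And>x. x \<in> C \<Longrightarrow> openin X (V x) \<and> compactin X (D x) \<and> x \<in> V x \<and> V x \<subseteq> D x \<and> D x \<subseteq> U"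
    by metis
  obtain F where F: "finite F" "F \<subseteq> V ` C" "C \<subseteq> \<Union>F"
    using compactinD[OF C, of "V ` C"] VD by blast
  then obtain I where I: "finite I" "I \<subseteq> C" "F = V ` I" by (meson finite_subset_image)
  show ?thesis
  proof
    show "openin X (\<Union>x\<in>I. V x)" using I VD by blast
    show "compactin X (\<Union>x\<in>I. D x)" using I VD by (intro compactin_Union) auto
    show "C \<subseteq> (\<Union>x\<in>I. V x)" using F I by blast
    show "(\<Union>x\<in>I. V x) \<subseteq> (\<Union>x\<in>I. D x)" "(\<Union>x\<in>I. D x) \<subseteq> U" using I VD by blast+
  qed
qed

lemma bump_function:
  assumes X: "lchs X" and C: "compactin X C" and U: "openin X U" "C \<subseteq> U"
  obtains b :: "'a \<Rightarrow> real" and D where "continuous_map X euclidean b" "\<And>x. b x \<ge> 0" "\<And>x. b x \<le> 1"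
    "\<And>x. x \<in> C \<Longrightarrow> b x = 1" "compactin X D" "D \<subseteq> U" "\<And>x. b x \<noteq> 0 \<Longrightarrow> x \<in> D"
proof -
  obtain V D where VD: "openin X V" "compactin X D" "C \<subseteq> V" "V \<subseteq> D" "D \<subseteq> U"
    using compact_neighbourhood[OF X C U] by blast
  have "closedin X (topspace X - V)" using VD by blast
  moreover have "disjnt (topspace X - V) C" using VD by (auto simp: disjnt_def)
  ultimately obtain f where f: "continuous_map X (top_of_set {0..1::real}) f" "f ` (topspace X - V) \<subseteq> {0}" "f ` C \<subseteq> {1}"
    using Urysohn_lemma[OF lchs_normal[OF X] _ lchs_compact_closed[OF X C], of "topspace X - V" 0 1] by auto
  then have fc: "continuous_map X euclideanreal f" "\<And>x. x \<in> topspace X \<Longrightarrow> f x \<in> {0..1}"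
    by (auto simp: continuous_map_in_subtopology)
  define b where "b x = (if x \<in> topspace X then f x else 0)" for x
  show ?thesis
  proof (rule that[of b D])
    show "continuous_map X euclidean b" using fc(1) by (rule continuous_map_eq) (simp add: b_def)
    show "b x \<ge> 0" "b x \<le> 1" for x using fc(2)[of x] by (auto simp: b_def)
    show "x \<in> C \<Longrightarrow> b x = 1" for x using f(3) C compactin_subset_topspace by (fastforce simp: b_def)
    show "b x \<noteq> 0 \<Longrightarrow> x \<in> D" for x using f(2) VD by (auto simp: b_def split: if_splits)
  qed (use VD in auto)
qed

lemma Cc_iff:
  assumes X: "lchs X"
  shows "f \<in> Cc X \<longleftrightarrow> continuous_map X euclidean f \<and>
    (\<exists>C. compactin X C \<and> (\<forall>x\<in>topspace X. f x \<noteq> 0 \<longrightarrow> x \<in> C))"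
proof
  assume f: "f \<in> Cc X"
  have "{x \<in> topspace X. f x \<noteq> 0} \<subseteq> X closure_of {x \<in> topspace X. f x \<noteq> 0}"
    by (rule closure_of_subset) auto
  then show "continuous_map X euclidean f \<and> (\<exists>C. compactin X C \<and> (\<forall>x\<in>topspace X. f x \<noteq> 0 \<longrightarrow> x \<in> C))"
    using f by (auto simp: Cc_def)
next
  assume "continuous_map X euclidean f \<and> (\<exists>C. compactin X C \<and> (\<forall>x\<in>topspace X. f x \<noteq> 0 \<longrightarrow> x \<in> C))"
  then obtain C where f: "continuous_map X euclidean f" and C: "compactin X C" "{x\<in>topspace X. f x \<noteq> 0} \<subseteq> C" by auto
  have "X closure_of {x \<in> topspace X. f x \<noteq> 0} \<subseteq> C"
    using C lchs_compact_closed[OF X] by (simp add: closure_of_minimal)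
  then show "f \<in> Cc X" using f C closed_compactin closedin_closure_of unfolding Cc_def by blast
qed

text \<open>
  The Tietze theorem for real and imaginary part, followed by cutting off with a bump function.
\<close>

lemma Cc_extension:
  assumes X: "lchs X" and Z: "closedin X Z"
    and g: "continuous_map (subtopology X Z) euclidean (g :: 'a \<Rightarrow> complex)"
    and C: "compactin X C" "\<And>z. \<lbrakk>z \<in> Z; g z \<noteq> 0\<rbrakk> \<Longrightarrow> z \<in> C"
  obtains f where "f \<in> Cc X" "\<And>z. z \<in> Z \<Longrightarrow> f z = g z"
proof -
  have "continuous_map (subtopology X Z) euclidean (\<lambda>z. Re (g z))"
    "continuous_map (subtopology X Z) euclidean (\<lambda>z. Im (g z))"
    using g by (auto intro!: continuous_map_unop[OF g] continuous_intros)
  note re = this(1) and im = this(2)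
  obtain r where r: "continuous_map X euclideanreal r" "\<And>z. z \<in> Z \<Longrightarrow> r z = Re (g z)"
    using Tietze_extension_realinterval[OF lchs_normal[OF X] Z is_interval_univ _ re] by auto
  obtain i where i: "continuous_map X euclideanreal i" "\<And>z. z \<in> Z \<Longrightarrow> i z = Im (g z)"
    using Tietze_extension_realinterval[OF lchs_normal[OF X] Z is_interval_univ _ im] by auto
  obtain b :: "'a \<Rightarrow> real" and D where b: "continuous_map X euclidean b" "\<And>x. x \<in> C \<Longrightarrow> b x = 1"
    "compactin X D" "\<And>x. b x \<noteq> 0 \<Longrightarrow> x \<in> D"
    using bump_function[OF X C(1) openin_topspace] C(1) compactin_subset_topspace by metis
  define f where "f x = complex_of_real (b x) * (complex_of_real (r x) + \<i> * complex_of_real (i x))" for x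
  have of: "continuous_map X euclidean (\<lambda>x. complex_of_real (h x))" if "continuous_map X euclidean h" for h
    using that by (rule continuous_map_unop) (auto intro!: continuous_intros)
  have "f \<in> Cc X"
    unfolding Cc_iff[OF X] f_def using b r i of
    by (auto intro!: continuous_map_complex_mult continuous_map_add exI[of _ D])
  moreover have "f z = g z" if z: "z \<in> Z" for z
  proof (cases "g z = 0")
    case True
    then show ?thesis using r i z by (simp add: f_def)
  next
    case False
    then show ?thesis using r i z b(2)[OF C(2)[OF z]] by (simp add: f_def complex_eq_iff)
  qed
  ultimately show ?thesis using that by blast
qed

lemma Cc_mult:
  assumes X: "lchs X" and f: "f \<in> Cc X" and g: "continuous_map X euclidean g"
  shows "(\<lambda>x. g x * f x) \<in> Cc X"
proof -
  have "continuous_map X euclidean f" using f by (simp add: Cc_def)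
  then show ?thesis
    using f continuous_map_complex_mult[OF g, of f] unfolding Cc_iff[OF X] by (metis mult_zero_right)
qed

lemma Cc_diff:
  assumes X: "lchs X" and f: "f \<in> Cc X" and g: "g \<in> Cc X"
  shows "(\<lambda>x. f x - g x) \<in> Cc X"
proof -
  obtain C D where C: "compactin X C" "\<forall>x\<in>topspace X. f x \<noteq> 0 \<longrightarrow> x \<in> C"
    and D: "compactin X D" "\<forall>x\<in>topspace X. g x \<noteq> 0 \<longrightarrow> x \<in> D"
    using f g unfolding Cc_iff[OF X] by blast
  then have "compactin X (C \<union> D)" "\<forall>x\<in>topspace X. f x - g x \<noteq> 0 \<longrightarrow> x \<in> C \<union> D"
    by (auto intro: compactin_Un)
  then show ?thesis
    using f g continuous_map_diff[of X f g] unfolding Cc_iff[OF X] by blast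
qed


section \<open>Fields of Radon measures\<close>

lemma radon_open: "\<lbrakk>radon_measure X M; openin X U\<rbrakk> \<Longrightarrow> U \<in> sets M"
  by (simp add: radon_measure_def sigma_sets.Basic)

lemma radon_closed:
  assumes M: "radon_measure X M" and C: "closedin X C" shows "C \<in> sets M"
proof -
  have "C = space M - (topspace X - C)" using closedin_subset[OF C] M by (auto simp: radon_measure_def)
  moreover have "topspace X - C \<in> sets M" using C by (intro radon_open[OF M]) auto
  ultimately show ?thesis by (metis sets.compl_sets)
qed

lemma radon_measurable:
  fixes f :: "'a \<Rightarrow> 'b::topological_space"
  assumes M: "radon_measure X M" and f: "continuous_map X euclidean f" shows "f \<in> borel_measurable M"
proof (rule borel_measurableI)
  fix S :: "'b set" assume "open S"
  then have "openin X {x \<in> topspace X. f x \<in> S}"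
    by (intro openin_continuous_map_preimage[OF f]) auto
  moreover have "f -` S \<inter> space M = {x \<in> topspace X. f x \<in> S}" using M by (auto simp: radon_measure_def)
  ultimately show "f -` S \<inter> space M \<in> sets M" using radon_open[OF M] by simp
qed

lemma Cc_bounded:
  assumes X: "lchs X" and f: "f \<in> Cc X"
  obtains B where "B \<ge> 0" "\<And>x. x \<in> topspace X \<Longrightarrow> cmod (f x) \<le> B"
proof -
  obtain C where c: "continuous_map X euclidean f" and C: "compactin X C" "\<forall>x\<in>topspace X. f x \<noteq> 0 \<longrightarrow> x \<in> C"
    using f unfolding Cc_iff[OF X] by blast
  have "compactin euclidean (f ` C)" by (rule image_compactin[OF C(1) c])
  then have "bounded (f ` C)" by (simp add: compact_imp_bounded)
  then obtain B where B: "\<And>x. x \<in> C \<Longrightarrow> cmod (f x) \<le> B" by (auto simp: bounded_iff)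
  show ?thesis
  proof (rule that[of "max B 0"])
    show "cmod (f x) \<le> max B 0" if "x \<in> topspace X" for x
      using B[of x] C(2) that by (cases "f x = 0") auto
  qed simp
qed

lemma Cc_integrable:
  assumes X: "lchs X" and M: "radon_measure X M" and f: "f \<in> Cc X" shows "integrable M f"
proof -
  obtain B where B: "\<And>x. x \<in> topspace X \<Longrightarrow> cmod (f x) \<le> B" using Cc_bounded[OF X f] by metis
  obtain C where c: "continuous_map X euclidean f" and C: "compactin X C" "\<forall>x\<in>topspace X. f x \<noteq> 0 \<longrightarrow> x \<in> C"
    using f unfolding Cc_iff[OF X] by blast
  have sp: "space M = topspace X" using M by (simp add: radon_measure_def)
  show ?thesis
  proof (rule integrableI_bounded_set[where A = C and B = B])
    show "C \<in> sets M" using radon_closed[OF M lchs_compact_closed[OF X C(1)]] .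
    show "f \<in> borel_measurable M" using radon_measurable[OF M c] .
    show "emeasure M C < \<infinity>" using M C(1) by (simp add: radon_measure_def)
  qed (use B C sp in \<open>auto intro!: AE_I2\<close>)
qed

lemma radon_support_AE:
  assumes M: "radon_measure X M" shows "AE x in M. x \<in> measure_support X M"
proof -
  let ?N = "\<Union>{U. openin X U \<and> emeasure M U = 0}"
  have o: "openin X ?N" by auto
  have "emeasure M C \<le> 0" if C: "compactin X C" "C \<subseteq> ?N" for C
  proof -
    obtain F where F: "finite F" "F \<subseteq> {U. openin X U \<and> emeasure M U = 0}" "C \<subseteq> \<Union>F"
      using compactinD[OF C(1), of "{U. openin X U \<and> emeasure M U = 0}"] C(2) by auto
    have "\<Union>F \<in> null_sets M"
      using F radon_open[OF M] countable_finite[OF F(1)] by (intro null_sets_UN'[of F "\<lambda>x. x", simplified]) (auto simp: null_sets_def)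
    then show ?thesis using emeasure_mono[OF F(3), of M] by (auto simp: null_sets_def)
  qed
  then have "(SUP C \<in> {C. compactin X C \<and> C \<subseteq> ?N}. emeasure M C) \<le> 0"
    by (intro SUP_least) auto
  moreover have "emeasure M ?N = (SUP C \<in> {C. compactin X C \<and> C \<subseteq> ?N}. emeasure M C)"
    using M o unfolding radon_measure_def by blast
  ultimately have "emeasure M ?N = 0" by simp
  then have "?N \<in> null_sets M" using radon_open[OF M o] by auto
  then show ?thesis
  proof (rule AE_I')
    have "space M = topspace X" using M by (simp add: radon_measure_def)
    then show "{x \<in> space M. x \<notin> measure_support X M} \<subseteq> ?N"
      by (auto simp: measure_support_def zero_less_iff_neq_zero)
  qed
qed

text \<open>
  A continuous family of Radon measures on the fibres of \<open>q\<close>: both the Haar systems and the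
  equivariant systems are of this kind.
\<close>

locale measure_field =
  fixes Y :: "'y topology" and B :: "'b topology" and q :: "'y \<Rightarrow> 'b" and \<nu> :: "'b \<Rightarrow> 'y measure"
  assumes lchs: "lchs Y" and Hausdorff_base: "Hausdorff_space B" and q: "continuous_map Y B q"
    and radon: "u \<in> topspace B \<Longrightarrow> radon_measure Y (\<nu> u)"
    and support: "u \<in> topspace B \<Longrightarrow> measure_support Y (\<nu> u) = {y \<in> topspace Y. q y = u}"
    and integral_continuous: "f \<in> Cc Y \<Longrightarrow> continuous_map B euclidean (\<lambda>u. LINT y|\<nu> u. f y)"
begin

abbreviation "fib u \<equiv> {y \<in> topspace Y. q y = u}"

definition FI :: "'b \<Rightarrow> ('y \<Rightarrow> complex) \<Rightarrow> complex"
  where "FI u g = (LINT y : fib u|\<nu> u. g y)"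

lemma fib_closed: "u \<in> topspace B \<Longrightarrow> closedin Y (fib u)"
  using closedin_continuous_map_preimage[OF q, of "{u}"] Hausdorff_base
  by (simp add: closedin_Hausdorff_singleton)

lemma fib_sets: "u \<in> topspace B \<Longrightarrow> fib u \<in> sets (\<nu> u)"
  by (simp add: radon_closed[OF radon] fib_closed)

lemma fib_AE: "u \<in> topspace B \<Longrightarrow> AE y in \<nu> u. y \<in> fib u"
  using radon_support_AE[OF radon] support by simp

lemma FI_cong: "(\<And>y. y \<in> fib u \<Longrightarrow> f y = g y) \<Longrightarrow> FI u f = FI u g"
  unfolding FI_def set_lebesgue_integral_def by (rule Bochner_Integration.integral_cong) (auto simp: indicator_def)

lemma FI_Cc:
  assumes u: "u \<in> topspace B" and f: "f \<in> Cc Y"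
  shows "FI u f = (LINT y|\<nu> u. f y)"
  unfolding FI_def set_lebesgue_integral_def
proof (rule integral_cong_AE)
  have m: "f \<in> borel_measurable (\<nu> u)"
    using f radon_measurable[OF radon[OF u]] by (auto simp: Cc_def)
  then show "f \<in> borel_measurable (\<nu> u)" "(\<lambda>y. indicat_real (fib u) y *\<^sub>R f y) \<in> borel_measurable (\<nu> u)"
    using fib_sets[OF u] by auto
  show "AE y in \<nu> u. indicat_real (fib u) y *\<^sub>R f y = f y"
    using fib_AE[OF u] by eventually_elim simp
qed

text \<open>
  The integrands considered live on a fibre only; there they coincide with members of
  \<open>C\<^sub>c\<close> by Tietze's theorem.
\<close>

definition fibre_fun :: "'b \<Rightarrow> ('y \<Rightarrow> complex) \<Rightarrow> bool"
  where "fibre_fun u g \<longleftrightarrow> continuous_map (subtopology Y (fib u)) euclidean g \<and>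
    (\<exists>C. compactin Y C \<and> (\<forall>y\<in>fib u. g y \<noteq> 0 \<longrightarrow> y \<in> C))"

lemma fibre_fun_extend:
  assumes u: "u \<in> topspace B" and g: "fibre_fun u g"
  obtains f where "f \<in> Cc Y" "\<And>y. y \<in> fib u \<Longrightarrow> f y = g y"
proof -
  obtain C where "compactin Y C" "\<And>y. \<lbrakk>y \<in> fib u; g y \<noteq> 0\<rbrakk> \<Longrightarrow> y \<in> C"
    using g unfolding fibre_fun_def by blast
  then show ?thesis
    using Cc_extension[OF lchs fib_closed[OF u], of g C] g that unfolding fibre_fun_def by blast
qed

lemma fibre_fun_Cc: "f \<in> Cc Y \<Longrightarrow> fibre_fun u f"
  unfolding fibre_fun_def Cc_iff[OF lchs] by (auto intro: continuous_map_from_subtopology)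

lemma fibre_fun_cong:
  assumes "fibre_fun u f" "\<And>y. y \<in> fib u \<Longrightarrow> f y = g y" shows "fibre_fun u g"
proof -
  obtain C where C: "compactin Y C" "\<forall>y\<in>fib u. f y \<noteq> 0 \<longrightarrow> y \<in> C" and "continuous_map (subtopology Y (fib u)) euclidean f"
    using assms(1) unfolding fibre_fun_def by blast
  then have "continuous_map (subtopology Y (fib u)) euclidean g"
    using assms(2) by (intro continuous_map_eq[of _ _ f g]) auto
  moreover have "\<forall>y\<in>fib u. g y \<noteq> 0 \<longrightarrow> y \<in> C" using C(2) assms(2) by simp
  ultimately show ?thesis using C(1) unfolding fibre_fun_def by blast
qed

lemma FI_add:
  assumes u: "u \<in> topspace B" and "fibre_fun u f" "fibre_fun u g"
  shows "FI u (\<lambda>y. f y + g y) = FI u f + FI u g"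
proof -
  obtain f' where f': "f' \<in> Cc Y" "\<And>y. y \<in> fib u \<Longrightarrow> f' y = f y"
    using fibre_fun_extend[OF u assms(2)] by blast
  obtain g' where g': "g' \<in> Cc Y" "\<And>y. y \<in> fib u \<Longrightarrow> g' y = g y"
    using fibre_fun_extend[OF u assms(3)] by blast
  have i: "integrable (\<nu> u) (\<lambda>y. indicat_real (fib u) y *\<^sub>R h y)" if "h \<in> Cc Y" for h :: "'y \<Rightarrow> complex"
    using Cc_integrable[OF lchs radon[OF u] that] fib_sets[OF u] by (rule integrable_mult_indicator[rotated])
  have "FI u (\<lambda>y. f y + g y) = FI u (\<lambda>y. f' y + g' y)" by (rule FI_cong) (simp add: f' g')
  also have "\<dots> = FI u f' + FI u g'"
    unfolding FI_def set_lebesgue_integral_def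
    using Bochner_Integration.integral_add[OF i[OF f'(1)] i[OF g'(1)]] by (simp add: scaleR_add_right)
  also have "FI u f' = FI u f" by (rule FI_cong) (simp add: f')
  also have "FI u g' = FI u g" by (rule FI_cong) (simp add: g')
  finally show ?thesis .
qed

lemma FI_scale: "FI u (\<lambda>y. c * g y) = c * FI u g"
proof -
  have "(\<lambda>y. indicat_real (fib u) y *\<^sub>R (c * g y)) = (\<lambda>y. c * (indicat_real (fib u) y *\<^sub>R g y))"
    by (simp add: indicator_def)
  then show ?thesis unfolding FI_def set_lebesgue_integral_def
    by (simp only: integral_mult_right_zero)
qed

lemma FI_cnj: "FI u (\<lambda>y. cnj (g y)) = cnj (FI u g)"
proof -
  have "(\<lambda>y. indicat_real (fib u) y *\<^sub>R cnj (g y)) = (\<lambda>y. cnj (indicat_real (fib u) y *\<^sub>R g y))"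
    by (simp add: indicator_def)
  then show ?thesis unfolding FI_def set_lebesgue_integral_def by (simp only: Bochner_Integration.integral_cnj)
qed

text \<open>
  An integrand given on one fibre may fail to be measurable elsewhere, so the estimate is made for
  an extension in \<open>C\<^sub>c\<close>.
\<close>

lemma FI_bound:
  assumes u: "u \<in> topspace B" and g: "fibre_fun u g" and b: "(\<lambda>y. complex_of_real (b y)) \<in> Cc Y"
    and le: "\<And>y. y \<in> fib u \<Longrightarrow> cmod (g y) \<le> b y"
  shows "cmod (FI u g) \<le> Re (LINT y|\<nu> u. complex_of_real (b y))"
proof -
  obtain f where f: "f \<in> Cc Y" "\<And>y. y \<in> fib u \<Longrightarrow> f y = g y" using fibre_fun_extend[OF u g] by metis
  have "FI u g = FI u f" by (rule FI_cong) (simp add: f)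
  then have eq: "FI u g = (LINT y|\<nu> u. f y)" using FI_Cc[OF u f(1)] by simp
  have bi: "integrable (\<nu> u) b"
    using Cc_integrable[OF lchs radon[OF u] b] by (simp only: complex_of_real_integrable_eq)
  have "cmod (LINT y|\<nu> u. f y) \<le> (LINT y|\<nu> u. cmod (f y))" by (rule integral_norm_bound)
  also have "\<dots> \<le> (LINT y|\<nu> u. b y)"
  proof (rule integral_mono_AE)
    show "integrable (\<nu> u) (\<lambda>y. cmod (f y))" using Cc_integrable[OF lchs radon[OF u] f(1)] by simp
    show "AE y in \<nu> u. cmod (f y) \<le> b y" using fib_AE[OF u] by eventually_elim (use f(2) le in auto)
  qed (rule bi)
  finally show ?thesis using eq by simp
qed

lemma FI_nonneg:
  assumes "\<And>y. y \<in> fib u \<Longrightarrow> Im (g y) = 0 \<and> Re (g y) \<ge> 0"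
  shows "Re (FI u g) \<ge> 0" "Im (FI u g) = 0"
proof -
  have "FI u g = (LINT y : fib u|\<nu> u. complex_of_real (Re (g y)))"
    unfolding FI_def[symmetric] by (rule FI_cong) (use assms in \<open>auto simp: complex_eq_iff\<close>)
  also have "\<dots> = complex_of_real (LINT y|\<nu> u. indicat_real (fib u) y * Re (g y))"
    unfolding set_lebesgue_integral_def by (simp add: scaleR_conv_of_real flip: of_real_mult)
  finally have eq: "FI u g = complex_of_real (LINT y|\<nu> u. indicat_real (fib u) y * Re (g y))" .
  have "(LINT y|\<nu> u. indicat_real (fib u) y * Re (g y)) \<ge> 0"
    by (rule Bochner_Integration.integral_nonneg) (use assms in \<open>auto simp: indicator_def\<close>)
  then show "Re (FI u g) \<ge> 0" "Im (FI u g) = 0" using eq by simp_all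
qed

text \<open>
  A point of the fibre lies in the support of the measure, so the open set where the integrand is
  positive is not null.
\<close>

lemma FI_pos:
  assumes u: "u \<in> topspace B" and f: "f \<in> Cc Y"
    and nn: "\<And>y. y \<in> fib u \<Longrightarrow> Im (f y) = 0 \<and> Re (f y) \<ge> 0"
    and y0: "y0 \<in> fib u" "Re (f y0) > 0"
  shows "Re (FI u f) > 0"
proof -
  have i: "integrable (\<nu> u) (\<lambda>y. Re (f y))" using Cc_integrable[OF lchs radon[OF u] f] by simp
  have sp: "space (\<nu> u) = topspace Y" using radon[OF u] by (simp add: radon_measure_def)
  have nn': "AE y in \<nu> u. 0 \<le> Re (f y)" using fib_AE[OF u] by eventually_elim (use nn in auto)
  have eq: "Re (FI u f) = (LINT y|\<nu> u. Re (f y))"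
    using FI_Cc[OF u f] Cc_integrable[OF lchs radon[OF u] f] by simp
  have "(LINT y|\<nu> u. Re (f y)) \<noteq> 0"
  proof
    assume "(LINT y|\<nu> u. Re (f y)) = 0"
    then have z: "AE y in \<nu> u. Re (f y) = 0" using integral_nonneg_eq_0_iff_AE[OF i nn'] by simp
    let ?U = "{y \<in> topspace Y. Re (f y) \<in> {0<..}}"
    have "continuous_map Y euclidean f" using f by (simp add: Cc_def)
    then have "continuous_map Y euclidean (\<lambda>y. Re (f y))"
      by (rule continuous_map_unop) (intro continuous_intros)
    then have U: "openin Y ?U" by (intro openin_continuous_map_preimage) auto
    have "AE y in \<nu> u. y \<notin> ?U" using z by eventually_elim simp
    then have "?U \<in> null_sets (\<nu> u)"
      using AE_iff_null_sets[OF radon_open[OF radon[OF u] U]] by blast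
    then have "emeasure (\<nu> u) ?U = 0" by (rule null_setsD1)
    moreover have "y0 \<in> measure_support Y (\<nu> u)" using support[OF u] y0 by simp
    then have "emeasure (\<nu> u) ?U > 0" unfolding measure_support_def using U y0 by blast
    ultimately show False by simp
  qed
  moreover have "(LINT y|\<nu> u. Re (f y)) \<ge> 0" using nn' by (rule integral_nonneg_AE)
  ultimately show ?thesis using eq by simp
qed

text \<open>
  Fix \<open>x0\<close> and extend \<open>\<Psi> x0\<close> to \<open>\<phi> \<in> C\<^sub>c(Y)\<close>. By the tube lemma over the compact set carrying both
  functions, \<open>\<Psi> x\<close> is uniformly close to \<open>\<phi>\<close> on the fibre of \<open>x\<close> for \<open>x\<close> near \<open>x0\<close>, and the
  integrals of \<open>\<phi>\<close> vary continuously by assumption.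
\<close>

lemma param_integral:
  fixes X :: "'x topology" and \<Psi> :: "'x \<Rightarrow> 'y \<Rightarrow> complex"
  assumes p: "continuous_map X B p"
    and \<Psi>: "continuous_map (subtopology (prod_topology X Y) {(x, y). p x = q y}) euclidean (\<lambda>(x, y). \<Psi> x y)"
    and supp: "\<And>x0. x0 \<in> topspace X \<Longrightarrow> \<exists>U C. openin X U \<and> x0 \<in> U \<and> compactin Y C \<and>
        (\<forall>x\<in>U. \<forall>y\<in>fib (p x). \<Psi> x y \<noteq> 0 \<longrightarrow> y \<in> C)"
  shows "continuous_map X euclidean (\<lambda>x. FI (p x) (\<Psi> x))"
    and "\<And>x. x \<in> topspace X \<Longrightarrow> fibre_fun (p x) (\<Psi> x)"
proof -
  let ?P = "subtopology (prod_topology X Y) {(x, y). p x = q y}"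
  have pB: "p x \<in> topspace B" if "x \<in> topspace X" for x
    using continuous_map_image_subset_topspace[OF p] that by blast
  show ff: "fibre_fun (p x) (\<Psi> x)" if x: "x \<in> topspace X" for x
  proof -
    have "continuous_map (subtopology Y (fib (p x))) ?P (\<lambda>y. (x, y))"
      unfolding continuous_map_in_subtopology
      using x by (auto intro!: continuous_map_pairedI continuous_map_from_subtopology)
    from continuous_map_compose[OF this \<Psi>]
    have "continuous_map (subtopology Y (fib (p x))) euclidean (\<Psi> x)" by (simp add: o_def)
    then show ?thesis using supp[OF x] unfolding fibre_fun_def by blast
  qed
  show "continuous_map X euclidean (\<lambda>x. FI (p x) (\<Psi> x))"
    unfolding continuous_map_euclidean_iff
  proof (intro ballI allI impI)
    fix x0 and e :: real assume x0: "x0 \<in> topspace X" and e: "e > 0"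
    obtain U C where U: "openin X U" "x0 \<in> U" and C: "compactin Y C"
      and UC: "\<And>x y. \<lbrakk>x \<in> U; y \<in> fib (p x); \<Psi> x y \<noteq> 0\<rbrakk> \<Longrightarrow> y \<in> C"
      using supp[OF x0] by blast
    obtain \<phi> where \<phi>: "\<phi> \<in> Cc Y" "\<And>y. y \<in> fib (p x0) \<Longrightarrow> \<phi> y = \<Psi> x0 y"
      using fibre_fun_extend[OF pB[OF x0] ff[OF x0]] by metis
    obtain C' where C': "compactin Y C'" "\<And>y. \<lbrakk>y \<in> topspace Y; \<phi> y \<noteq> 0\<rbrakk> \<Longrightarrow> y \<in> C'"
      and \<phi>c: "continuous_map Y euclidean \<phi>"
      using \<phi>(1) unfolding Cc_iff[OF lchs] by blast
    define D where "D = C \<union> C'"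
    have D: "compactin Y D" using C C' by (simp add: D_def compactin_Un)
    obtain b :: "'y \<Rightarrow> real" and D' where b: "continuous_map Y euclidean b" "\<And>y. b y \<ge> 0"
      "\<And>y. y \<in> D \<Longrightarrow> b y = 1" "compactin Y D'" "\<And>y. b y \<noteq> 0 \<Longrightarrow> y \<in> D'"
      using bump_function[OF lchs D openin_topspace] D compactin_subset_topspace by metis
    have bc: "continuous_map Y euclidean (\<lambda>y. complex_of_real (b y))"
      using b(1) by (rule continuous_map_unop) (auto intro!: continuous_intros)
    then have bCc: "(\<lambda>y. complex_of_real (b y)) \<in> Cc Y"
      unfolding Cc_iff[OF lchs] using b(4,5) by auto
    define m where "m u = Re (LINT y|\<nu> u. complex_of_real (b y))" for u
    have mc: "continuous_map X euclidean (\<lambda>x. m (p x))"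
      using continuous_map_compose[OF p continuous_map_unop[OF integral_continuous[OF bCc], of Re]]
      by (simp add: o_def m_def continuous_intros)
    have pc: "continuous_map X euclidean (\<lambda>x. LINT y|\<nu> (p x). \<phi> y)"
      using continuous_map_compose[OF p integral_continuous[OF \<phi>(1)]] by (simp add: o_def)
    define A where "A = \<bar>m (p x0)\<bar> + 1"
    have A: "A > 0" by (simp add: A_def add_nonneg_pos)
    define d where "d = e / (2 * A)"
    have d: "d > 0" using e A by (simp add: d_def)
    \<comment> \<open>closeness on a product neighbourhood; off the fibre of \<open>x0\<close> it is vacuous, the base being Hausdorff\<close>
    have "\<exists>W T. openin X W \<and> x0 \<in> W \<and> openin Y T \<and> y \<in> T \<and>
        (\<forall>x\<in>W. \<forall>z\<in>T. p x = q z \<longrightarrow> cmod (\<Psi> x z - \<phi> z) < d)" if y: "y \<in> D" for y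
    proof -
      have yY: "y \<in> topspace Y" using y D compactin_subset_topspace by blast
      show ?thesis
      proof (cases "q y = p x0")
        case False
        have "q y \<in> topspace B" using continuous_map_image_subset_topspace[OF q] yY by blast
        then obtain B1 B2 where Bs: "openin B B1" "openin B B2" "p x0 \<in> B1" "q y \<in> B2" "disjnt B1 B2"
          using Hausdorff_base pB[OF x0] False unfolding Hausdorff_space_def by metis
        then show ?thesis
          using openin_continuous_map_preimage[OF p Bs(1)] openin_continuous_map_preimage[OF q Bs(2)] x0 yY
          by (intro exI[of _ "{x \<in> topspace X. p x \<in> B1}"] exI[of _ "{y \<in> topspace Y. q y \<in> B2}"])
            (auto simp: disjnt_iff)
      next
        case True
        have "continuous_map ?P Y snd" by (intro continuous_map_from_subtopology continuous_map_snd)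
        then have "continuous_map ?P euclidean (\<lambda>z. (case z of (x, y) \<Rightarrow> \<Psi> x y) - \<phi> (snd z))"
          using continuous_map_compose[OF _ \<phi>c, of ?P snd] by (intro continuous_map_diff \<Psi>) (simp add: o_def)
        moreover define \<Phi> where "\<Phi> = (\<lambda>z. (case z of (x, y) \<Rightarrow> \<Psi> x y) - \<phi> (snd z))"
        ultimately have \<Phi>: "continuous_map ?P euclidean \<Phi>" by simp
        have "(x0, y) \<in> topspace ?P" using x0 yY True by simp
        then obtain N where N: "openin ?P N" "(x0, y) \<in> N" "\<And>z. z \<in> N \<Longrightarrow> dist (\<Phi> (x0, y)) (\<Phi> z) < d"
          using continuous_map_nbhd[OF \<Phi> _ d] by blast
        obtain N' where N': "openin (prod_topology X Y) N'" "N = N' \<inter> {(x, y). p x = q y}"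
          using N(1) by (auto simp: openin_subtopology)
        obtain W T where WT: "openin X W" "openin Y T" "x0 \<in> W" "y \<in> T" "W \<times> T \<subseteq> N'"
          using N'(1)[unfolded openin_prod_topology_alt, rule_format, of x0 y] N(2) N'(2) by auto
        have "cmod (\<Psi> x z - \<phi> z) < d" if "x \<in> W" "z \<in> T" "p x = q z" for x z
        proof -
          have "(x, z) \<in> N" using N' WT that by auto
          then have "dist (\<Psi> x0 y - \<phi> y) (\<Psi> x z - \<phi> z) < d" using N(3)[of "(x, z)"] by (simp add: \<Phi>_def)
          then show ?thesis using \<phi>(2)[of y] yY True by (simp add: dist_norm norm_minus_commute)
        qed
        then show ?thesis using WT by blast
      qed
    qed
    then obtain W T where WT: "\<And>y. y \<in> D \<Longrightarrow> openin X (W y) \<and> x0 \<in> W y \<and> openin Y (T y) \<and> y \<in> T y \<and>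
        (\<forall>x\<in>W y. \<forall>z\<in>T y. p x = q z \<longrightarrow> cmod (\<Psi> x z - \<phi> z) < d)"
      by metis
    obtain F where F: "finite F" "F \<subseteq> T ` D" "D \<subseteq> \<Union>F"
      using compactinD[OF D, of "T ` D"] WT by blast
    then obtain I where I: "finite I" "I \<subseteq> D" "F = T ` I" by (meson finite_subset_image)
    define V where "V = U \<inter> ((\<Inter>i\<in>I. W i) \<inter> topspace X)"
    have V1: "openin X V" "x0 \<in> V"
    proof -
      have "openin X ((\<Inter>i\<in>I. W i) \<inter> topspace X)" by (rule openin_INT[OF I(1)]) (use I(2) WT in auto)
      then show "openin X V" unfolding V_def by (rule openin_Int[OF U(1)])
      show "x0 \<in> V" unfolding V_def using I(2) WT U(2) x0 by blast
    qed
    have close: "cmod (\<Psi> x y - \<phi> y) \<le> d * b y" if x: "x \<in> V" and y: "y \<in> fib (p x)" for x y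
    proof (cases "y \<in> D")
      case True
      then obtain i where "i \<in> I" "y \<in> T i" using F I by blast
      then have "cmod (\<Psi> x y - \<phi> y) < d" using WT[of i] I x y by (auto simp: V_def)
      then show ?thesis using b(3)[OF True] by simp
    next
      case False
      then have "\<Psi> x y = 0" "\<phi> y = 0" using UC[of x y] C'(2)[of y] x y by (auto simp: D_def V_def)
      then show ?thesis using d b(2)[of y] by simp
    qed
    have main: "cmod (FI (p x) (\<Psi> x) - (LINT y|\<nu> (p x). \<phi> y)) \<le> d * m (p x)" if x: "x \<in> V" for x
    proof -
      have xX: "x \<in> topspace X" using x by (simp add: V_def)
      note u = pB[OF xX]
      obtain \<psi> where \<psi>: "\<psi> \<in> Cc Y" "\<And>y. y \<in> fib (p x) \<Longrightarrow> \<psi> y = \<Psi> x y"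
        using fibre_fun_extend[OF u ff[OF xX]] by metis
      have m': "(\<lambda>y. - \<phi> y) \<in> Cc Y" using Cc_mult[OF lchs \<phi>(1), of "\<lambda>_. -1"] by simp
      have ffd: "fibre_fun (p x) (\<lambda>y. \<Psi> x y + - \<phi> y)"
        using fibre_fun_Cc[OF Cc_diff[OF lchs \<psi>(1) \<phi>(1)]] by (rule fibre_fun_cong) (simp add: \<psi>)
      have "FI (p x) (\<Psi> x) - (LINT y|\<nu> (p x). \<phi> y) = FI (p x) (\<Psi> x) + FI (p x) (\<lambda>y. - \<phi> y)"
        using FI_Cc[OF u m'] by simp
      also have "\<dots> = FI (p x) (\<lambda>y. \<Psi> x y + - \<phi> y)"
        by (rule FI_add[OF u ff[OF xX] fibre_fun_Cc[OF m'], symmetric])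
      also have "cmod \<dots> \<le> Re (LINT y|\<nu> (p x). complex_of_real (d * b y))"
      proof (rule FI_bound[OF u ffd])
        show "(\<lambda>y. complex_of_real (d * b y)) \<in> Cc Y"
          using Cc_mult[OF lchs bCc, of "\<lambda>_. complex_of_real d"] by simp
      qed (use close[OF x] in simp)
      also have "\<dots> = d * m (p x)" by (simp add: m_def)
      finally show ?thesis .
    qed
    obtain V2 where V2: "openin X V2" "x0 \<in> V2" "\<And>x. x \<in> V2 \<Longrightarrow> dist (m (p x0)) (m (p x)) < 1"
      using continuous_map_nbhd[OF mc x0, of 1] by auto
    obtain V3 where V3: "openin X V3" "x0 \<in> V3"
      "\<And>x. x \<in> V3 \<Longrightarrow> dist (LINT y|\<nu> (p x0). \<phi> y) (LINT y|\<nu> (p x). \<phi> y) < e / 2"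
      using continuous_map_nbhd[OF pc x0, of "e / 2"] e by auto
    have x0eq: "FI (p x0) (\<Psi> x0) = (LINT y|\<nu> (p x0). \<phi> y)"
      using FI_cong[of "p x0" \<phi> "\<Psi> x0"] \<phi>(2) FI_Cc[OF pB[OF x0] \<phi>(1)] by simp
    \<comment> \<open>\<open>d\<close> was chosen so that \<open>d\<close> times a local bound \<open>A\<close> for the integrals of \<open>b\<close> is \<open>e / 2\<close>\<close>
    have "dist (FI (p x0) (\<Psi> x0)) (FI (p x) (\<Psi> x)) < e" if x: "x \<in> V \<inter> V2 \<inter> V3" for x
    proof -
      have "m (p x) \<le> A" using V2(3)[of x] x by (auto simp: A_def dist_real_def)
      then have "d * m (p x) \<le> e / 2"
        using d A by (intro order_trans[OF mult_left_mono[of "m (p x)" A d]]) (auto simp: d_def)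
      then have "dist (LINT y|\<nu> (p x). \<phi> y) (FI (p x) (\<Psi> x)) \<le> e / 2"
        using main[of x] x by (simp add: dist_norm norm_minus_commute)
      moreover have "dist (LINT y|\<nu> (p x0). \<phi> y) (LINT y|\<nu> (p x). \<phi> y) < e / 2" using V3(3)[of x] x by simp
      ultimately show ?thesis
        unfolding x0eq using dist_triangle[of "LINT y|\<nu> (p x0). \<phi> y" "FI (p x) (\<Psi> x)" "LINT y|\<nu> (p x). \<phi> y"]
        by linarith
    qed
    then show "\<exists>U. openin X U \<and> x0 \<in> U \<and> (\<forall>x\<in>U. dist (FI (p x0) (\<Psi> x0)) (FI (p x) (\<Psi> x)) < e)"
      using V1 V2 V3 by (intro exI[of _ "V \<inter> V2 \<inter> V3"]) auto
  qed
qed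

end

section \<open>Groupoids and coset spaces\<close>

locale top_groupoid =
  fixes G :: "'g groupoid"
  assumes tg: "topological_groupoid G"
begin

abbreviation gm (infixl "\<cdot>" 70) where "x \<cdot> y \<equiv> gmul G x y"
abbreviation "iv \<equiv> ginv G"
abbreviation "r \<equiv> rng G"
abbreviation "d \<equiv> src G"
abbreviation "Ar \<equiv> arrows G"

lemma grp: "is_groupoid G" using tg by (simp add: topological_groupoid_def)

lemma inv_closed [simp]: "x \<in> Ar \<Longrightarrow> iv x \<in> Ar"
  and inv_inv [simp]: "x \<in> Ar \<Longrightarrow> iv (iv x) = x"
  using grp by (auto simp: is_groupoid_def)

lemma src_inv [simp]: "x \<in> Ar \<Longrightarrow> d (iv x) = r x"
  and rng_inv [simp]: "x \<in> Ar \<Longrightarrow> r (iv x) = d x"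
  by (simp_all add: src_def rng_def)

lemma mult_closed [simp]: "\<lbrakk>x \<in> Ar; y \<in> Ar; d x = r y\<rbrakk> \<Longrightarrow> x \<cdot> y \<in> Ar"
  and inv_mult [simp]: "\<lbrakk>x \<in> Ar; y \<in> Ar; d x = r y\<rbrakk> \<Longrightarrow> iv x \<cdot> (x \<cdot> y) = y"
  and mult_inv [simp]: "\<lbrakk>x \<in> Ar; y \<in> Ar; d x = r y\<rbrakk> \<Longrightarrow> x \<cdot> y \<cdot> iv y = x"
  using grp by (auto simp: is_groupoid_def composable_def)

lemma assoc:
  "\<lbrakk>x \<in> Ar; y \<in> Ar; z \<in> Ar; d x = r y; d y = r z\<rbrakk> \<Longrightarrow> x \<cdot> y \<cdot> z = x \<cdot> (y \<cdot> z)"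
  and src_mult_aux: "\<lbrakk>x \<in> Ar; y \<in> Ar; z \<in> Ar; d x = r y; d y = r z\<rbrakk> \<Longrightarrow> d (x \<cdot> y) = r z \<and> d x = r (y \<cdot> z)"
  using grp unfolding is_groupoid_def composable_def by blast+

lemma src_mult [simp]: "\<lbrakk>x \<in> Ar; y \<in> Ar; d x = r y\<rbrakk> \<Longrightarrow> d (x \<cdot> y) = d y"
  using src_mult_aux[of x y "iv y"] by simp

lemma rng_mult [simp]: "\<lbrakk>x \<in> Ar; y \<in> Ar; d x = r y\<rbrakk> \<Longrightarrow> r (x \<cdot> y) = r x"
  using src_mult_aux[of "iv x" x y] by simp

lemma rng_arrow [simp]: "x \<in> Ar \<Longrightarrow> r x \<in> Ar"
  and src_arrow [simp]: "x \<in> Ar \<Longrightarrow> d x \<in> Ar"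
  by (simp_all add: rng_def[of G x] src_def[of G x])

lemma rng_rng [simp]: "x \<in> Ar \<Longrightarrow> r (r x) = r x" and src_rng [simp]: "x \<in> Ar \<Longrightarrow> d (r x) = r x"
  and rng_src [simp]: "x \<in> Ar \<Longrightarrow> r (d x) = d x" and src_src [simp]: "x \<in> Ar \<Longrightarrow> d (d x) = d x"
  using rng_mult[of x "iv x"] src_mult[of x "iv x"] rng_mult[of "iv x" x] src_mult[of "iv x" x]
  by (simp_all add: rng_def[of G x, symmetric] src_def[of G x, symmetric])

lemma rng_mult_self [simp]: "x \<in> Ar \<Longrightarrow> r x \<cdot> x = x"
  using mult_inv[of x "iv x"] by (simp add: rng_def[of G x])

lemma mult_src_self [simp]: "x \<in> Ar \<Longrightarrow> x \<cdot> d x = x"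
  using inv_mult[of "iv x" x] by (simp add: src_def[of G x])

lemma mult_inv_mult [simp]: "\<lbrakk>x \<in> Ar; y \<in> Ar; r x = r y\<rbrakk> \<Longrightarrow> x \<cdot> (iv x \<cdot> y) = y"
  using inv_mult[of "iv x" y] by simp

lemma rng_unit [simp]: "x \<in> Ar \<Longrightarrow> r x \<in> units G" by (simp add: units_def)

lemma src_unit [simp]: "x \<in> Ar \<Longrightarrow> d x \<in> units G" 
  using rng_unit[of "iv x"] by simp

lemma unitE: assumes "u \<in> units G" shows "u \<in> Ar" "r u = u" "d u = u" "iv u = u"
proof -
  obtain x where x: "x \<in> Ar" "u = r x" using assms by (auto simp: units_def)
  then show a: "u \<in> Ar" "r u = u" "d u = u" by simp_all
  have "iv u = iv u \<cdot> (u \<cdot> u)" using a rng_mult_self[of u] mult_src_self[of "iv u"] by simp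
  then show "iv u = u" using inv_mult[of u u] a by simp
qed

lemma inv_of_mult: "\<lbrakk>x \<in> Ar; y \<in> Ar; d x = r y\<rbrakk> \<Longrightarrow> iv (x \<cdot> y) = iv y \<cdot> iv x"
proof -
  assume x: "x \<in> Ar" "y \<in> Ar" "d x = r y"
  have "(x \<cdot> y) \<cdot> (iv y \<cdot> iv x) = (x \<cdot> y \<cdot> iv y) \<cdot> iv x"
    using x by (subst assoc[of "x \<cdot> y" "iv y" "iv x"]) auto
  then have *: "(x \<cdot> y) \<cdot> (iv y \<cdot> iv x) = r x" using x by (simp add: rng_def)
  have "iv (x \<cdot> y) = iv (x \<cdot> y) \<cdot> d (iv (x \<cdot> y))" using x by (subst mult_src_self) auto
  also have "\<dots> = iv (x \<cdot> y) \<cdot> ((x \<cdot> y) \<cdot> (iv y \<cdot> iv x))" using x * by simp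
  also have "\<dots> = iv y \<cdot> iv x" using x by (subst inv_mult) auto
  finally show ?thesis .
qed

lemma units_subset: "units G \<subseteq> Ar" using unitE by blast

lemma topspace_unit_space [simp]: "topspace (unit_space G) = units G"
  using units_subset by (auto simp: unit_space_def)

lemma lchs_gtop: "lchs (gtop G)"
  using tg by (simp add: topological_groupoid_def lchs_def)

lemma cont_inv: "continuous_map (gtop G) (gtop G) iv"
  using tg by (simp add: topological_groupoid_def)

lemma cont_mult:
  assumes "continuous_map X (gtop G) a" "continuous_map X (gtop G) b"
    and "\<And>x. x \<in> topspace X \<Longrightarrow> d (a x) = r (b x)"
  shows "continuous_map X (gtop G) (\<lambda>x. a x \<cdot> b x)"
proof -
  have "continuous_map X (prod_topology (gtop G) (gtop G)) (\<lambda>x. (a x, b x))"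
    by (rule continuous_map_pairedI[OF assms(1,2)])
  moreover have "(a x, b x) \<in> composable G" if "x \<in> topspace X" for x
    using continuous_map_image_subset_topspace[OF assms(1)] continuous_map_image_subset_topspace[OF assms(2)]
      assms(3)[OF that] that by (simp add: composable_def image_subset_iff)
  ultimately have "continuous_map X (subtopology (prod_topology (gtop G) (gtop G)) (composable G)) (\<lambda>x. (a x, b x))"
    unfolding continuous_map_in_subtopology by blast
  moreover have "continuous_map (subtopology (prod_topology (gtop G) (gtop G)) (composable G)) (gtop G) (\<lambda>(x, y). x \<cdot> y)"
    using tg by (simp add: topological_groupoid_def)
  ultimately have "continuous_map X (gtop G) ((\<lambda>(x, y). x \<cdot> y) \<circ> (\<lambda>x. (a x, b x)))"
    by (rule continuous_map_compose)
  then show ?thesis by (simp add: o_def)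
qed

lemma mult_nbhd:
  assumes U: "openin (gtop G) U" and x: "x \<in> Ar" "y \<in> Ar" "d x = r y" "x \<cdot> y \<in> U"
  obtains A B where "openin (gtop G) A" "openin (gtop G) B" "x \<in> A" "y \<in> B"
    "\<And>a b. \<lbrakk>a \<in> A; b \<in> B; d a = r b\<rbrakk> \<Longrightarrow> a \<cdot> b \<in> U"
proof -
  let ?P = "subtopology (prod_topology (gtop G) (gtop G)) (composable G)"
  have "continuous_map ?P (gtop G) (\<lambda>(x, y). x \<cdot> y)"
    using tg by (simp add: topological_groupoid_def)
  then have "openin ?P {z \<in> topspace ?P. (\<lambda>(x, y). x \<cdot> y) z \<in> U}"
    using U by (rule openin_continuous_map_preimage)
  then obtain N where N: "openin (prod_topology (gtop G) (gtop G)) N"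
    "{z \<in> topspace ?P. (\<lambda>(x, y). x \<cdot> y) z \<in> U} = N \<inter> composable G"
    unfolding openin_subtopology by blast
  have "(x, y) \<in> {z \<in> topspace ?P. (\<lambda>(x, y). x \<cdot> y) z \<in> U}"
    using x by (simp add: composable_def)
  then have xy: "(x, y) \<in> N" using N(2) by blast
  obtain A B where AB: "openin (gtop G) A" "openin (gtop G) B" "x \<in> A" "y \<in> B" "A \<times> B \<subseteq> N"
    using N(1)[unfolded openin_prod_topology_alt, rule_format, OF xy] by blast
  show ?thesis
  proof (rule that[OF AB(1-4)])
    fix a b assume ab: "a \<in> A" "b \<in> B" "d a = r b"
    then have "(a, b) \<in> N \<inter> composable G"
      using AB openin_subset[OF AB(1)] openin_subset[OF AB(2)] by (auto simp: composable_def)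
    then have "(a, b) \<in> {z \<in> topspace ?P. (\<lambda>(x, y). x \<cdot> y) z \<in> U}" using N(2) by blast
    then show "a \<cdot> b \<in> U" by simp
  qed
qed

lemma cont_rng: "continuous_map (gtop G) (gtop G) r"
  unfolding rng_def[abs_def] by (rule cont_mult[OF continuous_map_id[unfolded id_def] cont_inv]) simp

lemma cont_src: "continuous_map (gtop G) (gtop G) d"
  unfolding src_def[abs_def] by (rule cont_mult[OF cont_inv continuous_map_id[unfolded id_def]]) simp

lemma cont_rng_unit: "continuous_map (gtop G) (unit_space G) r"
  unfolding unit_space_def continuous_map_in_subtopology using cont_rng by auto

lemma cont_src_unit: "continuous_map (gtop G) (unit_space G) d"
  unfolding unit_space_def continuous_map_in_subtopology using cont_src by auto

lemma Hausdorff_unit_space: "Hausdorff_space (unit_space G)"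
  using lchs_gtop by (simp add: lchs_def unit_space_def Hausdorff_space_subtopology)

lemma haar_measure_field:
  assumes "haar_system G lam" shows "measure_field (gtop G) (unit_space G) r lam"
  using assms lchs_gtop Hausdorff_unit_space cont_rng_unit
  by (simp add: measure_field_def haar_system_def range_fibre_def)

text \<open>
  For \<open>x \<in> U\<close> take a bump function at \<open>x\<close> supported in \<open>U\<close>. Its integrals depend continuously on
  the unit, are positive at \<open>r(x)\<close> and vanish wherever the fibre misses \<open>U\<close>.
\<close>

lemma haar_rng_open:
  assumes haar: "haar_system G lam" and U: "openin (gtop G) U"
  shows "openin (unit_space G) (r ` U)"
proof (subst openin_subopen, intro ballI)
  interpret mf: measure_field "gtop G" "unit_space G" r lam by (rule haar_measure_field[OF haar])
  fix u assume "u \<in> r ` U"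
  then obtain x where x: "x \<in> U" "r x = u" by blast
  have xA: "x \<in> Ar" using x U openin_subset by blast
  have uu: "u \<in> topspace (unit_space G)" using x rng_unit[OF xA] by simp
  have "compactin (gtop G) {x}" using xA by simp
  then obtain b :: "'g \<Rightarrow> real" and D where b: "continuous_map (gtop G) euclidean b" "\<And>x. b x \<ge> 0"
    "b x = 1" "compactin (gtop G) D" "D \<subseteq> U" "\<And>y. b y \<noteq> 0 \<Longrightarrow> y \<in> D"
    using bump_function[OF lchs_gtop _ U, of "{x}"] x by (metis empty_subsetI insert_subset singletonI)
  let ?b = "\<lambda>y. complex_of_real (b y)"
  have "continuous_map (gtop G) euclidean ?b"
    using b(1) by (rule continuous_map_unop) (intro continuous_intros)
  then have bC: "?b \<in> Cc (gtop G)" using b unfolding Cc_iff[OF lchs_gtop] by auto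
  have pos: "Re (LINT y|lam u. ?b y) > 0"
    using mf.FI_pos[OF uu bC, of x] mf.FI_Cc[OF uu bC] b x xA by simp
  let ?V = "{v \<in> topspace (unit_space G). Re (LINT y|lam v. ?b y) \<in> {0<..}}"
  have "continuous_map (unit_space G) euclidean (\<lambda>v. Re (LINT y|lam v. ?b y))"
    using mf.integral_continuous[OF bC] by (rule continuous_map_unop) (intro continuous_intros)
  then have V: "openin (unit_space G) ?V" by (rule openin_continuous_map_preimage) auto
  have "?V \<subseteq> r ` U"
  proof
    fix v assume v: "v \<in> ?V"
    then have vu: "v \<in> topspace (unit_space G)" by simp
    show "v \<in> r ` U"
    proof (rule ccontr)
      assume "v \<notin> r ` U"
      then have "mf.FI v ?b = mf.FI v (\<lambda>_. 0)"
        using b by (intro mf.FI_cong) (auto simp: image_iff subset_iff)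
      also have "\<dots> = 0" using mf.FI_scale[of v 0 "\<lambda>_. 0"] by simp
      finally show False using v mf.FI_Cc[OF vu bC] by simp
    qed
  qed
  then show "\<exists>T. openin (unit_space G) T \<and> u \<in> T \<and> T \<subseteq> r ` U" using V pos uu by (intro exI[of _ ?V]) simp
qed

end

lemma sub_groupoid_simps [simp]:
  "rng (sub_groupoid G H) = rng G" "src (sub_groupoid G H) = src G"
  "gmul (sub_groupoid G H) = gmul G" "ginv (sub_groupoid G H) = ginv G"
  "gtop (sub_groupoid G H) = subtopology (gtop G) H"
  by (auto simp: sub_groupoid_def rng_def src_def)

lemma coset_sub_groupoid [simp]: "coset (sub_groupoid G H) K = coset G K"
  by (auto simp: coset_def fun_eq_iff)

locale groupoid_pair = top_groupoid G for G :: "'g groupoid" +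
  fixes H :: "'g set"
  assumes cw: "closed_wide_subgroupoid G H"
begin

lemma H_closed: "closedin (gtop G) H"
  and H_inv [simp]: "h \<in> H \<Longrightarrow> iv h \<in> H"
  and units_eq: "r ` H = units G"
  using cw by (auto simp: closed_wide_subgroupoid_def)

lemma H_sub: "H \<subseteq> Ar" using H_closed closedin_subset by blast

lemma H_arrow [simp]: "h \<in> H \<Longrightarrow> h \<in> Ar" using H_sub by blast

lemma H_mult [simp]: "\<lbrakk>h \<in> H; k \<in> H; d h = r k\<rbrakk> \<Longrightarrow> h \<cdot> k \<in> H"
  using cw by (auto simp: closed_wide_subgroupoid_def composable_def)

lemma H_rng [simp]: "h \<in> H \<Longrightarrow> r h \<in> H" and H_src [simp]: "h \<in> H \<Longrightarrow> d h \<in> H"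
  using H_mult[of h "iv h"] H_mult[of "iv h" h] by (simp_all add: rng_def[symmetric] src_def[symmetric])

lemma units_H: "units G \<subseteq> H"
  using units_eq H_rng by (metis image_subsetI)

lemma src_H [simp]: "x \<in> Ar \<Longrightarrow> d x \<in> H" using units_H src_unit by blast

lemma units_sub [simp]: "units (sub_groupoid G H) = units G"
  using H_sub units_eq by (simp add: units_def Int_absorb1)

lemma unit_space_sub [simp]: "unit_space (sub_groupoid G H) = unit_space G"
  using units_H by (simp add: unit_space_def subtopology_subtopology Int_absorb1)

lemma arrows_sub: "arrows (sub_groupoid G H) = H"
  using H_sub by auto

lemma top_groupoid_sub: "top_groupoid (sub_groupoid G H)"
proof
  have comp: "composable (sub_groupoid G H) = {(x, y). x \<in> H \<and> y \<in> H \<and> d x = r y}"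
    unfolding composable_def arrows_sub by simp
  have "is_groupoid (sub_groupoid G H)"
    unfolding is_groupoid_def comp arrows_sub by (auto intro: assoc)
  moreover have "continuous_map (subtopology (prod_topology (subtopology (gtop G) H) (subtopology (gtop G) H))
      (composable (sub_groupoid G H))) (subtopology (gtop G) H) (\<lambda>(x, y). x \<cdot> y)"
    unfolding continuous_map_in_subtopology case_prod_unfold
  proof (intro conjI cont_mult)
    let ?P = "subtopology (prod_topology (subtopology (gtop G) H) (subtopology (gtop G) H)) (composable (sub_groupoid G H))"
    have "continuous_map ?P (subtopology (gtop G) H) fst" "continuous_map ?P (subtopology (gtop G) H) snd"
      by (intro continuous_map_from_subtopology continuous_map_fst continuous_map_snd)+
    then show "continuous_map ?P (gtop G) fst" "continuous_map ?P (gtop G) snd"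
      by (auto simp: continuous_map_in_subtopology)
  qed (auto simp: comp)
  moreover have "continuous_map (subtopology (gtop G) H) (subtopology (gtop G) H) iv"
    unfolding continuous_map_in_subtopology by (auto intro: continuous_map_from_subtopology cont_inv)
  ultimately show "topological_groupoid (sub_groupoid G H)"
    using lchs_closed_subspace[OF lchs_gtop H_closed] by (simp add: topological_groupoid_def lchs_def)
qed

lemma coset_mem_iff: "y \<in> coset G H x \<longleftrightarrow> (\<exists>h\<in>H. r h = d x \<and> y = x \<cdot> h)"
  by (auto simp: coset_def)

lemma coset_self [simp]: "x \<in> Ar \<Longrightarrow> x \<in> coset G H x"
  unfolding coset_mem_iff by (intro bexI[of _ "d x"]) auto

lemma coset_mult [simp]: 
  assumes x: "x \<in> Ar" and h: "h \<in> H" "d x = r h" shows "coset G H (x \<cdot> h) = coset G H x"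
proof (intro equalityI subsetI)
  fix y assume "y \<in> coset G H (x \<cdot> h)"
  then obtain k where "k \<in> H" "r k = d h" "y = x \<cdot> h \<cdot> k" using x h by (auto simp: coset_mem_iff)
  then show "y \<in> coset G H x" using x h unfolding coset_mem_iff
    by (intro bexI[of _ "h \<cdot> k"]) (auto simp: assoc)
next
  fix y assume "y \<in> coset G H x"
  then obtain k where k: "k \<in> H" "r k = d x" "y = x \<cdot> k" by (auto simp: coset_mem_iff)
  then have "y = x \<cdot> h \<cdot> (iv h \<cdot> k)" using x h by (subst assoc) auto
  then show "y \<in> coset G H (x \<cdot> h)" using x h k unfolding coset_mem_iff
    by (intro bexI[of _ "iv h \<cdot> k"]) auto
qed

lemma coset_subset: "x \<in> Ar \<Longrightarrow> coset G H x \<subseteq> {y \<in> Ar. r y = r x}"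
  by (auto simp: coset_mem_iff)

lemma coset_eq: "\<lbrakk>x \<in> Ar; y \<in> coset G H x\<rbrakk> \<Longrightarrow> coset G H y = coset G H x"
  by (auto simp: coset_mem_iff)

lemma coset_eq_iff:
  assumes "x \<in> Ar" "y \<in> Ar"
  shows "coset G H x = coset G H y \<longleftrightarrow> r x = r y \<and> iv x \<cdot> y \<in> H"
proof
  assume "coset G H x = coset G H y"
  then have "y \<in> coset G H x" using assms by simp
  then show "r x = r y \<and> iv x \<cdot> y \<in> H" using assms by (auto simp: coset_mem_iff)
next
  assume *: "r x = r y \<and> iv x \<cdot> y \<in> H"
  then have "y \<in> coset G H x" using assms unfolding coset_mem_iff by (intro bexI[of _ "iv x \<cdot> y"]) auto
  then show "coset G H x = coset G H y" by (rule coset_eq[OF assms(1), symmetric])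
qed

lemma coset_rng_coset [simp]: "x \<in> Ar \<Longrightarrow> coset_rng G (coset G H x) = r x"
proof -
  assume x: "x \<in> Ar"
  have "r ` coset G H x = {r x}" using coset_subset[OF x] coset_self[OF x] by auto
  then show ?thesis by (simp add: coset_rng_def)
qed

lemma coset_rep_coset:
  assumes "x \<in> Ar"
  obtains h where "h \<in> H" "r h = d x" "coset_rep (coset G H x) = x \<cdot> h"
proof -
  have "coset_rep (coset G H x) \<in> coset G H x"
    unfolding coset_rep_def using coset_self[OF assms] by (rule someI[of "\<lambda>z. z \<in> coset G H x"])
  then show ?thesis using that by (auto simp: coset_mem_iff)
qed

lemma coset_rep:
  assumes "C \<in> topspace (coset_space G H)"
  shows "coset_rep C \<in> Ar" "coset G H (coset_rep C) = C" "r (coset_rep C) = coset_rng G C"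
proof -
  obtain x where x: "x \<in> Ar" "C = coset G H x" using assms by (auto simp: topspace_coset_space)
  obtain h where "h \<in> H" "r h = d x" "coset_rep C = x \<cdot> h" using coset_rep_coset[OF x(1)] x(2) by metis
  then show "coset_rep C \<in> Ar" "coset G H (coset_rep C) = C" "r (coset_rep C) = coset_rng G C" using x by simp_all
qed

lemma coset_in_space [simp]: "x \<in> Ar \<Longrightarrow> coset G H x \<in> topspace (coset_space G H)"
  by (simp add: topspace_coset_space)

lemma translate_coset:
  assumes "g \<in> Ar" "x \<in> Ar" "d g = r x"
  shows "translate G g (coset G H x) = coset G H (g \<cdot> x)"
proof -
  have c: "coset G H x = (\<lambda>h. x \<cdot> h) ` {h \<in> H. r h = d x}" for x by (auto simp: coset_def)
  show ?thesis
    unfolding translate_def c image_image using assms by (intro image_cong) (auto simp: assoc)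
qed

lemma cont_coset: "continuous_map (gtop G) (coset_space G H) (coset G H)"
  using quotient_map_coset quotient_imp_continuous_map by blast

end

text \<open>
  A Haar system on \<open>H\<close> enters the topology of \<open>G/H\<close> through the openness of its range map, which
  makes the quotient map open.
\<close>

locale open_pair = groupoid_pair +
  assumes rng_open: "openin (subtopology (gtop G) H) U \<Longrightarrow> openin (unit_space G) (r ` U)"
begin

text \<open>
  If \<open>y0 k \<in> U\<close> with \<open>k \<in> H\<close>, then for \<open>y\<close> near \<open>y0\<close> some \<open>k' \<in> H\<close> near \<open>k\<close> is composable with
  \<open>y\<close>, as the range map of \<open>H\<close> is open, and \<open>y k' \<in> U\<close>.
\<close>

lemma coset_open_map: "open_map (gtop G) (coset_space G H) (coset G H)"
  unfolding open_map_def
proof (intro allI impI)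
  fix U assume U: "openin (gtop G) U"
  have UA: "U \<subseteq> Ar" using U openin_subset by blast
  have "openin (gtop G) {y \<in> Ar. coset G H y \<in> coset G H ` U}"
  proof (subst openin_subopen, intro ballI)
    fix y0 assume "y0 \<in> {y \<in> Ar. coset G H y \<in> coset G H ` U}"
    then obtain x where y0: "y0 \<in> Ar" and x: "x \<in> U" "coset G H y0 = coset G H x" by auto
    then have xA: "x \<in> Ar" using UA by blast
    define k where "k = iv y0 \<cdot> x"
    have k: "k \<in> H" "r k = d y0" "y0 \<cdot> k = x"
      using x coset_eq_iff[OF y0 xA] y0 xA by (auto simp: k_def)
    obtain A B where AB: "openin (gtop G) A" "openin (gtop G) B" "y0 \<in> A" "k \<in> B"
      "\<And>a b. \<lbrakk>a \<in> A; b \<in> B; d a = r b\<rbrakk> \<Longrightarrow> a \<cdot> b \<in> U"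
      using mult_nbhd[OF U y0 H_arrow[OF k(1)]] k x by metis
    have "openin (unit_space G) (r ` (B \<inter> H))" using AB(2) by (intro rng_open) (auto simp: openin_subtopology)
    then have o: "openin (gtop G) {y \<in> Ar. d y \<in> r ` (B \<inter> H)}"
      using openin_continuous_map_preimage[OF cont_src_unit] by blast
    let ?T = "A \<inter> {y \<in> Ar. d y \<in> r ` (B \<inter> H)}"
    have "y0 \<in> ?T" using AB k y0 by (auto simp flip: k(2))
    moreover have "?T \<subseteq> {y \<in> Ar. coset G H y \<in> coset G H ` U}"
    proof
      fix y assume y: "y \<in> ?T"
      then obtain k' where k': "k' \<in> B" "k' \<in> H" "d y = r k'" by auto
      then have "y \<cdot> k' \<in> U" using AB(5) y by blast
      moreover have "coset G H (y \<cdot> k') = coset G H y" using y k' by simp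
      ultimately show "y \<in> {y \<in> Ar. coset G H y \<in> coset G H ` U}" using y by (auto simp: image_iff intro: bexI[of _ "y \<cdot> k'"])
    qed
    ultimately show "\<exists>T. openin (gtop G) T \<and> y0 \<in> T \<and> T \<subseteq> {y \<in> Ar. coset G H y \<in> coset G H ` U}"
      using AB o by (intro exI[of _ ?T]) auto
  qed
  then show "openin (coset_space G H) (coset G H ` U)"
    unfolding openin_coset_space using UA by blast
qed

lemma coset_openI: "openin (gtop G) U \<Longrightarrow> openin (coset_space G H) (coset G H ` U)"
  using coset_open_map by (simp add: open_map_def)

text \<open>
  Two cosets \<open>xH\<close> and \<open>yH\<close> differ because the ranges differ or because \<open>x\<^sup>-\<^sup>1 y\<close> lies in the open
  complement of \<open>H\<close>; both conditions are open in \<open>x\<close> and \<open>y\<close>.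
\<close>

lemma Hausdorff_coset_space: "Hausdorff_space (coset_space G H)"
  unfolding Hausdorff_space_def
proof (intro allI impI, elim conjE)
  fix C D assume CD: "C \<in> topspace (coset_space G H)" "D \<in> topspace (coset_space G H)" "C \<noteq> D"
  then obtain x y where x: "x \<in> Ar" "C = coset G H x" and y: "y \<in> Ar" "D = coset G H y"
    by (auto simp: topspace_coset_space)
  have "\<exists>A B. openin (gtop G) A \<and> openin (gtop G) B \<and> x \<in> A \<and> y \<in> B \<and>
      (\<forall>a\<in>A. \<forall>b\<in>B. \<not> (r a = r b \<and> iv a \<cdot> b \<in> H))"
  proof (cases "r x = r y")
    case False
    then obtain U V where UV: "openin (unit_space G) U" "openin (unit_space G) V" "r x \<in> U" "r y \<in> V" "disjnt U V"
      using Hausdorff_unit_space x y unfolding Hausdorff_space_def by (metis rng_unit topspace_unit_space)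
    then show ?thesis
      using openin_continuous_map_preimage[OF cont_rng_unit UV(1)] openin_continuous_map_preimage[OF cont_rng_unit UV(2)] x y
      by (intro exI[of _ "{x \<in> Ar. r x \<in> U}"] exI[of _ "{x \<in> Ar. r x \<in> V}"]) (auto simp: disjnt_iff)
  next
    case True
    then have "iv x \<cdot> y \<in> Ar - H" using CD x y coset_eq_iff by auto
    moreover have "openin (gtop G) (Ar - H)" using H_closed by blast
    ultimately obtain A B where AB: "openin (gtop G) A" "openin (gtop G) B" "iv x \<in> A" "y \<in> B"
      "\<And>a b. \<lbrakk>a \<in> A; b \<in> B; d a = r b\<rbrakk> \<Longrightarrow> a \<cdot> b \<in> Ar - H"
      using mult_nbhd[of "Ar - H" "iv x" y] x y True by auto
    have "openin (gtop G) {a \<in> Ar. iv a \<in> A}" by (rule openin_continuous_map_preimage[OF cont_inv AB(1)])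
    moreover have "\<not> (r a = r b \<and> iv a \<cdot> b \<in> H)" if "a \<in> {a \<in> Ar. iv a \<in> A}" "b \<in> B" for a b
      using AB(5)[of "iv a" b] that by auto
    ultimately show ?thesis
      using AB(2,3,4) x by (intro exI[of _ "{a \<in> Ar. iv a \<in> A}"] exI[of _ B]) auto
  qed
  then obtain A B where AB: "openin (gtop G) A" "openin (gtop G) B" "x \<in> A" "y \<in> B"
    and sep: "\<And>a b. \<lbrakk>a \<in> A; b \<in> B\<rbrakk> \<Longrightarrow> \<not> (r a = r b \<and> iv a \<cdot> b \<in> H)" by blast
  have "disjnt (coset G H ` A) (coset G H ` B)"
  proof (clarsimp simp: disjnt_iff)
    fix a b assume "a \<in> A" "b \<in> B" "coset G H a = coset G H b"
    then show False using sep[of a b] coset_eq_iff[of a b] openin_subset[OF AB(1)] openin_subset[OF AB(2)] by blast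
  qed
  then show "\<exists>U V. openin (coset_space G H) U \<and> openin (coset_space G H) V \<and> C \<in> U \<and> D \<in> V \<and> disjnt U V"
    using AB x y
    by (intro exI[of _ "coset G H ` A"] exI[of _ "coset G H ` B"] conjI coset_openI) auto
qed

lemma lchs_coset_space: "lchs (coset_space G H)"
  using locally_compact_space_continuous_open_map_image[OF cont_coset coset_open_map]
    second_countable_open_map_image[OF cont_coset coset_open_map] lchs_gtop Hausdorff_coset_space
  by (simp add: lchs_def topspace_coset_space)

lemma cont_from_coset_space:
  "continuous_map (coset_space G H) Y f \<longleftrightarrow> continuous_map (gtop G) Y (\<lambda>x. f (coset G H x))"
  using continuous_compose_quotient_map_eq[OF quotient_map_coset, symmetric] by (simp add: o_def)

lemma cont_coset_rng: "continuous_map (coset_space G H) (unit_space G) (coset_rng G)"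
  unfolding cont_from_coset_space using cont_rng_unit by (rule continuous_map_eq) simp

text \<open>
  The quotient map is open, so the images of relatively compact open sets form an open cover.
\<close>

lemma compact_lift:
  assumes C: "compactin (coset_space G H) C"
  obtains D where "compactin (gtop G) D" "C \<subseteq> coset G H ` D"
proof -
  have "\<exists>U D. openin (gtop G) U \<and> compactin (gtop G) D \<and> x \<in> U \<and> U \<subseteq> D" if "x \<in> Ar" for x
    using lchs_gtop that by (auto simp: lchs_def locally_compact_space_def)
  then obtain U D where UD: "\<And>x. x \<in> Ar \<Longrightarrow> openin (gtop G) (U x) \<and> compactin (gtop G) (D x) \<and> x \<in> U x \<and> U x \<subseteq> D x"
    by metis
  let ?W = "(\<lambda>x. coset G H ` U x) ` Ar"
  have "C \<subseteq> topspace (coset_space G H)" using C compactin_subset_topspace by blast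
  then have "C \<subseteq> \<Union>?W" using UD by (fastforce simp: topspace_coset_space)
  moreover have "\<And>V. V \<in> ?W \<Longrightarrow> openin (coset_space G H) V" using UD coset_openI by blast
  ultimately obtain F where F: "finite F" "F \<subseteq> ?W" "C \<subseteq> \<Union>F" using compactinD[OF C, of ?W] by metis
  then obtain I where I: "finite I" "I \<subseteq> Ar" "F = (\<lambda>x. coset G H ` U x) ` I" by (meson finite_subset_image)
  show ?thesis
  proof
    show "compactin (gtop G) (\<Union>x\<in>I. D x)" using I UD by (intro compactin_Union) auto
    show "C \<subseteq> coset G H ` (\<Union>x\<in>I. D x)"
    proof
      fix A assume "A \<in> C"
      then obtain x where x: "x \<in> I" "A \<in> coset G H ` U x" using F(3) I(3) by blast
      then have "U x \<subseteq> D x" using UD I(2) by blast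
      then show "A \<in> coset G H ` (\<Union>x\<in>I. D x)" using x by blast
    qed
  qed
qed

lemma system_measure_field:
  assumes "full_equivariant_system G H \<mu>"
  shows "measure_field (coset_space G H) (unit_space G) (coset_rng G) \<mu>"
  using assms lchs_coset_space Hausdorff_unit_space cont_coset_rng
  by (simp add: measure_field_def full_equivariant_system_def coset_range_fibre_def)

end

lemma open_pairI:
  assumes "topological_groupoid G" "closed_wide_subgroupoid G H" "haar_system (sub_groupoid G H) lam"
  shows "open_pair G H"
proof -
  interpret groupoid_pair G H using assms by unfold_locales
  interpret S: top_groupoid "sub_groupoid G H" by (rule top_groupoid_sub)
  show ?thesis
    using S.haar_rng_open[OF assms(3)] by unfold_locales simp
qed

section \<open>Equivariant functions and their approximation\<close>

lemma hilbert_geometric_limit: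
  assumes V: "is_hilbert_space V" and s: "\<And>n. s n \<in> carrier V"
    and step: "\<And>n. hnorm V (s (Suc n) \<ominus>\<^bsub>V\<^esub> s n) \<le> c * (1/2) ^ n"
  obtains a where "a \<in> carrier V" "\<And>n. hnorm V (s n \<ominus>\<^bsub>V\<^esub> a) \<le> 2 * c * (1/2) ^ n"
proof -
  interpret V: semi_inner V by (rule hilbert_semi_inner[OF V])
  have le: "hnorm V (s (n + k) \<ominus>\<^bsub>V\<^esub> s n) \<le> 2 * c * (1/2) ^ n - 2 * c * (1/2) ^ (n + k)" for n k
  proof (induction k)
    case 0
    then show ?case using s by (simp add: V.norm_minus_self)
  next
    case (Suc k)
    have "hnorm V (s (n + Suc k) \<ominus>\<^bsub>V\<^esub> s n) \<le> hnorm V (s (Suc (n + k)) \<ominus>\<^bsub>V\<^esub> s (n + k)) + hnorm V (s (n + k) \<ominus>\<^bsub>V\<^esub> s n)"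
      using V.norm_triangle_minus[of "s (Suc (n + k))" "s (n + k)" "s n"] s by simp
    then show ?case using step[of "n + k"] Suc by simp
  qed
  have c: "c \<ge> 0" using step[of 0] V.norm_ge0[OF V.minus_closed[OF s s], of 1 0] by simp
  have le2: "hnorm V (s m \<ominus>\<^bsub>V\<^esub> s n) \<le> 2 * c * (1/2) ^ N" if "m \<ge> n" "n \<ge> N" for m n N
  proof -
    have "hnorm V (s m \<ominus>\<^bsub>V\<^esub> s n) \<le> 2 * c * (1/2) ^ n - 2 * c * (1/2) ^ m"
      using le[of n "m - n"] that by simp
    also have "\<dots> \<le> 2 * c * (1/2) ^ n" using c by simp
    also have "\<dots> \<le> 2 * c * (1/2) ^ N"
      using c that by (intro mult_left_mono power_decreasing) auto
    finally show ?thesis .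
  qed
  have "s \<in> cauchy_sequences V (hnorm V)"
    unfolding cauchy_sequences_def
  proof (intro CollectI conjI allI impI s)
    fix e :: real assume e: "e > 0"
    have "(\<lambda>N. 2 * c * (1/2) ^ N) \<longlonglongrightarrow> 2 * c * 0" by (intro tendsto_intros LIMSEQ_realpow_zero) auto
    then have "\<forall>\<^sub>F N in sequentially. 2 * c * (1/2) ^ N < e" using e by (intro order_tendstoD(2)) auto
    then obtain N where N: "2 * c * (1/2) ^ N < e" unfolding eventually_sequentially by blast
    have "hnorm V (s i \<ominus>\<^bsub>V\<^esub> s j) < e" if "i \<ge> N" "j \<ge> N" for i j
    proof (cases "i \<ge> j")
      case True
      then show ?thesis using le2[of j i N] that N by simp
    next
      case False
      then show ?thesis using le2[of i j N] that N V.norm_minus_commute[OF s s, of i j] by simp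
    qed
    then show "\<exists>N. \<forall>i\<ge>N. \<forall>j\<ge>N. hnorm V (s i \<ominus>\<^bsub>V\<^esub> s j) < e" by blast
  qed
  then obtain a where a: "a \<in> carrier V" "(\<lambda>i. hnorm V (s i \<ominus>\<^bsub>V\<^esub> a)) \<longlonglongrightarrow> 0"
    using V unfolding is_hilbert_space_def by blast
  have "hnorm V (s n \<ominus>\<^bsub>V\<^esub> a) \<le> 2 * c * (1/2) ^ n" for n
  proof (rule LIMSEQ_le_const)
    show "(\<lambda>i. 2 * c * (1/2) ^ n + hnorm V (s i \<ominus>\<^bsub>V\<^esub> a)) \<longlonglongrightarrow> 2 * c * (1/2) ^ n"
      using tendsto_add[OF tendsto_const a(2)] by simp
    have "hnorm V (s n \<ominus>\<^bsub>V\<^esub> a) \<le> 2 * c * (1/2) ^ n + hnorm V (s i \<ominus>\<^bsub>V\<^esub> a)" if "i \<ge> n" for i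
      using V.norm_triangle_minus[OF s s a(1), of n i] le2[of n i n] that V.norm_minus_commute[OF s s, of i n] by simp
    then show "\<exists>N. \<forall>i\<ge>N. hnorm V (s n \<ominus>\<^bsub>V\<^esub> a) \<le> 2 * c * (1/2) ^ n + hnorm V (s i \<ominus>\<^bsub>V\<^esub> a)" by blast
  qed
  then show ?thesis using a that by blast
qed

locale unitary_action = open_pair G H + hilbert_field "unit_space G" \<sigma>
  for G :: "'g groupoid" and H :: "'g set" and \<sigma> :: "('g, 'h) representation" +
  assumes act_unitary: "h \<in> H \<Longrightarrow> unitary_on (fibre \<sigma> (src G h)) (fibre \<sigma> (rng G h)) (act \<sigma> h)"
begin

abbreviation "Q \<equiv> coset_space G H"
abbreviation "co \<equiv> coset G H"
abbreviation "IF \<equiv> ind_functions G H \<sigma>"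
abbreviation "fs x \<equiv> fibre \<sigma> (src G x)"

lemma fs_inner: "x \<in> Ar \<Longrightarrow> semi_inner (fs x)" by (simp add: fibre_inner)
lemma fs_hilbert: "x \<in> Ar \<Longrightarrow> is_hilbert_space (fs x)" by (simp add: fibre_hilbert)

lemma act_closed: "\<lbrakk>h \<in> H; v \<in> carrier (fs h)\<rbrakk> \<Longrightarrow> act \<sigma> h v \<in> carrier (fb (r h))"
  and act_add: "\<lbrakk>h \<in> H; v \<in> carrier (fs h); w \<in> carrier (fs h)\<rbrakk> \<Longrightarrow>
    act \<sigma> h (v \<oplus>\<^bsub>fs h\<^esub> w) = act \<sigma> h v \<oplus>\<^bsub>fb (r h)\<^esub> act \<sigma> h w"
  and act_smult: "\<lbrakk>h \<in> H; v \<in> carrier (fs h)\<rbrakk> \<Longrightarrow> act \<sigma> h (z \<odot>\<^bsub>fs h\<^esub> v) = z \<odot>\<^bsub>fb (r h)\<^esub> act \<sigma> h v"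
  and act_inner: "\<lbrakk>h \<in> H; v \<in> carrier (fs h); w \<in> carrier (fs h)\<rbrakk> \<Longrightarrow>
    hinner (fb (r h)) (act \<sigma> h v) (act \<sigma> h w) = hinner (fs h) v w"
  and act_norm: "\<lbrakk>h \<in> H; v \<in> carrier (fs h)\<rbrakk> \<Longrightarrow> nm (r h) (act \<sigma> h v) = nm (d h) v"
  using act_unitary[of h] by (auto simp: unitary_on_def bounded_linear_on_def hnorm_def Pi_iff)

lemma act_minus:
  assumes h: "h \<in> H" and v: "v \<in> carrier (fs h)" "w \<in> carrier (fs h)"
  shows "act \<sigma> h (v \<ominus>\<^bsub>fs h\<^esub> w) = act \<sigma> h v \<ominus>\<^bsub>fb (r h)\<^esub> act \<sigma> h w"
proof -
  interpret A: semi_inner "fs h" by (rule fs_inner) (use h in simp)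
  interpret B: semi_inner "fb (r h)" by (rule fibre_inner) (use h in simp)
  show ?thesis using h v by (simp add: A.minus_eq_smult B.minus_eq_smult act_add act_smult act_closed)
qed

lemma act_zero: "h \<in> H \<Longrightarrow> act \<sigma> h \<zero>\<^bsub>fs h\<^esub> = \<zero>\<^bsub>fb (r h)\<^esub>"
proof -
  assume h: "h \<in> H"
  interpret A: semi_inner "fs h" by (rule fs_inner) (use h in simp)
  have "act \<sigma> h \<zero>\<^bsub>fs h\<^esub> \<in> carrier (fb (r h))" "nm (r h) (act \<sigma> h \<zero>\<^bsub>fs h\<^esub>) = 0"
    using h by (simp_all add: act_closed act_norm)
  then show ?thesis using h by (intro hilbert_norm_eq_0 fibre_hilbert) auto
qed

text \<open>
  Equivariance and compactness of the support modulo \<open>H\<close> are needed on closed subsets too: on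
  range fibres, whose functions make up the induced bundle, and on subgroupoids, from which
  functions are extended.
\<close>

definition stable :: "'g set \<Rightarrow> bool"
  where "stable Z \<longleftrightarrow> closedin (gtop G) Z \<and> (\<forall>x\<in>Z. \<forall>h\<in>H. d x = r h \<longrightarrow> x \<cdot> h \<in> Z)"

definition equiv_on :: "'g set \<Rightarrow> ('g \<Rightarrow> 'h) \<Rightarrow> bool"
  where "equiv_on Z f \<longleftrightarrow> asec (subtopology (gtop G) Z) d f \<and>
    (\<forall>x\<in>Z. \<forall>h\<in>H. d x = r h \<longrightarrow> f (x \<cdot> h) = act \<sigma> (iv h) (f x))"

definition supported :: "'g set \<Rightarrow> ('g \<Rightarrow> 'h) \<Rightarrow> 'g set set \<Rightarrow> bool"
  where "supported Z f C \<longleftrightarrow> compactin Q C \<and> (\<forall>x\<in>Z. f x \<noteq> \<zero>\<^bsub>fs x\<^esub> \<longrightarrow> co x \<in> C)"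

lemma stable_sub: "stable Z \<Longrightarrow> Z \<subseteq> Ar"
  using closedin_subset by (auto simp: stable_def)

lemma stable_mult: "\<lbrakk>stable Z; x \<in> Z; h \<in> H; d x = r h\<rbrakk> \<Longrightarrow> x \<cdot> h \<in> Z"
  by (simp add: stable_def)

lemma stable_Ar: "stable Ar" by (simp add: stable_def)

lemma stable_coset_eq:
  assumes Z: "stable Z" and x: "x \<in> Z" and y: "y \<in> Ar" "co x = co y" shows "y \<in> Z"
proof -
  have xA: "x \<in> Ar" using stable_sub[OF Z] x by blast
  have "r x = r y" "iv x \<cdot> y \<in> H" using coset_eq_iff[OF xA y(1)] y by auto
  then show ?thesis using stable_mult[OF Z x, of "iv x \<cdot> y"] xA y by simp
qed

lemma equiv_on_mem: "\<lbrakk>equiv_on Z f; x \<in> Z; x \<in> Ar\<rbrakk> \<Longrightarrow> f x \<in> carrier (fs x)"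
  unfolding equiv_on_def using asec_mem[of "subtopology (gtop G) Z" d f x] by simp

lemma equiv_on_act: "\<lbrakk>equiv_on Z f; x \<in> Z; h \<in> H; d x = r h\<rbrakk> \<Longrightarrow> f (x \<cdot> h) = act \<sigma> (iv h) (f x)"
  by (simp add: equiv_on_def)

text \<open>
  The action being unitary, both sides of each equation are moved into one another by the element
  of \<open>H\<close> that takes \<open>x\<close> to \<open>y\<close>. So these quantities are functions on the coset space.
\<close>

lemma equiv_inner:
  assumes Z: "stable Z" and f: "equiv_on Z f" and g: "equiv_on Z g"
    and x: "x \<in> Z" and y: "y \<in> Ar" "co x = co y"
  shows "hinner (fs y) (f y) (g y) = hinner (fs x) (f x) (g x)"
    and "nm (d y) (f y \<ominus>\<^bsub>fs y\<^esub> g y) = nm (d x) (f x \<ominus>\<^bsub>fs x\<^esub> g x)"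
    and "nm (d y) (f y) = nm (d x) (f x)"
proof -
  have xA: "x \<in> Ar" using stable_sub[OF Z] x by blast
  define h where "h = iv x \<cdot> y"
  have h: "h \<in> H" "r h = d x" "y = x \<cdot> h" "d h = d y"
    using coset_eq_iff[OF xA y(1)] y xA by (auto simp: h_def)
  have fy: "f y = act \<sigma> (iv h) (f x)" "g y = act \<sigma> (iv h) (g x)"
    using equiv_on_act[OF f x h(1)] equiv_on_act[OF g x h(1)] h by auto
  have c: "f x \<in> carrier (fs (iv h))" "g x \<in> carrier (fs (iv h))"
    using equiv_on_mem[OF f x xA] equiv_on_mem[OF g x xA] h by auto
  have r: "r (iv h) = d y" "d (iv h) = d x" using h by auto
  have ih: "iv h \<in> H" using h by simp
  show "hinner (fs y) (f y) (g y) = hinner (fs x) (f x) (g x)"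
    using act_inner[OF ih c] r fy by simp
  show "nm (d y) (f y \<ominus>\<^bsub>fs y\<^esub> g y) = nm (d x) (f x \<ominus>\<^bsub>fs x\<^esub> g x)"
    using act_norm[OF ih semi_inner.minus_closed[OF fs_inner c]] act_minus[OF ih c] ih r fy by simp
  show "nm (d y) (f y) = nm (d x) (f x)"
    using act_norm[OF ih c(1)] r fy by simp
qed

lemma asec_d_minus: "\<lbrakk>equiv_on Z f; equiv_on Z g\<rbrakk> \<Longrightarrow>
    continuous_map (subtopology (gtop G) Z) euclidean (\<lambda>x. nm (d x) (f x \<ominus>\<^bsub>fs x\<^esub> g x))"
  unfolding equiv_on_def by (intro asec_norm asec_minus) auto

lemma equiv_on_subset: "\<lbrakk>equiv_on Z f; Z' \<subseteq> Z\<rbrakk> \<Longrightarrow> equiv_on Z' f"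
  unfolding equiv_on_def continuous_total_iff[symmetric]
  using continuous_map_from_subtopology_mono by blast

lemma supported_zero_iff:
  assumes Z: "stable Z" and f: "equiv_on Z f" and x: "x \<in> Z" and y: "y \<in> Ar" "co x = co y"
  shows "f x = \<zero>\<^bsub>fs x\<^esub> \<longleftrightarrow> f y = \<zero>\<^bsub>fs y\<^esub>"
proof -
  have xA: "x \<in> Ar" and yZ: "y \<in> Z" using stable_sub[OF Z] x stable_coset_eq[OF Z x y] by auto
  have "f z = \<zero>\<^bsub>fs z\<^esub> \<longleftrightarrow> nm (d z) (f z) = 0" if z: "z \<in> Z" for z
  proof -
    have zA: "z \<in> Ar" using z stable_sub[OF Z] by blast
    show ?thesis using semi_inner.norm_zero[OF fs_inner[OF zA]]
        hilbert_norm_eq_0[OF fs_hilbert[OF zA] equiv_on_mem[OF f z zA]] by auto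
  qed
  then show ?thesis using equiv_inner(3)[OF Z f f x y] x yZ by metis
qed

text \<open>
  The support condition in the definition of the induced functions says just that a compact set of
  cosets carries the function, because the quotient map is open and the function is equivariant.
\<close>

lemma IF_iff:
  "f \<in> IF \<longleftrightarrow> f \<in> extensional Ar \<and> equiv_on Ar f \<and> (\<exists>C. supported Ar f C)"
proof -
  let ?N = "{x \<in> Ar. f x \<noteq> \<zero>\<^bsub>fs x\<^esub>}"
  have "compactin Q (co ` (gtop G closure_of ?N)) \<longleftrightarrow> (\<exists>C. supported Ar f C)" if eq: "equiv_on Ar f"
  proof
    assume "compactin Q (co ` (gtop G closure_of ?N))"
    moreover have "?N \<subseteq> gtop G closure_of ?N" by (rule closure_of_subset) auto
    ultimately show "\<exists>C. supported Ar f C" unfolding supported_def by blast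
  next
    assume "\<exists>C. supported Ar f C"
    then obtain C where C: "compactin Q C" "co ` ?N \<subseteq> C" by (auto simp: supported_def)
    have "co ` (gtop G closure_of ?N) = Q closure_of (co ` ?N)"
    proof
      show "co ` (gtop G closure_of ?N) \<subseteq> Q closure_of (co ` ?N)"
        using cont_coset by (rule continuous_map_image_closure_subset)
      show "Q closure_of (co ` ?N) \<subseteq> co ` (gtop G closure_of ?N)"
      proof
        fix D assume D: "D \<in> Q closure_of (co ` ?N)"
        then obtain y where y: "y \<in> Ar" "D = co y"
          by (auto simp: in_closure_of topspace_coset_space)
        have "\<exists>n\<in>?N. n \<in> U" if U: "openin (gtop G) U" "y \<in> U" for U
        proof -
          have "\<exists>E. E \<in> co ` ?N \<and> E \<in> co ` U"
            using D coset_openI[OF U(1)] U(2) y unfolding in_closure_of by blast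
          then obtain n u where n: "n \<in> ?N" "u \<in> U" "co n = co u" by blast
          moreover have "u \<in> Ar" using n U openin_subset by blast
          ultimately have "u \<in> ?N" using supported_zero_iff[OF stable_Ar eq, of n u] by auto
          then show ?thesis using n by blast
        qed
        then have "y \<in> gtop G closure_of ?N" using y by (auto simp: in_closure_of)
        then show "D \<in> co ` (gtop G closure_of ?N)" using y by blast
      qed
    qed
    moreover have "Q closure_of (co ` ?N) \<subseteq> C"
      using C lchs_compact_closed[OF lchs_coset_space C(1)] by (intro closure_of_minimal) auto
    then have "compactin Q (Q closure_of (co ` ?N))"
      by (rule closed_compactin[OF C(1)]) auto
    ultimately show "compactin Q (co ` (gtop G closure_of ?N))" by simp
  qed
  moreover have "f \<in> (\<Pi>\<^sub>E x \<in> Ar. carrier (fs x)) \<longleftrightarrow> f \<in> extensional Ar \<and> (\<forall>x\<in>Ar. f x \<in> carrier (fs x))"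
    by (auto simp: PiE_def)
  moreover have "equiv_on Ar f \<longleftrightarrow> (\<forall>x\<in>Ar. f x \<in> carrier (fs x)) \<and>
      continuous_map (gtop G) (total_space (unit_space G) \<sigma>) (\<lambda>x. (d x, f x)) \<and>
      (\<forall>x\<in>Ar. \<forall>h\<in>H. d x = r h \<longrightarrow> f (x \<cdot> h) = act \<sigma> (iv h) (f x))"
    unfolding equiv_on_def continuous_total_iff using asec_mem[of "gtop G" d f] by auto
  ultimately show ?thesis unfolding ind_functions_def by auto
qed

lemma IF_ext: "f \<in> IF \<Longrightarrow> f \<in> extensional Ar"
  and IF_equiv: "f \<in> IF \<Longrightarrow> equiv_on Ar f"
  and IF_supp: "f \<in> IF \<Longrightarrow> \<exists>C. supported Ar f C"
  by (simp_all add: IF_iff)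

lemma IF_mem: "\<lbrakk>f \<in> IF; x \<in> Ar\<rbrakk> \<Longrightarrow> f x \<in> carrier (fs x)"
  using IF_equiv equiv_on_mem by blast

lemma IF_asec: "f \<in> IF \<Longrightarrow> asec (gtop G) d f"
  using IF_equiv by (simp add: equiv_on_def)

lemma IF_act: "\<lbrakk>f \<in> IF; x \<in> Ar; h \<in> H; d x = r h\<rbrakk> \<Longrightarrow> f (x \<cdot> h) = act \<sigma> (iv h) (f x)"
  using IF_equiv equiv_on_act by blast

lemma equiv_on_cong:
  assumes "equiv_on Z f" "stable Z" "\<And>x. x \<in> Z \<Longrightarrow> f x = g x" shows "equiv_on Z g"
  unfolding equiv_on_def
proof (intro conjI ballI impI)
  show "asec (subtopology (gtop G) Z) d g"
    using assms(1,3) unfolding equiv_on_def by (auto elim: asec_cong)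
  show "g (x \<cdot> h) = act \<sigma> (iv h) (g x)" if "x \<in> Z" "h \<in> H" "d x = r h" for x h
    using equiv_on_act[OF assms(1) that] assms(3) stable_mult[OF assms(2) that] that by simp
qed

lemma equiv_on_add:
  assumes Z: "stable Z" and f: "equiv_on Z f" and g: "equiv_on Z g"
  shows "equiv_on Z (\<lambda>x. f x \<oplus>\<^bsub>fs x\<^esub> g x)"
  unfolding equiv_on_def
proof (intro conjI ballI impI)
  show "asec (subtopology (gtop G) Z) d (\<lambda>x. f x \<oplus>\<^bsub>fs x\<^esub> g x)"
    using f g by (simp add: equiv_on_def asec_add)
  fix x h assume x: "x \<in> Z" and h: "h \<in> H" "d x = r h"
  have xA: "x \<in> Ar" using x stable_sub[OF Z] by blast
  show "f (x \<cdot> h) \<oplus>\<^bsub>fs (x \<cdot> h)\<^esub> g (x \<cdot> h) = act \<sigma> (iv h) (f x \<oplus>\<^bsub>fs x\<^esub> g x)"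
    using act_add[of "iv h" "f x" "g x"] equiv_on_act[OF f x h] equiv_on_act[OF g x h]
      equiv_on_mem[OF f x xA] equiv_on_mem[OF g x xA] x xA h by simp
qed

lemma equiv_on_scale:
  assumes Z: "stable Z" and f: "equiv_on Z f" and a: "continuous_map Q euclidean (a :: 'g set \<Rightarrow> complex)"
  shows "equiv_on Z (\<lambda>x. a (co x) \<odot>\<^bsub>fs x\<^esub> f x)"
  unfolding equiv_on_def
proof (intro conjI ballI impI)
  have "continuous_map (subtopology (gtop G) Z) euclidean (\<lambda>x. a (co x))"
    using continuous_map_compose[OF cont_coset a] by (auto simp: o_def intro: continuous_map_from_subtopology)
  then show "asec (subtopology (gtop G) Z) d (\<lambda>x. a (co x) \<odot>\<^bsub>fs x\<^esub> f x)"
    using f by (simp add: equiv_on_def asec_smult)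
  fix x h assume x: "x \<in> Z" and h: "h \<in> H" "d x = r h"
  have xA: "x \<in> Ar" using x stable_sub[OF Z] by blast
  show "a (co (x \<cdot> h)) \<odot>\<^bsub>fs (x \<cdot> h)\<^esub> f (x \<cdot> h) = act \<sigma> (iv h) (a (co x) \<odot>\<^bsub>fs x\<^esub> f x)"
    using act_smult[of "iv h" "f x" "a (co x)"] equiv_on_act[OF f x h]
      equiv_on_mem[OF f x xA] x xA h by simp
qed

lemma equiv_on_minus:
  assumes Z: "stable Z" and f: "equiv_on Z f" and g: "equiv_on Z g"
  shows "equiv_on Z (\<lambda>x. f x \<ominus>\<^bsub>fs x\<^esub> g x)"
proof (rule equiv_on_cong[OF equiv_on_add[OF Z f equiv_on_scale[OF Z g, of "\<lambda>_. -1"]] Z])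
  show "f x \<oplus>\<^bsub>fs x\<^esub> (-1) \<odot>\<^bsub>fs x\<^esub> g x = f x \<ominus>\<^bsub>fs x\<^esub> g x" if x: "x \<in> Z" for x
  proof -
    have xA: "x \<in> Ar" using x stable_sub[OF Z] by blast
    show ?thesis using semi_inner.minus_eq_smult[OF fs_inner[OF xA]]
      equiv_on_mem[OF f x xA] equiv_on_mem[OF g x xA] by simp
  qed
qed simp

lemma IF_restrict:
  assumes "equiv_on Ar f" "supported Ar f C" shows "(\<lambda>x\<in>Ar. f x) \<in> IF"
  unfolding IF_iff
proof (intro conjI exI)
  show "equiv_on Ar (\<lambda>x\<in>Ar. f x)" using assms(1) by (rule equiv_on_cong[OF _ stable_Ar]) simp
  show "supported Ar (\<lambda>x\<in>Ar. f x) C" using assms(2) by (simp add: supported_def)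
qed simp

lemma supported_Un:
  assumes "supported Z f C" "supported Z g D" and Z: "Z \<subseteq> Ar"
  shows "supported Z (\<lambda>x. f x \<oplus>\<^bsub>fs x\<^esub> g x) (C \<union> D)" "supported Z (\<lambda>x. f x \<ominus>\<^bsub>fs x\<^esub> g x) (C \<union> D)"
proof -
  have "f x \<oplus>\<^bsub>fs x\<^esub> g x = \<zero>\<^bsub>fs x\<^esub>" "f x \<ominus>\<^bsub>fs x\<^esub> g x = \<zero>\<^bsub>fs x\<^esub>"
    if "x \<in> Z" "f x = \<zero>\<^bsub>fs x\<^esub>" "g x = \<zero>\<^bsub>fs x\<^esub>" for x
  proof -
    interpret F: semi_inner "fs x" using fs_inner Z that by blast
    interpret M: module complex_ring "fs x" by (rule F.mod)
    show "f x \<oplus>\<^bsub>fs x\<^esub> g x = \<zero>\<^bsub>fs x\<^esub>" "f x \<ominus>\<^bsub>fs x\<^esub> g x = \<zero>\<^bsub>fs x\<^esub>" using that F.minus_self[of "\<zero>\<^bsub>fs x\<^esub>"] by simp_all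
  qed
  moreover have "compactin Q (C \<union> D)" using assms by (simp add: supported_def compactin_Un)
  ultimately show "supported Z (\<lambda>x. f x \<oplus>\<^bsub>fs x\<^esub> g x) (C \<union> D)" "supported Z (\<lambda>x. f x \<ominus>\<^bsub>fs x\<^esub> g x) (C \<union> D)"
    using assms unfolding supported_def by (metis Un_iff)+
qed

lemma IF_add: "\<lbrakk>f \<in> IF; g \<in> IF\<rbrakk> \<Longrightarrow> (\<lambda>x\<in>Ar. f x \<oplus>\<^bsub>fs x\<^esub> g x) \<in> IF"
  and IF_minus: "\<lbrakk>f \<in> IF; g \<in> IF\<rbrakk> \<Longrightarrow> (\<lambda>x\<in>Ar. f x \<ominus>\<^bsub>fs x\<^esub> g x) \<in> IF"
proof -
  assume f: "f \<in> IF" and g: "g \<in> IF"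
  obtain C D where "supported Ar f C" "supported Ar g D" using IF_supp[OF f] IF_supp[OF g] by blast
  note s = supported_Un[OF this subset_refl]
  show "(\<lambda>x\<in>Ar. f x \<oplus>\<^bsub>fs x\<^esub> g x) \<in> IF"
    by (rule IF_restrict[OF equiv_on_add[OF stable_Ar IF_equiv[OF f] IF_equiv[OF g]] s(1)])
  show "(\<lambda>x\<in>Ar. f x \<ominus>\<^bsub>fs x\<^esub> g x) \<in> IF"
    by (rule IF_restrict[OF equiv_on_minus[OF stable_Ar IF_equiv[OF f] IF_equiv[OF g]] s(2)])
qed

lemma supported_scale:
  assumes "supported Z f C" "Z \<subseteq> Ar" shows "supported Z (\<lambda>x. a x \<odot>\<^bsub>fs x\<^esub> f x) C"
proof -
  have "a x \<odot>\<^bsub>fs x\<^esub> f x = \<zero>\<^bsub>fs x\<^esub>" if "x \<in> Z" "f x = \<zero>\<^bsub>fs x\<^esub>" for x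
    using that assms(2) semi_inner.smult_zero[OF fs_inner] by auto
  then show ?thesis using assms unfolding supported_def by metis
qed

lemma IF_scale:
  "\<lbrakk>f \<in> IF; continuous_map Q euclidean a\<rbrakk> \<Longrightarrow> (\<lambda>x\<in>Ar. a (co x) \<odot>\<^bsub>fs x\<^esub> f x) \<in> IF"
  using supported_scale[of Ar f _ "\<lambda>x. a (co x)"] equiv_on_scale[OF stable_Ar, of f a] IF_restrict IF_equiv IF_supp
  by blast

lemma IF_smult: "f \<in> IF \<Longrightarrow> (\<lambda>x\<in>Ar. z \<odot>\<^bsub>fs x\<^esub> f x) \<in> IF"
  using IF_scale[of f "\<lambda>_. z"] by simp

lemma IF_zero: "(\<lambda>x\<in>Ar. \<zero>\<^bsub>fs x\<^esub>) \<in> IF"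
proof (rule IF_restrict)
  show "supported Ar (\<lambda>x. \<zero>\<^bsub>fs x\<^esub>) {}" by (simp add: supported_def)
  have z: "act \<sigma> (iv h) \<zero>\<^bsub>fb (r h)\<^esub> = \<zero>\<^bsub>fs h\<^esub>" if "h \<in> H" for h
    using act_zero[OF H_inv[OF that]] that by simp
  have "asec (gtop G) d (\<lambda>x. \<zero>\<^bsub>fs x\<^esub>)"
  proof (rule asec_cong)
    show "asec (gtop G) d (\<lambda>x. (\<lambda>u\<in>topspace (unit_space G). \<zero>\<^bsub>fb u\<^esub>) (d x))"
    proof (rule asec_section[OF cont_src_unit])
      show "(\<lambda>u\<in>topspace (unit_space G). \<zero>\<^bsub>fb u\<^esub>) \<in> sections \<sigma>"
        using subgroup.one_closed[OF submodule.axioms(1)[OF section_submodule]] by (simp add: section_module_def)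
    qed
  qed auto
  then show "equiv_on Ar (\<lambda>x. \<zero>\<^bsub>fs x\<^esub>)"
    unfolding equiv_on_def using z by auto
qed

text \<open>
  Convexity of the norm, in the form in which approximants are glued. The combination is built by
  induction because \<open>\<A>\<close> is closed under sums of two functions and multiplication by functions on
  \<open>G/H\<close>.
\<close>

lemma weighted_combination:
  assumes "finite I" and A: "\<A> \<subseteq> IF" "(\<lambda>x\<in>Ar. \<zero>\<^bsub>fs x\<^esub>) \<in> \<A>"
    and add: "\<And>f g. \<lbrakk>f \<in> \<A>; g \<in> \<A>\<rbrakk> \<Longrightarrow> (\<lambda>x\<in>Ar. f x \<oplus>\<^bsub>fs x\<^esub> g x) \<in> \<A>"
    and scale: "\<And>f a. \<lbrakk>f \<in> \<A>; continuous_map Q euclidean a\<rbrakk> \<Longrightarrow> (\<lambda>x\<in>Ar. a (co x) \<odot>\<^bsub>fs x\<^esub> f x) \<in> \<A>"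
    and F: "\<And>i. i \<in> I \<Longrightarrow> F i \<in> \<A>"
    and p: "\<And>i. i \<in> I \<Longrightarrow> continuous_map Q euclidean (p i :: 'g set \<Rightarrow> real)" "\<And>i C. p i C \<ge> 0"
  shows "\<exists>f\<in>\<A>. \<forall>x\<in>Ar. \<forall>w\<in>carrier (fs x).
    nm (d x) (f x \<ominus>\<^bsub>fs x\<^esub> complex_of_real (\<Sum>i\<in>I. p i (co x)) \<odot>\<^bsub>fs x\<^esub> w) \<le> (\<Sum>i\<in>I. p i (co x) * nm (d x) (F i x \<ominus>\<^bsub>fs x\<^esub> w))"
  using assms(1) F p(1)
proof (induction I rule: finite_induct)
  case empty
  have "nm (d x) (\<zero>\<^bsub>fs x\<^esub> \<ominus>\<^bsub>fs x\<^esub> 0 \<odot>\<^bsub>fs x\<^esub> w) = 0" if "x \<in> Ar" "w \<in> carrier (fs x)" for x w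
  proof -
    interpret S: semi_inner "fs x" using fs_inner that by blast
    show ?thesis using that by (simp add: S.zero_smult S.norm_minus_self)
  qed
  then show ?case using A(2) by (intro bexI[OF _ A(2)]) auto
next
  case (insert j I)
  then obtain f where f: "f \<in> \<A>" and le: "\<And>x w. \<lbrakk>x \<in> Ar; w \<in> carrier (fs x)\<rbrakk> \<Longrightarrow>
      nm (d x) (f x \<ominus>\<^bsub>fs x\<^esub> complex_of_real (\<Sum>i\<in>I. p i (co x)) \<odot>\<^bsub>fs x\<^esub> w) \<le> (\<Sum>i\<in>I. p i (co x) * nm (d x) (F i x \<ominus>\<^bsub>fs x\<^esub> w))"
    by auto
  let ?a = "\<lambda>C. complex_of_real (p j C)"
  let ?Fj = "\<lambda>x\<in>Ar. ?a (co x) \<odot>\<^bsub>fs x\<^esub> F j x"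
  have Fj: "F j \<in> \<A>" using insert by simp
  have "continuous_map Q euclidean ?a"
    by (rule continuous_map_unop[where h = complex_of_real]) (use insert in \<open>auto intro!: continuous_intros\<close>)
  then have 1: "?Fj \<in> \<A>" using scale Fj by blast
  let ?f = "\<lambda>x\<in>Ar. ?Fj x \<oplus>\<^bsub>fs x\<^esub> f x"
  have "nm (d x) (?f x \<ominus>\<^bsub>fs x\<^esub> complex_of_real (\<Sum>i\<in>insert j I. p i (co x)) \<odot>\<^bsub>fs x\<^esub> w)
      \<le> (\<Sum>i\<in>insert j I. p i (co x) * nm (d x) (F i x \<ominus>\<^bsub>fs x\<^esub> w))" if x: "x \<in> Ar" and w: "w \<in> carrier (fs x)" for x w
  proof -
    interpret S: semi_inner "fs x" using fs_inner x by blast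
    interpret M: module complex_ring "fs x" by (rule S.mod)
    have fx: "f x \<in> carrier (fs x)" "F j x \<in> carrier (fs x)" using f Fj A(1) IF_mem x by blast+
    define s where "s = complex_of_real (\<Sum>i\<in>I. p i (co x))"
    define t where "t = complex_of_real (p j (co x))"
    have eq: "complex_of_real (\<Sum>i\<in>insert j I. p i (co x)) \<odot>\<^bsub>fs x\<^esub> w = t \<odot>\<^bsub>fs x\<^esub> w \<oplus>\<^bsub>fs x\<^esub> s \<odot>\<^bsub>fs x\<^esub> w"
      using insert(1,2) w M.smult_l_distr[of t s w] by (simp add: s_def t_def)
    have "nm (d x) ((t \<odot>\<^bsub>fs x\<^esub> F j x \<oplus>\<^bsub>fs x\<^esub> f x) \<ominus>\<^bsub>fs x\<^esub> (t \<odot>\<^bsub>fs x\<^esub> w \<oplus>\<^bsub>fs x\<^esub> s \<odot>\<^bsub>fs x\<^esub> w))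
      \<le> nm (d x) (t \<odot>\<^bsub>fs x\<^esub> F j x \<ominus>\<^bsub>fs x\<^esub> t \<odot>\<^bsub>fs x\<^esub> w) + nm (d x) (f x \<ominus>\<^bsub>fs x\<^esub> s \<odot>\<^bsub>fs x\<^esub> w)"
      using fx w by (intro S.norm_add_diff) auto
    also have "nm (d x) (t \<odot>\<^bsub>fs x\<^esub> F j x \<ominus>\<^bsub>fs x\<^esub> t \<odot>\<^bsub>fs x\<^esub> w) = p j (co x) * nm (d x) (F j x \<ominus>\<^bsub>fs x\<^esub> w)"
      using fx w p(2) by (simp add: S.norm_smult_diff t_def)
    finally show ?thesis using le[OF x w] insert(1,2) eq x by (simp add: s_def t_def)
  qed
  then show ?case using add[OF 1 f] by (intro bexI[of _ ?f]) auto
qed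

text \<open>
  Choose an approximant at each point of the support; it stays good on a neighbourhood in \<open>G/H\<close>,
  as the norms involved are functions on \<open>G/H\<close>; then glue by a partition of unity on \<open>G/H\<close>. The
  last clause, a norm bound that holds off \<open>Z\<close> as well, keeps the series in the extension theorem
  convergent everywhere.
\<close>

lemma uniform_approximation:
  assumes A: "\<A> \<subseteq> IF" "(\<lambda>x\<in>Ar. \<zero>\<^bsub>fs x\<^esub>) \<in> \<A>"
    and add: "\<And>f g. \<lbrakk>f \<in> \<A>; g \<in> \<A>\<rbrakk> \<Longrightarrow> (\<lambda>x\<in>Ar. f x \<oplus>\<^bsub>fs x\<^esub> g x) \<in> \<A>"
    and scale: "\<And>f a. \<lbrakk>f \<in> \<A>; continuous_map Q euclidean a\<rbrakk> \<Longrightarrow> (\<lambda>x\<in>Ar. a (co x) \<odot>\<^bsub>fs x\<^esub> f x) \<in> \<A>"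
    and dense: "\<And>x v e. \<lbrakk>x \<in> Ar; v \<in> carrier (fs x); e > 0\<rbrakk> \<Longrightarrow> \<exists>f\<in>\<A>. nm (d x) (f x \<ominus>\<^bsub>fs x\<^esub> v) < e"
    and Z: "stable Z" and g: "equiv_on Z g" and C: "supported Z g C" and V: "openin Q V" "C \<subseteq> V"
    and e: "e > 0"
  obtains f C' where "f \<in> \<A>" "\<And>z. z \<in> Z \<Longrightarrow> nm (d z) (f z \<ominus>\<^bsub>fs z\<^esub> g z) \<le> e"
    "supported Ar f C'" "C' \<subseteq> V"
    "0 \<le> c \<Longrightarrow> (\<And>z. z \<in> Z \<Longrightarrow> nm (d z) (g z) < c) \<Longrightarrow> (\<And>x. x \<in> Ar \<Longrightarrow> nm (d x) (f x) \<le> c)"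
proof -
  have Zs: "Z \<subseteq> Ar" by (rule stable_sub[OF Z])
  have Zc: "closedin (gtop G) Z" using Z by (simp add: stable_def)
  define bd where "bd \<longleftrightarrow> (\<forall>z\<in>Z. nm (d z) (g z) < c)"
  have "closedin Q (co ` Z)"
  proof -
    have "co ` Z = topspace Q - co ` (Ar - Z)"
    proof (intro equalityI subsetI)
      fix D assume "D \<in> co ` Z"
      then obtain z where z: "z \<in> Z" "D = co z" by blast
      have "D \<notin> co ` (Ar - Z)"
        using stable_coset_eq[OF Z z(1)] z(2) by blast
      then show "D \<in> topspace Q - co ` (Ar - Z)" using z Zs by (auto simp: topspace_coset_space)
    qed (auto simp: topspace_coset_space)
    moreover have "openin Q (co ` (Ar - Z))" using Zc by (intro coset_openI) blast
    ultimately show ?thesis by auto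
  qed
  moreover have Cc: "compactin Q C" using C by (simp add: supported_def)
  ultimately have D: "compactin Q (C \<inter> co ` Z)" (is "compactin Q ?D") by (rule compact_Int_closedin[rotated])
  \<comment> \<open>good approximants near each point\<close>
  have "\<exists>f\<in>\<A>. \<exists>O'. openin (gtop G) O' \<and> A \<in> co ` O' \<and> co ` O' \<subseteq> V \<and>
      (\<forall>y\<in>Ar. co y \<in> co ` O' \<longrightarrow> (y \<in> Z \<longrightarrow> nm (d y) (f y \<ominus>\<^bsub>fs y\<^esub> g y) < e) \<and> (bd \<longrightarrow> nm (d y) (f y) < c))"
    if AD: "A \<in> ?D" for A
  proof -
    obtain x where x: "x \<in> Z" "A = co x" and AC: "A \<in> C" using AD by blast
    have xA: "x \<in> Ar" using x Zs by blast
    interpret S: semi_inner "fs x" using fs_inner xA by blast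
    define e' where "e' = (if bd then min e (c - nm (d x) (g x)) else e)"
    have e': "e' > 0" "e' \<le> e" using e x by (auto simp: e'_def bd_def)
    obtain f where f: "f \<in> \<A>" "nm (d x) (f x \<ominus>\<^bsub>fs x\<^esub> g x) < e'"
      using dense[OF xA equiv_on_mem[OF g x(1) xA] e'(1)] by blast
    have fI: "f \<in> IF" using f A by blast
    have feq: "equiv_on Ar f" by (rule IF_equiv[OF fI])
    have feqZ: "equiv_on Z f" using feq Zs by (rule equiv_on_subset)
    let ?K = "{z \<in> topspace (subtopology (gtop G) Z). nm (d z) (f z \<ominus>\<^bsub>fs z\<^esub> g z) \<in> {e..}}"
    have "closedin (subtopology (gtop G) Z) ?K"
      by (rule closedin_continuous_map_preimage[OF asec_d_minus[OF feqZ g]]) auto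
    then have K: "closedin (gtop G) ?K" by (rule closedin_trans_full[OF _ Zc])
    let ?V = "{y \<in> Ar. co y \<in> V}"
    have V': "openin (gtop G) ?V" by (rule openin_continuous_map_preimage[OF cont_coset V(1)])
    let ?B = "{y \<in> Ar. nm (d y) (f y) \<in> {..<c}}"
    have B: "openin (gtop G) ?B"
      by (rule openin_continuous_map_preimage[OF asec_norm[OF IF_asec[OF fI]]]) auto
    define O' where "O' = ?V \<inter> (Ar - ?K) \<inter> (if bd then ?B else Ar)"
    have O1: "openin (gtop G) O'" unfolding O'_def using V' K B by (auto intro!: openin_Int)
    have "nm (d x) (f x) \<le> nm (d x) (f x \<ominus>\<^bsub>fs x\<^esub> g x) + nm (d x) (g x)"
      using IF_mem[OF fI xA] equiv_on_mem[OF g x(1) xA] by (rule S.norm_le_minus)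
    then have "bd \<Longrightarrow> nm (d x) (f x) < c" using f(2) by (simp add: e'_def)
    then have "x \<in> O'" using x xA AC V f(2) e' by (auto simp: O'_def)
    have main: "(y \<in> Z \<longrightarrow> nm (d y) (f y \<ominus>\<^bsub>fs y\<^esub> g y) < e) \<and> (bd \<longrightarrow> nm (d y) (f y) < c)"
      if y: "y \<in> Ar" and oy: "o' \<in> O'" "co y = co o'" for y o'
    proof (intro conjI impI)
      have oA: "o' \<in> Ar" using oy by (auto simp: O'_def)
      show "nm (d y) (f y \<ominus>\<^bsub>fs y\<^esub> g y) < e" if yZ: "y \<in> Z"
      proof -
        have "o' \<in> Z" by (rule stable_coset_eq[OF Z yZ oA oy(2)])
        then have "nm (d o') (f o' \<ominus>\<^bsub>fs o'\<^esub> g o') < e" using oy(1) oA by (auto simp: O'_def)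
        then show ?thesis using equiv_inner(2)[OF Z feqZ g yZ oA oy(2)] by simp
      qed
      show "nm (d y) (f y) < c" if bd
        using equiv_inner(3)[OF stable_Ar feq feq y oA oy(2)] oy(1) \<open>bd\<close> by (simp add: O'_def)
    qed
    have "co ` O' \<subseteq> V" by (auto simp: O'_def)
    moreover have "A \<in> co ` O'" using \<open>x \<in> O'\<close> x by blast
    ultimately show ?thesis using f(1) O1 main by (intro bexI[OF _ f(1)] exI[of _ O']) blast
  qed
  then obtain F Os where FO: "\<And>A. A \<in> ?D \<Longrightarrow> F A \<in> \<A> \<and> openin (gtop G) (Os A) \<and> A \<in> co ` Os A \<and> co ` Os A \<subseteq> V \<and>
      (\<forall>y\<in>Ar. co y \<in> co ` Os A \<longrightarrow> (y \<in> Z \<longrightarrow> nm (d y) (F A y \<ominus>\<^bsub>fs y\<^esub> g y) < e) \<and> (bd \<longrightarrow> nm (d y) (F A y) < c))"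
    by metis
  \<comment> \<open>partition of unity on the coset space\<close>
  have "\<exists>b S. continuous_map Q euclidean b \<and> (\<forall>B. b B \<ge> 0) \<and> b A = (1::real) \<and> compactin Q S \<and> S \<subseteq> co ` Os A \<and>
      (\<forall>B. b B \<noteq> 0 \<longrightarrow> B \<in> S)" if AD: "A \<in> ?D" for A
  proof -
    have "compactin Q {A}" using AD compactin_subset_topspace[OF D] by auto
    then show ?thesis
      using bump_function[OF lchs_coset_space, of "{A}" "co ` Os A"] FO[OF AD] coset_openI
      by (metis empty_subsetI insert_subset singletonI)
  qed
  then obtain b S where b: "\<And>A. A \<in> ?D \<Longrightarrow> continuous_map Q euclidean (b A) \<and> (\<forall>B. b A B \<ge> 0) \<and> b A A = (1::real) \<and>
      compactin Q (S A) \<and> S A \<subseteq> co ` Os A \<and> (\<forall>B. b A B \<noteq> 0 \<longrightarrow> B \<in> S A)" by metis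
  let ?W = "(\<lambda>A. {B \<in> topspace Q. b A B \<in> {1/2<..}}) ` ?D"
  have "openin Q W" if W: "W \<in> ?W" for W
  proof -
    obtain A where A: "A \<in> ?D" "W = {B \<in> topspace Q. b A B \<in> {1/2<..}}" using W by blast
    have "continuous_map Q euclidean (b A)" using b[OF A(1)] by blast
    then show ?thesis unfolding A(2) by (rule openin_continuous_map_preimage) auto
  qed
  moreover have "?D \<subseteq> \<Union>?W"
  proof
    fix A assume A: "A \<in> ?D"
    then have "b A A = 1" "A \<in> topspace Q" using b[OF A] compactin_subset_topspace[OF D] by blast+
    then have "A \<in> {B \<in> topspace Q. b A B \<in> {1/2<..}}" by simp
    then show "A \<in> \<Union>?W" using A by blast
  qed
  ultimately obtain \<W> where W: "finite \<W>" "\<W> \<subseteq> ?W" "?D \<subseteq> \<Union>\<W>" using compactinD[OF D, of ?W] by blast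
  then obtain I where I: "finite I" "I \<subseteq> ?D" "\<W> = (\<lambda>A. {B \<in> topspace Q. b A B \<in> {1/2<..}}) ` I"
    by (meson finite_subset_image)
  define s where "s B = (\<Sum>i\<in>I. b i B)" for B
  \<comment> \<open>the maximum avoids division by zero; on the compact set to be covered \<open>s > 1/2\<close>, so there the weights add up to one\<close>
  define p where "p i B = (if i \<in> I then b i B / max (s B) (1/2) else 0)" for i B
  have bI: "continuous_map Q euclidean (b i)" "b i B \<ge> 0" "compactin Q (S i)" if "i \<in> I" for i B
    using b[of i] I(2) that by blast+
  have FI: "F i \<in> \<A>" if "i \<in> I" for i using FO[of i] I(2) that by blast
  have sc: "continuous_map Q euclidean s"
    unfolding s_def using I(1) bI(1) by (intro continuous_map_sum) auto
  have pc: "continuous_map Q euclidean (p i)" if "i \<in> I" for i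
    unfolding p_def using that bI(1) sc by (auto intro!: continuous_map_real_divide continuous_map_real_max)
  have p0: "p i B \<ge> 0" for i B using bI(2) by (auto simp: p_def)
  have psum: "(\<Sum>i\<in>I. p i B) = s B / max (s B) (1/2)" for B
    by (simp add: p_def s_def sum_divide_distrib)
  have s0: "s B \<ge> 0" for B unfolding s_def using bI(2) by (intro sum_nonneg) auto
  have ps1: "(\<Sum>i\<in>I. p i B) \<le> 1" for B
    unfolding psum using s0[of B] by (simp add: divide_le_eq)
  have psD: "(\<Sum>i\<in>I. p i B) = 1" if B: "B \<in> ?D" for B
  proof -
    have "B \<in> (\<Union>i\<in>I. {B \<in> topspace Q. b i B \<in> {1/2<..}})" using B W(3) unfolding I(3) by blast
    then obtain i where i: "i \<in> I" "b i B > 1/2" by auto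
    have "b i B \<le> s B" unfolding s_def by (rule member_le_sum) (use i I(1) bI(2) in auto)
    then show ?thesis unfolding psum using i by simp
  qed
  have "\<exists>f\<in>\<A>. \<forall>x\<in>Ar. \<forall>w\<in>carrier (fs x).
    nm (d x) (f x \<ominus>\<^bsub>fs x\<^esub> complex_of_real (\<Sum>i\<in>I. p i (co x)) \<odot>\<^bsub>fs x\<^esub> w) \<le> (\<Sum>i\<in>I. p i (co x) * nm (d x) (F i x \<ominus>\<^bsub>fs x\<^esub> w))"
    using FI pc p0 by (intro weighted_combination[OF I(1) A add scale]) auto
  then obtain f where f: "f \<in> \<A>" and le: "\<And>x w. \<lbrakk>x \<in> Ar; w \<in> carrier (fs x)\<rbrakk> \<Longrightarrow>
    nm (d x) (f x \<ominus>\<^bsub>fs x\<^esub> complex_of_real (\<Sum>i\<in>I. p i (co x)) \<odot>\<^bsub>fs x\<^esub> w) \<le> (\<Sum>i\<in>I. p i (co x) * nm (d x) (F i x \<ominus>\<^bsub>fs x\<^esub> w))"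
    by blast
  have pS: "co x \<in> S i \<and> co x \<in> co ` Os i" if "i \<in> I" "p i (co x) \<noteq> 0" for i x
  proof -
    have "b i (co x) \<noteq> 0" using that by (auto simp: p_def)
    then show ?thesis using b[of i] that I(2) by blast
  qed
  have 1: "nm (d z) (f z \<ominus>\<^bsub>fs z\<^esub> g z) \<le> e" if z: "z \<in> Z" for z
  proof -
    have zA: "z \<in> Ar" using z Zs by blast
    interpret S: semi_inner "fs z" using fs_inner zA by blast
    interpret M: module complex_ring "fs z" by (rule S.mod)
    have gz: "g z \<in> carrier (fs z)" by (rule equiv_on_mem[OF g z zA])
    have "complex_of_real (\<Sum>i\<in>I. p i (co z)) \<odot>\<^bsub>fs z\<^esub> g z = g z"
    proof (cases "g z = \<zero>\<^bsub>fs z\<^esub>")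
      case True then show ?thesis by (simp add: S.smult_zero)
    next
      case False
      then have "co z \<in> ?D" using C z by (auto simp: supported_def)
      then show ?thesis using psD M.smult_one[OF gz] by simp
    qed
    then have "nm (d z) (f z \<ominus>\<^bsub>fs z\<^esub> g z) \<le> (\<Sum>i\<in>I. p i (co z) * nm (d z) (F i z \<ominus>\<^bsub>fs z\<^esub> g z))"
      using le[OF zA gz] by simp
    also have "\<dots> \<le> (\<Sum>i\<in>I. p i (co z) * e)"
    proof (rule sum_mono)
      fix i assume i: "i \<in> I"
      show "p i (co z) * nm (d z) (F i z \<ominus>\<^bsub>fs z\<^esub> g z) \<le> p i (co z) * e"
      proof (cases "p i (co z) = 0")
        case False
        then have "nm (d z) (F i z \<ominus>\<^bsub>fs z\<^esub> g z) < e" using pS[OF i False] FO[of i] i I(2) zA z by blast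
        then show ?thesis using p0 by (intro mult_left_mono) auto
      qed simp
    qed
    also have "\<dots> = (\<Sum>i\<in>I. p i (co z)) * e" by (simp add: sum_distrib_right)
    also have "\<dots> \<le> e" using ps1[of "co z"] e by (simp add: mult_left_le_one_le sum_nonneg p0)
    finally show ?thesis .
  qed
  have nf: "nm (d x) (f x) \<le> (\<Sum>i\<in>I. p i (co x) * nm (d x) (F i x))" if x: "x \<in> Ar" for x
  proof -
    interpret S: semi_inner "fs x" using fs_inner x by blast
    have m: "f x \<in> carrier (fs x)" "\<And>i. i \<in> I \<Longrightarrow> F i x \<in> carrier (fs x)"
      using IF_mem[OF subsetD[OF A(1) f] x] IF_mem[OF subsetD[OF A(1) FI] x] by blast+
    show ?thesis
      using le[OF x S.zero_closed] m by (simp add: S.smult_zero S.norm_minus_zero)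
  qed
  have 2: "supported Ar f (\<Union>i\<in>I. S i)"
    unfolding supported_def
  proof (intro conjI ballI impI)
    show "compactin Q (\<Union>i\<in>I. S i)" using I(1) bI(3) by (intro compactin_Union) auto
    fix x assume x: "x \<in> Ar" and nz: "f x \<noteq> \<zero>\<^bsub>fs x\<^esub>"
    show "co x \<in> (\<Union>i\<in>I. S i)"
    proof (rule ccontr)
      assume "co x \<notin> (\<Union>i\<in>I. S i)"
      then have "p i (co x) = 0" if "i \<in> I" for i using pS that by blast
      then have "nm (d x) (f x) \<le> 0" using nf[OF x] by simp
      moreover have fx: "f x \<in> carrier (fs x)" using f A IF_mem[OF _ x] by blast
      ultimately have "nm (d x) (f x) = 0" using semi_inner.norm_ge0[OF fs_inner[OF x] fx] by simp
      then show False using hilbert_norm_eq_0[OF fs_hilbert[OF x] fx] nz by simp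
    qed
  qed
  have "S i \<subseteq> V" if "i \<in> I" for i
  proof -
    have i: "i \<in> ?D" using that I(2) by blast
    have "S i \<subseteq> co ` Os i" using b[OF i] by blast
    moreover have "co ` Os i \<subseteq> V" using FO[OF i] by blast
    ultimately show ?thesis by (rule subset_trans)
  qed
  then have 3: "(\<Union>i\<in>I. S i) \<subseteq> V" by blast
  have 4: "nm (d x) (f x) \<le> c" if c: "0 \<le> c" and bnd: "\<And>z. z \<in> Z \<Longrightarrow> nm (d z) (g z) < c" and x: "x \<in> Ar" for x
  proof -
    have "bd" using bnd by (simp add: bd_def)
    have "(\<Sum>i\<in>I. p i (co x) * nm (d x) (F i x)) \<le> (\<Sum>i\<in>I. p i (co x) * c)"
    proof (rule sum_mono)
      fix i assume i: "i \<in> I"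
      show "p i (co x) * nm (d x) (F i x) \<le> p i (co x) * c"
      proof (cases "p i (co x) = 0")
        case False
        then have "nm (d x) (F i x) < c" using pS[OF i False] FO[of i] i I(2) x \<open>bd\<close> by blast
        then show ?thesis using p0 by (intro mult_left_mono) auto
      qed simp
    qed
    also have "\<dots> = (\<Sum>i\<in>I. p i (co x)) * c" by (simp add: sum_distrib_right)
    also have "\<dots> \<le> c" using ps1[of "co x"] c by (simp add: mult_left_le_one_le sum_nonneg p0)
    finally show ?thesis using nf[OF x] by simp
  qed
  show thesis by (rule that[OF f 1 2 3]) (use 4 in auto)
qed

end

section \<open>An equivariant Tietze theorem\<close>

lemma le_geometric_imp_le_0:
  fixes r :: real assumes "\<And>n. r \<le> c * (1/2) ^ n" shows "r \<le> 0"
proof (rule LIMSEQ_le_const)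
  have "(\<lambda>n. c * (1/2::real) ^ n) \<longlonglongrightarrow> c * 0" by (intro tendsto_intros LIMSEQ_realpow_zero) auto
  then show "(\<lambda>n. c * (1/2::real) ^ n) \<longlonglongrightarrow> 0" by simp
qed (use assms in auto)

lemma geometric_small: fixes e :: real assumes "e > 0" shows "\<exists>n. c * (1/2) ^ n < e"
  using le_geometric_imp_le_0[of e c] assms by (metis not_le)

lemma hilbert_eqI:
  assumes V: "is_hilbert_space V" and ab: "a \<in> carrier V" "b \<in> carrier V" and le: "hnorm V (a \<ominus>\<^bsub>V\<^esub> b) \<le> 0"
  shows "a = b"
proof -
  interpret V: semi_inner V by (rule hilbert_semi_inner[OF V])
  have "hnorm V (a \<ominus>\<^bsub>V\<^esub> b) = 0" using le V.norm_ge0[OF V.minus_closed[OF ab]] by simp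
  then have "a \<ominus>\<^bsub>V\<^esub> b = \<zero>\<^bsub>V\<^esub>" using hilbert_norm_eq_0[OF V] V.minus_closed[OF ab] by blast
  then show ?thesis using V.minus_eq_zeroD ab by blast
qed

locale equivariant_field = unitary_action +
  assumes IF_dense: "\<lbrakk>x \<in> Ar; v \<in> carrier (fs x); e > 0\<rbrakk> \<Longrightarrow> \<exists>f\<in>IF. nm (d x) (f x \<ominus>\<^bsub>fs x\<^esub> v) < e"
begin

lemma IF_approximation:
  assumes Z: "stable Z" and g: "equiv_on Z g" and C: "supported Z g C" and V: "openin Q V" "C \<subseteq> V"
    and e: "e > 0"
  obtains f C' where "f \<in> IF" "\<And>z. z \<in> Z \<Longrightarrow> nm (d z) (f z \<ominus>\<^bsub>fs z\<^esub> g z) \<le> e"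
    "supported Ar f C'" "C' \<subseteq> V"
    "0 \<le> c \<Longrightarrow> (\<And>z. z \<in> Z \<Longrightarrow> nm (d z) (g z) < c) \<Longrightarrow> (\<And>x. x \<in> Ar \<Longrightarrow> nm (d x) (f x) \<le> c)"
proof (rule uniform_approximation[where c = c, OF subset_refl IF_zero _ _ _ assms])
  fix f C'
  assume "f \<in> IF" "\<And>z. z \<in> Z \<Longrightarrow> nm (d z) (f z \<ominus>\<^bsub>fs z\<^esub> g z) \<le> e" "supported Ar f C'" "C' \<subseteq> V"
    "\<And>x. \<lbrakk>0 \<le> c; \<And>z. z \<in> Z \<Longrightarrow> nm (d z) (g z) < c; x \<in> Ar\<rbrakk> \<Longrightarrow> nm (d x) (f x) \<le> c"
  then show thesis by (rule that)
next
  show "(\<lambda>x\<in>Ar. f x \<oplus>\<^bsub>fs x\<^esub> g x) \<in> IF" if "f \<in> IF" "g \<in> IF" for f g using that by (rule IF_add)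
  show "(\<lambda>x\<in>Ar. a (co x) \<odot>\<^bsub>fs x\<^esub> f x) \<in> IF" if "f \<in> IF" "continuous_map Q euclidean a" for f a
    using that by (rule IF_scale)
  show "\<exists>f\<in>IF. nm (d x) (f x \<ominus>\<^bsub>fs x\<^esub> v) < e" if "x \<in> Ar" "v \<in> carrier (fs x)" "e > 0" for x v e
    using that by (rule IF_dense)
qed

text \<open>
  As in the proof of the Tietze theorem: successive approximation, each time of the remaining
  error with a bound of the same order, gives a uniformly convergent series. The supports stay in
  one compact set \<open>D\<close>.
\<close>

theorem equivariant_Tietze:
  assumes Z: "stable Z" and g: "equiv_on Z g" and C: "supported Z g C"
  obtains f where "f \<in> IF" "\<And>z. z \<in> Z \<Longrightarrow> f z = g z"
proof -
  have Zs: "Z \<subseteq> Ar" by (rule stable_sub[OF Z])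
  have Cc: "compactin Q C" using C by (simp add: supported_def)
  obtain V D where VD: "openin Q V" "compactin Q D" "C \<subseteq> V" "V \<subseteq> D" "D \<subseteq> topspace Q"
    by (rule compact_neighbourhood[OF lchs_coset_space Cc openin_topspace compactin_subset_topspace[OF Cc]])
  define P where "P n F \<longleftrightarrow> F \<in> IF \<and> (\<exists>C'. supported Ar F C' \<and> C' \<subseteq> V) \<and>
    (\<forall>z\<in>Z. nm (d z) (F z \<ominus>\<^bsub>fs z\<^esub> g z) \<le> (1/2) ^ n)" for n :: nat and F
  define R where "R n F F' \<longleftrightarrow> (\<forall>x\<in>Ar. nm (d x) (F' x \<ominus>\<^bsub>fs x\<^esub> F x) \<le> 2 * (1/2) ^ n)" for n :: nat and F F'
  note approx = IF_approximation[OF Z]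
  have "\<exists>F. P 0 F"
    by (rule approx[OF g C VD(1,3), of 1 0]) (auto simp: P_def)
  moreover have "\<exists>F'. P (Suc n) F' \<and> R n F F'" if F: "P n F" for n F
  proof -
    have FI: "F \<in> IF" using F by (simp add: P_def)
    obtain C' where C': "supported Ar F C'" "C' \<subseteq> V" using F by (auto simp: P_def)
    have FZ: "equiv_on Z F" using IF_equiv[OF FI] Zs by (rule equiv_on_subset)
    have C'Z: "supported Z F C'" using C'(1) Zs by (auto simp: supported_def)
    have small: "nm (d z) (g z \<ominus>\<^bsub>fs z\<^esub> F z) < 2 * (1/2) ^ n" if z: "z \<in> Z" for z
    proof -
      have zA: "z \<in> Ar" using z Zs by blast
      have "nm (d z) (g z \<ominus>\<^bsub>fs z\<^esub> F z) = nm (d z) (F z \<ominus>\<^bsub>fs z\<^esub> g z)"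
        using semi_inner.norm_minus_commute[OF fs_inner[OF zA] equiv_on_mem[OF g z zA] equiv_on_mem[OF FZ z zA]] .
      also have "\<dots> \<le> (1/2) ^ n" using F z by (simp add: P_def)
      finally show ?thesis by (rule le_less_trans) simp
    qed
    obtain f C'' where f: "f \<in> IF" "\<And>z. z \<in> Z \<Longrightarrow> nm (d z) (f z \<ominus>\<^bsub>fs z\<^esub> (g z \<ominus>\<^bsub>fs z\<^esub> F z)) \<le> (1/2) ^ Suc n"
      and C'': "supported Ar f C''" "C'' \<subseteq> V"
      and bound: "\<And>x. x \<in> Ar \<Longrightarrow> nm (d x) (f x) \<le> 2 * (1/2) ^ n"
      by (rule approx[OF equiv_on_minus[OF Z g FZ] supported_Un(2)[OF C C'Z Zs] VD(1), of "(1/2) ^ Suc n" "2 * (1/2) ^ n"])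
        (use VD C' small in auto)
    let ?F = "\<lambda>x\<in>Ar. F x \<oplus>\<^bsub>fs x\<^esub> f x"
    have "nm (d z) (?F z \<ominus>\<^bsub>fs z\<^esub> g z) \<le> (1/2) ^ Suc n" if z: "z \<in> Z" for z
    proof -
      have zA: "z \<in> Ar" using z Zs by blast
      interpret S: semi_inner "fs z" using fs_inner zA by blast
      have m: "F z \<in> carrier (fs z)" "f z \<in> carrier (fs z)" "g z \<in> carrier (fs z)"
        using FI f zA IF_mem equiv_on_mem[OF g z zA] by auto
      have "nm (d z) ((F z \<oplus>\<^bsub>fs z\<^esub> f z) \<ominus>\<^bsub>fs z\<^esub> g z) = nm (d z) (f z \<ominus>\<^bsub>fs z\<^esub> (g z \<ominus>\<^bsub>fs z\<^esub> F z))"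
        using m by (intro S.norm_cong) (simp add: S.inner_simps algebra_simps)
      then show ?thesis using f(2)[OF z] zA by simp
    qed
    moreover have "supported Ar ?F (C' \<union> C'')"
      using supported_Un(1)[OF C'(1) C''(1) subset_refl] by (simp add: supported_def)
    ultimately have "P (Suc n) ?F"
      using IF_add[OF FI f(1)] C'(2) C''(2) by (auto simp: P_def)
    moreover have "R n F ?F"
      unfolding R_def
    proof
      fix x assume x: "x \<in> Ar"
      interpret S: semi_inner "fs x" using fs_inner x by blast
      have "nm (d x) ((F x \<oplus>\<^bsub>fs x\<^esub> f x) \<ominus>\<^bsub>fs x\<^esub> F x) = nm (d x) (f x)"
        using IF_mem[OF FI x] IF_mem[OF f(1) x] by (intro S.norm_cong) (simp add: S.inner_simps algebra_simps)
      then show "nm (d x) (?F x \<ominus>\<^bsub>fs x\<^esub> F x) \<le> 2 * (1/2) ^ n" using bound[OF x] x by simp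
    qed
    ultimately show ?thesis by blast
  qed
  ultimately obtain F where F: "\<And>n. P n (F n)" "\<And>n. R n (F n) (F (Suc n))"
    using dependent_nat_choice[of P R] by blast
  have FI: "F n \<in> IF" for n using F(1) by (simp add: P_def)
  have "\<exists>a. a \<in> carrier (fs x) \<and> (\<forall>n. nm (d x) (F n x \<ominus>\<^bsub>fs x\<^esub> a) \<le> 4 * (1/2) ^ n)" if x: "x \<in> Ar" for x
    by (rule hilbert_geometric_limit[OF fs_hilbert[OF x], of "\<lambda>n. F n x" 2])
      (use IF_mem[OF FI x] F(2) x in \<open>auto simp: R_def\<close>)
  then obtain L where L: "\<And>x. x \<in> Ar \<Longrightarrow> L x \<in> carrier (fs x)"
    and lim: "\<And>x n. x \<in> Ar \<Longrightarrow> nm (d x) (F n x \<ominus>\<^bsub>fs x\<^esub> L x) \<le> 4 * (1/2) ^ n" by metis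
  have lim': "nm (d x) (L x \<ominus>\<^bsub>fs x\<^esub> F n x) \<le> 4 * (1/2) ^ n" if x: "x \<in> Ar" for x n
    using lim[OF x, of n] semi_inner.norm_minus_commute[OF fs_inner[OF x] L[OF x] IF_mem[OF FI[of n] x]] by simp
  have "equiv_on Ar L"
    unfolding equiv_on_def subtopology_topspace
  proof (intro conjI ballI impI)
    show "asec (gtop G) d L"
    proof (rule asec_limit[OF cont_src_unit L])
      fix x0 and e :: real assume "x0 \<in> Ar" "e > 0"
      then obtain n where "4 * (1/2) ^ n < e" using geometric_small by blast
      then have "\<forall>x\<in>Ar. nm (d x) (L x \<ominus>\<^bsub>fs x\<^esub> F n x) < e" using lim' le_less_trans by blast
      then show "\<exists>g U. asec (gtop G) d g \<and> openin (gtop G) U \<and> x0 \<in> U \<and>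
          (\<forall>x\<in>U. nm (d x) (L x \<ominus>\<^bsub>fs x\<^esub> g x) < e)"
        using IF_asec[OF FI[of n]] \<open>x0 \<in> Ar\<close> by (intro exI[of _ "F n"] exI[of _ Ar]) auto
    qed
    fix x h assume x: "x \<in> Ar" and h: "h \<in> H" "d x = r h"
    have y: "x \<cdot> h \<in> Ar" "d (x \<cdot> h) = d h" using x h by auto
    interpret S: semi_inner "fs h" using fs_inner h by simp
    have ih: "iv h \<in> H" using h by simp
    have c: "L x \<in> carrier (fs (iv h))" "F n x \<in> carrier (fs (iv h))" for n
      using L[OF x] IF_mem[OF FI x] h by simp_all
    have ca: "act \<sigma> (iv h) (L x) \<in> carrier (fs h)" "act \<sigma> (iv h) (F n x) \<in> carrier (fs h)" for n
      using act_closed[OF ih c(1)] act_closed[OF ih c(2)] h by simp_all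
    show "L (x \<cdot> h) = act \<sigma> (iv h) (L x)"
    proof (rule hilbert_eqI[OF fs_hilbert[OF H_arrow[OF h(1)]] _ ca(1)])
      show Lc: "L (x \<cdot> h) \<in> carrier (fs h)" using L[OF y(1)] y(2) by simp
      have "nm (d h) (L (x \<cdot> h) \<ominus>\<^bsub>fs h\<^esub> act \<sigma> (iv h) (L x)) \<le> 8 * (1/2) ^ n" for n
      proof -
        have "nm (d h) (L (x \<cdot> h) \<ominus>\<^bsub>fs h\<^esub> act \<sigma> (iv h) (L x)) \<le>
          nm (d h) (L (x \<cdot> h) \<ominus>\<^bsub>fs h\<^esub> F n (x \<cdot> h)) + nm (d h) (F n (x \<cdot> h) \<ominus>\<^bsub>fs h\<^esub> act \<sigma> (iv h) (L x))"
          using Lc ca IF_mem[OF FI y(1), of n] y(2) by (intro S.norm_triangle_minus) auto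
        moreover have "nm (d h) (L (x \<cdot> h) \<ominus>\<^bsub>fs h\<^esub> F n (x \<cdot> h)) \<le> 4 * (1/2) ^ n"
          using lim'[OF y(1), of n] y(2) by simp
        moreover have "nm (d h) (F n (x \<cdot> h) \<ominus>\<^bsub>fs h\<^esub> act \<sigma> (iv h) (L x)) = nm (d x) (F n x \<ominus>\<^bsub>fs x\<^esub> L x)"
          using act_norm[OF ih semi_inner.minus_closed[OF fs_inner c(2)[of n] c(1)]] act_minus[OF ih c(2)[of n] c(1)]
            IF_act[OF FI x h, of n] h by simp
        ultimately show ?thesis using lim[OF x, of n] by simp
      qed
      then show "nm (d h) (L (x \<cdot> h) \<ominus>\<^bsub>fs h\<^esub> act \<sigma> (iv h) (L x)) \<le> 0" by (rule le_geometric_imp_le_0)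
    qed
  qed
  moreover have "supported Ar L D"
    unfolding supported_def
  proof (intro conjI ballI impI VD(2))
    fix x assume x: "x \<in> Ar" and nz: "L x \<noteq> \<zero>\<^bsub>fs x\<^esub>"
    show "co x \<in> D"
    proof (rule ccontr)
      assume "co x \<notin> D"
      interpret S: semi_inner "fs x" using fs_inner x by blast
      have "F n x = \<zero>\<^bsub>fs x\<^esub>" for n
      proof -
        obtain C' where "supported Ar (F n) C'" "C' \<subseteq> V" using F(1)[of n] by (auto simp: P_def)
        then show ?thesis using VD \<open>co x \<notin> D\<close> x by (auto simp: supported_def)
      qed
      then have "nm (d x) (L x \<ominus>\<^bsub>fs x\<^esub> \<zero>\<^bsub>fs x\<^esub>) \<le> 4 * (1/2) ^ n" for n using lim'[OF x, of n] by simp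
      then have "nm (d x) (L x \<ominus>\<^bsub>fs x\<^esub> \<zero>\<^bsub>fs x\<^esub>) \<le> 0" by (rule le_geometric_imp_le_0)
      then show False using hilbert_eqI[OF fs_hilbert[OF x] L[OF x] S.zero_closed] nz by blast
    qed
  qed
  ultimately have "(\<lambda>x\<in>Ar. L x) \<in> IF" by (rule IF_restrict)
  moreover have "(\<lambda>x\<in>Ar. L x) z = g z" if z: "z \<in> Z" for z
  proof -
    have zA: "z \<in> Ar" using z Zs by blast
    interpret S: semi_inner "fs z" using fs_inner zA by blast
    have gz: "g z \<in> carrier (fs z)" by (rule equiv_on_mem[OF g z zA])
    have "nm (d z) (L z \<ominus>\<^bsub>fs z\<^esub> g z) \<le> 5 * (1/2) ^ n" for n
    proof -
      have "nm (d z) (L z \<ominus>\<^bsub>fs z\<^esub> g z) \<le> nm (d z) (L z \<ominus>\<^bsub>fs z\<^esub> F n z) + nm (d z) (F n z \<ominus>\<^bsub>fs z\<^esub> g z)"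
        using L[OF zA] IF_mem[OF FI zA] gz by (rule S.norm_triangle_minus)
      moreover have "nm (d z) (F n z \<ominus>\<^bsub>fs z\<^esub> g z) \<le> (1/2) ^ n" using F(1)[of n] z by (simp add: P_def)
      ultimately show ?thesis using lim'[OF zA, of n] by simp
    qed
    then have "nm (d z) (L z \<ominus>\<^bsub>fs z\<^esub> g z) \<le> 0" by (rule le_geometric_imp_le_0)
    then show ?thesis using hilbert_eqI[OF fs_hilbert[OF zA] L[OF zA] gz] zA by simp
  qed
  ultimately show ?thesis by (rule that)
qed

end

section \<open>The induced representation\<close>

lemma luc_mono:
  assumes S: "S \<subseteq> S'" shows "locally_uniform_closure B V S \<subseteq> locally_uniform_closure B V S'"
proof
  fix \<xi> assume \<xi>: "\<xi> \<in> locally_uniform_closure B V S"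
  have "\<exists>\<eta>\<in>S'. \<exists>U. openin B U \<and> v \<in> U \<and> (\<forall>u\<in>U. hnorm (V u) (\<xi> u \<ominus>\<^bsub>V u\<^esub> \<eta> u) < e)"
    if v: "v \<in> topspace B" "e > 0" for v e
  proof -
    obtain \<eta> where "\<eta> \<in> S" "\<exists>U. openin B U \<and> v \<in> U \<and> (\<forall>u\<in>U. hnorm (V u) (\<xi> u \<ominus>\<^bsub>V u\<^esub> \<eta> u) < e)"
      using \<xi> v unfolding locally_uniform_closure_def by blast
    then show ?thesis using S by blast
  qed
  then show "\<xi> \<in> locally_uniform_closure B V S'"
    using \<xi> unfolding locally_uniform_closure_def by blast
qed

lemma pointwise_module:
  fixes M :: "(complex, 'x \<Rightarrow> 'h, 'm) module_scheme" and V :: "'x \<Rightarrow> 'h prehilbert"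
  assumes V: "\<And>x. x \<in> D \<Longrightarrow> Module.module complex_ring (V x)"
    and S: "S \<subseteq> (\<Pi>\<^sub>E x \<in> D. carrier (V x))"
    and ops: "carrier M = S" "zero M = (\<lambda>x \<in> D. \<zero>\<^bsub>V x\<^esub>)"
      "add M = (\<lambda>f g. \<lambda>x \<in> D. f x \<oplus>\<^bsub>V x\<^esub> g x)" "module.smult M = (\<lambda>z f. \<lambda>x \<in> D. z \<odot>\<^bsub>V x\<^esub> f x)"
    and zero: "(\<lambda>x \<in> D. \<zero>\<^bsub>V x\<^esub>) \<in> S"
    and add: "\<And>f g. \<lbrakk>f \<in> S; g \<in> S\<rbrakk> \<Longrightarrow> (\<lambda>x \<in> D. f x \<oplus>\<^bsub>V x\<^esub> g x) \<in> S"
    and smult: "\<And>f z. f \<in> S \<Longrightarrow> (\<lambda>x \<in> D. z \<odot>\<^bsub>V x\<^esub> f x) \<in> S"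
  shows "Module.module complex_ring M"
proof -
  have mem: "f x \<in> carrier (V x)" if "f \<in> S" "x \<in> D" for f x using that S by blast
  have res: "restrict f D = f" if "f \<in> S" for f using that S by (auto intro: PiE_restrict)
  have ab: "abelian_group (V x)" if "x \<in> D" for x using V[OF that] by (simp add: module_def)
  note a = abelian_monoid.a_comm[OF abelian_group.axioms(1)[OF ab]] abelian_monoid.a_assoc[OF abelian_group.axioms(1)[OF ab]]
    abelian_monoid.l_zero[OF abelian_group.axioms(1)[OF ab]]
  note m = module.smult_l_distr[OF V] module.smult_r_distr[OF V] module.smult_assoc1[OF V] module.smult_one[OF V]
  show ?thesis
  proof (rule moduleI[OF cring_complex_ring])
    show "abelian_group M"
    proof (rule abelian_groupI)
      fix f g h assume f: "f \<in> carrier M" and g: "g \<in> carrier M"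
      show "f \<oplus>\<^bsub>M\<^esub> g \<in> carrier M" using f g ops add by simp
      show "f \<oplus>\<^bsub>M\<^esub> g = g \<oplus>\<^bsub>M\<^esub> f" using f g ops mem a by (auto intro!: restrict_ext)
      assume h: "h \<in> carrier M"
      show "f \<oplus>\<^bsub>M\<^esub> g \<oplus>\<^bsub>M\<^esub> h = f \<oplus>\<^bsub>M\<^esub> (g \<oplus>\<^bsub>M\<^esub> h)" using f g h ops mem a by (auto intro!: restrict_ext)
    next
      show "\<zero>\<^bsub>M\<^esub> \<in> carrier M" using ops zero by simp
    next
      fix f assume f: "f \<in> carrier M"
      have "\<zero>\<^bsub>M\<^esub> \<oplus>\<^bsub>M\<^esub> f = restrict f D" unfolding ops(2,3) using f ops(1) mem a by (intro restrict_ext) simp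
      then show "\<zero>\<^bsub>M\<^esub> \<oplus>\<^bsub>M\<^esub> f = f" using f ops(1) res by simp
      let ?g = "\<lambda>x\<in>D. (-1) \<odot>\<^bsub>V x\<^esub> f x"
      have "?g \<oplus>\<^bsub>M\<^esub> f = \<zero>\<^bsub>M\<^esub>"
        unfolding ops(2,3)
      proof (rule restrict_ext)
        fix x assume x: "x \<in> D"
        interpret X: module complex_ring "V x" by (rule V[OF x])
        have fx: "f x \<in> carrier (V x)" using f ops(1) mem x by simp
        show "?g x \<oplus>\<^bsub>V x\<^esub> f x = \<zero>\<^bsub>V x\<^esub>"
          using X.smult_l_minus[of 1 "f x"] X.smult_one[OF fx] fx x by (simp add: X.M.l_neg)
      qed
      moreover have "?g \<in> carrier M" using f ops(1) smult by simp
      ultimately show "\<exists>y\<in>carrier M. y \<oplus>\<^bsub>M\<^esub> f = \<zero>\<^bsub>M\<^esub>" by blast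
    qed
  next
    fix z w f g assume f: "f \<in> carrier M"
    show "z \<odot>\<^bsub>M\<^esub> f \<in> carrier M" using f ops smult by simp
    show "(z \<oplus>\<^bsub>complex_ring\<^esub> w) \<odot>\<^bsub>M\<^esub> f = z \<odot>\<^bsub>M\<^esub> f \<oplus>\<^bsub>M\<^esub> w \<odot>\<^bsub>M\<^esub> f"
      unfolding ops(3,4) using f ops(1) mem m(1) by (intro restrict_ext) simp
    show "(z \<otimes>\<^bsub>complex_ring\<^esub> w) \<odot>\<^bsub>M\<^esub> f = z \<odot>\<^bsub>M\<^esub> (w \<odot>\<^bsub>M\<^esub> f)"
      unfolding ops(3,4) using f ops(1) mem m(3) by (intro restrict_ext) simp
    have "\<one>\<^bsub>complex_ring\<^esub> \<odot>\<^bsub>M\<^esub> f = restrict f D"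
      unfolding ops(4) using f ops(1) mem m(4) by (intro restrict_ext) simp
    then show "\<one>\<^bsub>complex_ring\<^esub> \<odot>\<^bsub>M\<^esub> f = f" using f ops(1) res by simp
    assume g: "g \<in> carrier M"
    show "z \<odot>\<^bsub>M\<^esub> (f \<oplus>\<^bsub>M\<^esub> g) = z \<odot>\<^bsub>M\<^esub> f \<oplus>\<^bsub>M\<^esub> z \<odot>\<^bsub>M\<^esub> g"
      unfolding ops(3,4) using f g ops(1) mem m(2) by (intro restrict_ext) simp
  qed
qed

text \<open>
  The generating sections are approximants of all others, so each condition passes to the locally
  uniform closure by the triangle inequality.
\<close>

lemma generated_bundle:
  fixes E :: "('b, 'h, 'm) hilbert_bundle_scheme"
  assumes hil: "\<And>u. u \<in> topspace B \<Longrightarrow> is_hilbert_space (fibre E u)"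
    and S: "S \<subseteq> (\<Pi>\<^sub>E u \<in> topspace B. carrier (fibre E u))" and ne: "S \<noteq> {}"
    and add: "\<And>f g. \<lbrakk>f \<in> S; g \<in> S\<rbrakk> \<Longrightarrow> (\<lambda>u \<in> topspace B. f u \<oplus>\<^bsub>fibre E u\<^esub> g u) \<in> S"
    and smult: "\<And>f z. f \<in> S \<Longrightarrow> (\<lambda>u \<in> topspace B. z \<odot>\<^bsub>fibre E u\<^esub> f u) \<in> S"
    and norm: "\<And>f. f \<in> S \<Longrightarrow> continuous_map B euclidean (\<lambda>u. hnorm (fibre E u) (f u))"
    and dense: "\<And>u h e. \<lbrakk>u \<in> topspace B; h \<in> carrier (fibre E u); e > 0\<rbrakk> \<Longrightarrow>
      \<exists>f\<in>S. hnorm (fibre E u) (h \<ominus>\<^bsub>fibre E u\<^esub> f u) < e"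
    and sec: "sections E = locally_uniform_closure B (fibre E) S"
  shows "continuous_hilbert_bundle B E"
proof -
  let ?V = "fibre E" and ?T = "topspace B"
  let ?P = "\<Pi>\<^sub>E u \<in> topspace B. carrier (fibre E u)"
  have si: "semi_inner (?V u)" if "u \<in> ?T" for u using hil[OF that] by (rule hilbert_semi_inner)
  have Sm: "f u \<in> carrier (?V u)" if "f \<in> S" "u \<in> ?T" for f u using that S by blast
  have secP: "\<xi> \<in> ?P" if "\<xi> \<in> sections E" for \<xi> using that by (simp add: sec locally_uniform_closure_def)
  have secm: "\<xi> u \<in> carrier (?V u)" if "\<xi> \<in> sections E" "u \<in> ?T" for \<xi> u using secP[OF that(1)] that(2) by blast
  have app: "\<exists>\<eta>\<in>S. \<exists>U. openin B U \<and> v \<in> U \<and> (\<forall>u\<in>U. hnorm (?V u) (\<xi> u \<ominus>\<^bsub>?V u\<^esub> \<eta> u) < e)"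
    if "\<xi> \<in> sections E" "v \<in> ?T" "e > 0" for \<xi> v e
    using that unfolding sec locally_uniform_closure_def by blast
  have secI: "\<xi> \<in> sections E" if "\<xi> \<in> ?P" "\<And>v e. \<lbrakk>v \<in> ?T; e > 0\<rbrakk> \<Longrightarrow> \<exists>\<eta>\<in>S. \<exists>U. openin B U \<and> v \<in> U \<and>
      (\<forall>u\<in>U. hnorm (?V u) (\<xi> u \<ominus>\<^bsub>?V u\<^esub> \<eta> u) < e)" for \<xi>
    using that unfolding sec locally_uniform_closure_def by blast
  have Ssec: "S \<subseteq> sections E"
  proof
    fix f assume f: "f \<in> S"
    show "f \<in> sections E"
    proof (rule secI)
      show "f \<in> ?P" using f S by blast
      show "\<exists>\<eta>\<in>S. \<exists>U. openin B U \<and> v \<in> U \<and> (\<forall>u\<in>U. hnorm (?V u) (f u \<ominus>\<^bsub>?V u\<^esub> \<eta> u) < e)"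
        if "v \<in> ?T" "e > 0" for v e
        using f that Sm[OF f] by (intro bexI[of _ f] exI[of _ ?T]) (auto simp: semi_inner.norm_minus_self[OF si])
    qed
  qed
  have add': "(\<lambda>u \<in> ?T. \<xi> u \<oplus>\<^bsub>?V u\<^esub> \<eta> u) \<in> sections E" if \<xi>: "\<xi> \<in> sections E" and \<eta>: "\<eta> \<in> sections E" for \<xi> \<eta>
  proof (rule secI)
    show "(\<lambda>u \<in> ?T. \<xi> u \<oplus>\<^bsub>?V u\<^esub> \<eta> u) \<in> ?P"
      using \<xi> \<eta> by (simp add: PiE_iff semi_inner.add_closed[OF si] secm)
    fix v and e :: real assume v: "v \<in> ?T" and e: "e > 0"
    obtain f U where f: "f \<in> S" "openin B U" "v \<in> U" "\<And>u. u \<in> U \<Longrightarrow> hnorm (?V u) (\<xi> u \<ominus>\<^bsub>?V u\<^esub> f u) < e / 2"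
      using app[OF \<xi> v, of "e/2"] e by auto
    obtain g W where g: "g \<in> S" "openin B W" "v \<in> W" "\<And>u. u \<in> W \<Longrightarrow> hnorm (?V u) (\<eta> u \<ominus>\<^bsub>?V u\<^esub> g u) < e / 2"
      using app[OF \<eta> v, of "e/2"] e by auto
    have "hnorm (?V u) ((\<lambda>u \<in> ?T. \<xi> u \<oplus>\<^bsub>?V u\<^esub> \<eta> u) u \<ominus>\<^bsub>?V u\<^esub> (\<lambda>u \<in> ?T. f u \<oplus>\<^bsub>?V u\<^esub> g u) u) < e" if u: "u \<in> U \<inter> W" for u
    proof -
      have uT: "u \<in> ?T" using u f(2) openin_subset by blast
      show ?thesis
        using semi_inner.norm_add_diff[OF si[OF uT] secm[OF \<xi> uT] secm[OF \<eta> uT] Sm[OF f(1) uT] Sm[OF g(1) uT]]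
          f(4)[of u] g(4)[of u] u uT by simp
    qed
    then show "\<exists>\<zeta>\<in>S. \<exists>U. openin B U \<and> v \<in> U \<and> (\<forall>u\<in>U. hnorm (?V u) ((\<lambda>u \<in> ?T. \<xi> u \<oplus>\<^bsub>?V u\<^esub> \<eta> u) u \<ominus>\<^bsub>?V u\<^esub> \<zeta> u) < e)"
      using f g add[OF f(1) g(1)] by (intro bexI[of _ "\<lambda>u \<in> ?T. f u \<oplus>\<^bsub>?V u\<^esub> g u"] exI[of _ "U \<inter> W"]) auto
  qed
  have smult': "(\<lambda>u \<in> ?T. z \<odot>\<^bsub>?V u\<^esub> \<xi> u) \<in> sections E" if \<xi>: "\<xi> \<in> sections E" for \<xi> z
  proof (rule secI)
    show "(\<lambda>u \<in> ?T. z \<odot>\<^bsub>?V u\<^esub> \<xi> u) \<in> ?P"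
      using \<xi> by (simp add: PiE_iff semi_inner.smult_closed[OF si] secm)
    fix v and e :: real assume v: "v \<in> ?T" and e: "e > 0"
    have p: "cmod z + 1 > 0" by (simp add: add_nonneg_pos)
    obtain f U where f: "f \<in> S" "openin B U" "v \<in> U" "\<And>u. u \<in> U \<Longrightarrow> hnorm (?V u) (\<xi> u \<ominus>\<^bsub>?V u\<^esub> f u) < e / (cmod z + 1)"
      using app[OF \<xi> v, of "e/(cmod z + 1)"] e p by auto
    have "hnorm (?V u) ((\<lambda>u \<in> ?T. z \<odot>\<^bsub>?V u\<^esub> \<xi> u) u \<ominus>\<^bsub>?V u\<^esub> (\<lambda>u \<in> ?T. z \<odot>\<^bsub>?V u\<^esub> f u) u) < e" if u: "u \<in> U" for u
    proof -
      have uT: "u \<in> ?T" using u f(2) openin_subset by blast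
      interpret S: semi_inner "?V u" by (rule si[OF uT])
      have m: "\<xi> u \<in> carrier (?V u)" "f u \<in> carrier (?V u)" using secm[OF \<xi> uT] Sm[OF f(1) uT] .
      have "(cmod z + 1) * hnorm (?V u) (\<xi> u \<ominus>\<^bsub>?V u\<^esub> f u) < e"
        using f(4)[OF u] p by (simp add: pos_less_divide_eq mult.commute)
      moreover have "cmod z * hnorm (?V u) (\<xi> u \<ominus>\<^bsub>?V u\<^esub> f u) \<le> (cmod z + 1) * hnorm (?V u) (\<xi> u \<ominus>\<^bsub>?V u\<^esub> f u)"
        by (rule mult_right_mono) (use S.norm_ge0[OF S.minus_closed[OF m]] in auto)
      ultimately show ?thesis using uT by (simp add: S.norm_smult_diff[OF m])
    qed
    then show "\<exists>\<zeta>\<in>S. \<exists>U. openin B U \<and> v \<in> U \<and> (\<forall>u\<in>U. hnorm (?V u) ((\<lambda>u \<in> ?T. z \<odot>\<^bsub>?V u\<^esub> \<xi> u) u \<ominus>\<^bsub>?V u\<^esub> \<zeta> u) < e)"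
      using f smult[OF f(1)] by (intro bexI[of _ "\<lambda>u \<in> ?T. z \<odot>\<^bsub>?V u\<^esub> f u"] exI[of _ U]) auto
  qed
  obtain f0 where f0: "f0 \<in> S" using ne by blast
  have zeq: "(\<lambda>u \<in> ?T. 0 \<odot>\<^bsub>?V u\<^esub> f0 u) = (\<lambda>u \<in> ?T. \<zero>\<^bsub>?V u\<^esub>)"
    by (intro restrict_ext) (simp add: semi_inner.zero_smult[OF si] Sm[OF f0])
  have zero': "(\<lambda>u \<in> ?T. \<zero>\<^bsub>?V u\<^esub>) \<in> sections E"
    using smult'[of f0 0] f0 Ssec unfolding zeq by blast
  have mP: "Module.module complex_ring (section_module ?T ?V ?P)"
    by (rule pointwise_module[of ?T ?V ?P])
      (auto simp: section_module_def semi_inner.mod[OF si] semi_inner.zero_closed[OF si]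
        intro!: semi_inner.add_closed[OF si] semi_inner.smult_closed[OF si])
  interpret MP: module complex_ring "section_module ?T ?V ?P" by (rule mP)
  have sub: "submodule (sections E) complex_ring (section_module ?T ?V ?P)"
  proof (rule MP.submoduleI)
    show "sections E \<subseteq> carrier (section_module ?T ?V ?P)" using secP by (auto simp: section_module_def)
    fix \<xi> assume \<xi>: "\<xi> \<in> sections E"
    then have c: "\<xi> \<in> carrier (section_module ?T ?V ?P)" using secP by (auto simp: section_module_def)
    have "\<ominus>\<^bsub>section_module ?T ?V ?P\<^esub> \<xi> = (-1) \<odot>\<^bsub>section_module ?T ?V ?P\<^esub> \<xi>"
      using MP.smult_l_minus[of 1 \<xi>] MP.smult_one[OF c] c by simp
    then show "\<ominus>\<^bsub>section_module ?T ?V ?P\<^esub> \<xi> \<in> sections E" using smult'[OF \<xi>, of "-1"] by (simp add: section_module_def)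
  qed (use zero' add' smult' in \<open>auto simp: section_module_def\<close>)
  have nc: "continuous_map B euclidean (\<lambda>u. hnorm (?V u) (\<xi> u))" if \<xi>: "\<xi> \<in> sections E" for \<xi>
    unfolding continuous_map_euclidean_iff
  proof (intro ballI allI impI)
    fix v and e :: real assume v: "v \<in> ?T" and e: "e > 0"
    obtain f U where f: "f \<in> S" "openin B U" "v \<in> U" "\<And>u. u \<in> U \<Longrightarrow> hnorm (?V u) (\<xi> u \<ominus>\<^bsub>?V u\<^esub> f u) < e / 3"
      using app[OF \<xi> v, of "e/3"] e by auto
    obtain W where W: "openin B W" "v \<in> W" "\<And>u. u \<in> W \<Longrightarrow> dist (hnorm (?V v) (f v)) (hnorm (?V u) (f u)) < e / 3"
      using continuous_map_nbhd[OF norm[OF f(1)] v, of "e/3"] e by auto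
    have d: "\<bar>hnorm (?V u) (\<xi> u) - hnorm (?V u) (f u)\<bar> < e / 3" if u: "u \<in> U" for u
    proof -
      have uT: "u \<in> ?T" using u f(2) openin_subset by blast
      show ?thesis using semi_inner.norm_diff_le[OF si[OF uT] secm[OF \<xi> uT] Sm[OF f(1) uT]] f(4)[OF u] by linarith
    qed
    have "dist (hnorm (?V v) (\<xi> v)) (hnorm (?V u) (\<xi> u)) < e" if u: "u \<in> U \<inter> W" for u
    proof -
      have "u \<in> U" "u \<in> W" using u by auto
      then show ?thesis using d[of u] d[OF f(3)] W(3)[of u] unfolding dist_real_def by argo
    qed
    then show "\<exists>U. openin B U \<and> v \<in> U \<and> (\<forall>u\<in>U. dist (hnorm (?V v) (\<xi> v)) (hnorm (?V u) (\<xi> u)) < e)"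
      using f W by (intro exI[of _ "U \<inter> W"]) auto
  qed
  have cl: "locally_uniform_closure B ?V (sections E) \<subseteq> sections E"
  proof
    fix \<xi> assume \<xi>: "\<xi> \<in> locally_uniform_closure B ?V (sections E)"
    then have \<xi>P: "\<xi> \<in> ?P" by (simp add: locally_uniform_closure_def)
    show "\<xi> \<in> sections E"
    proof (rule secI[OF \<xi>P])
      fix v and e :: real assume v: "v \<in> ?T" and e: "e > 0"
      have e2: "e / 2 > 0" using e by simp
      have cl: "\<forall>v\<in>?T. \<forall>e>0. \<exists>\<eta>\<in>sections E. \<exists>U. openin B U \<and> v \<in> U \<and>
          (\<forall>u\<in>U. hnorm (?V u) (\<xi> u \<ominus>\<^bsub>?V u\<^esub> \<eta> u) < e)"
        using \<xi> unfolding locally_uniform_closure_def by simp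
      obtain \<eta> U where \<eta>: "\<eta> \<in> sections E" "openin B U" "v \<in> U" "\<And>u. u \<in> U \<Longrightarrow> hnorm (?V u) (\<xi> u \<ominus>\<^bsub>?V u\<^esub> \<eta> u) < e / 2"
        using cl[rule_format, OF v e2] by blast
      obtain f W where f: "f \<in> S" "openin B W" "v \<in> W" "\<And>u. u \<in> W \<Longrightarrow> hnorm (?V u) (\<eta> u \<ominus>\<^bsub>?V u\<^esub> f u) < e / 2"
        using app[OF \<eta>(1) v, of "e/2"] e by auto
      have "hnorm (?V u) (\<xi> u \<ominus>\<^bsub>?V u\<^esub> f u) < e" if u: "u \<in> U \<inter> W" for u
      proof -
        have uT: "u \<in> ?T" using u f(2) openin_subset by blast
        have m: "\<xi> u \<in> carrier (?V u)" using \<xi>P uT by blast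
        show ?thesis using semi_inner.norm_triangle_minus[OF si[OF uT] m secm[OF \<eta>(1) uT] Sm[OF f(1) uT]]
          \<eta>(4)[of u] f(4)[of u] u by simp
      qed
      then show "\<exists>f\<in>S. \<exists>U. openin B U \<and> v \<in> U \<and> (\<forall>u\<in>U. hnorm (?V u) (\<xi> u \<ominus>\<^bsub>?V u\<^esub> f u) < e)"
        using f \<eta> by (intro bexI[of _ f] exI[of _ "U \<inter> W"]) auto
    qed
  qed
  have dn: "\<exists>\<xi>\<in>sections E. hnorm (?V u) (h \<ominus>\<^bsub>?V u\<^esub> \<xi> u) < e"
    if "u \<in> ?T" "h \<in> carrier (?V u)" "e > 0" for u h e
    using dense[OF that] Ssec by blast
  show ?thesis
    unfolding continuous_hilbert_bundle_def using hil sub nc cl dn by blast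
qed

locale induced = equivariant_field G H \<sigma>
  for G :: "'g groupoid" and H :: "'g set" and \<sigma> :: "('g, 'h) representation" +
  fixes \<mu> :: "'g \<Rightarrow> 'g set measure"
  assumes system: "full_equivariant_system G H \<mu>"
begin

sublocale mf: measure_field "coset_space G H" "unit_space G" "coset_rng G" \<mu>
  by (rule system_measure_field[OF system])

abbreviation "RF u \<equiv> range_fibre G u"
abbreviation "PF u \<equiv> ind_prefibre G H \<sigma> \<mu> u"
abbreviation "IH \<equiv> ind_fibre G H \<sigma> \<mu>"
abbreviation "cls u k \<equiv> limit_class (PF u) (\<lambda>_. k)"

text \<open>
  The integrand of the inner product. By equivariance of the arguments, another choice of
  representative gives the same value.
\<close>

definition IP :: "('g \<Rightarrow> 'h) \<Rightarrow> ('g \<Rightarrow> 'h) \<Rightarrow> 'g set \<Rightarrow> complex"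
  where "IP f g C = hinner (fs (coset_rep C)) (f (coset_rep C)) (g (coset_rep C))"

lemma ind_inner_eq: "ind_inner G H \<sigma> \<mu> f g u = mf.FI u (IP f g)"
  unfolding ind_inner_def mf.FI_def coset_range_fibre_def IP_def[abs_def] ..

lemma PF_simps [simp]:
  "carrier (PF u) = (\<lambda>f. restrict f (RF u)) ` IF"
  "zero (PF u) = (\<lambda>x \<in> RF u. \<zero>\<^bsub>fs x\<^esub>)"
  "add (PF u) = (\<lambda>f g. \<lambda>x \<in> RF u. f x \<oplus>\<^bsub>fs x\<^esub> g x)"
  "module.smult (PF u) = (\<lambda>z f. \<lambda>x \<in> RF u. z \<odot>\<^bsub>fs x\<^esub> f x)"
  "hinner (PF u) f g = mf.FI u (IP f g)"
  by (simp_all add: ind_prefibre_def module.extend_def prehilbert.fields_def section_module_def ind_inner_eq)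

lemma RF_mem: "x \<in> RF u \<longleftrightarrow> x \<in> Ar \<and> r x = u" by (simp add: range_fibre_def)

lemma stable_RF: "u \<in> units G \<Longrightarrow> stable (RF u)"
proof -
  assume u: "u \<in> units G"
  have "closedin (gtop G) {x \<in> Ar. r x \<in> {u}}"
    using u Hausdorff_unit_space by (intro closedin_continuous_map_preimage[OF cont_rng_unit]) (simp add: closedin_Hausdorff_singleton)
  then show ?thesis by (auto simp: stable_def RF_mem range_fibre_def)
qed

text \<open>
  Restrictions of induced functions are recognised on the range fibre alone, by the extension
  theorem. This is what makes translation between range fibres accessible.
\<close>

lemma PF_carrier_iff:
  assumes u: "u \<in> units G"
  shows "k \<in> carrier (PF u) \<longleftrightarrow> k \<in> extensional (RF u) \<and> equiv_on (RF u) k \<and> (\<exists>C. supported (RF u) k C)"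
proof
  assume "k \<in> carrier (PF u)"
  then obtain f where f: "f \<in> IF" "k = restrict f (RF u)" by auto
  obtain C where C: "supported Ar f C" using IF_supp[OF f(1)] by blast
  have "equiv_on (RF u) f" using IF_equiv[OF f(1)] by (rule equiv_on_subset) (simp add: range_fibre_def)
  then have "equiv_on (RF u) k" by (rule equiv_on_cong[OF _ stable_RF[OF u]]) (simp add: f)
  moreover have "supported (RF u) k C" using C by (auto simp: supported_def f RF_mem)
  ultimately show "k \<in> extensional (RF u) \<and> equiv_on (RF u) k \<and> (\<exists>C. supported (RF u) k C)" using f by auto
next
  assume k: "k \<in> extensional (RF u) \<and> equiv_on (RF u) k \<and> (\<exists>C. supported (RF u) k C)"
  then obtain C where "supported (RF u) k C" by blast
  then obtain f where f: "f \<in> IF" "\<And>z. z \<in> RF u \<Longrightarrow> f z = k z"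
    using equivariant_Tietze[OF stable_RF[OF u]] k by blast
  have "restrict f (RF u) = k"
    using k f(2) by (intro extensionalityI[of _ "RF u"]) auto
  then show "k \<in> carrier (PF u)" using f(1) by auto
qed

lemma PF_mem: "\<lbrakk>k \<in> carrier (PF u); x \<in> RF u\<rbrakk> \<Longrightarrow> k x \<in> carrier (fs x)"
  using IF_mem by (auto simp: RF_mem)

lemma IP_coset: 
  assumes f: "f \<in> IF" and g: "g \<in> IF" and x: "x \<in> Ar"
  shows "IP f g (co x) = hinner (fs x) (f x) (g x)"
proof -
  obtain h where h: "h \<in> H" "r h = d x" "coset_rep (co x) = x \<cdot> h" using coset_rep_coset[OF x] .
  have "hinner (fs (x \<cdot> h)) (f (x \<cdot> h)) (g (x \<cdot> h)) = hinner (fs x) (f x) (g x)"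
    by (rule equiv_inner(1)[OF stable_Ar IF_equiv[OF f] IF_equiv[OF g] x]) (use h x in auto)
  then show ?thesis by (simp add: IP_def h(3))
qed

lemma IP_Cc: 
  assumes f: "f \<in> IF" and g: "g \<in> IF" shows "IP f g \<in> Cc Q"
  unfolding Cc_iff[OF lchs_coset_space]
proof
  have "continuous_map (gtop G) euclidean (\<lambda>x. hinner (fs x) (f x) (g x))"
    by (rule asec_inner[OF IF_asec[OF f] IF_asec[OF g]])
  then show "continuous_map Q euclidean (IP f g)"
    unfolding cont_from_coset_space by (rule continuous_map_eq) (simp add: IP_coset[OF f g])
  obtain C where C: "supported Ar f C" using IF_supp[OF f] by blast
  have "D \<in> C" if D: "D \<in> topspace Q" and nz: "IP f g D \<noteq> 0" for D
  proof -
    obtain x where x: "x \<in> Ar" "D = co x" using D by (auto simp: topspace_coset_space)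
    have "f x \<noteq> \<zero>\<^bsub>fs x\<^esub>"
      using nz IP_coset[OF f g x(1)] x semi_inner.inner_zero_left[OF fs_inner IF_mem[OF g]] by auto
    then show ?thesis using C x by (simp add: supported_def)
  qed
  then show "\<exists>C. compactin Q C \<and> (\<forall>D\<in>topspace Q. IP f g D \<noteq> 0 \<longrightarrow> D \<in> C)"
    using C by (auto simp: supported_def)
qed

lemma IP_fib_cong:
  assumes "\<And>x. x \<in> RF u \<Longrightarrow> f x = f' x" "\<And>x. x \<in> RF u \<Longrightarrow> g x = g' x" "C \<in> topspace Q" "coset_rng G C = u"
  shows "IP f g C = IP f' g' C"
  using assms coset_rep[OF assms(3)] by (simp add: IP_def RF_mem)

lemma FI_IP_restrict: "mf.FI u (IP (restrict f (RF u)) (restrict g (RF u))) = mf.FI u (IP f g)"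
  by (rule mf.FI_cong) (auto intro: IP_fib_cong)

lemma IP_fibre_fun:
  assumes k: "k \<in> carrier (PF u)" and l: "l \<in> carrier (PF u)"
  shows "mf.fibre_fun u (IP k l)"
proof -
  obtain f g where f: "f \<in> IF" "k = restrict f (RF u)" and g: "g \<in> IF" "l = restrict g (RF u)"
    using k l by auto
  show ?thesis
    by (rule mf.fibre_fun_cong[OF mf.fibre_fun_Cc[OF IP_Cc[OF f(1) g(1)]]]) (auto simp: f g intro: IP_fib_cong)
qed

lemma fib_rep:
  assumes "C \<in> mf.fib u" shows "coset_rep C \<in> RF u" "coset_rep C \<in> Ar"
  using assms coset_rep[of C] by (auto simp: RF_mem)

lemma PF_semi_inner:
  assumes u: "u \<in> units G" shows "semi_inner (PF u)"
proof (rule semi_inner.intro)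
  have Rs: "RF u \<subseteq> Ar" by (auto simp: RF_mem)
  have res: "restrict (restrict f Ar) (RF u) = restrict f (RF u)" for f :: "'g \<Rightarrow> 'h" using Rs by (auto simp: restrict_def fun_eq_iff)
  show "Module.module complex_ring (PF u)"
  proof (rule pointwise_module[of "RF u" fs "carrier (PF u)"])
    show "x \<in> RF u \<Longrightarrow> Module.module complex_ring (fs x)" for x using semi_inner.mod[OF fs_inner] by (simp add: RF_mem)
    show "carrier (PF u) \<subseteq> (\<Pi>\<^sub>E x\<in>RF u. carrier (fs x))" using IF_mem by (auto simp: RF_mem)
    have "restrict (\<lambda>x\<in>Ar. \<zero>\<^bsub>fs x\<^esub>) (RF u) \<in> carrier (PF u)"
      unfolding PF_simps by (rule imageI[OF IF_zero])
    then show "(\<lambda>x\<in>RF u. \<zero>\<^bsub>fs x\<^esub>) \<in> carrier (PF u)" unfolding res .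
    fix k l assume "k \<in> carrier (PF u)"
    then obtain f where f: "f \<in> IF" "k = restrict f (RF u)" by auto
    show "(\<lambda>x\<in>RF u. z \<odot>\<^bsub>fs x\<^esub> k x) \<in> carrier (PF u)" for z
    proof -
      have "(\<lambda>x\<in>RF u. z \<odot>\<^bsub>fs x\<^esub> k x) = restrict (\<lambda>x\<in>Ar. z \<odot>\<^bsub>fs x\<^esub> f x) (RF u)"
        unfolding res f(2) by (rule restrict_ext) simp
      then show ?thesis unfolding PF_simps by (simp only:) (rule imageI[OF IF_smult[OF f(1)]])
    qed
    assume "l \<in> carrier (PF u)"
    then obtain g where g: "g \<in> IF" "l = restrict g (RF u)" by auto
    have "(\<lambda>x\<in>RF u. k x \<oplus>\<^bsub>fs x\<^esub> l x) = restrict (\<lambda>x\<in>Ar. f x \<oplus>\<^bsub>fs x\<^esub> g x) (RF u)"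
      unfolding res f(2) g(2) by (rule restrict_ext) simp
    then show "(\<lambda>x\<in>RF u. k x \<oplus>\<^bsub>fs x\<^esub> l x) \<in> carrier (PF u)"
      unfolding PF_simps by (simp only:) (rule imageI[OF IF_add[OF f(1) g(1)]])
  qed simp_all
  have uu: "u \<in> topspace (unit_space G)" using u by simp
  fix k l m z assume k: "k \<in> carrier (PF u)"
  show "0 \<le> Re (hinner (PF u) k k)"
    unfolding PF_simps
  proof (rule mf.FI_nonneg)
    fix C assume C: "C \<in> mf.fib u"
    show "Im (IP k k C) = 0 \<and> 0 \<le> Re (IP k k C)"
      using semi_inner.inner_self[OF fs_inner[OF fib_rep(2)[OF C]] PF_mem[OF k fib_rep(1)[OF C]]] by (simp add: IP_def)
  qed
  assume l: "l \<in> carrier (PF u)"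
  show "hinner (PF u) (z \<odot>\<^bsub>PF u\<^esub> k) l = z * hinner (PF u) k l"
    unfolding PF_simps mf.FI_scale[symmetric]
  proof (rule mf.FI_cong)
    fix C assume C: "C \<in> mf.fib u"
    note x = fib_rep[OF C]
    show "IP (\<lambda>x\<in>RF u. z \<odot>\<^bsub>fs x\<^esub> k x) l C = z * IP k l C"
      using semi_inner.inner_smult_left[OF fs_inner[OF x(2)] PF_mem[OF k x(1)] PF_mem[OF l x(1)]] x(1) by (simp add: IP_def)
  qed
  show "hinner (PF u) l k = cnj (hinner (PF u) k l)"
    unfolding PF_simps mf.FI_cnj[symmetric]
  proof (rule mf.FI_cong)
    fix C assume C: "C \<in> mf.fib u"
    note x = fib_rep[OF C]
    show "IP l k C = cnj (IP k l C)"
      unfolding IP_def by (rule semi_inner.inner_cnj[OF fs_inner[OF x(2)] PF_mem[OF k x(1)] PF_mem[OF l x(1)]])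
  qed
  assume m: "m \<in> carrier (PF u)"
  have "hinner (PF u) k m + hinner (PF u) l m = mf.FI u (\<lambda>C. IP k m C + IP l m C)"
    unfolding PF_simps by (rule mf.FI_add[OF uu IP_fibre_fun[OF k m] IP_fibre_fun[OF l m], symmetric])
  also have "\<dots> = mf.FI u (IP (\<lambda>x\<in>RF u. k x \<oplus>\<^bsub>fs x\<^esub> l x) m)"
  proof (rule mf.FI_cong)
    fix C assume C: "C \<in> mf.fib u"
    note x = fib_rep[OF C]
    show "IP k m C + IP l m C = IP (\<lambda>x\<in>RF u. k x \<oplus>\<^bsub>fs x\<^esub> l x) m C"
      using semi_inner.inner_add_left[OF fs_inner[OF x(2)] PF_mem[OF k x(1)] PF_mem[OF l x(1)] PF_mem[OF m x(1)]] x(1)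
      by (simp add: IP_def)
  qed
  finally show "hinner (PF u) (k \<oplus>\<^bsub>PF u\<^esub> l) m = hinner (PF u) k m + hinner (PF u) l m" by simp
qed

lemma PF_minus:
  assumes u: "u \<in> units G" and k: "k \<in> carrier (PF u)" "l \<in> carrier (PF u)"
  shows "k \<ominus>\<^bsub>PF u\<^esub> l = (\<lambda>x\<in>RF u. k x \<ominus>\<^bsub>fs x\<^esub> l x)"
proof -
  have "k \<ominus>\<^bsub>PF u\<^esub> l = k \<oplus>\<^bsub>PF u\<^esub> (-1) \<odot>\<^bsub>PF u\<^esub> l"
    by (rule semi_inner.minus_eq_smult[OF PF_semi_inner[OF u] k])
  also have "\<dots> = (\<lambda>x\<in>RF u. k x \<oplus>\<^bsub>fs x\<^esub> (\<lambda>x\<in>RF u. (-1) \<odot>\<^bsub>fs x\<^esub> l x) x)" by (simp only: PF_simps)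
  also have "\<dots> = (\<lambda>x\<in>RF u. k x \<ominus>\<^bsub>fs x\<^esub> l x)"
    by (rule restrict_ext)
      (use PF_mem[OF k(1)] PF_mem[OF k(2)] semi_inner.minus_eq_smult[OF fs_inner] in \<open>auto simp: RF_mem\<close>)
  finally show ?thesis .
qed

lemma PF_norm: "hnorm (PF u) k = sqrt (Re (mf.FI u (IP k k)))"
  by (simp add: hnorm_def)

lemma PF_norm_restrict: "hnorm (PF u) (restrict f (RF u)) = sqrt (Re (mf.FI u (IP f f)))"
  by (simp add: hnorm_def FI_IP_restrict)

lemma restrict_PF: "f \<in> IF \<Longrightarrow> restrict f (RF u) \<in> carrier (PF u)" by simp

lemma restrict_minus:
  assumes u: "u \<in> units G" and f: "f \<in> IF" "g \<in> IF"
  shows "restrict f (RF u) \<ominus>\<^bsub>PF u\<^esub> restrict g (RF u) = restrict (\<lambda>x\<in>Ar. f x \<ominus>\<^bsub>fs x\<^esub> g x) (RF u)"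
  unfolding PF_minus[OF u restrict_PF[OF f(1)] restrict_PF[OF f(2)]]
  by (auto simp: restrict_def fun_eq_iff RF_mem)

lemma IP_integral_continuous:
  assumes "f \<in> IF" "g \<in> IF" shows "continuous_map (unit_space G) euclidean (\<lambda>u. mf.FI u (IP f g))"
  using mf.integral_continuous[OF IP_Cc[OF assms]]
  by (rule continuous_map_eq) (simp add: mf.FI_Cc[OF _ IP_Cc[OF assms]])

lemma norm_continuous:
  assumes f: "f \<in> IF" 
  shows "continuous_map (unit_space G) euclidean (\<lambda>u. hnorm (PF u) (restrict f (RF u)))"
  unfolding PF_norm_restrict
  by (rule continuous_map_unop[OF IP_integral_continuous[OF f f]]) (intro continuous_intros)

text \<open>The pointwise norms of an induced function vanish off a compact set of units, hence are bounded.\<close>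

lemma PF_norm_le_ind_norm:
  assumes f: "f \<in> IF" and u: "u \<in> units G"
  shows "hnorm (PF u) (restrict f (RF u)) \<le> ind_norm G H \<sigma> \<mu> f"
proof -
  obtain C where C: "supported Ar f C" using IF_supp[OF f] by blast
  let ?K = "coset_rng G ` C"
  have K: "compactin (unit_space G) ?K"
    using C cont_coset_rng by (auto simp: supported_def intro: image_compactin)
  have "compactin euclidean ((\<lambda>u. hnorm (PF u) (restrict f (RF u))) ` ?K)"
    by (rule image_compactin[OF K norm_continuous[OF f]])
  then have "bounded ((\<lambda>u. hnorm (PF u) (restrict f (RF u))) ` ?K)" by (simp add: compact_imp_bounded)
  then obtain M where M: "\<And>u. u \<in> ?K \<Longrightarrow> \<bar>hnorm (PF u) (restrict f (RF u))\<bar> \<le> M"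
    unfolding bounded_iff by auto
  have 0: "hnorm (PF v) (restrict f (RF v)) = 0" if v: "v \<in> units G" "v \<notin> ?K" for v
  proof -
    have "mf.FI v (IP f f) = mf.FI v (\<lambda>_. 0 * 0)"
    proof (rule mf.FI_cong)
      fix D assume D: "D \<in> mf.fib v"
      let ?x = "coset_rep D"
      have x: "?x \<in> Ar" "co ?x = D" "coset_rng G D = v" using D coset_rep[of D] by auto
      have "f ?x = \<zero>\<^bsub>fs ?x\<^esub>" using C x v(2) by (auto simp: supported_def)
      then show "IP f f D = 0 * 0" using x(1) semi_inner.zero_closed[OF fs_inner] semi_inner.inner_zero_left[OF fs_inner] by (simp add: IP_def)
    qed
    then show ?thesis unfolding PF_norm_restrict mf.FI_scale by simp
  qed
  have le: "hnorm (PF v) (restrict f (RF v)) \<le> max M 0" if v: "v \<in> units G" for v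
    using M[of v] 0[OF v] by (cases "v \<in> ?K") auto
  have "bdd_above ((\<lambda>u. sqrt (Re (ind_inner G H \<sigma> \<mu> f f u))) ` units G)"
    using le unfolding PF_norm_restrict ind_inner_eq by (intro bdd_aboveI[of _ "max M 0"]) auto
  then show ?thesis
    unfolding ind_norm_def PF_norm_restrict ind_inner_eq[symmetric] by (rule cSUP_upper[OF u])
qed


lemma IH_eq: "IH u = hilbert_completion (PF u)" by (simp add: ind_fibre_def)

definition t0 :: "('g \<Rightarrow> 'h) \<Rightarrow> 'g \<Rightarrow> (nat \<Rightarrow> 'g \<Rightarrow> 'h) set"
  where "t0 f = (\<lambda>u \<in> units G. cls u (restrict f (RF u)))"

text \<open>
  The sections coming from the completion are uniform limits of those coming from induced functions,
  so both generate the same bundle.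
\<close>

lemma ind_sections:
  "sections (ind G H \<sigma> \<mu>) = locally_uniform_closure (unit_space G) IH (t0 ` IF)"
proof (cases "units G = {}")
  case True
  then show ?thesis by (simp add: ind_def locally_uniform_closure_def)
next
  case ne: False
  let ?M = "section_module Ar fs IF"
  have modM: "Module.module complex_ring ?M"
    by (rule pointwise_module[of Ar fs IF])
      (use IF_mem IF_ext IF_zero IF_add IF_smult semi_inner.mod[OF fs_inner] in \<open>auto simp: section_module_def PiE_def\<close>)
  interpret MM: module complex_ring ?M by (rule modM)
  have minusM: "f \<ominus>\<^bsub>?M\<^esub> g = (\<lambda>x\<in>Ar. f x \<ominus>\<^bsub>fs x\<^esub> g x)" if fg: "f \<in> IF" "g \<in> IF" for f g
  proof -
    have c: "g \<in> carrier ?M" using fg by (simp add: section_module_def)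
    have "f \<ominus>\<^bsub>?M\<^esub> g = f \<oplus>\<^bsub>?M\<^esub> (-1) \<odot>\<^bsub>?M\<^esub> g"
      using MM.smult_l_minus[of 1 g] MM.smult_one[OF c] c by (simp add: a_minus_def)
    also have "\<dots> = (\<lambda>x\<in>Ar. f x \<ominus>\<^bsub>fs x\<^esub> g x)"
      using fg by (auto simp: section_module_def IF_mem semi_inner.minus_eq_smult[OF fs_inner] intro!: restrict_ext)
    finally show ?thesis .
  qed
  let ?cs = "cauchy_sequences ?M (ind_norm G H \<sigma> \<mu>)"
  have csIF: "s i \<in> IF" if "s \<in> ?cs" for s i using that by (simp add: cauchy_sequences_def section_module_def)
  have nle: "hnorm (PF u) (restrict f (RF u) \<ominus>\<^bsub>PF u\<^esub> restrict g (RF u)) \<le> ind_norm G H \<sigma> \<mu> (f \<ominus>\<^bsub>?M\<^esub> g)"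
    if "f \<in> IF" "g \<in> IF" "u \<in> units G" for f g u
    using PF_norm_le_ind_norm[OF IF_minus[OF that(1,2)] that(3)] that
    by (simp add: restrict_minus minusM)
  have csu: "(\<lambda>i. restrict (s i) (RF u)) \<in> cauchy_sequences (PF u) (hnorm (PF u))" if s: "s \<in> ?cs" and u: "u \<in> units G" for s u
    unfolding cauchy_sequences_def
  proof (intro CollectI conjI allI impI)
    show "restrict (s i) (RF u) \<in> carrier (PF u)" for i using csIF[OF s] by simp
    fix e :: real assume "e > 0"
    then obtain N where "\<forall>i\<ge>N. \<forall>j\<ge>N. ind_norm G H \<sigma> \<mu> (s i \<ominus>\<^bsub>?M\<^esub> s j) < e"
      using s unfolding cauchy_sequences_def by blast
    then show "\<exists>N. \<forall>i\<ge>N. \<forall>j\<ge>N. hnorm (PF u) (restrict (s i) (RF u) \<ominus>\<^bsub>PF u\<^esub> restrict (s j) (RF u)) < e"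
      using nle[OF csIF[OF s] csIF[OF s] u] le_less_trans by blast
  qed
  have tF: "ind_section G H \<sigma> \<mu> (null_rel ?M (ind_norm G H \<sigma> \<mu>) `` {s}) u = limit_class (PF u) (\<lambda>i. restrict (s i) (RF u))"
    if s: "s \<in> ?cs" and self: "(s, s) \<in> null_rel ?M (ind_norm G H \<sigma> \<mu>)" and u: "u \<in> units G" for s u
  proof -
    interpret V: semi_inner "PF u" by (rule PF_semi_inner[OF u])
    have "limit_class (PF u) (\<lambda>i. restrict (t i) (RF u)) = limit_class (PF u) (\<lambda>i. restrict (s i) (RF u))"
      if st: "(s, t) \<in> null_rel ?M (ind_norm G H \<sigma> \<mu>)" for t
    proof (rule V.lc_eqI[symmetric])
      have t: "t \<in> ?cs" "(\<lambda>i. ind_norm G H \<sigma> \<mu> (s i \<ominus>\<^bsub>?M\<^esub> t i)) \<longlonglongrightarrow> 0" using st by (auto simp: null_rel_def)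
      show "(\<lambda>i. restrict (s i) (RF u)) \<in> V.cs" "(\<lambda>i. restrict (t i) (RF u)) \<in> V.cs"
        using csu[OF s u] csu[OF t(1) u] .
      show "(\<lambda>i. hnorm (PF u) (restrict (s i) (RF u) \<ominus>\<^bsub>PF u\<^esub> restrict (t i) (RF u))) \<longlonglongrightarrow> 0"
        by (rule null_le[OF _ _ t(2)])
          (use nle[OF csIF[OF s] csIF[OF t(1)] u] V.norm_ge0[OF V.minus_closed[OF restrict_PF[OF csIF[OF s]] restrict_PF[OF csIF[OF t(1)]]]] in auto)
    qed
    then have "(\<Union>t \<in> null_rel ?M (ind_norm G H \<sigma> \<mu>) `` {s}. limit_class (PF u) (\<lambda>i. restrict (t i) (RF u)))
      = limit_class (PF u) (\<lambda>i. restrict (s i) (RF u))"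
      using self by blast
    then show ?thesis using u by (simp add: ind_section_def)
  qed
  have zn: "ind_norm G H \<sigma> \<mu> (f \<ominus>\<^bsub>?M\<^esub> f) = 0" if f: "f \<in> IF" for f
  proof -
    have "sqrt (Re (ind_inner G H \<sigma> \<mu> (f \<ominus>\<^bsub>?M\<^esub> f) (f \<ominus>\<^bsub>?M\<^esub> f) u)) = 0" if u: "u \<in> units G" for u
    proof -
      interpret V: semi_inner "PF u" by (rule PF_semi_inner[OF u])
      have "hnorm (PF u) (restrict (f \<ominus>\<^bsub>?M\<^esub> f) (RF u)) = 0"
        unfolding minusM[OF f f] restrict_minus[OF u f f, symmetric]
        by (rule V.norm_minus_self[OF restrict_PF[OF f]])
      then show ?thesis by (simp only: PF_norm_restrict ind_inner_eq)
    qed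
    then show ?thesis using ne by (simp add: ind_norm_def)
  qed
  have refl: "(s, s) \<in> null_rel ?M (ind_norm G H \<sigma> \<mu>)" if s: "s \<in> ?cs" for s
    using s zn[OF csIF[OF s]] by (simp add: null_rel_def)
  have comp: "ind_completion G H \<sigma> \<mu> = (\<lambda>s. null_rel ?M (ind_norm G H \<sigma> \<mu>) `` {s}) ` ?cs"
    by (auto simp: ind_completion_def completion_def quotient_def)
  have const: "(\<lambda>_. f) \<in> ?cs" if f: "f \<in> IF" for f
    using f zn[OF f] by (simp add: cauchy_sequences_def section_module_def)
  have sub1: "t0 ` IF \<subseteq> ind_section G H \<sigma> \<mu> ` ind_completion G H \<sigma> \<mu>"
  proof
    fix \<xi> assume "\<xi> \<in> t0 ` IF"
    then obtain f where f: "f \<in> IF" "\<xi> = t0 f" by blast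
    have "ind_section G H \<sigma> \<mu> (null_rel ?M (ind_norm G H \<sigma> \<mu>) `` {\<lambda>_. f}) = \<xi>"
    proof (rule extensionalityI[of _ "units G"])
      show "ind_section G H \<sigma> \<mu> (null_rel ?M (ind_norm G H \<sigma> \<mu>) `` {\<lambda>_. f}) \<in> extensional (units G)" by (simp add: ind_section_def)
      show "\<xi> \<in> extensional (units G)" unfolding f(2) t0_def by simp
      fix u assume u: "u \<in> units G"
      show "ind_section G H \<sigma> \<mu> (null_rel ?M (ind_norm G H \<sigma> \<mu>) `` {\<lambda>_. f}) u = \<xi> u"
        unfolding tF[OF const[OF f(1)] refl[OF const[OF f(1)]] u] f(2) t0_def using u by simp
    qed
    then show "\<xi> \<in> ind_section G H \<sigma> \<mu> ` ind_completion G H \<sigma> \<mu>" using const[OF f(1)] unfolding comp by blast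
  qed
  have app: "\<exists>f\<in>IF. \<forall>u\<in>units G. hnorm (IH u) (\<xi> u \<ominus>\<^bsub>IH u\<^esub> t0 f u) \<le> e \<and> \<xi> u \<in> carrier (IH u)"
    if \<xi>: "\<xi> \<in> ind_section G H \<sigma> \<mu> ` ind_completion G H \<sigma> \<mu>" and e: "e > 0" for \<xi> e
  proof -
    obtain s where s: "s \<in> ?cs" "\<xi> = ind_section G H \<sigma> \<mu> (null_rel ?M (ind_norm G H \<sigma> \<mu>) `` {s})"
      using \<xi> unfolding comp by blast
    obtain N where N: "\<forall>i\<ge>N. \<forall>j\<ge>N. ind_norm G H \<sigma> \<mu> (s i \<ominus>\<^bsub>?M\<^esub> s j) < e"
      using s(1) e unfolding cauchy_sequences_def by blast
    have "hnorm (IH u) (\<xi> u \<ominus>\<^bsub>IH u\<^esub> t0 (s N) u) \<le> e \<and> \<xi> u \<in> carrier (IH u)" if u: "u \<in> units G" for u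
    proof -
      interpret V: semi_inner "PF u" by (rule PF_semi_inner[OF u])
      have \<xi>u: "\<xi> u = limit_class (PF u) (\<lambda>i. restrict (s i) (RF u))" using tF[OF s(1) refl[OF s(1)] u] s(2) by simp
      have "(\<lambda>i. hnorm (PF u) (restrict (s i) (RF u) \<ominus>\<^bsub>PF u\<^esub> restrict (s N) (RF u)))
        \<longlonglongrightarrow> hnorm (IH u) (\<xi> u \<ominus>\<^bsub>IH u\<^esub> t0 (s N) u)"
        using V.HC_norm_minus[OF csu[OF s(1) u] V.const_cs[OF restrict_PF[OF csIF[OF s(1), of N]]]] u
        by (simp add: \<xi>u t0_def IH_eq)
      moreover have "hnorm (PF u) (restrict (s i) (RF u) \<ominus>\<^bsub>PF u\<^esub> restrict (s N) (RF u)) \<le> e" if "i \<ge> N" for i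
        using nle[OF csIF[OF s(1)] csIF[OF s(1)] u, of i N] N that by (meson le_less_trans less_imp_le order_refl)
      ultimately have "hnorm (IH u) (\<xi> u \<ominus>\<^bsub>IH u\<^esub> t0 (s N) u) \<le> e" by (intro LIMSEQ_le_const2) auto
      then show ?thesis using V.lc_carrier[OF csu[OF s(1) u]] by (simp add: \<xi>u IH_eq)
    qed
    then show ?thesis using csIF[OF s(1)] by blast
  qed
  have t0m: "t0 f u \<in> carrier (IH u)" if "f \<in> IF" "u \<in> units G" for f u
    using semi_inner.lc_carrier[OF PF_semi_inner semi_inner.const_cs[OF PF_semi_inner restrict_PF]] that by (simp add: t0_def IH_eq)
  have sec: "sections (ind G H \<sigma> \<mu>)
    = locally_uniform_closure (unit_space G) IH (ind_section G H \<sigma> \<mu> ` ind_completion G H \<sigma> \<mu>)"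
    by (simp add: ind_def)
  show ?thesis
  proof
    show "locally_uniform_closure (unit_space G) IH (t0 ` IF) \<subseteq> sections (ind G H \<sigma> \<mu>)"
      unfolding sec by (rule luc_mono[OF sub1])
    show "sections (ind G H \<sigma> \<mu>) \<subseteq> locally_uniform_closure (unit_space G) IH (t0 ` IF)"
    proof
      fix \<xi> assume "\<xi> \<in> sections (ind G H \<sigma> \<mu>)"
      then have \<xi>: "\<xi> \<in> (\<Pi>\<^sub>E u \<in> units G. carrier (IH u))"
        and ap: "\<And>v e. \<lbrakk>v \<in> units G; e > 0\<rbrakk> \<Longrightarrow> \<exists>\<eta>\<in>ind_section G H \<sigma> \<mu> ` ind_completion G H \<sigma> \<mu>. \<exists>U. openin (unit_space G) U \<and> v \<in> U \<and>
          (\<forall>u\<in>U. hnorm (IH u) (\<xi> u \<ominus>\<^bsub>IH u\<^esub> \<eta> u) < e)"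
        by (auto simp: ind_def locally_uniform_closure_def)
      have "\<exists>\<eta>\<in>t0 ` IF. \<exists>U. openin (unit_space G) U \<and> v \<in> U \<and> (\<forall>u\<in>U. hnorm (IH u) (\<xi> u \<ominus>\<^bsub>IH u\<^esub> \<eta> u) < e)"
        if v: "v \<in> units G" and e: "e > 0" for v e
      proof -
        obtain \<eta> U where \<eta>: "\<eta> \<in> ind_section G H \<sigma> \<mu> ` ind_completion G H \<sigma> \<mu>" "openin (unit_space G) U" "v \<in> U"
          "\<And>u. u \<in> U \<Longrightarrow> hnorm (IH u) (\<xi> u \<ominus>\<^bsub>IH u\<^esub> \<eta> u) < e / 2"
          using ap[OF v, of "e/2"] e by auto
        obtain f where f: "f \<in> IF" "\<And>u. u \<in> units G \<Longrightarrow> hnorm (IH u) (\<eta> u \<ominus>\<^bsub>IH u\<^esub> t0 f u) \<le> e / 2 \<and> \<eta> u \<in> carrier (IH u)"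
          using app[OF \<eta>(1), of "e/2"] e by auto
        have "hnorm (IH u) (\<xi> u \<ominus>\<^bsub>IH u\<^esub> t0 f u) < e" if u: "u \<in> U" for u
        proof -
          have uu: "u \<in> units G" using u \<eta>(2) openin_subset by fastforce
          interpret I: semi_inner "IH u" unfolding IH_eq by (rule semi_inner.HC_semi_inner[OF PF_semi_inner[OF uu]])
          have "\<xi> u \<in> carrier (IH u)" using \<xi> uu by blast
          then show ?thesis
            using I.norm_triangle_minus[of "\<xi> u" "\<eta> u" "t0 f u"] \<eta>(4)[OF u] f(2)[OF uu] t0m[OF f(1) uu] by simp
        qed
        then show ?thesis using f(1) \<eta>(2,3) by blast
      qed
      then show "\<xi> \<in> locally_uniform_closure (unit_space G) IH (t0 ` IF)" using \<xi> by (simp add: locally_uniform_closure_def)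
    qed
  qed
qed

lemma fibre_ind [simp]: "fibre (ind G H \<sigma> \<mu>) = IH" by (simp add: ind_def)

lemma IH_hilbert: "u \<in> units G \<Longrightarrow> is_hilbert_space (IH u)"
  unfolding IH_eq by (rule semi_inner.HC_hilbert[OF PF_semi_inner])

lemma t0_mem: "\<lbrakk>f \<in> IF; u \<in> units G\<rbrakk> \<Longrightarrow> t0 f u \<in> carrier (IH u)"
  using semi_inner.lc_carrier[OF PF_semi_inner semi_inner.const_cs[OF PF_semi_inner restrict_PF]] by (simp add: t0_def IH_eq)

theorem ind_bundle: "continuous_hilbert_bundle (unit_space G) (ind G H \<sigma> \<mu>)"
proof (rule generated_bundle[where S = "t0 ` IF"])
  show "is_hilbert_space (fibre (ind G H \<sigma> \<mu>) u)" if "u \<in> topspace (unit_space G)" for u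
    using IH_hilbert that by simp
  show "t0 ` IF \<subseteq> (\<Pi>\<^sub>E u\<in>topspace (unit_space G). carrier (fibre (ind G H \<sigma> \<mu>) u))"
    using t0_mem by (auto simp: t0_def)
  show "t0 ` IF \<noteq> {}" using IF_zero by blast
  have Rs: "RF u \<subseteq> Ar" for u by (auto simp: RF_mem)
  fix \<xi> \<eta> assume "\<xi> \<in> t0 ` IF"
  then obtain f where f: "f \<in> IF" "\<xi> = t0 f" by blast
  show "(\<lambda>u\<in>topspace (unit_space G). z \<odot>\<^bsub>fibre (ind G H \<sigma> \<mu>) u\<^esub> \<xi> u) \<in> t0 ` IF" for z
  proof
    show "(\<lambda>x\<in>Ar. z \<odot>\<^bsub>fs x\<^esub> f x) \<in> IF" by (rule IF_smult[OF f(1)])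
    have "restrict (\<lambda>x\<in>Ar. z \<odot>\<^bsub>fs x\<^esub> f x) (RF u) = z \<odot>\<^bsub>PF u\<^esub> restrict f (RF u)" for u
      using Rs by (auto simp: restrict_def fun_eq_iff)
    then show "(\<lambda>u\<in>topspace (unit_space G). z \<odot>\<^bsub>fibre (ind G H \<sigma> \<mu>) u\<^esub> \<xi> u) = t0 (\<lambda>x\<in>Ar. z \<odot>\<^bsub>fs x\<^esub> f x)"
      unfolding t0_def f(2) fibre_ind topspace_unit_space
      using semi_inner.HC_const(5)[OF PF_semi_inner restrict_PF[OF f(1)]] by (intro restrict_ext) (simp add: IH_eq del: PF_simps)
  qed
  have "continuous_map (unit_space G) euclidean (\<lambda>u. hnorm (PF u) (restrict f (RF u)))" by (rule norm_continuous[OF f(1)])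
  then show "continuous_map (unit_space G) euclidean (\<lambda>u. hnorm (fibre (ind G H \<sigma> \<mu>) u) (\<xi> u))"
    by (rule continuous_map_eq)
      (use semi_inner.HC_const(2)[OF PF_semi_inner restrict_PF[OF f(1)]] in \<open>simp add: f(2) t0_def IH_eq\<close>)
  assume "\<eta> \<in> t0 ` IF"
  then obtain g where g: "g \<in> IF" "\<eta> = t0 g" by blast
  show "(\<lambda>u\<in>topspace (unit_space G). \<xi> u \<oplus>\<^bsub>fibre (ind G H \<sigma> \<mu>) u\<^esub> \<eta> u) \<in> t0 ` IF"
  proof
    show "(\<lambda>x\<in>Ar. f x \<oplus>\<^bsub>fs x\<^esub> g x) \<in> IF" by (rule IF_add[OF f(1) g(1)])
    have "restrict (\<lambda>x\<in>Ar. f x \<oplus>\<^bsub>fs x\<^esub> g x) (RF u) = restrict f (RF u) \<oplus>\<^bsub>PF u\<^esub> restrict g (RF u)" for u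
      using Rs by (auto simp: restrict_def fun_eq_iff)
    then show "(\<lambda>u\<in>topspace (unit_space G). \<xi> u \<oplus>\<^bsub>fibre (ind G H \<sigma> \<mu>) u\<^esub> \<eta> u) = t0 (\<lambda>x\<in>Ar. f x \<oplus>\<^bsub>fs x\<^esub> g x)"
      unfolding t0_def f(2) g(2) fibre_ind topspace_unit_space
      using semi_inner.HC_const(3)[OF PF_semi_inner restrict_PF[OF f(1)] restrict_PF[OF g(1)]]
      by (intro restrict_ext) (simp add: IH_eq del: PF_simps)
  qed
next
  fix u A and e :: real assume u: "u \<in> topspace (unit_space G)" and A: "A \<in> carrier (fibre (ind G H \<sigma> \<mu>) u)" and e: "e > 0"
  have uu: "u \<in> units G" using u by simp
  obtain k where k: "k \<in> carrier (PF u)" "hnorm (hilbert_completion (PF u)) (A \<ominus>\<^bsub>hilbert_completion (PF u)\<^esub> cls u k) < e"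
    using semi_inner.HC_dense[OF PF_semi_inner[OF uu] _ e] A by (auto simp: IH_eq simp del: PF_simps)
  obtain f where f: "f \<in> IF" "k = restrict f (RF u)" using k(1) by auto
  then show "\<exists>\<xi>\<in>t0 ` IF. hnorm (fibre (ind G H \<sigma> \<mu>) u) (A \<ominus>\<^bsub>fibre (ind G H \<sigma> \<mu>) u\<^esub> \<xi> u) < e"
    using k(2) uu by (intro bexI[of _ "t0 f"]) (auto simp: t0_def IH_eq)
qed (rule ind_sections[folded fibre_ind])

text \<open>The action of \<open>x\<close> before completion.\<close>

definition trans :: "'g \<Rightarrow> ('g \<Rightarrow> 'h) \<Rightarrow> 'g \<Rightarrow> 'h"
  where "trans x k = (\<lambda>y \<in> RF (r x). k (iv x \<cdot> y))"

text \<open>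
  The translate of a compact set carrying \<open>k\<close> carries the translate of \<open>k\<close>; it is formed on a
  compact lift to \<open>G\<close>, cut down to the fibre where left multiplication by \<open>x\<close> is defined.
\<close>

lemma trans_closed:
  assumes x: "x \<in> Ar" and k: "k \<in> carrier (PF (d x))"
  shows "trans x k \<in> carrier (PF (r x))"
  unfolding PF_carrier_iff[OF rng_unit[OF x]]
proof (intro conjI)
  have k': "k \<in> extensional (RF (d x))" "equiv_on (RF (d x)) k" "\<exists>C. supported (RF (d x)) k C"
    using k PF_carrier_iff[OF src_unit[OF x]] by blast+
  show "trans x k \<in> extensional (RF (r x))" by (simp add: trans_def)
  let ?X = "subtopology (gtop G) (RF (r x))"
  have tX: "topspace ?X = RF (r x)" by (auto simp: RF_mem)
  have c: "continuous_map ?X (subtopology (gtop G) (RF (d x))) (\<lambda>y. iv x \<cdot> y)"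
    unfolding continuous_map_in_subtopology
  proof
    show "continuous_map ?X (gtop G) (\<lambda>y. iv x \<cdot> y)"
      by (rule cont_mult) (use x in \<open>auto intro: continuous_map_from_subtopology simp: RF_mem\<close>)
  qed (use x in \<open>auto simp: RF_mem\<close>)
  have eq: "equiv_on (RF (r x)) (\<lambda>y. k (iv x \<cdot> y))"
    unfolding equiv_on_def
  proof (intro conjI ballI impI)
    have "asec (subtopology (gtop G) (RF (d x))) d k" using k'(2) by (simp add: equiv_on_def)
    from asec_compose[OF this c] show "asec ?X d (\<lambda>y. k (iv x \<cdot> y))"
      by (rule asec_cong) (use x in \<open>auto simp: RF_mem\<close>)
    fix y h assume "y \<in> RF (r x)" "h \<in> H" "d y = r h"
    then show "k (iv x \<cdot> (y \<cdot> h)) = act \<sigma> (iv h) (k (iv x \<cdot> y))"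
      using equiv_on_act[OF k'(2), of "iv x \<cdot> y" h] x by (simp add: RF_mem assoc)
  qed
  then show "equiv_on (RF (r x)) (trans x k)"
    by (rule equiv_on_cong[OF _ stable_RF]) (use x in \<open>auto simp: trans_def\<close>)
  obtain C where C: "supported (RF (d x)) k C" using k'(3) by blast
  then obtain D where D: "compactin (gtop G) D" "C \<subseteq> co ` D" using compact_lift by (auto simp: supported_def)
  let ?D = "D \<inter> RF (d x)"
  have "compactin (gtop G) ?D"
    using D(1) stable_RF[OF src_unit[OF x]] by (simp add: stable_def compact_Int_closedin)
  then have "compactin (subtopology (gtop G) (RF (d x))) ?D" by (simp add: compactin_subtopology)
  moreover have "continuous_map (subtopology (gtop G) (RF (d x))) (gtop G) (\<lambda>y. x \<cdot> y)"
    by (rule cont_mult) (use x in \<open>auto intro: continuous_map_from_subtopology simp: RF_mem\<close>)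
  ultimately have "compactin (gtop G) ((\<lambda>y. x \<cdot> y) ` ?D)" by (rule image_compactin)
  then have K: "compactin Q (co ` (\<lambda>y. x \<cdot> y) ` ?D)" using cont_coset by (rule image_compactin)
  have "supported (RF (r x)) (trans x k) (co ` (\<lambda>y. x \<cdot> y) ` ?D)"
    unfolding supported_def
  proof (intro conjI ballI impI K)
    fix y assume y: "y \<in> RF (r x)" and nz: "trans x k y \<noteq> \<zero>\<^bsub>fs y\<^esub>"
    have yA: "y \<in> Ar" "r y = r x" using y by (auto simp: RF_mem)
    have z: "iv x \<cdot> y \<in> RF (d x)" "iv x \<cdot> y \<in> Ar" using yA x by (auto simp: RF_mem)
    have "k (iv x \<cdot> y) \<noteq> \<zero>\<^bsub>fs (iv x \<cdot> y)\<^esub>" using nz y yA x by (simp add: trans_def)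
    then have "co (iv x \<cdot> y) \<in> C" using C z by (simp add: supported_def)
    then obtain w where w: "w \<in> D" "co (iv x \<cdot> y) = co w" using D(2) by blast
    have wA: "w \<in> Ar" using w D(1) compactin_subset_topspace by blast
    have "w \<in> RF (d x)" using stable_coset_eq[OF stable_RF z(1) wA w(2)] x by simp
    moreover have "co (x \<cdot> w) = co y"
    proof -
      have "r w = d x" using \<open>w \<in> RF (d x)\<close> by (simp add: RF_mem)
      then have "translate G x (co w) = co (x \<cdot> w)" using x wA by (intro translate_coset) auto
      moreover have "translate G x (co (iv x \<cdot> y)) = co (x \<cdot> (iv x \<cdot> y))" using x z yA by (intro translate_coset) auto
      ultimately show ?thesis using w(2) x yA by simp
    qed
    ultimately show "co y \<in> co ` (\<lambda>y. x \<cdot> y) ` ?D" using w(1) by (metis IntI image_eqI)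
  qed
  then show "\<exists>C. supported (RF (r x)) (trans x k) C" by blast
qed

lemma trans_inverse:
  assumes x: "x \<in> Ar" and k: "k \<in> carrier (PF (d x))"
  shows "trans (iv x) (trans x k) = k"
proof (rule extensionalityI[of _ "RF (d x)"])
  show "trans (iv x) (trans x k) \<in> extensional (RF (d x))" using x by (simp add: trans_def)
  show "k \<in> extensional (RF (d x))" using k by auto
  fix y assume y: "y \<in> RF (d x)"
  then have "y \<in> Ar" "r y = d x" by (auto simp: RF_mem)
  moreover have "iv x \<cdot> (x \<cdot> y) = y" using x calculation by simp
  ultimately show "trans (iv x) (trans x k) y = k y" using x by (simp add: trans_def RF_mem)
qed

lemma trans_bij: "x \<in> Ar \<Longrightarrow> bij_betw (trans x) (carrier (PF (d x))) (carrier (PF (r x)))"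
  using trans_closed[of x] trans_closed[of "iv x"] trans_inverse[of x] trans_inverse[of "iv x"]
  by (intro bij_betwI[where g = "trans (iv x)"]) (auto simp del: PF_simps)

text \<open>
  Invariance of the system of measures, applied to the integrand of the inner product.
\<close>

lemma trans_isometry:
  assumes x: "x \<in> Ar" shows "linear_isometry (PF (d x)) (PF (r x)) (trans x)"
proof (intro linear_isometry.intro linear_isometry_axioms.intro PF_semi_inner)
  show "d x \<in> units G" "r x \<in> units G" using x by auto
  have m: "iv x \<cdot> y \<in> RF (d x)" "d (iv x \<cdot> y) = d y" if "y \<in> RF (r x)" for y
    using x that by (auto simp: RF_mem)
  fix k l z assume k: "k \<in> carrier (PF (d x))"
  show "trans x k \<in> carrier (PF (r x))" by (rule trans_closed[OF x k])
  show "trans x (z \<odot>\<^bsub>PF (d x)\<^esub> k) = z \<odot>\<^bsub>PF (r x)\<^esub> trans x k"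
    unfolding PF_simps trans_def by (rule restrict_ext) (use m in simp)
  assume l: "l \<in> carrier (PF (d x))"
  show "trans x (k \<oplus>\<^bsub>PF (d x)\<^esub> l) = trans x k \<oplus>\<^bsub>PF (r x)\<^esub> trans x l"
    unfolding PF_simps trans_def by (rule restrict_ext) (use m in simp)
  obtain f where f: "f \<in> IF" "trans x k = restrict f (RF (r x))" using trans_closed[OF x k] by auto
  obtain g where g: "g \<in> IF" "trans x l = restrict g (RF (r x))" using trans_closed[OF x l] by auto
  have "hinner (PF (r x)) (trans x k) (trans x l) = (LINT C|\<mu> (r x). IP f g C)"
    unfolding f(2) g(2) PF_simps FI_IP_restrict using x by (intro mf.FI_Cc IP_Cc f g) simp
  also have "\<dots> = (LINT C : coset_range_fibre G H (d x)|\<mu> (d x). IP f g (translate G x C))"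
    using system IP_Cc[OF f(1) g(1)] x unfolding full_equivariant_system_def by metis
  also have "\<dots> = mf.FI (d x) (\<lambda>C. IP f g (translate G x C))"
    by (simp add: mf.FI_def coset_range_fibre_def)
  also have "\<dots> = mf.FI (d x) (IP k l)"
  proof (rule mf.FI_cong)
    fix C assume C: "C \<in> mf.fib (d x)"
    let ?y = "coset_rep C"
    have y: "?y \<in> Ar" "co ?y = C" "r ?y = d x" using C coset_rep[of C] by auto
    have xy: "x \<cdot> ?y \<in> Ar" "x \<cdot> ?y \<in> RF (r x)" "d (x \<cdot> ?y) = d ?y" "iv x \<cdot> (x \<cdot> ?y) = ?y" using x y by (auto simp: RF_mem)
    have "translate G x C = co (x \<cdot> ?y)" using translate_coset[OF x y(1)] y by simp
    then have "IP f g (translate G x C) = hinner (fs (x \<cdot> ?y)) (f (x \<cdot> ?y)) (g (x \<cdot> ?y))"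
      using IP_coset[OF f(1) g(1) xy(1)] by simp
    also have "f (x \<cdot> ?y) = trans x k (x \<cdot> ?y)" using f(2) xy by simp
    also have "g (x \<cdot> ?y) = trans x l (x \<cdot> ?y)" using g(2) xy by simp
    finally show "IP f g (translate G x C) = IP k l C" using xy by (simp add: trans_def IP_def)
  qed
  finally show "hinner (PF (r x)) (trans x k) (trans x l) = hinner (PF (d x)) k l" by simp
qed

lemma act_ind: "act (ind G H \<sigma> \<mu>) x A = (\<lambda>f i. trans x (f i)) ` A"
  by (simp add: ind_def trans_def)

text \<open>
  The image of a whole class under termwise translation is a class again because translation is
  bijective.
\<close>

lemma act_ind_class:
  assumes x: "x \<in> Ar" and s: "s \<in> cauchy_sequences (PF (d x)) (hnorm (PF (d x)))"
  shows "act (ind G H \<sigma> \<mu>) x (limit_class (PF (d x)) s) = limit_class (PF (r x)) (\<lambda>i. trans x (s i))"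
  unfolding act_ind by (rule linear_isometry.image_lc[OF trans_isometry[OF x] trans_bij[OF x] s])

theorem act_ind_unitary:
  assumes x: "x \<in> Ar" shows "unitary_on (IH (d x)) (IH (r x)) (act (ind G H \<sigma> \<mu>) x)"
proof -
  interpret T: linear_isometry "PF (d x)" "PF (r x)" "trans x" by (rule trans_isometry[OF x])
  have u: "unitary_on (IH (d x)) (IH (r x)) (completion_map (PF (r x)) (trans x))"
    unfolding IH_eq
  proof (rule T.completion_map_unitary)
    fix b and e :: real assume b: "b \<in> carrier (PF (r x))" and e: "e > 0"
    then obtain a where "a \<in> carrier (PF (d x))" "trans x a = b" using trans_bij[OF x] by (metis bij_betw_imp_surj_on imageE)
    then show "\<exists>a\<in>carrier (PF (d x)). hnorm (PF (r x)) (b \<ominus>\<^bsub>PF (r x)\<^esub> trans x a) < e"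
      using T.W.norm_minus_self[OF b] e by (intro bexI[of _ a]) (simp_all del: PF_simps)
  qed
  have eq: "completion_map (PF (r x)) (trans x) A = act (ind G H \<sigma> \<mu>) x A" if A: "A \<in> carrier (IH (d x))" for A
  proof -
    obtain s where "s \<in> T.V.cs" "A = limit_class (PF (d x)) s" using A unfolding IH_eq T.V.HC_carrier by blast
    then show ?thesis using act_ind_class[OF x] T.completion_map_lc by simp
  qed
  interpret I: semi_inner "IH (d x)" unfolding IH_eq by (rule T.V.HC_semi_inner)
  show ?thesis
    using u eq unfolding unitary_on_def bounded_linear_on_def
    by (simp add: Pi_iff cong: bij_betw_cong)
qed

end

section \<open>Induced functions are dense in the fibres\<close>

text \<open>
  Riesz representation, by minimising \<open>\<parallel>w\<parallel>\<^sup>2 - 2 Re (l w)\<close>; the parallelogram law makes every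
  minimising sequence Cauchy.
\<close>

lemma Riesz_representation:
  assumes V: "is_hilbert_space V"
    and add: "\<And>a b. \<lbrakk>a \<in> carrier V; b \<in> carrier V\<rbrakk> \<Longrightarrow> l (a \<oplus>\<^bsub>V\<^esub> b) = l a + l b"
    and smult: "\<And>a z. a \<in> carrier V \<Longrightarrow> l (z \<odot>\<^bsub>V\<^esub> a) = z * l a"
    and bound: "\<And>a. a \<in> carrier V \<Longrightarrow> cmod (l a) \<le> M * hnorm V a"
  obtains a where "a \<in> carrier V" "\<And>w. w \<in> carrier V \<Longrightarrow> hinner V w a = l w"
proof -
  interpret V: semi_inner V by (rule hilbert_semi_inner[OF V])
  have lminus: "l (a \<ominus>\<^bsub>V\<^esub> b) = l a - l b" if "a \<in> carrier V" "b \<in> carrier V" for a b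
    using that by (simp add: V.minus_eq_smult add smult)
  define J where "J w = (hnorm V w)\<^sup>2 - 2 * Re (l w)" for w
  have lb: "J w \<ge> - M\<^sup>2" if w: "w \<in> carrier V" for w
  proof -
    have "Re (l w) \<le> M * hnorm V w" using bound[OF w] complex_Re_le_cmod[of "l w"] by linarith
    then have "J w \<ge> (hnorm V w)\<^sup>2 - 2 * (M * hnorm V w)" by (simp add: J_def)
    moreover have "0 \<le> (hnorm V w - M)\<^sup>2" by simp
    ultimately show ?thesis by (simp add: power2_diff algebra_simps)
  qed
  define I where "I = (INF w\<in>carrier V. J w)"
  have bdd: "bdd_below (J ` carrier V)" using lb by (auto intro!: bdd_belowI2)
  have ne: "carrier V \<noteq> {}" using V.zero_closed by blast
  have I_le: "I \<le> J w" if "w \<in> carrier V" for w unfolding I_def by (rule cINF_lower[OF bdd that])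
  have "\<exists>w\<in>carrier V. J w < I + 1 / real (Suc n)" for n
  proof -
    have "I < I + 1 / real (Suc n)" by simp
    then show ?thesis using cINF_less_iff[OF ne bdd] unfolding I_def by blast
  qed
  then obtain w where w: "\<And>n. w n \<in> carrier V" and Jw: "\<And>n. J (w n) < I + 1 / real (Suc n)" by metis
  have par: "(hnorm V (a \<ominus>\<^bsub>V\<^esub> b))\<^sup>2 = 2 * J a + 2 * J b - 4 * J ((1/2) \<odot>\<^bsub>V\<^esub> (a \<oplus>\<^bsub>V\<^esub> b))"
    if "a \<in> carrier V" "b \<in> carrier V" for a b
    using that by (simp add: J_def V.norm_smult add smult power_mult_distrib)
      (simp add: V.norm_sq V.inner_simps power_divide field_simps)
  have close: "(hnorm V (w m \<ominus>\<^bsub>V\<^esub> w n))\<^sup>2 \<le> 4 * (1 / real (Suc N))" if "m \<ge> N" "n \<ge> N" for m n N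
  proof -
    have "(hnorm V (w m \<ominus>\<^bsub>V\<^esub> w n))\<^sup>2 \<le> 2 * (I + 1 / real (Suc m)) + 2 * (I + 1 / real (Suc n)) - 4 * I"
      using par[OF w w, of m n] Jw[of m] Jw[of n] I_le[of "(1/2) \<odot>\<^bsub>V\<^esub> (w m \<oplus>\<^bsub>V\<^esub> w n)"] w by simp
    moreover have "1 / real (Suc m) \<le> 1 / real (Suc N)" "1 / real (Suc n) \<le> 1 / real (Suc N)"
      using that by (simp_all add: frac_le)
    moreover have "x \<le> 4 * c" if "x \<le> 2 * (I + a) + 2 * (I + b) - 4 * I" "a \<le> c" "b \<le> c" for x a b c :: real
    proof -
      have "x \<le> 2 * a + 2 * b" using that(1) by (simp add: algebra_simps)
      then show ?thesis using that(2,3) by simp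
    qed
    ultimately show ?thesis by blast
  qed
  have "w \<in> cauchy_sequences V (hnorm V)"
    unfolding cauchy_sequences_def
  proof (intro CollectI conjI allI impI w)
    fix e :: real assume e: "e > 0"
    obtain N where N: "4 / e\<^sup>2 < real N" using reals_Archimedean2 by blast
    have "hnorm V (w i \<ominus>\<^bsub>V\<^esub> w j) < e" if "i \<ge> N" "j \<ge> N" for i j
    proof -
      have "4 / real (Suc N) < e\<^sup>2"
        using N e by (simp add: field_simps) (smt (verit) mult_pos_pos zero_less_power2)
      then have "(hnorm V (w i \<ominus>\<^bsub>V\<^esub> w j))\<^sup>2 < e\<^sup>2" using close[OF that] by simp
      then show ?thesis using e by (simp add: power2_less_imp_less)
    qed
    then show "\<exists>N. \<forall>i\<ge>N. \<forall>j\<ge>N. hnorm V (w i \<ominus>\<^bsub>V\<^esub> w j) < e" by blast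
  qed
  then obtain a where a: "a \<in> carrier V" "(\<lambda>i. hnorm V (w i \<ominus>\<^bsub>V\<^esub> a)) \<longlonglongrightarrow> 0"
    using V unfolding is_hilbert_space_def by blast
  have n1: "(\<lambda>i. hnorm V (w i)) \<longlonglongrightarrow> hnorm V a"
  proof (rule LIM_zero_cancel, rule Lim_null_comparison[OF _ a(2)])
    show "\<forall>\<^sub>F i in sequentially. norm (hnorm V (w i) - hnorm V a) \<le> hnorm V (w i \<ominus>\<^bsub>V\<^esub> a)"
      using V.norm_diff_le[OF w a(1)] by simp
  qed
  have l1: "(\<lambda>i. l (w i)) \<longlonglongrightarrow> l a"
  proof (rule LIM_zero_cancel, rule Lim_null_comparison)
    show "\<forall>\<^sub>F i in sequentially. norm (l (w i) - l a) \<le> M * hnorm V (w i \<ominus>\<^bsub>V\<^esub> a)"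
      using bound[OF V.minus_closed[OF w a(1)]] lminus[OF w a(1)] by simp
    show "(\<lambda>i. M * hnorm V (w i \<ominus>\<^bsub>V\<^esub> a)) \<longlonglongrightarrow> 0" using tendsto_mult[OF tendsto_const a(2), of M] by simp
  qed
  have "(\<lambda>i. J (w i)) \<longlonglongrightarrow> J a" unfolding J_def by (intro tendsto_intros n1 l1)
  moreover have "(\<lambda>i. I + 1 / real (Suc i)) \<longlonglongrightarrow> I + 0"
    by (intro tendsto_intros) (use LIMSEQ_inverse_real_of_nat in \<open>simp add: inverse_eq_divide\<close>)
  ultimately have "J a \<le> I + 0" by (rule LIMSEQ_le) (use Jw less_imp_le in blast)
  then have min: "J a \<le> J v" if "v \<in> carrier V" for v using I_le[OF that] by simp
  have "hinner V v a = l v" if v: "v \<in> carrier V" for v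
  proof (rule ccontr)
    assume ne: "hinner V v a \<noteq> l v"
    define z where "z = hinner V v a - l v"
    define B where "B = (hnorm V v)\<^sup>2"
    define s where "s = 1 / (1 + B)"
    have B: "B \<ge> 0" by (simp add: B_def)
    have s: "s > 0" "s * B < 1" using B by (auto simp: s_def field_simps)
    let ?t = "complex_of_real s * cnj z"
    have J: "J (a \<ominus>\<^bsub>V\<^esub> t \<odot>\<^bsub>V\<^esub> v) = J a - 2 * Re (t * z) + (cmod t)\<^sup>2 * B" for t
    proof -
      have "Re (cnj t * hinner V a v) = Re (t * hinner V v a)" using V.inner_cnj[OF v a(1)] by simp
      then show ?thesis
        unfolding J_def V.norm_minus_sq[OF a(1) v] lminus[OF a(1) V.smult_closed[OF v]] smult[OF v] z_def B_def
        by (simp add: algebra_simps)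
    qed
    have "Re (?t * z) = s * (cmod z)\<^sup>2" by (simp add: cmod_power2) (simp add: power2_eq_square algebra_simps)
    moreover have "(cmod ?t)\<^sup>2 = s\<^sup>2 * (cmod z)\<^sup>2" by (simp add: norm_mult power_mult_distrib)
    ultimately have "J (a \<ominus>\<^bsub>V\<^esub> ?t \<odot>\<^bsub>V\<^esub> v) = J a - s * (cmod z)\<^sup>2 * (2 - s * B)"
      unfolding J by (simp add: power2_eq_square algebra_simps)
    moreover have "s * (cmod z)\<^sup>2 * (2 - s * B) > 0" using s ne by (simp add: z_def)
    ultimately show False using min[of "a \<ominus>\<^bsub>V\<^esub> ?t \<odot>\<^bsub>V\<^esub> v"] a v by simp
  qed
  then show ?thesis using a that by blast
qed

lemma (in measure_field) FI_bound_fibre_fun: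
  assumes u: "u \<in> topspace B" and g: "fibre_fun u g" and b: "fibre_fun u b"
    and le: "\<And>y. y \<in> fib u \<Longrightarrow> cmod (g y) \<le> Re (b y)" "\<And>y. y \<in> fib u \<Longrightarrow> Im (b y) = 0"
  shows "cmod (FI u g) \<le> Re (FI u b)"
proof -
  obtain f where f: "f \<in> Cc Y" "\<And>y. y \<in> fib u \<Longrightarrow> f y = b y" using fibre_fun_extend[OF u b] by metis
  have fc: "continuous_map Y euclidean f" using f(1) by (simp add: Cc_def)
  have cf: "(\<lambda>y. complex_of_real (cmod (f y))) \<in> Cc Y"
    using f(1) continuous_map_unop[OF fc, of "\<lambda>z. complex_of_real (cmod z)"]
    unfolding Cc_iff[OF lchs] by (auto intro!: continuous_intros)
  have "cmod (FI u g) \<le> Re (LINT y|\<nu> u. complex_of_real (cmod (f y)))"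
  proof (rule FI_bound[OF u g cf])
    fix y assume y: "y \<in> fib u"
    show "cmod (g y) \<le> cmod (f y)"
      using le(1)[OF y] f(2)[OF y] complex_Re_le_cmod[of "b y"] by simp
  qed
  also have "(LINT y|\<nu> u. complex_of_real (cmod (f y))) = FI u (\<lambda>y. complex_of_real (cmod (f y)))"
    by (rule FI_Cc[OF u cf, symmetric])
  also have "\<dots> = FI u b"
  proof (rule FI_cong)
    fix y assume y: "y \<in> fib u"
    have "Re (b y) \<ge> 0" using le(1)[OF y] norm_ge_zero order_trans by blast
    then have "cmod (b y) = Re (b y)" using le(2)[OF y] by (simp add: cmod_def)
    then show "complex_of_real (cmod (f y)) = b y"
      unfolding f(2)[OF y] using le(2)[OF y] by (simp add: complex_eq_iff)
  qed
  finally show ?thesis .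
qed

lemma (in top_groupoid) lchs_unit_space: "lchs (unit_space G)"
proof -
  have "units G = {x \<in> topspace (gtop G). r x = x}"
  proof (intro equalityI subsetI)
    show "x \<in> units G" if "x \<in> {x \<in> topspace (gtop G). r x = x}" for x using that rng_unit[of x] by simp
  qed (use unitE in auto)
  moreover have "closedin (gtop G) {x \<in> topspace (gtop G). r x = x}"
    using lchs_gtop by (intro closedin_continuous_maps_eq[OF _ cont_rng continuous_map_id[unfolded id_def]]) (simp add: lchs_def)
  ultimately show ?thesis unfolding unit_space_def using lchs_closed_subspace[OF lchs_gtop] by simp
qed

text \<open>
  The pairs with equal ranges form a closed subset of the compact product, on which the quotient
  is continuous.
\<close>

lemma (in top_groupoid) compact_quotients:
  assumes N: "compactin (gtop G) N" and D: "compactin (gtop G) D"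
  obtains L where "compactin (gtop G) L" "\<And>a b. \<lbrakk>a \<in> N; b \<in> D; r a = r b\<rbrakk> \<Longrightarrow> iv a \<cdot> b \<in> L"
proof -
  let ?P = "prod_topology (gtop G) (gtop G)"
  let ?E = "{z \<in> topspace ?P. r (fst z) = r (snd z)}"
  have c: "continuous_map ?P (gtop G) (\<lambda>z. r (fst z))" "continuous_map ?P (gtop G) (\<lambda>z. r (snd z))"
    using continuous_map_compose[OF continuous_map_fst cont_rng] continuous_map_compose[OF continuous_map_snd cont_rng]
    by (simp_all add: o_def)
  have "closedin ?P ?E" using lchs_gtop by (intro closedin_continuous_maps_eq[OF _ c]) (simp add: lchs_def)
  moreover have "compactin ?P (N \<times> D)" using N D by (simp add: compactin_Times)
  ultimately have K: "compactin ?P ((N \<times> D) \<inter> ?E)" by (rule compact_Int_closedin[rotated])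
  then have K': "compactin (subtopology ?P ?E) ((N \<times> D) \<inter> ?E)" by (simp add: compactin_subtopology)
  have m: "continuous_map (subtopology ?P ?E) (gtop G) (\<lambda>z. iv (fst z) \<cdot> snd z)"
  proof (rule cont_mult)
    show "continuous_map (subtopology ?P ?E) (gtop G) (\<lambda>z. iv (fst z))"
      using continuous_map_compose[OF continuous_map_fst cont_inv] by (auto simp: o_def intro: continuous_map_from_subtopology)
    show "continuous_map (subtopology ?P ?E) (gtop G) snd" by (intro continuous_map_from_subtopology continuous_map_snd)
  qed auto
  show ?thesis
  proof
    show "compactin (gtop G) ((\<lambda>z. iv (fst z) \<cdot> snd z) ` ((N \<times> D) \<inter> ?E))" by (rule image_compactin[OF K' m])
    fix a b assume ab: "a \<in> N" "b \<in> D" "r a = r b"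
    then have "(a, b) \<in> (N \<times> D) \<inter> ?E"
      using compactin_subset_topspace[OF N] compactin_subset_topspace[OF D] by auto
    then show "iv a \<cdot> b \<in> (\<lambda>z. iv (fst z) \<cdot> snd z) ` ((N \<times> D) \<inter> ?E)" by (auto intro!: image_eqI[of _ _ "(a, b)"])
  qed
qed

locale haar_representation = open_pair G H for G :: "'g groupoid" and H :: "'g set" +
  fixes lam :: "'g \<Rightarrow> 'g measure" and \<sigma> :: "('g, 'h) representation"
  assumes haar: "haar_system (sub_groupoid G H) lam"
    and rep: "continuous_unitary_representation (sub_groupoid G H) \<sigma>"
begin

sublocale unitary_action G H \<sigma>
proof
  show "continuous_hilbert_bundle (unit_space G) \<sigma>"
    using rep by (simp add: continuous_unitary_representation_def)
  show "unitary_on (fibre \<sigma> (d h)) (fibre \<sigma> (r h)) (act \<sigma> h)" if "h \<in> H" for h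
    using rep that by (simp add: continuous_unitary_representation_def)
qed

abbreviation "HT \<equiv> subtopology (gtop G) H"

sublocale S: top_groupoid "sub_groupoid G H" by (rule top_groupoid_sub)

sublocale hf: measure_field HT "unit_space G" r lam
  using S.haar_measure_field[OF haar] by simp

lemma act_unit: "\<lbrakk>u \<in> units G; v \<in> carrier (fb u)\<rbrakk> \<Longrightarrow> act \<sigma> u v = v"
  using rep by (simp add: continuous_unitary_representation_def)

lemma act_act: "\<lbrakk>h \<in> H; k \<in> H; d h = r k; v \<in> carrier (fs k)\<rbrakk> \<Longrightarrow> act \<sigma> h (act \<sigma> k v) = act \<sigma> (h \<cdot> k) v"
  using rep H_sub by (auto simp: continuous_unitary_representation_def composable_def)

lemma act_adjoint:
  assumes h: "h \<in> H" and v: "v \<in> carrier (fs h)" and w: "w \<in> carrier (fb (r h))"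
  shows "hinner (fb (r h)) (act \<sigma> h v) w = hinner (fs h) v (act \<sigma> (iv h) w)"
proof -
  have w': "act \<sigma> (iv h) w \<in> carrier (fs h)" using act_closed[of "iv h" w] h w by simp
  have "act \<sigma> h (act \<sigma> (iv h) w) = w"
    using act_act[of h "iv h" w] act_unit[of "r h" w] h w by (simp add: rng_def[symmetric])
  then show ?thesis using act_inner[OF h v w'] by simp
qed

lemma HT_top [simp]: "topspace HT = H" using H_sub by auto

text \<open>
  Continuity of a representation is given for sections vanishing at infinity; cutting off makes it
  available for arbitrary sections.
\<close>

lemma cutoff_C0:
  assumes b: "b \<in> Cc (unit_space G)" and \<xi>: "\<xi> \<in> sections \<sigma>"
  shows "(\<lambda>u\<in>units G. b u \<odot>\<^bsub>fb u\<^esub> \<xi> u) \<in> sections \<sigma> \<inter> C0_sections (unit_space G) \<sigma>"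
proof -
  let ?x = "\<lambda>u\<in>units G. b u \<odot>\<^bsub>fb u\<^esub> \<xi> u"
  have bc: "continuous_map (unit_space G) euclidean b" using b by (simp add: Cc_def)
  have s: "?x \<in> sections \<sigma>" using section_scale[OF bc \<xi>] by simp
  obtain C where C: "compactin (unit_space G) C" "\<forall>u\<in>units G. b u \<noteq> 0 \<longrightarrow> u \<in> C"
    using b unfolding Cc_iff[OF lchs_unit_space] by auto
  have "continuous_map (unit_space G) (total_space (unit_space G) \<sigma>) (\<lambda>u. (u, ?x u))"
    unfolding continuous_total_iff by (rule asec_section[OF continuous_map_id[unfolded id_def] s])
  moreover have "nm u (?x u) < e" if "u \<in> units G - C" "e > 0" for u e
  proof -
    have "b u = 0" using C that by blast
    then show ?thesis using that semi_inner.zero_smult[OF fibre_inner section_mem[OF \<xi>]]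
        semi_inner.norm_zero[OF fibre_inner] by simp
  qed
  ultimately have "?x \<in> C0_sections (unit_space G) \<sigma>" using C(1) unfolding C0_sections_def by auto
  then show ?thesis using s by blast
qed

text \<open>
  Near a given arrow, \<open>\<eta>\<close> may be multiplied by a bump function equal to one there.
\<close>

lemma weak_continuity:
  assumes \<xi>: "\<xi> \<in> sections \<sigma> \<inter> C0_sections (unit_space G) \<sigma>" and \<eta>: "\<eta> \<in> sections \<sigma>"
  shows "continuous_map HT euclidean (\<lambda>k. hinner (fb (r k)) (act \<sigma> k (\<xi> (d k))) (\<eta> (r k)))"
  unfolding continuous_map_euclidean_iff
proof (intro ballI allI impI)
  fix k0 and e :: real assume k0: "k0 \<in> topspace HT" and e: "e > 0"
  have k0H: "k0 \<in> H" using k0 by simp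
  have "compactin (unit_space G) {r k0}" using k0H by simp
  then obtain V D where V: "openin (unit_space G) V" "compactin (unit_space G) D" "{r k0} \<subseteq> V" "V \<subseteq> D" "D \<subseteq> topspace (unit_space G)"
    by (rule compact_neighbourhood[OF lchs_unit_space _ openin_topspace]) (use k0H in auto)
  obtain b :: "'g \<Rightarrow> real" and D' where b: "continuous_map (unit_space G) euclidean b" "\<And>u. u \<in> D \<Longrightarrow> b u = 1"
    "compactin (unit_space G) D'" "\<And>u. b u \<noteq> 0 \<Longrightarrow> u \<in> D'"
    using bump_function[OF lchs_unit_space V(2) openin_topspace V(5)] by metis
  have "(\<lambda>u. complex_of_real (b u)) \<in> Cc (unit_space G)"
    unfolding Cc_iff[OF lchs_unit_space] using b continuous_map_unop[OF b(1), of complex_of_real]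
    by (auto intro!: continuous_intros)
  then have z: "(\<lambda>u\<in>units G. complex_of_real (b u) \<odot>\<^bsub>fb u\<^esub> \<eta> u) \<in> C0_sections (unit_space G) \<sigma>" (is "?z \<in> _")
    using cutoff_C0 \<eta> by blast
  have wc: "continuous_map HT euclidean (\<lambda>k. hinner (fb (r k)) (act \<sigma> k (\<alpha> (d k))) (\<beta> (r k)))"
    if "\<alpha> \<in> C0_sections (unit_space G) \<sigma>" "\<beta> \<in> C0_sections (unit_space G) \<sigma>" for \<alpha> \<beta>
    using rep that by (simp add: continuous_unitary_representation_def)
  have c: "continuous_map HT euclidean (\<lambda>k. hinner (fb (r k)) (act \<sigma> k (\<xi> (d k))) (?z (r k)))"
    using wc[OF _ z] \<xi> by blast
  obtain U where U: "openin HT U" "k0 \<in> U" "\<And>k. k \<in> U \<Longrightarrow>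
      dist (hinner (fb (r k0)) (act \<sigma> k0 (\<xi> (d k0))) (?z (r k0))) (hinner (fb (r k)) (act \<sigma> k (\<xi> (d k))) (?z (r k))) < e"
    using continuous_map_nbhd[OF c k0 e] by blast
  have eq: "?z (r k) = \<eta> (r k)" if "k \<in> H" "r k \<in> V" for k
  proof -
    interpret F: semi_inner "fb (r k)" using fibre_inner that by simp
    interpret M: module complex_ring "fb (r k)" by (rule F.mod)
    have "b (r k) = 1" using b(2) V(4) that by blast
    then show ?thesis using that M.smult_one[OF section_mem[OF \<eta>]] by simp
  qed
  let ?W = "{k \<in> topspace HT. r k \<in> V}"
  have "continuous_map HT (unit_space G) r" by (rule continuous_map_from_subtopology[OF cont_rng_unit])
  then have "openin HT ?W" using V(1) by (rule openin_continuous_map_preimage)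
  moreover have "dist (hinner (fb (r k0)) (act \<sigma> k0 (\<xi> (d k0))) (\<eta> (r k0))) (hinner (fb (r k)) (act \<sigma> k (\<xi> (d k))) (\<eta> (r k))) < e"
    if k: "k \<in> U \<inter> ?W" for k
  proof -
    have "?z (r k0) = \<eta> (r k0)" "?z (r k) = \<eta> (r k)" using eq k k0H V(3) by auto
    then show ?thesis using U(3)[of k] k by simp
  qed
  ultimately show "\<exists>U. openin HT U \<and> k0 \<in> U \<and> (\<forall>k\<in>U.
      dist (hinner (fb (r k0)) (act \<sigma> k0 (\<xi> (d k0))) (\<eta> (r k0))) (hinner (fb (r k)) (act \<sigma> k (\<xi> (d k))) (\<eta> (r k))) < e)"
    using U(1,2) V(3) k0 by (intro exI[of _ "U \<inter> ?W"]) auto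
qed

end

text \<open>
  The average of \<open>\<phi>(x k) \<sigma>(k) \<xi>(d(k))\<close> over \<open>k\<close> with respect to the Haar system is equivariant in
  \<open>x\<close> by invariance of the Haar system. The integral is taken weakly, the vector being obtained
  from the Riesz representation.
\<close>

locale averaging = haar_representation G H lam \<sigma>
  for G :: "'g groupoid" and H lam and \<sigma> :: "('g, 'h) representation" +
  fixes \<phi> :: "'g \<Rightarrow> complex" and \<xi> :: "'g \<Rightarrow> 'h"
  assumes \<phi>: "\<phi> \<in> Cc (gtop G)" and \<xi>: "\<xi> \<in> sections \<sigma> \<inter> C0_sections (unit_space G) \<sigma>"
    and \<xi>_bounded: "\<exists>M. \<forall>u\<in>units G. nm u (\<xi> u) \<le> M"
begin

definition integrand :: "'g \<Rightarrow> 'h \<Rightarrow> 'g \<Rightarrow> complex"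
  where "integrand x w k = \<phi> (x \<cdot> k) * hinner (fb (r k)) (act \<sigma> k (\<xi> (d k))) w"

lemma \<xi>_mem: "u \<in> units G \<Longrightarrow> \<xi> u \<in> carrier (fb u)" using section_mem \<xi> by simp

lemma \<phi>_cont: "continuous_map (gtop G) euclidean \<phi>" using \<phi> by (simp add: Cc_def)

lemma act_\<xi>: "k \<in> H \<Longrightarrow> act \<sigma> k (\<xi> (d k)) \<in> carrier (fb (r k))"
  by (rule act_closed) (auto intro: \<xi>_mem)

lemma kernel_support:
  assumes N: "compactin (gtop G) N"
  obtains L where "compactin HT L" "\<And>x k. \<lbrakk>x \<in> N; k \<in> H; d x = r k; \<phi> (x \<cdot> k) \<noteq> 0\<rbrakk> \<Longrightarrow> k \<in> L"
proof -
  obtain D where D: "compactin (gtop G) D" "\<forall>z\<in>Ar. \<phi> z \<noteq> 0 \<longrightarrow> z \<in> D"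
    using \<phi> unfolding Cc_iff[OF lchs_gtop] by blast
  obtain L where L: "compactin (gtop G) L" "\<And>a b. \<lbrakk>a \<in> N; b \<in> D; r a = r b\<rbrakk> \<Longrightarrow> iv a \<cdot> b \<in> L"
    using compact_quotients[OF N D(1)] by metis
  show ?thesis
  proof
    show "compactin HT (L \<inter> H)" using compact_Int_closedin[OF L(1) H_closed] by (simp add: compactin_subtopology)
    fix x k assume xk: "x \<in> N" "k \<in> H" "d x = r k" "\<phi> (x \<cdot> k) \<noteq> 0"
    have x: "x \<in> Ar" using xk(1) compactin_subset_topspace[OF N] by blast
    have "iv x \<cdot> (x \<cdot> k) \<in> L" using L(2)[of x "x \<cdot> k"] D(2) xk x by simp
    then show "k \<in> L \<inter> H" using xk x by simp
  qed
qed

lemma cont_\<phi>_mult: 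
  "continuous_map (subtopology (prod_topology (gtop G) HT) {(x, k). d x = r k}) euclidean (\<lambda>(x, k). \<phi> (x \<cdot> k))"
proof -
  let ?P = "subtopology (prod_topology (gtop G) HT) {(x, k). d x = r k}"
  have "continuous_map ?P HT snd" by (intro continuous_map_from_subtopology continuous_map_snd)
  then have s: "continuous_map ?P (gtop G) snd" by (simp add: continuous_map_in_subtopology)
  have f: "continuous_map ?P (gtop G) fst" by (intro continuous_map_from_subtopology continuous_map_fst)
  have "continuous_map ?P (gtop G) (\<lambda>z. fst z \<cdot> snd z)" by (rule cont_mult[OF f s]) auto
  from continuous_map_compose[OF this \<phi>_cont] show ?thesis by (simp add: o_def case_prod_unfold)
qed

lemma param_support:
  assumes "x0 \<in> Ar" and \<Psi>: "\<And>x k. \<lbrakk>x \<in> Ar; k \<in> H; r k = d x; \<phi> (x \<cdot> k) = 0\<rbrakk> \<Longrightarrow> \<Psi> x k = (0::complex)"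
  shows "\<exists>U C. openin (gtop G) U \<and> x0 \<in> U \<and> compactin HT C \<and> (\<forall>x\<in>U. \<forall>y\<in>hf.fib (d x). \<Psi> x y \<noteq> 0 \<longrightarrow> y \<in> C)"
proof -
  obtain U N where U: "openin (gtop G) U" "compactin (gtop G) N" "x0 \<in> U" "U \<subseteq> N"
    using lchs_gtop assms(1) by (auto simp: lchs_def locally_compact_space_def)
  obtain L where L: "compactin HT L" "\<And>x k. \<lbrakk>x \<in> N; k \<in> H; d x = r k; \<phi> (x \<cdot> k) \<noteq> 0\<rbrakk> \<Longrightarrow> k \<in> L"
    using kernel_support[OF U(2)] by metis
  have "y \<in> L" if "x \<in> U" "y \<in> hf.fib (d x)" "\<Psi> x y \<noteq> 0" for x y
    using L(2)[of x y] \<Psi>[of x y] that U(4) openin_subset[OF U(1)] by auto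
  then show ?thesis using U L(1) by blast
qed

lemma integrand_section:
  assumes \<eta>: "\<eta> \<in> sections \<sigma>"
  shows "continuous_map (gtop G) euclidean (\<lambda>x. hf.FI (d x) (integrand x (\<eta> (d x))))"
    and "x \<in> Ar \<Longrightarrow> hf.fibre_fun (d x) (integrand x (\<eta> (d x)))"
proof -
  let ?\<Psi> = "\<lambda>x k. \<phi> (x \<cdot> k) * hinner (fb (r k)) (act \<sigma> k (\<xi> (d k))) (\<eta> (r k))"
  let ?P = "subtopology (prod_topology (gtop G) HT) {(x, k). d x = r k}"
  have s: "continuous_map ?P HT snd" by (intro continuous_map_from_subtopology continuous_map_snd)
  have "continuous_map ?P euclidean (\<lambda>z. hinner (fb (r (snd z))) (act \<sigma> (snd z) (\<xi> (d (snd z)))) (\<eta> (r (snd z))))"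
    using continuous_map_compose[OF s weak_continuity[OF \<xi> \<eta>]] by (simp add: o_def)
  then have c: "continuous_map ?P euclidean (\<lambda>(x, k). ?\<Psi> x k)"
    using cont_\<phi>_mult unfolding case_prod_unfold by (rule continuous_map_complex_mult[rotated])
  have supp: "\<exists>U C. openin (gtop G) U \<and> x0 \<in> U \<and> compactin HT C \<and> (\<forall>x\<in>U. \<forall>y\<in>hf.fib (d x). ?\<Psi> x y \<noteq> 0 \<longrightarrow> y \<in> C)"
    if "x0 \<in> topspace (gtop G)" for x0
    using that by (intro param_support) auto
  note p = hf.param_integral[OF cont_src_unit c supp]
  have eq: "hf.FI (d x) (?\<Psi> x) = hf.FI (d x) (integrand x (\<eta> (d x)))" for x
    by (rule hf.FI_cong) (simp add: integrand_def)
  show "continuous_map (gtop G) euclidean (\<lambda>x. hf.FI (d x) (integrand x (\<eta> (d x))))"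
    using p(1) by (simp add: eq)
  show "x \<in> Ar \<Longrightarrow> hf.fibre_fun (d x) (integrand x (\<eta> (d x)))"
    using p(2)[of x] by (auto elim!: hf.fibre_fun_cong simp: integrand_def)
qed

lemma abs_kernel_fibre_fun:
  assumes x: "x \<in> Ar" shows "hf.fibre_fun (d x) (\<lambda>k. complex_of_real (c * cmod (\<phi> (x \<cdot> k))))"
proof -
  have "continuous_map (subtopology (prod_topology (gtop G) HT) {(x, k). d x = r k}) euclidean (\<lambda>z. complex_of_real (c * cmod ((\<lambda>(x, k). \<phi> (x \<cdot> k)) z)))"
    by (rule continuous_map_unop[OF cont_\<phi>_mult]) (intro continuous_intros)
  then have "continuous_map (subtopology (prod_topology (gtop G) HT) {(x, k). d x = r k}) euclidean (\<lambda>(x, k). complex_of_real (c * cmod (\<phi> (x \<cdot> k))))"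
    by (simp add: case_prod_unfold)
  note c = this
  have supp: "\<exists>U C. openin (gtop G) U \<and> x0 \<in> U \<and> compactin HT C \<and>
      (\<forall>x\<in>U. \<forall>y\<in>hf.fib (d x). complex_of_real (c * cmod (\<phi> (x \<cdot> y))) \<noteq> 0 \<longrightarrow> y \<in> C)"
    if "x0 \<in> topspace (gtop G)" for x0
    using that by (intro param_support) auto
  show ?thesis using hf.param_integral(2)[OF cont_src_unit c supp, of x] x by simp
qed

text \<open>
  Continuity is known when \<open>w\<close> is the value of a section. Other \<open>w\<close> are limits of such values, and
  the bounds on \<open>\<phi>\<close> and \<open>\<xi>\<close> make the convergence of the integrands uniform.
\<close>

lemma integrand_fibre_fun:
  assumes x: "x \<in> Ar" and w: "w \<in> carrier (fs x)"
  shows "hf.fibre_fun (d x) (integrand x w)"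
proof -
  obtain M where M: "\<And>u. u \<in> units G \<Longrightarrow> nm u (\<xi> u) \<le> M" using \<xi>_bounded by blast
  have xx: "compactin (gtop G) {x}" using x by simp
  obtain L where L: "compactin HT L" "\<And>k. \<lbrakk>k \<in> H; d x = r k; \<phi> (x \<cdot> k) \<noteq> 0\<rbrakk> \<Longrightarrow> k \<in> L"
    using kernel_support[OF xx] by (metis singletonI)
  obtain P where P: "P \<ge> 0" "\<And>z. z \<in> Ar \<Longrightarrow> cmod (\<phi> z) \<le> P" using Cc_bounded[OF lchs_gtop \<phi>] by metis
  interpret F: semi_inner "fs x" by (rule fs_inner[OF x])
  let ?X = "subtopology HT (hf.fib (d x))"
  have "continuous_map ?X euclidean (integrand x w)"
    unfolding continuous_map_euclidean_iff
  proof (intro ballI allI impI)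
    fix k0 and e :: real assume k0: "k0 \<in> topspace ?X" and e: "e > 0"
    define A where "A = P * \<bar>M\<bar> + 1"
    have A: "A > 0" using P by (simp add: A_def add_nonneg_pos)
    obtain \<eta> where \<eta>: "\<eta> \<in> sections \<sigma>" "nm (d x) (w \<ominus>\<^bsub>fs x\<^esub> \<eta> (d x)) < e / (3 * A)"
      using section_dense[of "d x" w "e / (3 * A)"] x w e A by auto
    have \<eta>m: "\<eta> (d x) \<in> carrier (fs x)" using section_mem[OF \<eta>(1)] x by simp
    have close: "cmod (integrand x w k - integrand x (\<eta> (d x)) k) < e / 3" if k: "k \<in> H" "r k = d x" for k
    proof -
      let ?a = "act \<sigma> k (\<xi> (d k))"
      have a: "?a \<in> carrier (fs x)" using act_\<xi>[OF k(1)] k(2) by simp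
      have na: "nm (d x) ?a \<le> \<bar>M\<bar>"
        using act_norm[OF k(1) \<xi>_mem] M[of "d k"] k by auto
      have "integrand x w k - integrand x (\<eta> (d x)) k = \<phi> (x \<cdot> k) * hinner (fs x) ?a (w \<ominus>\<^bsub>fs x\<^esub> \<eta> (d x))"
        using k by (simp add: integrand_def F.inner_minus(2)[OF w \<eta>m a] right_diff_distrib)
      then have "cmod (integrand x w k - integrand x (\<eta> (d x)) k) \<le> P * (\<bar>M\<bar> * nm (d x) (w \<ominus>\<^bsub>fs x\<^esub> \<eta> (d x)))"
        using P k x F.Cauchy_Schwarz[OF a F.minus_closed[OF w \<eta>m]] na F.norm_ge0[OF a] F.norm_ge0[OF F.minus_closed[OF w \<eta>m]]
        by (auto simp: norm_mult intro!: mult_mono order_trans[OF F.Cauchy_Schwarz[OF a F.minus_closed[OF w \<eta>m]]])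
      also have "\<dots> \<le> A * nm (d x) (w \<ominus>\<^bsub>fs x\<^esub> \<eta> (d x))"
        using F.norm_ge0[OF F.minus_closed[OF w \<eta>m]] by (simp add: A_def distrib_right)
      also have "\<dots> < A * (e / (3 * A))" using \<eta>(2) A by (intro mult_strict_left_mono)
      finally show ?thesis using A by simp
    qed
    have c: "continuous_map ?X euclidean (integrand x (\<eta> (d x)))"
      using integrand_section(2)[OF \<eta>(1) x] by (simp add: hf.fibre_fun_def)
    obtain U where U: "openin ?X U" "k0 \<in> U" "\<And>k. k \<in> U \<Longrightarrow> dist (integrand x (\<eta> (d x)) k0) (integrand x (\<eta> (d x)) k) < e / 3"
      using continuous_map_nbhd[OF c k0, of "e / 3"] e by auto
    have "dist (integrand x w k0) (integrand x w k) < e" if k: "k \<in> U" for k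
    proof -
      have "k \<in> topspace ?X" using openin_subset[OF U(1)] k by blast
      then have "dist (integrand x w k) (integrand x (\<eta> (d x)) k) < e / 3" "dist (integrand x w k0) (integrand x (\<eta> (d x)) k0) < e / 3"
        using close[of k] close[of k0] k0 by (auto simp: dist_norm)
      then show ?thesis
        using U(3)[OF k] dist_triangle[of "integrand x w k0" "integrand x w k" "integrand x (\<eta> (d x)) k0"]
          dist_triangle[of "integrand x (\<eta> (d x)) k0" "integrand x w k" "integrand x (\<eta> (d x)) k"]
          dist_commute[of "integrand x w k" "integrand x (\<eta> (d x)) k"] by linarith
    qed
    then show "\<exists>U. openin ?X U \<and> k0 \<in> U \<and> (\<forall>k\<in>U. dist (integrand x w k0) (integrand x w k) < e)" using U by blast
  qed
  moreover have "\<forall>k\<in>hf.fib (d x). integrand x w k \<noteq> 0 \<longrightarrow> k \<in> L" using L(2) by (auto simp: integrand_def)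
  ultimately show ?thesis using L(1) by (auto simp: hf.fibre_fun_def)
qed

lemma average_exists:
  assumes x: "x \<in> Ar"
  shows "\<exists>a\<in>carrier (fs x). \<forall>w\<in>carrier (fs x). hinner (fs x) a w = hf.FI (d x) (integrand x w)"
proof -
  obtain M where M: "\<And>u. u \<in> units G \<Longrightarrow> nm u (\<xi> u) \<le> M" using \<xi>_bounded by blast
  interpret F: semi_inner "fs x" by (rule fs_inner[OF x])
  have u: "d x \<in> topspace (unit_space G)" using x by simp
  let ?l = "\<lambda>w. cnj (hf.FI (d x) (integrand x w))"
  have a: "act \<sigma> k (\<xi> (d k)) \<in> carrier (fs x)" if "k \<in> hf.fib (d x)" for k
    using act_\<xi>[of k] that by auto
  obtain a where a: "a \<in> carrier (fs x)" "\<And>w. w \<in> carrier (fs x) \<Longrightarrow> hinner (fs x) w a = ?l w"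
  proof (rule Riesz_representation[OF fs_hilbert[OF x]])
    fix w assume w: "w \<in> carrier (fs x)"
    show "?l (z \<odot>\<^bsub>fs x\<^esub> w) = z * ?l w" for z
    proof -
      have "hf.FI (d x) (integrand x (z \<odot>\<^bsub>fs x\<^esub> w)) = hf.FI (d x) (\<lambda>k. cnj z * integrand x w k)"
        using a w by (intro hf.FI_cong) (simp add: integrand_def F.inner_smult_right)
      then show ?thesis by (simp add: hf.FI_scale)
    qed
    show "?l (w \<oplus>\<^bsub>fs x\<^esub> w') = ?l w + ?l w'" if w': "w' \<in> carrier (fs x)" for w'
    proof -
      have "hf.FI (d x) (integrand x (w \<oplus>\<^bsub>fs x\<^esub> w')) = hf.FI (d x) (\<lambda>k. integrand x w k + integrand x w' k)"
        using a w w' by (intro hf.FI_cong) (simp add: integrand_def F.inner_add_right algebra_simps)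
      then show ?thesis by (simp add: hf.FI_add[OF u integrand_fibre_fun[OF x w] integrand_fibre_fun[OF x w']])
    qed
    show "cmod (?l w) \<le> Re (hf.FI (d x) (\<lambda>k. complex_of_real (\<bar>M\<bar> * cmod (\<phi> (x \<cdot> k))))) * hnorm (fs x) w"
    proof -
      have "cmod (hf.FI (d x) (integrand x w)) \<le> Re (hf.FI (d x) (\<lambda>k. complex_of_real ((hnorm (fs x) w * \<bar>M\<bar>) * cmod (\<phi> (x \<cdot> k)))))"
      proof (rule hf.FI_bound_fibre_fun[OF u integrand_fibre_fun[OF x w] abs_kernel_fibre_fun[OF x]])
        fix k assume k: "k \<in> hf.fib (d x)"
        have "nm (d x) (act \<sigma> k (\<xi> (d k))) \<le> \<bar>M\<bar>"
          using act_norm[of k "\<xi> (d k)"] \<xi>_mem[of "d k"] M[of "d k"] k by auto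
        then have "cmod (hinner (fs x) (act \<sigma> k (\<xi> (d k))) w) \<le> \<bar>M\<bar> * hnorm (fs x) w"
          using F.Cauchy_Schwarz[OF a[OF k] w] F.norm_ge0[OF w] by (meson mult_right_mono order_trans)
        then show "cmod (integrand x w k) \<le> Re (complex_of_real ((hnorm (fs x) w * \<bar>M\<bar>) * cmod (\<phi> (x \<cdot> k))))"
          using k by (simp add: integrand_def norm_mult mult.commute mult_left_mono)
      qed simp
      also have "hf.FI (d x) (\<lambda>k. complex_of_real ((hnorm (fs x) w * \<bar>M\<bar>) * cmod (\<phi> (x \<cdot> k))))
        = complex_of_real (hnorm (fs x) w) * hf.FI (d x) (\<lambda>k. complex_of_real (\<bar>M\<bar> * cmod (\<phi> (x \<cdot> k))))"
        unfolding hf.FI_scale[symmetric] by (rule hf.FI_cong) simp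
      finally show ?thesis by (simp add: mult.commute)
    qed
  next
    fix a assume "a \<in> carrier (fs x)" "\<And>w. w \<in> carrier (fs x) \<Longrightarrow> hinner (fs x) w a = ?l w"
    then show thesis by (rule that)
  qed
  show ?thesis
  proof (intro bexI[OF _ a(1)] ballI)
    fix w assume w: "w \<in> carrier (fs x)"
    show "hinner (fs x) a w = hf.FI (d x) (integrand x w)"
      using F.inner_cnj[OF w a(1)] a(2)[OF w] by simp
  qed
qed

definition average :: "'g \<Rightarrow> 'h"
  where "average x = (SOME a. a \<in> carrier (fs x) \<and> (\<forall>w\<in>carrier (fs x). hinner (fs x) a w = hf.FI (d x) (integrand x w)))"

lemma average:
  assumes x: "x \<in> Ar"
  shows "average x \<in> carrier (fs x)" "w \<in> carrier (fs x) \<Longrightarrow> hinner (fs x) (average x) w = hf.FI (d x) (integrand x w)"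
proof -
  have "\<exists>a. a \<in> carrier (fs x) \<and> (\<forall>w\<in>carrier (fs x). hinner (fs x) a w = hf.FI (d x) (integrand x w))"
    using average_exists[OF x] by blast
  from someI_ex[OF this, folded average_def]
  show "average x \<in> carrier (fs x)" "w \<in> carrier (fs x) \<Longrightarrow> hinner (fs x) (average x) w = hf.FI (d x) (integrand x w)" by auto
qed

lemma weakly_equal:
  assumes x: "x \<in> Ar" and a: "a \<in> carrier (fs x)" "b \<in> carrier (fs x)"
    and eq: "\<And>w. w \<in> carrier (fs x) \<Longrightarrow> hinner (fs x) a w = hinner (fs x) b w"
  shows "a = b"
proof (rule hilbert_eqI[OF fs_hilbert[OF x] a])
  interpret F: semi_inner "fs x" by (rule fs_inner[OF x])
  have "hinner (fs x) (a \<ominus>\<^bsub>fs x\<^esub> b) (a \<ominus>\<^bsub>fs x\<^esub> b) = 0"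
    using a eq[OF F.minus_closed[OF a]] by (simp add: F.inner_minus(1))
  then show "nm (d x) (a \<ominus>\<^bsub>fs x\<^esub> b) \<le> 0" by (simp add: hnorm_def)
qed

lemma average_equivariant:
  assumes x: "x \<in> Ar" and h: "h \<in> H" "d x = r h"
  shows "average (x \<cdot> h) = act \<sigma> (iv h) (average x)"
proof -
  have y: "x \<cdot> h \<in> Ar" "d (x \<cdot> h) = d h" using x h by auto
  have hA: "h \<in> Ar" using h by simp
  have ih: "iv h \<in> H" using h by simp
  have ax: "average x \<in> carrier (fs (iv h))" using average(1)[OF x] h by simp
  show ?thesis
  proof (rule weakly_equal[OF hA])
    show "average (x \<cdot> h) \<in> carrier (fs h)" using average(1)[OF y(1)] y(2) by simp
    show "act \<sigma> (iv h) (average x) \<in> carrier (fs h)" using act_closed[OF ih ax] h by simp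
    fix w assume w: "w \<in> carrier (fs h)"
    have hw: "act \<sigma> h w \<in> carrier (fs x)" using act_closed[OF h(1) w] h by simp
    obtain F where F: "F \<in> Cc HT" "\<And>k. k \<in> hf.fib (d x) \<Longrightarrow> F k = integrand x (act \<sigma> h w) k"
      using hf.fibre_fun_extend[OF _ integrand_fibre_fun[OF x hw]] x by auto
    have "hinner (fs h) (act \<sigma> (iv h) (average x)) w = hinner (fs x) (average x) (act \<sigma> h w)"
      using act_adjoint[OF ih ax, of w] w h by simp
    also have "\<dots> = hf.FI (d x) (integrand x (act \<sigma> h w))" by (rule average(2)[OF x hw])
    also have "\<dots> = hf.FI (d x) F" by (rule hf.FI_cong) (simp add: F)
    also have "\<dots> = (LINT k|lam (r h). F k)" using hf.FI_Cc[OF _ F(1), of "d x"] x h by simp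
    also have "\<dots> = (LINT k : range_fibre (sub_groupoid G H) (d h)|lam (d h). F (h \<cdot> k))"
    proof -
      have "\<forall>f\<in>Cc HT. \<forall>x\<in>H. (LINT y : range_fibre (sub_groupoid G H) (d x)|lam (d x). f (x \<cdot> y)) = (LINT y|lam (r x). f y)"
        using haar unfolding haar_system_def by simp
      then show ?thesis using F(1) h(1) by simp
    qed
    also have "\<dots> = hf.FI (d h) (\<lambda>k. F (h \<cdot> k))"
      by (simp add: hf.FI_def range_fibre_def)
    also have "\<dots> = hf.FI (d h) (integrand (x \<cdot> h) w)"
    proof (rule hf.FI_cong)
      fix k assume "k \<in> hf.fib (d h)"
      then have k: "k \<in> H" "r k = d h" by auto
      have hk: "h \<cdot> k \<in> H" "r (h \<cdot> k) = d x" "d (h \<cdot> k) = d k" using h k by auto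
      have "act \<sigma> (h \<cdot> k) (\<xi> (d k)) = act \<sigma> h (act \<sigma> k (\<xi> (d k)))"
        using act_act[OF h(1) k(1), of "\<xi> (d k)"] k \<xi>_mem by simp
      moreover have "hinner (fb (r h)) (act \<sigma> h (act \<sigma> k (\<xi> (d k)))) (act \<sigma> h w) = hinner (fs h) (act \<sigma> k (\<xi> (d k))) w"
        using act_inner[OF h(1), of "act \<sigma> k (\<xi> (d k))" w] act_\<xi>[OF k(1)] k w by simp
      moreover have "x \<cdot> (h \<cdot> k) = x \<cdot> h \<cdot> k" using x h k by (simp add: assoc)
      ultimately show "F (h \<cdot> k) = integrand (x \<cdot> h) w k"
        using F(2)[of "h \<cdot> k"] hk h k by (simp add: integrand_def)
    qed
    also have "\<dots> = hinner (fs h) (average (x \<cdot> h)) w"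
      using average(2)[OF y(1), of w] w y(2) by simp
    finally show "hinner (fs h) (average (x \<cdot> h)) w = hinner (fs h) (act \<sigma> (iv h) (average x)) w" by simp
  qed
qed

lemma average_section_continuous:
  assumes \<eta>: "\<eta> \<in> sections \<sigma>"
  shows "continuous_map (gtop G) euclidean (\<lambda>x. hinner (fs x) (average x) (\<eta> (d x)))"
  using integrand_section(1)[OF \<eta>]
  by (rule continuous_map_eq) (simp add: average(2) section_mem[OF \<eta>])

text \<open>
  The weak integral is continuous against sections, which the average is not yet known to be. By
  equivariance \<open>\<langle>\<sigma>(k) \<xi>(d(k)), average x\<rangle> = \<langle>\<xi>(d(k)), average (x k)\<rangle>\<close>, and the right-hand side is
  the conjugate of a pairing of the average with a section, hence a continuous function of \<open>x k\<close>.
\<close>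

lemma average_norm_continuous: "continuous_map (gtop G) euclidean (\<lambda>x. hinner (fs x) (average x) (average x))"
proof -
  define c where "c z = cnj (hinner (fs z) (average z) (\<xi> (d z)))" for z
  have cc: "continuous_map (gtop G) euclidean c"
    unfolding c_def using average_section_continuous[of \<xi>] \<xi> by (intro continuous_map_unop[where h = cnj]) (auto intro!: continuous_intros)
  let ?P = "subtopology (prod_topology (gtop G) HT) {(x, k). d x = r k}"
  have s: "continuous_map ?P (gtop G) snd"
    using continuous_map_from_subtopology[OF continuous_map_snd, of "gtop G" HT] by (simp add: continuous_map_in_subtopology)
  have f: "continuous_map ?P (gtop G) fst" by (intro continuous_map_from_subtopology continuous_map_fst)
  have "continuous_map ?P (gtop G) (\<lambda>z. fst z \<cdot> snd z)" by (rule cont_mult[OF f s]) auto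
  from continuous_map_complex_mult[OF cont_\<phi>_mult continuous_map_compose[OF this cc]]
  have c2: "continuous_map ?P euclidean (\<lambda>(x, k). \<phi> (x \<cdot> k) * c (x \<cdot> k))" by (simp add: o_def case_prod_unfold)
  have "continuous_map (gtop G) euclidean (\<lambda>x. hf.FI (d x) (\<lambda>k. \<phi> (x \<cdot> k) * c (x \<cdot> k)))"
    by (rule hf.param_integral(1)[OF cont_src_unit c2]) (intro param_support, auto)
  then show ?thesis
  proof (rule continuous_map_eq)
    fix x assume "x \<in> topspace (gtop G)"
    then have x: "x \<in> Ar" by simp
    have "hf.FI (d x) (\<lambda>k. \<phi> (x \<cdot> k) * c (x \<cdot> k)) = hf.FI (d x) (integrand x (average x))"
    proof (rule hf.FI_cong)
      fix k assume "k \<in> hf.fib (d x)"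
      then have k: "k \<in> H" "d x = r k" by auto
      have m: "average x \<in> carrier (fb (r k))" using average(1)[OF x] k by simp
      have xk: "x \<cdot> k \<in> Ar" "d (x \<cdot> k) = d k" using x k by auto
      have am: "average (x \<cdot> k) \<in> carrier (fs k)" using average(1)[OF xk(1)] xk by simp
      have "hinner (fb (r k)) (act \<sigma> k (\<xi> (d k))) (average x) = hinner (fs k) (\<xi> (d k)) (act \<sigma> (iv k) (average x))"
        using k m by (intro act_adjoint) (auto intro: \<xi>_mem)
      also have "\<dots> = hinner (fs k) (\<xi> (d k)) (average (x \<cdot> k))" using average_equivariant[OF x k] by simp
      also have "\<dots> = c (x \<cdot> k)"
        unfolding c_def xk(2) using semi_inner.inner_cnj[OF fs_inner am \<xi>_mem] k by simp
      finally show "\<phi> (x \<cdot> k) * c (x \<cdot> k) = integrand x (average x) k" by (simp add: integrand_def)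
    qed
    then show "hf.FI (d x) (\<lambda>k. \<phi> (x \<cdot> k) * c (x \<cdot> k)) = hinner (fs x) (average x) (average x)"
      using average(2)[OF x average(1)[OF x]] by simp
  qed
qed

text \<open>
  Weak continuity together with continuity of the norm gives continuity, by expanding the square
  of the distance to a section.
\<close>

lemma average_asec: "asec (gtop G) d average"
  unfolding approx_by_sections_def
proof (intro conjI ballI allI impI cont_src_unit)
  show "x \<in> topspace (gtop G) \<Longrightarrow> average x \<in> carrier (fs x)" for x using average(1) by simp
  fix x0 and e :: real assume x0: "x0 \<in> topspace (gtop G)" and e: "e > 0"
  obtain \<eta> where \<eta>: "\<eta> \<in> sections \<sigma>" "nm (d x0) (average x0 \<ominus>\<^bsub>fs x0\<^esub> \<eta> (d x0)) < e"
    using section_dense[of "d x0" "average x0" e] average(1)[of x0] x0 e by auto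
  have "continuous_map (gtop G) euclidean (\<lambda>x. nm (d x) (\<eta> (d x)))"
    using continuous_map_compose[OF cont_src_unit section_norm[OF \<eta>(1)]] by (simp add: o_def)
  then have "continuous_map (gtop G) euclidean (\<lambda>x. sqrt (Re (hinner (fs x) (average x) (average x))
      - 2 * Re (hinner (fs x) (average x) (\<eta> (d x))) + (nm (d x) (\<eta> (d x)))\<^sup>2))"
    using average_norm_continuous average_section_continuous[OF \<eta>(1)]
    by (intro continuous_map_unop[where h = sqrt] continuous_map_add continuous_map_diff continuous_map_real_mult
        continuous_map_unop[where h = Re] continuous_map_unop[where h = "\<lambda>x. x\<^sup>2"]) (auto intro!: continuous_intros)
  then have c: "continuous_map (gtop G) euclidean (\<lambda>x. nm (d x) (average x \<ominus>\<^bsub>fs x\<^esub> \<eta> (d x)))"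
  proof (rule continuous_map_eq)
    fix x assume "x \<in> topspace (gtop G)"
    then have x: "x \<in> Ar" by simp
    interpret F: semi_inner "fs x" by (rule fs_inner[OF x])
    have m: "average x \<in> carrier (fs x)" "\<eta> (d x) \<in> carrier (fs x)" using average(1)[OF x] section_mem[OF \<eta>(1)] x by auto
    show "sqrt (Re (hinner (fs x) (average x) (average x)) - 2 * Re (hinner (fs x) (average x) (\<eta> (d x))) + (nm (d x) (\<eta> (d x)))\<^sup>2)
      = nm (d x) (average x \<ominus>\<^bsub>fs x\<^esub> \<eta> (d x))"
      using m F.inner_cnj[OF m] by (simp add: hnorm_def[of "fs x" "average x \<ominus>\<^bsub>fs x\<^esub> \<eta> (d x)"] F.norm_sq F.inner_minus algebra_simps)
  qed
  obtain U where "openin (gtop G) U" "x0 \<in> U" "\<And>x. x \<in> U \<Longrightarrow> nm (d x) (average x \<ominus>\<^bsub>fs x\<^esub> \<eta> (d x)) < e"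
    using continuous_map_real_nbhd[OF c x0 \<eta>(2)] by blast
  then show "\<exists>\<xi>\<in>sections \<sigma>. \<exists>U. openin (gtop G) U \<and> x0 \<in> U \<and> (\<forall>x\<in>U. nm (d x) (average x \<ominus>\<^bsub>fs x\<^esub> \<xi> (d x)) < e)"
    using \<eta>(1) by blast
qed

lemma average_IF: "(\<lambda>x\<in>Ar. average x) \<in> IF"
proof -
  obtain D where D: "compactin (gtop G) D" "\<forall>z\<in>Ar. \<phi> z \<noteq> 0 \<longrightarrow> z \<in> D"
    using \<phi> unfolding Cc_iff[OF lchs_gtop] by blast
  show ?thesis
  proof (rule IF_restrict)
    show "equiv_on Ar average" using average_asec average_equivariant by (simp add: equiv_on_def)
    show "supported Ar average (co ` D)"
      unfolding supported_def
    proof (intro conjI ballI impI image_compactin[OF D(1) cont_coset])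
      fix x assume x: "x \<in> Ar" and nz: "average x \<noteq> \<zero>\<^bsub>fs x\<^esub>"
      interpret F: semi_inner "fs x" by (rule fs_inner[OF x])
      show "co x \<in> co ` D"
      proof (rule ccontr)
        assume n: "co x \<notin> co ` D"
        have 0: "\<phi> (x \<cdot> k) = 0" if k: "k \<in> H" "d x = r k" for k
        proof (rule ccontr)
          assume "\<phi> (x \<cdot> k) \<noteq> 0"
          then have "x \<cdot> k \<in> D" using D(2) x k by simp
          then show False using n coset_mult[OF x k] by (metis image_eqI)
        qed
        have "hinner (fs x) (average x) w = hinner (fs x) \<zero>\<^bsub>fs x\<^esub> w" if w: "w \<in> carrier (fs x)" for w
        proof -
          have "hf.FI (d x) (integrand x w) = hf.FI (d x) (\<lambda>k. 0 * 0)"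
            by (rule hf.FI_cong) (simp add: integrand_def 0)
          then show ?thesis using average(2)[OF x w] F.inner_zero_left[OF w] by (simp only: hf.FI_scale) simp
        qed
        then show False using weakly_equal[OF x average(1)[OF x] F.zero_closed] nz by blast
      qed
    qed
  qed
qed

text \<open>
  As \<open>\<phi>\<close> has integral one, the difference \<open>w\<close> of the average and \<open>a\<close> is the average of the
  differences \<open>\<sigma>(k) \<xi>(d(k)) - a\<close>. Pairing it with \<open>w\<close> itself gives \<open>\<parallel>w\<parallel>\<^sup>2 \<le> \<delta> \<parallel>w\<parallel>\<close>.
\<close>

lemma average_near:
  assumes y: "y \<in> Ar" and a: "a \<in> carrier (fs y)" and \<delta>: "\<delta> \<ge> 0"
    and pos: "\<And>k. \<lbrakk>k \<in> H; r k = d y\<rbrakk> \<Longrightarrow> Im (\<phi> (y \<cdot> k)) = 0 \<and> Re (\<phi> (y \<cdot> k)) \<ge> 0"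
    and one: "hf.FI (d y) (\<lambda>k. \<phi> (y \<cdot> k)) = 1"
    and close: "\<And>k. \<lbrakk>k \<in> H; r k = d y; \<phi> (y \<cdot> k) \<noteq> 0\<rbrakk> \<Longrightarrow> nm (d y) (act \<sigma> k (\<xi> (d k)) \<ominus>\<^bsub>fs y\<^esub> a) \<le> \<delta>"
  shows "nm (d y) (average y \<ominus>\<^bsub>fs y\<^esub> a) \<le> \<delta>"
proof -
  interpret F: semi_inner "fs y" by (rule fs_inner[OF y])
  have u: "d y \<in> topspace (unit_space G)" using y by simp
  define w where "w = average y \<ominus>\<^bsub>fs y\<^esub> a"
  have w: "w \<in> carrier (fs y)" using average(1)[OF y] a by (simp add: w_def)
  have am: "act \<sigma> k (\<xi> (d k)) \<in> carrier (fs y)" if "k \<in> hf.fib (d y)" for k using act_\<xi>[of k] that by auto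
  have cm: "cmod (\<phi> (y \<cdot> k)) = Re (\<phi> (y \<cdot> k))" if "k \<in> hf.fib (d y)" for k
    using pos[of k] that by (simp add: cmod_def)
  have of: "complex_of_real (Re (\<phi> (y \<cdot> k))) = \<phi> (y \<cdot> k)" if "k \<in> hf.fib (d y)" for k
    using pos[of k] that by (simp add: complex_eq_iff)
  let ?m = "\<lambda>k. - hinner (fs y) a w * complex_of_real (1 * cmod (\<phi> (y \<cdot> k)))"
  have ff1: "hf.fibre_fun (d y) (\<lambda>k. complex_of_real (1 * cmod (\<phi> (y \<cdot> k))))" by (rule abs_kernel_fibre_fun[OF y])
  have "\<exists>f. f \<in> Cc HT \<and> (\<forall>k\<in>hf.fib (d y). f k = complex_of_real (1 * cmod (\<phi> (y \<cdot> k))))"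
    by (rule hf.fibre_fun_extend[OF u ff1]) blast
  then obtain f where f: "f \<in> Cc HT" "\<And>k. k \<in> hf.fib (d y) \<Longrightarrow> f k = complex_of_real (1 * cmod (\<phi> (y \<cdot> k)))"
    by blast
  have ff2: "hf.fibre_fun (d y) ?m"
    using hf.fibre_fun_Cc[OF Cc_mult[OF hf.lchs f(1), of "\<lambda>_. - hinner (fs y) a w"]]
    by (rule hf.fibre_fun_cong) (use f(2) in auto)
  have "\<exists>f. f \<in> Cc HT \<and> (\<forall>k\<in>hf.fib (d y). f k = integrand y w k)"
    by (rule hf.fibre_fun_extend[OF u integrand_fibre_fun[OF y w]]) blast
  then obtain g1 where g1: "g1 \<in> Cc HT" "\<And>k. k \<in> hf.fib (d y) \<Longrightarrow> g1 k = integrand y w k"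
    by blast
  have "\<exists>f. f \<in> Cc HT \<and> (\<forall>k\<in>hf.fib (d y). f k = ?m k)"
    by (rule hf.fibre_fun_extend[OF u ff2]) blast
  then obtain g2 where g2: "g2 \<in> Cc HT" "\<And>k. k \<in> hf.fib (d y) \<Longrightarrow> g2 k = ?m k"
    by blast
  have fm: "hf.FI (d y) ?m = - hinner (fs y) a w"
  proof -
    have "hf.FI (d y) ?m = - hinner (fs y) a w * hf.FI (d y) (\<lambda>k. complex_of_real (1 * cmod (\<phi> (y \<cdot> k))))"
      by (rule hf.FI_scale)
    also have "hf.FI (d y) (\<lambda>k. complex_of_real (1 * cmod (\<phi> (y \<cdot> k)))) = hf.FI (d y) (\<lambda>k. \<phi> (y \<cdot> k))"
      by (rule hf.FI_cong) (simp add: cm of)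
    finally show ?thesis using one by simp
  qed
  have "hinner (fs y) w w = hinner (fs y) (average y) w - hinner (fs y) a w"
    using F.inner_minus(1)[OF average(1)[OF y] a w] by (simp add: w_def)
  then have "hinner (fs y) w w = hf.FI (d y) (integrand y w) + hf.FI (d y) ?m"
    unfolding fm average(2)[OF y w] by simp
  also have "\<dots> = hf.FI (d y) (\<lambda>k. integrand y w k + ?m k)"
    by (rule hf.FI_add[OF u integrand_fibre_fun[OF y w] ff2, symmetric])
  finally have eq: "hinner (fs y) w w = hf.FI (d y) (\<lambda>k. integrand y w k + ?m k)" .
  have ff3: "hf.fibre_fun (d y) (\<lambda>k. integrand y w k + ?m k)"
  proof -
    have "(\<lambda>k. g1 k - (-1) * g2 k) \<in> Cc HT" using Cc_diff[OF hf.lchs g1(1) Cc_mult[OF hf.lchs g2(1), of "\<lambda>_. -1"]] by simp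
    from hf.fibre_fun_Cc[OF this] show ?thesis by (rule hf.fibre_fun_cong) (use g1(2) g2(2) in auto)
  qed
  have "cmod (hinner (fs y) w w) \<le> Re (hf.FI (d y) (\<lambda>k. complex_of_real ((\<delta> * hnorm (fs y) w) * cmod (\<phi> (y \<cdot> k)))))"
    unfolding eq
  proof (rule hf.FI_bound_fibre_fun[OF u ff3 abs_kernel_fibre_fun[OF y]])
    fix k assume k: "k \<in> hf.fib (d y)"
    let ?a = "act \<sigma> k (\<xi> (d k))"
    have eq: "integrand y w k + ?m k = \<phi> (y \<cdot> k) * hinner (fs y) (?a \<ominus>\<^bsub>fs y\<^esub> a) w"
      using k by (simp add: integrand_def F.inner_minus(1)[OF am[OF k] a w] cm[OF k] of[OF k] right_diff_distrib mult.commute)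
    show "cmod (integrand y w k + ?m k) \<le> Re (complex_of_real ((\<delta> * hnorm (fs y) w) * cmod (\<phi> (y \<cdot> k))))"
    proof (cases "\<phi> (y \<cdot> k) = 0")
      case False
      then have "nm (d y) (?a \<ominus>\<^bsub>fs y\<^esub> a) \<le> \<delta>" using close[of k] k by auto
      then have "cmod (hinner (fs y) (?a \<ominus>\<^bsub>fs y\<^esub> a) w) \<le> \<delta> * hnorm (fs y) w"
        using F.Cauchy_Schwarz[OF F.minus_closed[OF am[OF k] a] w] F.norm_ge0[OF w] by (meson mult_right_mono order_trans)
      then show ?thesis unfolding eq by (simp add: norm_mult mult.commute mult_left_mono)
    next
      case True
      then show ?thesis unfolding eq by simp
    qed
  qed simp
  also have "hf.FI (d y) (\<lambda>k. complex_of_real ((\<delta> * hnorm (fs y) w) * cmod (\<phi> (y \<cdot> k))))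
      = complex_of_real (\<delta> * hnorm (fs y) w) * hf.FI (d y) (\<lambda>k. \<phi> (y \<cdot> k))"
    unfolding hf.FI_scale[symmetric] by (rule hf.FI_cong) (simp add: cm of)
  finally have "(hnorm (fs y) w)\<^sup>2 \<le> \<delta> * hnorm (fs y) w"
    using one F.inner_self[OF w] by (simp add: norm_power)
  then show ?thesis
    using F.norm_ge0[OF w] \<delta> unfolding w_def[symmetric] by (cases "hnorm (fs y) w = 0") (auto simp: power2_eq_square)
qed

end

context haar_representation
begin

text \<open>
  Take a section \<open>\<xi>\<close> with value near \<open>v\<close> and average it against a normalised bump function
  concentrated at \<open>y\<close>. Then \<open>\<phi>(y k)\<close> is nonzero for \<open>k\<close> near the unit \<open>d(y)\<close> alone, and there
  \<open>\<sigma>(k) \<xi>(d(k))\<close> is close to \<open>\<xi>(r(k))\<close>: weak continuity suffices for this since \<open>\<sigma>(k)\<close> preserves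
  norms.
\<close>

theorem pointwise_density:
  assumes y: "y \<in> Ar" and v: "v \<in> carrier (fs y)" and e: "e > 0"
  shows "\<exists>f\<in>IF. nm (d y) (f y \<ominus>\<^bsub>fs y\<^esub> v) < e"
proof -
  let ?u = "d y"
  have u: "?u \<in> units G" "?u \<in> topspace (unit_space G)" "?u \<in> H" "r ?u = ?u" "d ?u = ?u" using y by auto
  interpret F: semi_inner "fs y" by (rule fs_inner[OF y])
  interpret FM: module complex_ring "fs y" by (rule F.mod)
  obtain \<xi>0 where \<xi>0: "\<xi>0 \<in> sections \<sigma>" "nm ?u (v \<ominus>\<^bsub>fs y\<^esub> \<xi>0 ?u) < e / 2"
    using section_dense[OF u(2) v, of "e / 2"] e by auto
  have "compactin (unit_space G) {?u}" using u by simp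
  then obtain b :: "'g \<Rightarrow> real" and D where b: "continuous_map (unit_space G) euclidean b" "b ?u = 1"
    "compactin (unit_space G) D" "\<And>z. b z \<noteq> 0 \<Longrightarrow> z \<in> D" "\<And>z. 0 \<le> b z" "\<And>z. b z \<le> 1"
    using bump_function[OF lchs_unit_space _ openin_topspace, of "{?u}"] u(2) by (metis empty_subsetI insert_subset singletonI)
  let ?b = "\<lambda>z. complex_of_real (b z)"
  have bC: "?b \<in> Cc (unit_space G)"
    unfolding Cc_iff[OF lchs_unit_space] using b continuous_map_unop[OF b(1), of complex_of_real]
    by (auto intro!: continuous_intros)
  define \<xi> where "\<xi> = (\<lambda>z\<in>units G. ?b z \<odot>\<^bsub>fb z\<^esub> \<xi>0 z)"
  have \<xi>: "\<xi> \<in> sections \<sigma> \<inter> C0_sections (unit_space G) \<sigma>" unfolding \<xi>_def by (rule cutoff_C0[OF bC \<xi>0(1)])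
  have \<xi>s: "\<xi> \<in> sections \<sigma>" using \<xi> by blast
  have \<xi>u: "\<xi> ?u = \<xi>0 ?u" using u b(2) FM.smult_one[OF section_mem[OF \<xi>0(1)]] by (simp add: \<xi>_def)
  have \<xi>bd: "\<exists>M. \<forall>z\<in>units G. nm z (\<xi> z) \<le> M"
  proof -
    have "compactin euclidean ((\<lambda>z. nm z (\<xi> z)) ` D)"
      by (rule image_compactin[OF b(3) section_norm[OF \<xi>s]])
    then have "bounded ((\<lambda>z. nm z (\<xi> z)) ` D)" by (simp add: compact_imp_bounded)
    then obtain M where M: "\<And>z. z \<in> D \<Longrightarrow> \<bar>nm z (\<xi> z)\<bar> \<le> M"
      unfolding bounded_iff by auto
    have "nm z (\<xi> z) \<le> max M 0" if z: "z \<in> units G" for z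
    proof (cases "z \<in> D")
      case False
      then have "b z = 0" using b(4)[of z] by blast
      then have "\<xi> z = \<zero>\<^bsub>fb z\<^esub>" using z semi_inner.zero_smult[OF fibre_inner section_mem[OF \<xi>0(1)]] by (auto simp: \<xi>_def)
      then show ?thesis using semi_inner.norm_zero[OF fibre_inner] z by simp
    qed (use M in fastforce)
    then show ?thesis by blast
  qed
  have \<xi>m: "\<xi> z \<in> carrier (fb z)" if "z \<in> units G" for z using section_mem[OF \<xi>s] that by simp
  \<comment> \<open>\<open>\<sigma>(k) \<xi>(d(k))\<close> is close to \<open>\<xi>(r(k))\<close> for \<open>k\<close> near the unit\<close>
  let ?n = "\<lambda>k. nm (r k) (act \<sigma> k (\<xi> (d k)) \<ominus>\<^bsub>fb (r k)\<^esub> \<xi> (r k))"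
  have nd: "continuous_map HT euclidean (\<lambda>k. nm (d k) (\<xi> (d k)))" "continuous_map HT euclidean (\<lambda>k. nm (r k) (\<xi> (r k)))"
    using continuous_map_compose[OF continuous_map_from_subtopology[OF cont_src_unit] section_norm[OF \<xi>s]]
      continuous_map_compose[OF continuous_map_from_subtopology[OF cont_rng_unit] section_norm[OF \<xi>s]] by (simp_all add: o_def)
  have "continuous_map HT euclidean (\<lambda>k. sqrt ((nm (d k) (\<xi> (d k)))\<^sup>2
      - 2 * Re (hinner (fb (r k)) (act \<sigma> k (\<xi> (d k))) (\<xi> (r k))) + (nm (r k) (\<xi> (r k)))\<^sup>2))"
    using nd weak_continuity[OF \<xi> \<xi>s]
    by (intro continuous_map_unop[where h = sqrt] continuous_map_add continuous_map_diff continuous_map_real_mult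
        continuous_map_unop[where h = Re] continuous_map_unop[where h = "\<lambda>x. x\<^sup>2"]) (auto intro!: continuous_intros)
  then have nc: "continuous_map HT euclidean ?n"
  proof (rule continuous_map_eq)
    fix k assume "k \<in> topspace HT"
    then have k: "k \<in> H" by simp
    interpret R: semi_inner "fb (r k)" using fibre_inner k by simp
    have m: "act \<sigma> k (\<xi> (d k)) \<in> carrier (fb (r k))" "\<xi> (r k) \<in> carrier (fb (r k))"
      using k by (auto intro!: act_closed \<xi>m)
    have na: "nm (d k) (\<xi> (d k)) = nm (r k) (act \<sigma> k (\<xi> (d k)))" using act_norm[OF k \<xi>m] k by simp
    show "sqrt ((nm (d k) (\<xi> (d k)))\<^sup>2 - 2 * Re (hinner (fb (r k)) (act \<sigma> k (\<xi> (d k))) (\<xi> (r k))) + (nm (r k) (\<xi> (r k)))\<^sup>2) = ?n k"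
      unfolding na using m R.inner_cnj[OF m]
      by (simp add: hnorm_def[of "fb (r k)" "act \<sigma> k (\<xi> (d k)) \<ominus>\<^bsub>fb (r k)\<^esub> \<xi> (r k)"] R.norm_sq R.inner_minus algebra_simps)
  qed
  have n0: "?n ?u < e / 3"
    using u act_unit[OF u(1) \<xi>m] F.norm_minus_self[OF \<xi>m] e by simp
  obtain W where W: "openin HT W" "?u \<in> W" "\<And>k. k \<in> W \<Longrightarrow> ?n k < e / 3"
    using continuous_map_real_nbhd[OF nc _ n0] u(3) by auto
  obtain W' where W': "openin (gtop G) W'" "W = W' \<inter> H" using W(1) by (auto simp: openin_subtopology)
  have iyy: "iv y \<cdot> y = ?u" by (simp add: src_def)
  obtain A B where AB: "openin (gtop G) A" "openin (gtop G) B" "iv y \<in> A" "y \<in> B"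
    "\<And>a b. \<lbrakk>a \<in> A; b \<in> B; d a = r b\<rbrakk> \<Longrightarrow> a \<cdot> b \<in> W'"
    using mult_nbhd[OF W'(1), of "iv y" y] y iyy W W' by auto
  have "compactin (gtop G) {y}" using y by simp
  then obtain p :: "'g \<Rightarrow> real" and D' where p: "continuous_map (gtop G) euclidean p" "p y = 1" "\<And>z. 0 \<le> p z"
    "compactin (gtop G) D'" "D' \<subseteq> B" "\<And>z. p z \<noteq> 0 \<Longrightarrow> z \<in> D'"
    using bump_function[OF lchs_gtop _ AB(2), of "{y}"] AB(4) by (metis empty_subsetI insert_subset singletonI)
  let ?p = "\<lambda>z. complex_of_real (p z)"
  have pC: "?p \<in> Cc (gtop G)"
    unfolding Cc_iff[OF lchs_gtop] using p continuous_map_unop[OF p(1), of complex_of_real]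
    by (auto intro!: continuous_intros)
  interpret A0: averaging G H lam \<sigma> ?p \<xi> using pC \<xi> \<xi>bd by unfold_locales
  \<comment> \<open>the normalising constant, positive because the bump is positive at the unit of the fibre\<close>
  define c where "c = hf.FI ?u (\<lambda>k. ?p (y \<cdot> k))"
  have ff: "hf.fibre_fun ?u (\<lambda>k. ?p (y \<cdot> k))" using A0.abs_kernel_fibre_fun[OF y, of 1] p(3) by simp
  have "\<exists>f. f \<in> Cc HT \<and> (\<forall>k\<in>hf.fib ?u. f k = ?p (y \<cdot> k))"
    by (rule hf.fibre_fun_extend[OF u(2) ff]) blast
  then obtain f where f: "f \<in> Cc HT" "\<And>k. k \<in> hf.fib ?u \<Longrightarrow> f k = ?p (y \<cdot> k)"
    by blast
  have cf: "c = hf.FI ?u f" unfolding c_def by (rule hf.FI_cong) (simp add: f)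
  have "Re c > 0" unfolding cf
    by (rule hf.FI_pos[OF u(2) f(1), of ?u]) (use f(2) p(2,3) u y in auto)
  moreover have "Im c = 0" unfolding c_def by (rule hf.FI_nonneg(2)) (simp add: p(3))
  ultimately have c: "c = complex_of_real (Re c)" "Re c > 0" by (simp_all add: complex_eq_iff)
  define \<phi> where "\<phi> z = complex_of_real (1 / Re c) * ?p z" for z
  have "\<phi> \<in> Cc (gtop G)" unfolding \<phi>_def using Cc_mult[OF lchs_gtop pC, of "\<lambda>_. complex_of_real (1 / Re c)"] by simp
  then interpret A: averaging G H lam \<sigma> \<phi> \<xi> using \<xi> \<xi>bd by unfold_locales
  have "nm ?u (A.average y \<ominus>\<^bsub>fs y\<^esub> \<xi> ?u) \<le> e / 3"
  proof (rule A.average_near[OF y \<xi>m[OF u(1)]])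
    show "0 \<le> e / 3" using e by simp
    have "\<phi> z = complex_of_real (p z / Re c)" for z by (simp add: \<phi>_def)
    then show "Im (\<phi> (y \<cdot> k)) = 0 \<and> 0 \<le> Re (\<phi> (y \<cdot> k))" for k using p(3)[of "y \<cdot> k"] c(2) by simp
    have "hf.FI ?u (\<lambda>k. \<phi> (y \<cdot> k)) = complex_of_real (1 / Re c) * c"
      unfolding \<phi>_def hf.FI_scale c_def ..
    also have "\<dots> = 1" using c by (metis mult.commute nonzero_eq_divide_eq of_real_divide of_real_1 of_real_eq_0_iff less_irrefl)
    finally show "hf.FI ?u (\<lambda>k. \<phi> (y \<cdot> k)) = 1" .
    fix k assume k: "k \<in> H" "r k = ?u" "\<phi> (y \<cdot> k) \<noteq> 0"
    then have "p (y \<cdot> k) \<noteq> 0" by (auto simp: \<phi>_def)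
    then have "y \<cdot> k \<in> B" using p(5,6) by blast
    then have "iv y \<cdot> (y \<cdot> k) \<in> W'" using AB(5)[of "iv y" "y \<cdot> k"] AB(3) y k by simp
    then have "k \<in> W" using W'(2) y k by simp
    then show "nm ?u (act \<sigma> k (\<xi> (d k)) \<ominus>\<^bsub>fs y\<^esub> \<xi> ?u) \<le> e / 3" using W(3)[of k] k by simp
  qed
  moreover have am: "A.average y \<in> carrier (fs y)" by (rule A.average(1)[OF y])
  moreover have "nm ?u (A.average y \<ominus>\<^bsub>fs y\<^esub> v) \<le> nm ?u (A.average y \<ominus>\<^bsub>fs y\<^esub> \<xi> ?u) + nm ?u (\<xi> ?u \<ominus>\<^bsub>fs y\<^esub> v)"
    using am \<xi>m[OF u(1)] v by (rule F.norm_triangle_minus)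
  moreover have "nm ?u (\<xi> ?u \<ominus>\<^bsub>fs y\<^esub> v) < e / 2"
    using \<xi>0(2) F.norm_minus_commute[OF v section_mem[OF \<xi>0(1)]] u \<xi>u by simp
  ultimately have "nm ?u (A.average y \<ominus>\<^bsub>fs y\<^esub> v) < e" using e by simp
  then show ?thesis using A.average_IF y by (intro bexI[OF _ A.average_IF]) simp
qed

sublocale equivariant_field G H \<sigma>
  by unfold_locales (rule pointwise_density)

end

section \<open>Functions on the larger groupoid as functions with values in the intermediate bundle\<close>

context induced
begin

lemma t0_section: "f \<in> IF \<Longrightarrow> t0 f \<in> sections (ind G H \<sigma> \<mu>)"
  unfolding ind_sections locally_uniform_closure_def
proof (intro CollectI conjI ballI allI impI)
  assume f: "f \<in> IF"
  show "t0 f \<in> (\<Pi>\<^sub>E u\<in>topspace (unit_space G). carrier (IH u))" using t0_mem[OF f] by (auto simp: t0_def)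
  fix u and e :: real assume u: "u \<in> topspace (unit_space G)" and e: "e > 0"
  have "hnorm (IH v) (t0 f v \<ominus>\<^bsub>IH v\<^esub> t0 f v) < e" if v: "v \<in> units G" for v
    using semi_inner.norm_minus_self[OF hilbert_semi_inner[OF IH_hilbert[OF v]] t0_mem[OF f v]] e by simp
  then show "\<exists>\<eta>\<in>t0 ` IF. \<exists>U. openin (unit_space G) U \<and> u \<in> U \<and> (\<forall>v\<in>U. hnorm (IH v) (t0 f v \<ominus>\<^bsub>IH v\<^esub> \<eta> v) < e)"
    using f u openin_topspace[of "unit_space G"] by (intro bexI[of _ "t0 f"] exI[of _ "units G"]) auto
qed

lemma t0_minus_norm:
  assumes f: "f \<in> IF" and g: "g \<in> IF" and u: "u \<in> units G"
  shows "hnorm (IH u) (t0 f u \<ominus>\<^bsub>IH u\<^esub> t0 g u) = hnorm (PF u) (restrict f (RF u) \<ominus>\<^bsub>PF u\<^esub> restrict g (RF u))"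
proof -
  interpret P: semi_inner "PF u" by (rule PF_semi_inner[OF u])
  note c = restrict_PF[OF f, of u] restrict_PF[OF g, of u]
  show ?thesis using P.HC_const(4)[OF c] P.HC_const(2)[OF P.minus_closed[OF c]] u by (simp add: t0_def IH_eq del: PF_simps)
qed

end

text \<open>
  Two groupoids occur with the subgroupoid \<open>K\<close>, namely \<open>G\<close> (unqualified names) and \<open>H\<close> (prefix
  \<open>HK\<close>); the prefix \<open>GH\<close> belongs to the induction of the intermediate representation from \<open>H\<close> to
  \<open>G\<close>.
\<close>

locale induction_in_stages = haar_representation G K lam \<sigma> + induced G K \<sigma> \<gamma> + GH: open_pair G H
  for G :: "'g groupoid" and K :: "'g set" and lam and \<sigma> :: "('g, 'h) representation" and \<gamma> and H +
  fixes \<mu>H \<mu>G :: "'g \<Rightarrow> 'g set measure"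
  assumes KH: "K \<subseteq> H"
    and sysH: "full_equivariant_system (sub_groupoid G H) K \<mu>H"
    and sysG: "full_equivariant_system G H \<mu>G"
    and iterated: "\<lbrakk>f \<in> Cc (coset_space G K); u \<in> units G\<rbrakk> \<Longrightarrow>
      (LINT C|\<gamma> u. f C) =
      (LINT C|\<mu>G u. (LINT D : coset_range_fibre (sub_groupoid G H) K (src G (coset_rep C))
         |\<mu>H (src G (coset_rep C)). f (translate G (coset_rep C) D)))"
begin

abbreviation "SH \<equiv> sub_groupoid G H"

lemma SHK: "sub_groupoid SH K = sub_groupoid G K"
  using KH by (simp add: sub_groupoid_def subtopology_subtopology Int_absorb1)

lemma ArH [simp]: "Ar \<inter> H = H" using GH.H_sub by blast

lemma cwK: "closed_wide_subgroupoid SH K"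
proof -
  have "closedin (subtopology (gtop G) H) K" using H_closed KH by (simp add: closedin_subset_topspace closedin_subtopology_Int_subset closedin_closed_subtopology GH.H_closed)
  then show ?thesis using cw KH unfolding closed_wide_subgroupoid_def composable_def by auto
qed

sublocale HK: haar_representation SH K lam \<sigma>
proof -
  have "open_pair SH K"
    using open_pairI[OF top_groupoid.tg[OF GH.top_groupoid_sub] cwK] haar unfolding SHK .
  then show "haar_representation SH K lam \<sigma>"
    using haar rep by (intro haar_representation.intro haar_representation_axioms.intro) (simp_all add: SHK)
qed

sublocale HK: induced SH K \<sigma> \<mu>H
  by (intro induced.intro induced_axioms.intro HK.equivariant_field_axioms sysH)

abbreviation "L \<equiv> ind SH K \<sigma> \<mu>H"

sublocale GH: unitary_action G H L
proof (intro unitary_action.intro unitary_action_axioms.intro hilbert_field.intro GH.open_pair_axioms)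
  show "continuous_hilbert_bundle (unit_space G) L" using HK.ind_bundle by simp
  show "unitary_on (fibre L (d h)) (fibre L (r h)) (act L h)" if "h \<in> H" for h
    using HK.act_ind_unitary[of h] that by simp
qed


lemma RH_mem: "h \<in> HK.RF u \<longleftrightarrow> h \<in> H \<and> r h = u" by (simp add: HK.RF_mem)

text \<open>
  The coset \<open>xH\<close> is a copy of the range fibre of \<open>d(x)\<close> in \<open>H\<close>; this is \<open>f\<close> on that copy.
\<close>

definition slice :: "('g \<Rightarrow> 'h) \<Rightarrow> 'g \<Rightarrow> 'g \<Rightarrow> 'h"
  where "slice f x = (\<lambda>h \<in> HK.RF (d x). f (x \<cdot> h))"

text \<open>
  If \<open>f(xh)\<close> is nonzero then \<open>xhK\<close> meets a fixed compact set, at \<open>b\<close> say, and \<open>hK\<close> contains the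
  quotient of \<open>b\<close> by \<open>x\<close>. Letting \<open>x\<close> range over a compact set gives the uniformity needed for
  continuity in \<open>x\<close>.
\<close>

lemma slice_support:
  assumes f: "f \<in> IF" and N: "compactin (gtop G) N"
  obtains C where "compactin (coset_space SH K) C"
    "\<And>x h. \<lbrakk>x \<in> N; h \<in> H; d x = r h; f (x \<cdot> h) \<noteq> \<zero>\<^bsub>fs h\<^esub>\<rbrakk> \<Longrightarrow> co h \<in> C"
proof -
  obtain C0 where C0: "supported Ar f C0" using IF_supp[OF f] by blast
  then obtain D where D: "compactin (gtop G) D" "C0 \<subseteq> co ` D" using compact_lift by (auto simp: supported_def)
  obtain M where M: "compactin (gtop G) M" "\<And>a b. \<lbrakk>a \<in> N; b \<in> D; r a = r b\<rbrakk> \<Longrightarrow> iv a \<cdot> b \<in> M"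
    using compact_quotients[OF N D(1)] by blast
  have "compactin (subtopology (gtop G) H) (M \<inter> H)"
    using compact_Int_closedin[OF M(1) GH.H_closed] by (simp add: compactin_subtopology)
  then have "compactin (coset_space SH K) (co ` (M \<inter> H))"
    using image_compactin HK.cont_coset by fastforce
  moreover have "co h \<in> co ` (M \<inter> H)" if x: "x \<in> N" and h: "h \<in> H" "d x = r h" and nz: "f (x \<cdot> h) \<noteq> \<zero>\<^bsub>fs h\<^esub>" for x h
  proof -
    have xA: "x \<in> Ar" using x compactin_subset_topspace[OF N] by blast
    have xh: "x \<cdot> h \<in> Ar" "d (x \<cdot> h) = d h" "r (x \<cdot> h) = r x" using xA h by auto
    have "co (x \<cdot> h) \<in> C0" using C0 nz xh by (simp add: supported_def)
    then obtain b where b: "b \<in> D" "co (x \<cdot> h) = co b" using D(2) by blast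
    have bA: "b \<in> Ar" using b compactin_subset_topspace[OF D(1)] by blast
    have k: "r x = r b" "iv (x \<cdot> h) \<cdot> b \<in> K" using coset_eq_iff[OF xh(1) bA] b(2) xh by auto
    have e: "h \<cdot> (iv (x \<cdot> h) \<cdot> b) = iv x \<cdot> b"
    proof -
      have "iv (x \<cdot> h) = iv h \<cdot> iv x" using xA h by (simp add: inv_of_mult)
      then show ?thesis using xA h bA k(1) by (simp add: assoc)
    qed
    have "iv x \<cdot> b \<in> H" using GH.H_mult[OF h(1) subsetD[OF KH k(2)]] k(1) xh h bA unfolding e by simp
    moreover have "co (iv x \<cdot> b) = co h"
      unfolding e[symmetric] using h k xh bA by (intro coset_mult) auto
    ultimately show ?thesis using M(2)[OF x b(1) k(1)] by (metis IntI image_eqI)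
  qed
  ultimately show ?thesis by (rule that)
qed

lemma slice_carrier:
  assumes f: "f \<in> IF" and x: "x \<in> Ar"
  shows "slice f x \<in> carrier (HK.PF (d x))"
proof -
  have u: "d x \<in> units SH" using x by simp
  let ?X = "subtopology (subtopology (gtop G) H) (HK.RF (d x))"
  have c: "continuous_map ?X (gtop G) (\<lambda>h. x \<cdot> h)"
    by (rule cont_mult) (use x in \<open>auto intro!: continuous_map_from_subtopology simp: RH_mem\<close>)
  have "asec ?X d (slice f x)"
    by (rule asec_cong[OF asec_compose[OF IF_asec[OF f] c]]) (use x in \<open>auto simp: slice_def RH_mem\<close>)
  moreover have "slice f x (h \<cdot> k) = act \<sigma> (iv k) (slice f x h)" if "h \<in> HK.RF (d x)" "k \<in> K" "d h = r k" for h k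
  proof -
    have "h \<in> H" "k \<in> H" "r h = d x" using that KH by (auto simp: RH_mem)
    then show ?thesis using that x IF_act[OF f, of "x \<cdot> h" k] by (simp add: slice_def RH_mem assoc)
  qed
  ultimately have "HK.equiv_on (HK.RF (d x)) (slice f x)"
    unfolding HK.equiv_on_def by simp
  moreover have "\<exists>C. HK.supported (HK.RF (d x)) (slice f x) C"
  proof -
    have "compactin (gtop G) {x}" using x by (simp add: finite_imp_compactin)
    then obtain C where "compactin (coset_space SH K) C"
      "\<And>y h. \<lbrakk>y \<in> {x}; h \<in> H; d y = r h; f (y \<cdot> h) \<noteq> \<zero>\<^bsub>fs h\<^esub>\<rbrakk> \<Longrightarrow> co h \<in> C"
      using slice_support[OF f] by blast
    then show ?thesis by (intro exI[of _ C]) (auto simp: HK.supported_def slice_def RH_mem)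
  qed
  ultimately show ?thesis unfolding HK.PF_carrier_iff[OF u] by (simp add: slice_def)
qed

text \<open>
  This is \<open>f~\<close>, with values in the fibres of the representation of \<open>H\<close> induced from \<open>K\<close>.
\<close>

definition tilde :: "('g \<Rightarrow> 'h) \<Rightarrow> 'g \<Rightarrow> (nat \<Rightarrow> 'g \<Rightarrow> 'h) set"
  where "tilde f = (\<lambda>x \<in> Ar. HK.cls (d x) (slice f x))"

lemma tilde_mem: "\<lbrakk>f \<in> IF; x \<in> Ar\<rbrakk> \<Longrightarrow> tilde f x \<in> carrier (HK.IH (d x))"
  using semi_inner.lc_carrier[OF HK.PF_semi_inner semi_inner.const_cs[OF HK.PF_semi_inner slice_carrier]]
  by (simp add: tilde_def HK.IH_eq)

text \<open>
  The squared distance is an integral over \<open>H/K\<close> with parameter \<open>x\<close>. Its integrand \<open>\<Psi>\<close> is jointly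
  continuous: this is clear for a function of \<open>x\<close> and \<open>h \<in> H\<close>, and it descends to \<open>hK\<close> because the
  quotient map is open.
\<close>

lemma slice_distance_continuous:
  assumes f: "f \<in> IF" and k: "k \<in> HK.IF"
  shows "continuous_map (gtop G) euclidean
    (\<lambda>x. hnorm (HK.PF (d x)) (slice f x \<ominus>\<^bsub>HK.PF (d x)\<^esub> restrict k (HK.RF (d x))))"
proof -
  define w where "w x h = f (x \<cdot> h) \<ominus>\<^bsub>fs h\<^esub> k h" for x h
  define \<Psi> where "\<Psi> x D = hinner (fs (coset_rep D)) (w x (coset_rep D)) (w x (coset_rep D))" for x D
  let ?HT = "subtopology (gtop G) H" and ?Y = "coset_space SH K"
  have keq: "HK.equiv_on H k" using HK.IF_equiv[OF k] by simp
  have "slice f x \<ominus>\<^bsub>HK.PF (d x)\<^esub> restrict k (HK.RF (d x)) = (\<lambda>h\<in>HK.RF (d x). w x h)" if x: "x \<in> Ar" for x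
    using HK.PF_minus[OF _ slice_carrier[OF f x] HK.restrict_PF[OF k]] x by (simp add: slice_def w_def restrict_def fun_eq_iff del: HK.PF_simps)
  moreover have "HK.mf.FI (d x) (HK.IP (\<lambda>h\<in>HK.RF (d x). w x h) (\<lambda>h\<in>HK.RF (d x). w x h)) = HK.mf.FI (d x) (\<Psi> x)" if x: "x \<in> Ar" for x
    by (rule HK.mf.FI_cong, drule HK.fib_rep(1)) (simp add: HK.IP_def \<Psi>_def)
  ultimately have eq: "hnorm (HK.PF (d x)) (slice f x \<ominus>\<^bsub>HK.PF (d x)\<^esub> restrict k (HK.RF (d x))) = sqrt (Re (HK.mf.FI (d x) (\<Psi> x)))"
    if "x \<in> Ar" for x using that by (simp add: HK.PF_norm del: HK.PF_simps)
  have \<Psi>co: "\<Psi> x (co h) = hinner (fs h) (w x h) (w x h)" if x: "x \<in> Ar" and h: "h \<in> H" "d x = r h" for x h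
  proof -
    obtain l where l: "l \<in> K" "r l = d h" "coset_rep (co h) = h \<cdot> l" using HK.coset_rep_coset[of h] h by auto
    have lH: "l \<in> H" using l KH by blast
    have hl: "h \<cdot> l \<in> H" "d (h \<cdot> l) = d l" using h l lH by auto
    have il: "iv l \<in> K" "d (iv l) = d h" "r (iv l) = d l" using l lH by auto
    have "f (x \<cdot> (h \<cdot> l)) = act \<sigma> (iv l) (f (x \<cdot> h))" "k (h \<cdot> l) = act \<sigma> (iv l) (k h)"
      using IF_act[OF f, of "x \<cdot> h" l] HK.IF_act[OF k, of h l] x h l lH by (simp_all add: assoc)
    moreover have m: "f (x \<cdot> h) \<in> carrier (fs (iv l))" "k h \<in> carrier (fs (iv l))"
      using IF_mem[OF f, of "x \<cdot> h"] HK.IF_mem[OF k, of h] x h il by simp_all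
    ultimately have "w x (h \<cdot> l) = act \<sigma> (iv l) (w x h)" using act_minus[OF il(1) m] il hl by (simp add: w_def)
    moreover have "w x h \<in> carrier (fs (iv l))"
      using semi_inner.minus_closed[OF fs_inner m] il lH by (simp add: w_def)
    ultimately show ?thesis using act_inner[OF il(1)] il hl l(3) by (simp add: \<Psi>_def)
  qed
  let ?E = "subtopology (prod_topology (gtop G) ?HT) {(x, h). d x = r h}"
  have tE: "topspace ?E = {(x, h). x \<in> Ar \<and> h \<in> H \<and> d x = r h}" by auto
  have sH: "continuous_map ?E (gtop G) snd"
    using continuous_map_snd[of "gtop G" ?HT] by (auto intro!: continuous_map_from_subtopology simp: continuous_map_in_subtopology)
  have sH': "continuous_map ?E ?HT snd" unfolding continuous_map_in_subtopology using sH by auto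
  have fE: "continuous_map ?E (gtop G) fst" by (intro continuous_map_from_subtopology continuous_map_fst)
  have mE: "continuous_map ?E (gtop G) (\<lambda>z. fst z \<cdot> snd z)" by (rule cont_mult[OF fE sH]) auto
  have a1: "asec ?E (\<lambda>z. d (snd z)) (\<lambda>z. f (fst z \<cdot> snd z))"
    by (rule asec_cong[OF asec_compose[OF IF_asec[OF f] mE]]) auto
  have "asec ?HT d k" using HK.IF_asec[OF k] by simp
  from asec_compose[OF this sH'] have a2: "asec ?E (\<lambda>z. d (snd z)) (\<lambda>z. k (snd z))" .
  have a3: "asec ?E (\<lambda>z. d (snd z)) (\<lambda>z. w (fst z) (snd z))" unfolding w_def by (rule asec_minus[OF a1 a2])
  have ci: "continuous_map ?E euclidean (\<lambda>z. hinner (fs (snd z)) (w (fst z) (snd z)) (w (fst z) (snd z)))"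
    by (rule asec_inner[OF a3 a3])
  have tY: "topspace ?Y = co ` H" by (simp add: topspace_coset_space)
  have cr: "coset_rng SH (co h) = r h" if "h \<in> H" for h using HK.coset_rng_coset[of h] that by simp
  have cont: "continuous_map (subtopology (prod_topology (gtop G) ?Y) {(x, D). d x = coset_rng SH D}) euclidean (\<lambda>(x, D). \<Psi> x D)"
    (is "continuous_map ?F _ _")
    unfolding continuous_map_euclidean_iff
  proof (intro ballI allI impI)
    fix z and e :: real assume z: "z \<in> topspace ?F" and e: "e > 0"
    obtain x D where xD: "z = (x, D)" "x \<in> Ar" "D \<in> topspace ?Y" "d x = coset_rng SH D" using z by auto
    obtain h where h: "h \<in> H" "D = co h" using xD(3) unfolding tY by blast
    have xh: "(x, h) \<in> topspace ?E" using xD h cr by (simp add: tE)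
    obtain W where W: "openin ?E W" "(x, h) \<in> W" "\<And>z. z \<in> W \<Longrightarrow> dist (hinner (fs h) (w x h) (w x h))
        (hinner (fs (snd z)) (w (fst z) (snd z)) (w (fst z) (snd z))) < e"
      using continuous_map_nbhd[OF ci xh e] by auto
    obtain W' where W': "openin (prod_topology (gtop G) ?HT) W'" "W = W' \<inter> {(x, h). d x = r h}"
      using W(1) unfolding openin_subtopology by blast
    have xW: "(x, h) \<in> W'" using W(2) W'(2) by blast
    obtain A B where AB: "openin (gtop G) A" "openin ?HT B" "x \<in> A" "h \<in> B" "A \<times> B \<subseteq> W'"
      using W'(1)[unfolded openin_prod_topology_alt, rule_format, OF xW] by blast
    have B: "openin ?Y (co ` B)" "B \<subseteq> H" using HK.coset_openI[of B] AB(2) openin_subset[OF AB(2)] by auto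
    have A: "A \<subseteq> Ar" using openin_subset[OF AB(1)] .
    let ?U = "(A \<times> co ` B) \<inter> {(x, D). d x = coset_rng SH D}"
    have "openin (prod_topology (gtop G) ?Y) (A \<times> co ` B)" using AB(1) B by (simp add: openin_prod_Times_iff)
    then have "openin ?F ?U" unfolding openin_subtopology by blast
    moreover have "z \<in> ?U" using xD AB h by auto
    moreover have "dist (case z of (x, D) \<Rightarrow> \<Psi> x D) (case z' of (x, D) \<Rightarrow> \<Psi> x D) < e" if z': "z' \<in> ?U" for z'
    proof -
      obtain y b where y: "z' = (y, co b)" "y \<in> A" "b \<in> B" "d y = coset_rng SH (co b)" using z' by auto
      have yb: "y \<in> Ar" "b \<in> H" "d y = r b" using y A B cr by auto
      have "(y, b) \<in> W" using AB(5) y yb W'(2) by auto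
      from W(3)[OF this] show ?thesis using \<Psi>co[OF yb] \<Psi>co[OF xD(2) h(1)] xD h cr y by simp
    qed
    ultimately show "\<exists>U. openin ?F U \<and> z \<in> U \<and> (\<forall>y\<in>U. dist (case z of (x, D) \<Rightarrow> \<Psi> x D) (case y of (x, D) \<Rightarrow> \<Psi> x D) < e)" by blast
  qed
  obtain Ck where Ck: "HK.supported H k Ck" using HK.IF_supp[OF k] by auto
  have supp: "\<exists>U C. openin (gtop G) U \<and> x0 \<in> U \<and> compactin ?Y C \<and> (\<forall>x\<in>U. \<forall>D\<in>HK.mf.fib (d x). \<Psi> x D \<noteq> 0 \<longrightarrow> D \<in> C)"
    if x0: "x0 \<in> Ar" for x0
  proof -
    have c0: "compactin (gtop G) {x0}" "{x0} \<subseteq> Ar" using x0 by (simp_all add: finite_imp_compactin)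
    obtain U N where UN: "openin (gtop G) U" "compactin (gtop G) N" "{x0} \<subseteq> U" "U \<subseteq> N"
      by (rule compact_neighbourhood[OF lchs_gtop c0(1) openin_topspace c0(2)])
    obtain C where C: "compactin ?Y C" "\<And>x h. \<lbrakk>x \<in> N; h \<in> H; d x = r h; f (x \<cdot> h) \<noteq> \<zero>\<^bsub>fs h\<^esub>\<rbrakk> \<Longrightarrow> co h \<in> C"
      using slice_support[OF f UN(2)] by blast
    have "D \<in> C \<union> Ck" if x: "x \<in> U" and D: "D \<in> HK.mf.fib (d x)" and nz: "\<Psi> x D \<noteq> 0" for x D
    proof (rule ccontr)
      assume n: "D \<notin> C \<union> Ck"
      obtain h where h: "h \<in> H" "D = co h" using D tY by auto
      have xh: "x \<in> N" "x \<in> Ar" "d x = r h" using x UN openin_subset[OF UN(1)] D h cr by auto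
      have "f (x \<cdot> h) = \<zero>\<^bsub>fs h\<^esub>" using C(2)[OF xh(1) h(1) xh(3)] n h by blast
      moreover have "k h = \<zero>\<^bsub>fs h\<^esub>" using Ck n h by (auto simp: HK.supported_def)
      moreover have hA: "h \<in> Ar" using h by simp
      ultimately have "w x h = \<zero>\<^bsub>fs h\<^esub>"
        using semi_inner.minus_self[OF fs_inner[OF hA] semi_inner.zero_closed[OF fs_inner[OF hA]]] by (simp add: w_def)
      then have "\<Psi> x D = 0"
        using \<Psi>co[OF xh(2) h(1) xh(3)] h semi_inner.inner_zero_left[OF fs_inner[OF hA] semi_inner.zero_closed[OF fs_inner[OF hA]]] by simp
      then show False using nz by simp
    qed
    moreover have "compactin ?Y (C \<union> Ck)" using C Ck by (auto simp: HK.supported_def compactin_Un)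
    ultimately show ?thesis using UN by blast
  qed
  have "continuous_map (gtop G) euclidean (\<lambda>x. HK.mf.FI (d x) (\<Psi> x))"
    using HK.mf.param_integral(1)[of "gtop G" d \<Psi>, OF _ cont supp] cont_src_unit by simp
  from continuous_map_unop[OF this, of "\<lambda>z. sqrt (Re z)"]
  have "continuous_map (gtop G) euclidean (\<lambda>x. sqrt (Re (HK.mf.FI (d x) (\<Psi> x))))" by (simp add: continuous_intros)
  then show ?thesis by (rule continuous_map_eq) (simp add: eq del: HK.PF_simps)
qed

end

context induction_in_stages
begin

lemma GH_fs: "fibre L u = hilbert_completion (HK.PF u)" by (simp add: HK.IH_eq)

text \<open>
  Near \<open>x0\<close> the function is compared with the section given by an extension of its slice at \<open>x0\<close>;
  the distance is continuous in \<open>x\<close> and vanishes at \<open>x0\<close>.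
\<close>

lemma tilde_asec:
  assumes f: "f \<in> IF" shows "GH.asec (gtop G) d (tilde f)"
  unfolding approx_by_sections_def
proof (intro conjI ballI allI impI cont_src_unit)
  show "tilde f x \<in> carrier (fibre L (d x))" if "x \<in> Ar" for x using tilde_mem[OF f that] by simp
  fix x0 and e :: real assume x0: "x0 \<in> Ar" and e: "e > 0"
  obtain k where k: "k \<in> HK.IF" "slice f x0 = restrict k (HK.RF (d x0))" using slice_carrier[OF f x0] by auto
  let ?D = "\<lambda>x. hnorm (HK.PF (d x)) (slice f x \<ominus>\<^bsub>HK.PF (d x)\<^esub> restrict k (HK.RF (d x)))"
  have "?D x0 = 0"
    using semi_inner.norm_minus_self[OF HK.PF_semi_inner HK.restrict_PF[OF k(1)]] x0 k(2) by (simp del: HK.PF_simps)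
  then obtain U where U: "openin (gtop G) U" "x0 \<in> U" "\<And>x. x \<in> U \<Longrightarrow> ?D x < e"
    using continuous_map_real_nbhd[OF slice_distance_continuous[OF f k(1)] x0, of e] e by auto
  have "GH.nm (d x) (tilde f x \<ominus>\<^bsub>GH.fb (d x)\<^esub> HK.t0 k (d x)) < e" if x: "x \<in> U" for x
  proof -
    have xA: "x \<in> Ar" using x openin_subset[OF U(1)] by blast
    interpret P: semi_inner "HK.PF (d x)" by (rule HK.PF_semi_inner) (use xA in simp)
    note c = slice_carrier[OF f xA] HK.restrict_PF[OF k(1), of "d x"]
    show ?thesis using U(3)[OF x] P.HC_const(4)[OF c] P.HC_const(2)[OF P.minus_closed[OF c]] xA
      by (simp add: tilde_def HK.t0_def HK.IH_eq del: HK.PF_simps)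
  qed
  then show "\<exists>\<xi>\<in>sections L. \<exists>U. openin (gtop G) U \<and> x0 \<in> U \<and>
      (\<forall>x\<in>U. GH.nm (d x) (tilde f x \<ominus>\<^bsub>GH.fb (d x)\<^esub> \<xi> (d x)) < e)"
    using U HK.t0_section[OF k(1)] by blast
qed

lemma slice_mult:
  assumes x: "x \<in> Ar" and h: "h \<in> H" "d x = r h"
  shows "HK.trans (iv h) (slice f x) = slice f (x \<cdot> h)"
  using x h by (auto simp: HK.trans_def slice_def RH_mem assoc restrict_def fun_eq_iff)

lemma tilde_IF:
  assumes f: "f \<in> IF" shows "tilde f \<in> GH.IF"
  unfolding GH.IF_iff GH.equiv_on_def
proof (intro conjI ballI impI)
  show "tilde f \<in> extensional Ar" by (simp add: tilde_def)
  show "GH.asec (subtopology (gtop G) Ar) d (tilde f)" using tilde_asec[OF f] by simp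
  fix x h assume x: "x \<in> Ar" and h: "h \<in> H" "d x = r h"
  have "act L (iv h) (limit_class (HK.PF (d x)) (\<lambda>_. slice f x)) = limit_class (HK.PF (d h)) (\<lambda>_. slice f (x \<cdot> h))"
    using HK.act_ind_class[of "iv h" "\<lambda>_. slice f x"] semi_inner.const_cs[OF HK.PF_semi_inner slice_carrier[OF f x]] x h
    by (simp add: slice_mult del: HK.PF_simps)
  then show "tilde f (x \<cdot> h) = act L (iv h) (tilde f x)" using x h by (simp add: tilde_def)
next
  obtain C0 where C0: "supported Ar f C0" using IF_supp[OF f] by blast
  then obtain D where D: "compactin (gtop G) D" "C0 \<subseteq> co ` D" using compact_lift by (auto simp: supported_def)
  have "GH.co x \<in> GH.co ` D" if x: "x \<in> Ar" and nz: "tilde f x \<noteq> \<zero>\<^bsub>GH.fs x\<^esub>" for x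
  proof -
    have "\<exists>h\<in>HK.RF (d x). f (x \<cdot> h) \<noteq> \<zero>\<^bsub>fs h\<^esub>"
    proof (rule ccontr)
      assume "\<not> ?thesis"
      then have "slice f x = \<zero>\<^bsub>HK.PF (d x)\<^esub>" by (auto simp: slice_def)
      then show False using nz x semi_inner.HC_zero[OF HK.PF_semi_inner] by (simp add: tilde_def HK.IH_eq del: HK.PF_simps)
    qed
    then obtain h where h: "h \<in> H" "r h = d x" "f (x \<cdot> h) \<noteq> \<zero>\<^bsub>fs h\<^esub>" by (auto simp: RH_mem)
    then have "co (x \<cdot> h) \<in> C0" using C0 x by (simp add: supported_def)
    then obtain b where b: "b \<in> D" "co (x \<cdot> h) = co b" using D(2) by blast
    have bA: "b \<in> Ar" using b compactin_subset_topspace[OF D(1)] by blast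
    have "GH.co (x \<cdot> h) = GH.co b"
      using b(2) coset_eq_iff[of "x \<cdot> h" b] GH.coset_eq_iff[of "x \<cdot> h" b] KH x h bA by auto
    then show ?thesis using GH.coset_mult[OF x h(1)] h b(1) by auto
  qed
  moreover have "compactin GH.Q (GH.co ` D)" using D(1) GH.cont_coset by (rule image_compactin)
  ultimately show "\<exists>C. GH.supported Ar (tilde f) C" unfolding GH.supported_def by blast
qed

text \<open>
  Extend \<open>k\<close> from \<open>H\<close>, a closed set stable under \<open>K\<close>, to a function on \<open>G\<close>; translate the
  restriction of that to the range fibre of \<open>d(x)\<close> by \<open>x\<close>, and extend again.
\<close>

lemma slice_surjective:
  assumes x: "x \<in> Ar" and k: "k \<in> carrier (HK.PF (d x))"
  obtains f where "f \<in> IF" "slice f x = k"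
proof -
  obtain k' where k': "k' \<in> HK.IF" "k = restrict k' (HK.RF (d x))" using k by auto
  have Hst: "stable H" using GH.H_closed KH by (auto simp: stable_def)
  have eq: "equiv_on H k'" using HK.IF_equiv[OF k'(1)] by (simp add: equiv_on_def HK.equiv_on_def subtopology_subtopology)
  obtain C where C: "HK.supported H k' C" using HK.IF_supp[OF k'(1)] by auto
  then obtain D where D: "compactin (subtopology (gtop G) H) D" "C \<subseteq> co ` D"
    using HK.compact_lift[of C] by (auto simp: HK.supported_def)
  have "compactin Q (co ` D)" using D(1) cont_coset by (auto simp: compactin_subtopology intro: image_compactin)
  then have "supported H k' (co ` D)" using C D(2) by (auto simp: supported_def HK.supported_def)
  then obtain F where F: "F \<in> IF" "\<And>h. h \<in> H \<Longrightarrow> F h = k' h" using equivariant_Tietze[OF Hst eq] by blast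
  obtain f where f: "f \<in> IF" "trans x (restrict F (RF (d x))) = restrict f (RF (r x))"
    using trans_closed[OF x restrict_PF[OF F(1)]] by auto
  have "f (x \<cdot> h) = k' h" if h: "h \<in> H" "r h = d x" for h
    using fun_cong[OF f(2), of "x \<cdot> h"] x h F(2) by (simp add: trans_def RF_mem)
  then have "slice f x = k" unfolding k'(2) slice_def by (intro restrict_ext) (simp add: RH_mem)
  then show ?thesis using f(1) that by blast
qed

lemma tilde_dense:
  assumes x: "x \<in> Ar" and A: "A \<in> carrier (GH.fs x)" and e: "e > 0"
  shows "\<exists>f\<in>IF. GH.nm (d x) (tilde f x \<ominus>\<^bsub>GH.fs x\<^esub> A) < e"
proof -
  interpret P: semi_inner "HK.PF (d x)" by (rule HK.PF_semi_inner) (use x in simp)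
  obtain k where k: "k \<in> carrier (HK.PF (d x))" "hnorm P.HC (A \<ominus>\<^bsub>P.HC\<^esub> HK.cls (d x) k) < e"
    using P.HC_dense[OF _ e] A unfolding GH_fs by blast
  obtain f where f: "f \<in> IF" "slice f x = k" using slice_surjective[OF x k(1)] .
  interpret C: semi_inner P.HC by (rule P.HC_semi_inner)
  have "HK.cls (d x) k \<in> carrier P.HC" by (rule P.lc_carrier[OF P.const_cs[OF k(1)]])
  then have "hnorm P.HC (HK.cls (d x) k \<ominus>\<^bsub>P.HC\<^esub> A) < e" using k(2) A C.norm_minus_commute[of A "HK.cls (d x) k"] unfolding GH_fs by simp
  then show ?thesis
    using f x unfolding GH_fs by (intro bexI[of _ f]) (simp_all add: tilde_def)
qed

sublocale GH: equivariant_field G H L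
  by unfold_locales (use tilde_dense tilde_IF in blast)

sublocale GH: induced G H L \<mu>G
  by (intro induced.intro induced_axioms.intro GH.equivariant_field_axioms sysG)

lemma slice_add: 
  "x \<in> Ar \<Longrightarrow> slice (\<lambda>x\<in>Ar. f x \<oplus>\<^bsub>fs x\<^esub> g x) x = slice f x \<oplus>\<^bsub>HK.PF (d x)\<^esub> slice g x"
  and slice_smult: "x \<in> Ar \<Longrightarrow> slice (\<lambda>x\<in>Ar. a (GH.co x) \<odot>\<^bsub>fs x\<^esub> f x) x = a (GH.co x) \<odot>\<^bsub>HK.PF (d x)\<^esub> slice f x"
  and slice_zero: "x \<in> Ar \<Longrightarrow> slice (\<lambda>x\<in>Ar. \<zero>\<^bsub>fs x\<^esub>) x = \<zero>\<^bsub>HK.PF (d x)\<^esub>"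
  by (auto simp: slice_def RH_mem restrict_def fun_eq_iff)

text \<open>
  Multiplication of \<open>f~\<close> by a function on \<open>G/H\<close> is multiplication of \<open>f\<close> by its pullback to \<open>G/K\<close>,
  so these functions satisfy the conditions of the approximation theorem.
\<close>

lemma tilde_approximation:
  assumes F: "F \<in> GH.IF" and V: "GH.supported Ar F C" "openin GH.Q V" "C \<subseteq> V" and e: "e > 0"
  obtains f C' where "f \<in> IF" "\<And>x. x \<in> Ar \<Longrightarrow> GH.nm (d x) (tilde f x \<ominus>\<^bsub>GH.fs x\<^esub> F x) \<le> e"
    "GH.supported Ar (tilde f) C'" "C' \<subseteq> V"
proof (rule GH.uniform_approximation[of "tilde ` IF", OF _ _ _ _ _ GH.stable_Ar GH.IF_equiv[OF F] V e])
  show "tilde ` IF \<subseteq> GH.IF" using tilde_IF by blast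
  have "tilde (\<lambda>x\<in>Ar. \<zero>\<^bsub>fs x\<^esub>) = (\<lambda>x\<in>Ar. \<zero>\<^bsub>GH.fs x\<^esub>)"
    unfolding tilde_def by (rule restrict_ext)
      (simp add: slice_zero semi_inner.HC_zero[OF HK.PF_semi_inner] HK.IH_eq del: HK.PF_simps)
  then show "(\<lambda>x\<in>Ar. \<zero>\<^bsub>GH.fs x\<^esub>) \<in> tilde ` IF" using IF_zero by (metis imageI)
  show "(\<lambda>x\<in>Ar. A x \<oplus>\<^bsub>GH.fs x\<^esub> B x) \<in> tilde ` IF" if AB: "A \<in> tilde ` IF" "B \<in> tilde ` IF" for A B
  proof -
    obtain f g where f: "f \<in> IF" "A = tilde f" and g: "g \<in> IF" "B = tilde g" using AB by blast
    have "(\<lambda>x\<in>Ar. A x \<oplus>\<^bsub>GH.fs x\<^esub> B x) = tilde (\<lambda>x\<in>Ar. f x \<oplus>\<^bsub>fs x\<^esub> g x)"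
      unfolding f(2) g(2) tilde_def
      by (rule restrict_ext) (simp add: slice_add semi_inner.HC_const(3)[OF HK.PF_semi_inner] slice_carrier f g HK.IH_eq del: HK.PF_simps)
    then show ?thesis using IF_add[OF f(1) g(1)] by blast
  qed
  show "(\<lambda>x\<in>Ar. a (GH.co x) \<odot>\<^bsub>GH.fs x\<^esub> A x) \<in> tilde ` IF" if A: "A \<in> tilde ` IF" and a: "continuous_map GH.Q euclidean a" for A a
  proof -
    obtain f where f: "f \<in> IF" "A = tilde f" using A by blast
    let ?a = "\<lambda>D. a (GH.co (coset_rep D))"
    have ac: "?a (co x) = a (GH.co x)" if x: "x \<in> Ar" for x
    proof -
      obtain k where "k \<in> K" "r k = d x" "coset_rep (co x) = x \<cdot> k" using coset_rep_coset[OF x] .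
      then show ?thesis using GH.coset_mult[OF x, of k] KH by auto
    qed
    have "continuous_map (gtop G) euclidean (\<lambda>x. a (GH.co x))" using a unfolding GH.cont_from_coset_space .
    then have "continuous_map Q euclidean ?a"
      unfolding cont_from_coset_space by (rule continuous_map_eq) (simp add: ac)
    then have "(\<lambda>x\<in>Ar. ?a (co x) \<odot>\<^bsub>fs x\<^esub> f x) \<in> IF" by (rule IF_scale[OF f(1)])
    moreover have "(\<lambda>x\<in>Ar. ?a (co x) \<odot>\<^bsub>fs x\<^esub> f x) = (\<lambda>x\<in>Ar. a (GH.co x) \<odot>\<^bsub>fs x\<^esub> f x)"
      by (rule restrict_ext) (simp add: ac)
    moreover have "(\<lambda>x\<in>Ar. a (GH.co x) \<odot>\<^bsub>GH.fs x\<^esub> A x) = tilde (\<lambda>x\<in>Ar. a (GH.co x) \<odot>\<^bsub>fs x\<^esub> f x)"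
      unfolding f(2) tilde_def
      by (rule restrict_ext) (simp add: slice_smult semi_inner.HC_const(5)[OF HK.PF_semi_inner] slice_carrier f HK.IH_eq del: HK.PF_simps)
    ultimately show ?thesis by auto
  qed
  show "\<exists>F\<in>tilde ` IF. GH.nm (d x) (F x \<ominus>\<^bsub>GH.fs x\<^esub> A) < e" if "x \<in> Ar" "A \<in> carrier (GH.fs x)" "e > 0" for x A e
    using tilde_dense[OF that] by blast
  fix F' C' assume "F' \<in> tilde ` IF" "\<And>z. z \<in> Ar \<Longrightarrow> GH.nm (d z) (F' z \<ominus>\<^bsub>GH.fs z\<^esub> F z) \<le> e" "GH.supported Ar F' C'" "C' \<subseteq> V"
  then show thesis using that by blast
qed

end

section \<open>The intertwining unitary\<close>

context induction_in_stages
begin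

text \<open>
  A function bounded by \<open>\<surd>c\<close> and vanishing off \<open>D\<close> has squared norm at most \<open>c \<integral> b\<close>, where the
  bump function \<open>b\<close> is one on \<open>D\<close>; and \<open>\<integral> b\<close> is continuous in the unit, hence bounded near \<open>u0\<close>.
\<close>

lemma t0_tilde_approximation:
  assumes F: "F \<in> GH.IF" and u0: "u0 \<in> units G" and e: "e > 0"
  obtains f U where "f \<in> IF" "openin (unit_space G) U" "u0 \<in> U"
    "\<And>u. u \<in> U \<Longrightarrow> hnorm (GH.IH u) (GH.t0 F u \<ominus>\<^bsub>GH.IH u\<^esub> GH.t0 (tilde f) u) < e"
proof -
  obtain C where C: "GH.supported Ar F C" using GH.IF_supp[OF F] by blast
  then have Cc: "compactin GH.Q C" by (simp add: GH.supported_def)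
  obtain V D where VD: "openin GH.Q V" "compactin GH.Q D" "C \<subseteq> V" "V \<subseteq> D"
    by (rule compact_neighbourhood[OF GH.lchs_coset_space Cc openin_topspace compactin_subset_topspace[OF Cc]])
  obtain b :: "'g set \<Rightarrow> real" and D' where b: "continuous_map GH.Q euclidean b" "\<And>y. b y \<ge> 0" "\<And>y. y \<in> D \<Longrightarrow> b y = 1"
      "compactin GH.Q D'" "\<And>y. b y \<noteq> 0 \<Longrightarrow> y \<in> D'"
    by (rule bump_function[OF GH.lchs_coset_space VD(2) openin_topspace compactin_subset_topspace[OF VD(2)]]) blast
  have cb: "continuous_map GH.Q euclidean (\<lambda>y. complex_of_real (c * b y))" for c
    by (rule continuous_map_unop[OF b(1)]) (intro continuous_intros)
  have bC: "(\<lambda>y. complex_of_real (c * b y)) \<in> Cc GH.Q" for c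
    unfolding Cc_iff[OF GH.lchs_coset_space] using cb b(4,5) by auto
  define m where "m u = Re (LINT y|\<mu>G u. complex_of_real (1 * b y))" for u
  have mc: "continuous_map (unit_space G) euclidean m"
    unfolding m_def by (rule continuous_map_unop[OF GH.mf.integral_continuous[OF bC]]) (intro continuous_intros)
  have u0': "u0 \<in> topspace (unit_space G)" using u0 by simp
  have abs_bound: "m u0 < \<bar>m u0\<bar> + 1" by linarith
  obtain U where U: "openin (unit_space G) U" "u0 \<in> U" "\<And>u. u \<in> U \<Longrightarrow> m u < \<bar>m u0\<bar> + 1"
    by (rule continuous_map_real_nbhd[OF mc u0' abs_bound]) blast
  define c where "c = e\<^sup>2 / (\<bar>m u0\<bar> + 1)"
  have c: "c > 0" "c * (\<bar>m u0\<bar> + 1) = e\<^sup>2" using e by (auto simp: c_def add_nonneg_pos)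
  have sc: "sqrt c > 0" using c by simp
  obtain f C' where f: "f \<in> IF" "\<And>x. x \<in> Ar \<Longrightarrow> GH.nm (d x) (tilde f x \<ominus>\<^bsub>GH.fs x\<^esub> F x) \<le> sqrt c"
    "GH.supported Ar (tilde f) C'" "C' \<subseteq> V"
    using tilde_approximation[OF F C VD(1,3) sc] by blast
  have tf: "tilde f \<in> GH.IF" by (rule tilde_IF[OF f(1)])
  have "hnorm (GH.IH u) (GH.t0 F u \<ominus>\<^bsub>GH.IH u\<^esub> GH.t0 (tilde f) u) < e" if u: "u \<in> U" for u
  proof -
    have uu: "u \<in> units G" using u openin_subset[OF U(1)] by auto
    have uT: "u \<in> topspace (unit_space G)" using uu by simp
    interpret P: semi_inner "GH.PF u" by (rule GH.PF_semi_inner[OF uu])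
    define w where "w = restrict F (GH.RF u) \<ominus>\<^bsub>GH.PF u\<^esub> restrict (tilde f) (GH.RF u)"
    have w: "w \<in> carrier (GH.PF u)" unfolding w_def by (intro P.minus_closed GH.restrict_PF F tf)
    have wx: "w x = F x \<ominus>\<^bsub>GH.fs x\<^esub> tilde f x" if "x \<in> GH.RF u" for x
      unfolding w_def using GH.PF_minus[OF uu GH.restrict_PF[OF F] GH.restrict_PF[OF tf]] that by simp
    have "cmod (GH.IP w w y) \<le> c * b y" if y: "y \<in> GH.mf.fib u" for y
    proof -
      let ?x = "coset_rep y"
      have x: "?x \<in> GH.RF u" "?x \<in> Ar" using GH.fib_rep[OF y] by auto
      have cx: "GH.co ?x = y" using y GH.coset_rep[of y] by auto
      interpret S: semi_inner "GH.fs ?x" by (rule GH.fs_inner[OF x(2)])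
      note m = GH.IF_mem[OF F x(2)] GH.IF_mem[OF tf x(2)]
      have n: "cmod (GH.IP w w y) = (GH.nm (d ?x) (w ?x))\<^sup>2"
        unfolding GH.IP_def S.inner_self[OF GH.PF_mem[OF w x(1)]] by (simp add: norm_power)
      show ?thesis
      proof (cases "y \<in> D")
        case True
        have nn: "0 \<le> GH.nm (d ?x) (w ?x)" using S.norm_ge0[OF GH.PF_mem[OF w x(1)]] .
        have "GH.nm (d ?x) (w ?x) \<le> sqrt c" using f(2)[OF x(2)] S.norm_minus_commute[OF m] wx[OF x(1)] by simp
        then have "(GH.nm (d ?x) (w ?x))\<^sup>2 \<le> (sqrt c)\<^sup>2" using nn by (rule power_mono)
        then show ?thesis using n c True b(3) by simp
      next
        case False
        then have "GH.co ?x \<notin> C" "GH.co ?x \<notin> C'" using False VD(3,4) f(4) unfolding cx by blast+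
        then have "F ?x = \<zero>\<^bsub>GH.fs ?x\<^esub>" "tilde f ?x = \<zero>\<^bsub>GH.fs ?x\<^esub>"
          using C f(3) x(2) unfolding GH.supported_def by blast+
        then have "GH.nm (d ?x) (w ?x) = 0" using wx[OF x(1)] S.norm_minus_self[OF S.zero_closed] by simp
        then show ?thesis using n b(2)[of y] c by simp
      qed
    qed
    from GH.mf.FI_bound[OF uT GH.IP_fibre_fun[OF w w] bC this]
    have "cmod (GH.mf.FI u (GH.IP w w)) \<le> c * m u" by (simp add: m_def)
    also have "\<dots> < c * (\<bar>m u0\<bar> + 1)" using U(3)[OF u] c(1) by simp
    finally have "Re (GH.mf.FI u (GH.IP w w)) < e\<^sup>2" using complex_Re_le_cmod[of "GH.mf.FI u (GH.IP w w)"] c by linarith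
    then have "hnorm (GH.PF u) w < e" unfolding GH.PF_norm using e by (simp add: real_less_lsqrt)
    then show ?thesis unfolding GH.t0_minus_norm[OF F tf uu] w_def .
  qed
  then show ?thesis using f(1) U(1,2) that by blast
qed

text \<open>The map \<open>f \<mapsto> f~\<close> on functions given on one range fibre.\<close>

definition stage :: "'g \<Rightarrow> ('g \<Rightarrow> 'h) \<Rightarrow> 'g \<Rightarrow> (nat \<Rightarrow> 'g \<Rightarrow> 'h) set"
  where "stage u k = (\<lambda>x \<in> RF u. HK.cls (d x) (slice k x))"

lemma slice_restrict: "x \<in> RF u \<Longrightarrow> slice (restrict f (RF u)) x = slice f x"
  by (auto simp: slice_def RH_mem RF_mem restrict_def fun_eq_iff)

lemma stage_restrict: "stage u (restrict f (RF u)) = restrict (tilde f) (RF u)"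
  unfolding stage_def by (rule restrict_ext) (simp add: slice_restrict tilde_def RF_mem)

lemma PF_slice:
  assumes "k \<in> carrier (PF u)" "x \<in> RF u" shows "slice k x \<in> carrier (HK.PF (d x))"
  using assms slice_carrier slice_restrict by (auto simp: RF_mem simp del: HK.PF_simps)

text \<open>
  The formula for the iterated integral, applied to the integrand of the inner product of two
  induced functions. The inner integral is then the inner product of two slices.
\<close>

lemma stage_isometry:
  assumes u: "u \<in> units G" shows "linear_isometry (PF u) (GH.PF u) (stage u)"
proof (intro linear_isometry.intro linear_isometry_axioms.intro PF_semi_inner GH.PF_semi_inner u)
  fix k l z assume k: "k \<in> carrier (PF u)"
  then obtain f where f: "f \<in> IF" "k = restrict f (RF u)" by auto
  have P: "semi_inner (HK.PF (d x))" if "x \<in> RF u" for x using that by (intro HK.PF_semi_inner) (simp add: RF_mem)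
  show "stage u k \<in> carrier (GH.PF u)" unfolding f(2) stage_restrict by (rule GH.restrict_PF[OF tilde_IF[OF f(1)]])
  have "slice (z \<odot>\<^bsub>PF u\<^esub> k) x = z \<odot>\<^bsub>HK.PF (d x)\<^esub> slice k x" if "x \<in> RF u" for x
    using that by (auto simp: slice_def RH_mem RF_mem restrict_def fun_eq_iff)
  then show "stage u (z \<odot>\<^bsub>PF u\<^esub> k) = z \<odot>\<^bsub>GH.PF u\<^esub> stage u k"
    unfolding stage_def GH.PF_simps
    by (intro restrict_ext) (simp add: semi_inner.HC_const(5)[OF P PF_slice[OF k]] HK.IH_eq del: HK.PF_simps PF_simps)
  assume l: "l \<in> carrier (PF u)"
  then obtain g where g: "g \<in> IF" "l = restrict g (RF u)" by auto
  have "slice (k \<oplus>\<^bsub>PF u\<^esub> l) x = slice k x \<oplus>\<^bsub>HK.PF (d x)\<^esub> slice l x" if "x \<in> RF u" for x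
    using that by (auto simp: slice_def RH_mem RF_mem restrict_def fun_eq_iff)
  then show "stage u (k \<oplus>\<^bsub>PF u\<^esub> l) = stage u k \<oplus>\<^bsub>GH.PF u\<^esub> stage u l"
    unfolding stage_def GH.PF_simps
    by (intro restrict_ext) (simp add: semi_inner.HC_const(3)[OF P PF_slice[OF k] PF_slice[OF l]] HK.IH_eq del: HK.PF_simps PF_simps)
  note t = tilde_IF[OF f(1)] tilde_IF[OF g(1)]
  have uT: "u \<in> topspace (unit_space G)" using u by simp
  have inner: "(LINT D : coset_range_fibre SH K (d (coset_rep C)) |\<mu>H (d (coset_rep C)). IP f g (translate G (coset_rep C) D))
      = GH.IP (tilde f) (tilde g) C" if C: "C \<in> topspace GH.Q" for C
  proof -
    let ?x = "coset_rep C"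
    have x: "?x \<in> Ar" using GH.coset_rep[OF C] by simp
    have "GH.IP (tilde f) (tilde g) C = hinner (HK.PF (d ?x)) (slice f ?x) (slice g ?x)"
      using semi_inner.HC_const(1)[OF HK.PF_semi_inner slice_carrier[OF f(1) x] slice_carrier[OF g(1) x]] x
      by (simp add: GH.IP_def tilde_def HK.IH_eq del: HK.PF_simps)
    also have "\<dots> = HK.mf.FI (d ?x) (HK.IP (slice f ?x) (slice g ?x))" by simp
    also have "\<dots> = HK.mf.FI (d ?x) (\<lambda>D. IP f g (translate G ?x D))"
    proof (rule HK.mf.FI_cong)
      fix D assume D: "D \<in> HK.mf.fib (d ?x)"
      let ?h = "coset_rep D"
      have h: "?h \<in> HK.RF (d ?x)" "?h \<in> H" "r ?h = d ?x" using HK.fib_rep(1)[OF D] by (auto simp: RH_mem)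
      have "co ?h = D" using D HK.coset_rep[of D] by auto
      then have "translate G ?x D = co (?x \<cdot> ?h)" using translate_coset[OF x, of ?h] h by simp
      then show "HK.IP (slice f ?x) (slice g ?x) D = IP f g (translate G ?x D)"
        using h x IP_coset[OF f(1) g(1), of "?x \<cdot> ?h"] by (simp add: HK.IP_def slice_def)
    qed
    finally show ?thesis by (simp add: HK.mf.FI_def coset_range_fibre_def)
  qed
  have "hinner (GH.PF u) (stage u k) (stage u l) = GH.mf.FI u (GH.IP (tilde f) (tilde g))"
    unfolding f(2) g(2) stage_restrict GH.PF_simps GH.FI_IP_restrict ..
  also have "\<dots> = (LINT C|\<mu>G u. GH.IP (tilde f) (tilde g) C)" by (rule GH.mf.FI_Cc[OF uT GH.IP_Cc[OF t]])
  also have "\<dots> = (LINT C|\<mu>G u. (LINT D : coset_range_fibre SH K (d (coset_rep C)) |\<mu>H (d (coset_rep C)). IP f g (translate G (coset_rep C) D)))"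
    using GH.mf.radon[OF uT] by (intro Bochner_Integration.integral_cong refl) (simp add: inner radon_measure_def)
  also have "\<dots> = (LINT C|\<gamma> u. IP f g C)" by (rule iterated[OF IP_Cc[OF f(1) g(1)] u, symmetric])
  also have "\<dots> = hinner (PF u) k l"
    unfolding f(2) g(2) PF_simps FI_IP_restrict by (rule mf.FI_Cc[OF uT IP_Cc[OF f(1) g(1)], symmetric])
  finally show "hinner (GH.PF u) (stage u k) (stage u l) = hinner (PF u) k l" .
qed

abbreviation "I1 \<equiv> ind G K \<sigma> \<gamma>"
abbreviation "I2 \<equiv> ind G H L \<mu>G"

definition intertwiner :: "'g \<Rightarrow> (nat \<Rightarrow> 'g \<Rightarrow> 'h) set \<Rightarrow> (nat \<Rightarrow> 'g \<Rightarrow> (nat \<Rightarrow> 'g \<Rightarrow> 'h) set) set"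
  where "intertwiner u = completion_map (GH.PF u) (stage u)"

lemma intertwiner_class:
  assumes u: "u \<in> units G" and s: "s \<in> cauchy_sequences (PF u) (hnorm (PF u))"
  shows "intertwiner u (limit_class (PF u) s) = limit_class (GH.PF u) (\<lambda>i. stage u (s i))"
  unfolding intertwiner_def by (rule linear_isometry.completion_map_lc[OF stage_isometry[OF u] s])

lemma intertwiner_t0: 
  assumes f: "f \<in> IF" and u: "u \<in> units G"
  shows "intertwiner u (t0 f u) = GH.t0 (tilde f) u"
  using intertwiner_class[OF u semi_inner.const_cs[OF PF_semi_inner[OF u] restrict_PF[OF f]]] u
  by (simp add: t0_def GH.t0_def stage_restrict)

lemma intertwiner_unitary:
  assumes u: "u \<in> units G" shows "unitary_on (IH u) (GH.IH u) (intertwiner u)"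
  unfolding IH_eq GH.IH_eq intertwiner_def
proof (rule linear_isometry.completion_map_unitary[OF stage_isometry[OF u]])
  fix b and e :: real assume b: "b \<in> carrier (GH.PF u)" and e: "e > 0"
  obtain F where F: "F \<in> GH.IF" "b = restrict F (GH.RF u)" using b by auto
  obtain f U where f: "f \<in> IF" "u \<in> U" "\<And>u. u \<in> U \<Longrightarrow> hnorm (GH.IH u) (GH.t0 F u \<ominus>\<^bsub>GH.IH u\<^esub> GH.t0 (tilde f) u) < e"
    by (rule t0_tilde_approximation[OF F(1) u e]) blast
  have "hnorm (GH.PF u) (b \<ominus>\<^bsub>GH.PF u\<^esub> stage u (restrict f (RF u))) < e"
    using f(3)[OF f(2)] unfolding GH.t0_minus_norm[OF F(1) tilde_IF[OF f(1)] u] F(2) stage_restrict .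
  then show "\<exists>a\<in>carrier (PF u). hnorm (GH.PF u) (b \<ominus>\<^bsub>GH.PF u\<^esub> stage u a) < e" using restrict_PF[OF f(1), of u] by (rule bexI)
qed

lemma intertwiner_equivariant:
  assumes x: "x \<in> Ar" and A: "A \<in> carrier (IH (d x))"
  shows "intertwiner (r x) (act I1 x A) = act I2 x (intertwiner (d x) A)"
proof -
  have u: "d x \<in> units G" "r x \<in> units G" using x by auto
  obtain s where s: "s \<in> cauchy_sequences (PF (d x)) (hnorm (PF (d x)))" "A = limit_class (PF (d x)) s"
    by (rule semi_inner.HC_cases[OF PF_semi_inner[OF u(1)] A[unfolded IH_eq]])
  have si: "s i \<in> carrier (PF (d x))" for i by (rule semi_inner.cs_carrier[OF PF_semi_inner[OF u(1)] s(1)])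
  have ts: "(\<lambda>i. trans x (s i)) \<in> cauchy_sequences (PF (r x)) (hnorm (PF (r x)))"
    by (rule linear_isometry.map_cs[OF trans_isometry[OF x] s(1)])
  have js: "(\<lambda>i. stage (d x) (s i)) \<in> cauchy_sequences (GH.PF (d x)) (hnorm (GH.PF (d x)))"
    by (rule linear_isometry.map_cs[OF stage_isometry[OF u(1)] s(1)])
  have sl: "slice (trans x k) y = slice k (iv x \<cdot> y)" if y: "y \<in> RF (r x)" for k y
    using x y by (auto simp: slice_def trans_def RH_mem RF_mem assoc restrict_def fun_eq_iff)
  have "stage (r x) (trans x k) = GH.trans x (stage (d x) k)" for k
    unfolding stage_def GH.trans_def by (rule restrict_ext) (use x sl in \<open>auto simp: RF_mem\<close>)
  then show ?thesis
    unfolding s(2) act_ind_class[OF x s(1)] intertwiner_class[OF u(2) ts] intertwiner_class[OF u(1) s(1)] GH.act_ind_class[OF x js] by simp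
qed

text \<open>
  By density, a section \<open>\<xi>\<close> of the target bundle is locally close to one given by some \<open>f~\<close>. The
  intertwiner is isometric and takes the section given by \<open>f\<close> to it, so points near the former
  section are mapped to points near \<open>\<xi>\<close>.
\<close>

lemma intertwiner_continuous:
  "continuous_map (total_space (unit_space G) I1) (total_space (unit_space G) I2) (\<lambda>(u, h). (u, intertwiner u h))"
proof -
  interpret B1: hilbert_field "unit_space G" I1 by (rule hilbert_field.intro[OF ind_bundle])
  interpret B2: hilbert_field "unit_space G" I2 by (rule hilbert_field.intro[OF GH.ind_bundle])
  have un: "intertwiner u h \<in> carrier (GH.IH u)" if "u \<in> units G" "h \<in> carrier (IH u)" for u h
    using intertwiner_unitary[OF that(1)] that(2) by (auto simp: unitary_on_def bounded_linear_on_def)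
  have iso: "hnorm (GH.IH u) (intertwiner u h \<ominus>\<^bsub>GH.IH u\<^esub> GH.t0 (tilde f) u) = hnorm (IH u) (h \<ominus>\<^bsub>IH u\<^esub> t0 f u)"
    if u: "u \<in> units G" and h: "h \<in> carrier (IH u)" and f: "f \<in> IF" for u h f
  proof -
    have U: "unitary_on (IH u) (GH.IH u) (intertwiner u)" by (rule intertwiner_unitary[OF u])
    interpret T: linear_isometry "IH u" "GH.IH u" "intertwiner u"
      using U hilbert_semi_inner[OF IH_hilbert[OF u]] hilbert_semi_inner[OF GH.IH_hilbert[OF u]]
      by (intro linear_isometry.intro linear_isometry_axioms.intro) (auto simp: unitary_on_def bounded_linear_on_def)
    show ?thesis using T.map_norm_minus[OF h t0_mem[OF f u]] intertwiner_t0[OF f u] by simp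
  qed
  let ?X = "total_space (unit_space G) I1"
  have tX: "topspace ?X = {(u, h). u \<in> units G \<and> h \<in> carrier (IH u)}" using B1.topspace_total by simp
  show ?thesis
  proof (rule B2.continuous_into_totalI)
    show "fst (case z of (u, h) \<Rightarrow> (u, intertwiner u h)) \<in> topspace (unit_space G) \<and>
      snd (case z of (u, h) \<Rightarrow> (u, intertwiner u h)) \<in> carrier (fibre I2 (fst (case z of (u, h) \<Rightarrow> (u, intertwiner u h))))" if "z \<in> topspace ?X" for z
      using that un unfolding tX by auto
    fix V and e :: real and \<xi> assume V: "openin (unit_space G) V" and e: "e > 0" and \<xi>: "\<xi> \<in> sections I2"
    let ?S = "{z \<in> topspace ?X. fst (case z of (u, h) \<Rightarrow> (u, intertwiner u h)) \<in> V \<and>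
      snd (case z of (u, h) \<Rightarrow> (u, intertwiner u h)) \<in> carrier (fibre I2 (fst (case z of (u, h) \<Rightarrow> (u, intertwiner u h)))) \<and>
      hnorm (fibre I2 (fst (case z of (u, h) \<Rightarrow> (u, intertwiner u h)))) (snd (case z of (u, h) \<Rightarrow> (u, intertwiner u h))
        \<ominus>\<^bsub>fibre I2 (fst (case z of (u, h) \<Rightarrow> (u, intertwiner u h)))\<^esub> \<xi> (fst (case z of (u, h) \<Rightarrow> (u, intertwiner u h)))) < e}"
    define R where "R = {(u, h). u \<in> V \<and> h \<in> carrier (IH u) \<and> hnorm (GH.IH u) (intertwiner u h \<ominus>\<^bsub>GH.IH u\<^esub> \<xi> u) < e}"
    have Vs: "V \<subseteq> units G" using openin_subset[OF V] by simp
    have SR: "?S = R" unfolding R_def tX using Vs un by auto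
    have "openin ?X R"
    proof (subst openin_subopen, intro ballI)
      fix z assume "z \<in> R"
      then obtain u0 h0 where z: "z = (u0, h0)" "u0 \<in> V" "h0 \<in> carrier (IH u0)"
        and lt: "hnorm (GH.IH u0) (intertwiner u0 h0 \<ominus>\<^bsub>GH.IH u0\<^esub> \<xi> u0) < e" by (auto simp: R_def)
      have u0: "u0 \<in> units G" using z Vs by blast
      \<comment> \<open>two errors of size \<open>\<delta>\<close> occur at \<open>u0\<close> and two more at nearby points, and one \<open>\<delta>\<close> makes the inequalities strict\<close>
      define \<delta> where "\<delta> = (e - hnorm (GH.IH u0) (intertwiner u0 h0 \<ominus>\<^bsub>GH.IH u0\<^esub> \<xi> u0)) / 5"
      have \<delta>: "\<delta> > 0" "hnorm (GH.IH u0) (intertwiner u0 h0 \<ominus>\<^bsub>GH.IH u0\<^esub> \<xi> u0) = e - 5 * \<delta>" using lt by (simp_all add: \<delta>_def field_simps)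
      have "\<forall>u\<in>topspace (unit_space G). \<forall>e>0. \<exists>\<eta>\<in>GH.t0 ` GH.IF. \<exists>U. openin (unit_space G) U \<and> u \<in> U \<and>
          (\<forall>v\<in>U. hnorm (GH.IH v) (\<xi> v \<ominus>\<^bsub>GH.IH v\<^esub> \<eta> v) < e)"
        using \<xi> unfolding GH.ind_sections locally_uniform_closure_def by simp
      from this[rule_format, of u0 \<delta>] obtain F U1 where F: "F \<in> GH.IF" and U1: "openin (unit_space G) U1" "u0 \<in> U1"
          "\<And>v. v \<in> U1 \<Longrightarrow> hnorm (GH.IH v) (\<xi> v \<ominus>\<^bsub>GH.IH v\<^esub> GH.t0 F v) < \<delta>"
        using u0 \<delta>(1) by auto
      obtain f U2 where f: "f \<in> IF" and U2: "openin (unit_space G) U2" "u0 \<in> U2"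
          "\<And>v. v \<in> U2 \<Longrightarrow> hnorm (GH.IH v) (GH.t0 F v \<ominus>\<^bsub>GH.IH v\<^esub> GH.t0 (tilde f) v) < \<delta>"
        using t0_tilde_approximation[OF F u0 \<delta>(1)] by blast
      let ?U = "V \<inter> U1 \<inter> U2"
      have U: "openin (unit_space G) ?U" using V U1(1) U2(1) by blast
      have close: "hnorm (GH.IH v) (\<xi> v \<ominus>\<^bsub>GH.IH v\<^esub> GH.t0 (tilde f) v) < 2 * \<delta>"
        and sv: "\<xi> v \<in> carrier (GH.IH v)" "GH.t0 (tilde f) v \<in> carrier (GH.IH v)"
        and si: "semi_inner (GH.IH v)" and vu: "v \<in> units G" if v: "v \<in> ?U" for v
      proof -
        show vv: "v \<in> units G" using v Vs by blast
        show s: "semi_inner (GH.IH v)" by (rule hilbert_semi_inner[OF GH.IH_hilbert[OF vv]])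
        show m: "\<xi> v \<in> carrier (GH.IH v)" using B2.section_mem[OF \<xi>, of v] vv by simp
        show m': "GH.t0 (tilde f) v \<in> carrier (GH.IH v)" by (rule GH.t0_mem[OF tilde_IF[OF f] vv])
        show "hnorm (GH.IH v) (\<xi> v \<ominus>\<^bsub>GH.IH v\<^esub> GH.t0 (tilde f) v) < 2 * \<delta>"
          using semi_inner.norm_triangle_minus[OF s m GH.t0_mem[OF F vv] m'] U1(3)[of v] U2(3)[of v] v by simp
      qed
      let ?N = "{(u, h). u \<in> ?U \<and> h \<in> carrier (fibre I1 u) \<and> hnorm (fibre I1 u) (h \<ominus>\<^bsub>fibre I1 u\<^esub> t0 f u) < e - 2 * \<delta>}"
      have u0U: "u0 \<in> ?U" using z U1 U2 by blast
      have n0: "hnorm (GH.IH u0) (intertwiner u0 h0 \<ominus>\<^bsub>GH.IH u0\<^esub> GH.t0 (tilde f) u0) < e - 3 * \<delta>"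
        using semi_inner.norm_triangle_minus[OF si[OF u0U] un[OF u0 z(3)] sv[OF u0U]] close[OF u0U] \<delta>(2) by simp
      have p: "e - 2 * \<delta> > 0"
      proof -
        interpret S: semi_inner "GH.IH u0" by (rule si[OF u0U])
        have "0 \<le> hnorm (GH.IH u0) (intertwiner u0 h0 \<ominus>\<^bsub>GH.IH u0\<^esub> \<xi> u0)"
          by (rule S.norm_ge0[OF S.minus_closed[OF un[OF u0 z(3)] sv(1)[OF u0U]]])
        then show ?thesis using \<delta> by linarith
      qed
      have "openin ?X ?N" by (rule B1.openin_total_basic[OF U p t0_section[OF f]])
      moreover have "z \<in> ?N" using z u0U n0 iso[OF u0 z(3) f] \<delta>(1) by simp
      moreover have "?N \<subseteq> R"
      proof
        fix y assume "y \<in> ?N"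
        then obtain u h where y: "y = (u, h)" "u \<in> ?U" "h \<in> carrier (IH u)" "hnorm (IH u) (h \<ominus>\<^bsub>IH u\<^esub> t0 f u) < e - 2 * \<delta>" by auto
        note uu = vu[OF y(2)]
        have "hnorm (GH.IH u) (intertwiner u h \<ominus>\<^bsub>GH.IH u\<^esub> \<xi> u) < e"
          using semi_inner.norm_triangle_minus[OF si[OF y(2)] un[OF uu y(3)] sv(2)[OF y(2)] sv(1)[OF y(2)]]
            semi_inner.norm_minus_commute[OF si[OF y(2)] sv[OF y(2)]] close[OF y(2)] iso[OF uu y(3) f] y(4) by simp
        then show "y \<in> R" using y by (simp add: R_def)
      qed
      ultimately show "\<exists>T. openin ?X T \<and> z \<in> T \<and> T \<subseteq> R" by blast
    qed
    then show "openin ?X ?S" unfolding SR .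
  qed
qed

theorem iterated_induction_equivalent: "unitarily_equivalent G I1 I2"
  unfolding unitarily_equivalent_def
proof (intro bexI ballI)
  show "unitary_on (fibre I1 u) (fibre I2 u) (intertwiner u)" if "u \<in> units G" for u
    using intertwiner_unitary[OF that] by simp
  then show "intertwiner \<in> Mor G I1 I2"
    using intertwiner_continuous intertwiner_equivariant by (auto simp: Mor_def unitary_on_def)
qed

end

theorem theorem4p4:
  fixes G :: "'g groupoid" and H K :: "'g set"
    and lamG lamH lamK :: "'g \<Rightarrow> 'g measure"
    and \<mu>G \<mu>H \<gamma> :: "'g \<Rightarrow> 'g set measure"
    and \<sigma> :: "('g, 'h) representation"
  assumes "topological_groupoid G" and "haar_system G lamG"
    and "closed_wide_subgroupoid G H" and "closed_wide_subgroupoid G K" and "K \<subseteq> H"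
    and "haar_system (sub_groupoid G H) lamH" and "haar_system (sub_groupoid G K) lamK"
    and "full_equivariant_system G H \<mu>G"
    and "full_equivariant_system (sub_groupoid G H) K \<mu>H"
    and "full_equivariant_system G K \<gamma>"
    and "\<And>f u. f \<in> Cc (coset_space G K) \<Longrightarrow> u \<in> units G \<Longrightarrow>
      (LINT C|\<gamma> u. f C) =
      (LINT C|\<mu>G u. (LINT D : coset_range_fibre (sub_groupoid G H) K (src G (coset_rep C))
         |\<mu>H (src G (coset_rep C)). f (translate G (coset_rep C) D)))"
    and "continuous_unitary_representation (sub_groupoid G K) \<sigma>"
  shows "unitarily_equivalent G
    (ind G K \<sigma> \<gamma>)
    (ind G H (ind (sub_groupoid G H) K \<sigma> \<mu>H) \<mu>G)"
proof -
  have H: "open_pair G H" and K: "open_pair G K" using assms(1,3,4,6,7) by (auto intro: open_pairI)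
  have hr: "haar_representation G K lamK \<sigma>"
    using K assms(7,12) by (intro haar_representation.intro haar_representation_axioms.intro)
  interpret R: haar_representation G K lamK \<sigma> by (rule hr)
  have "induced G K \<sigma> \<gamma>"
    by (intro induced.intro induced_axioms.intro R.equivariant_field_axioms assms(10))
  then interpret induction_in_stages G K lamK \<sigma> \<gamma> H \<mu>H \<mu>G
    using H hr assms(5,8,9,11) by (intro induction_in_stages.intro induction_in_stages_axioms.intro)
  show ?thesis by (rule iterated_induction_equivalent)
qed

end
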